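(* Let $(V_1,N_1),\ldots,(V_n,N_n)$, $n>1$, be distinct DVRs with quotient field $F$, let $m>1$ be a positive integer, and let $S=\{S(V_1),\ldots,S(V_n)\}$ be an arbitrary $m$-consistent system for $\{V_1,\ldots,V_n\}$, where $S(V_i)=\{(K_{i,j},f_{i,j},e_{i,j})\mid j=1,\ldots,s_i\}$ for each $i=1,\ldots,n$. For each $i=1,\ldots,n$ let $S^*(V_i)=\{(K_{i,j},f_{i,j},m\,e_{i,j})\mid j=1,\ldots,s_i\}$. Then $S^*=\{S^*(V_1),\ldots,S^*(V_n)\}$ is a realizable $m^2$-consistent system for $\{V_1,\ldots,V_n\}$.
   Context: A DVR is a rank one discrete valuation ring; $(V,N)$ means that $N$ is the maximal ideal of $V$. Let $(V_1,N_1),\ldots,(V_n,N_n)$ be distinct DVRs with quotient field $F$, and put $K_i=V_i/N_i$. For a positive integer $m$, an $m$-consistent system for $\{V_1,\ldots,V_n\}$ is a collection $S=\{S(V_1),\ldots,S(V_n)\}$ such that: (1) $S(V_i)=\{(K_{i,j},f_{i,j},e_{i,j})\mid j=1,\ldots,s_i\}$ is a finite family indexed by $j$ (repetitions of triples are allowed), where $K_{i,j}$ is a simple algebraic field extension of $K_i$, $f_{i,j}=[K_{i,j}:K_i]$, and $s_i,e_{i,j}$ are positive integers; (2) for each $i$, $\sum_{j=1}^{s_i}e_{i,j}f_{i,j}=m$. Such a system $S$ is realizable for $\{V_1,\ldots,V_n\}$ if there exists a separable algebraic extension field $L$ of $F$ such that: (a) $[L:F]=m$; (b) for $1\le i\le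 n$, $V_i$ has exactly $s_i$ extensions $(V_{i,1},N_{i,1}),\ldots,(V_{i,s_i},N_{i,s_i})$ to valuation rings of $L$; (c) (for a suitable numbering) the residue field $V_{i,j}/N_{i,j}$ is $K_i$-isomorphic to $K_{i,j}$, and the ramification index of $V_{i,j}$ over $V_i$ is $e_{i,j}$, i.e. $N_iV_{i,j}=N_{i,j}^{e_{i,j}}$. Such an $L$ is called a realization of $S$. *)

theory Defs
  imports "HOL-Algebra.Algebra"
begin

section \<open>Field extensions\<close>

text \<open>An extension of a field \<open>k\<close> is a field \<open>K\<close> together with an embedding
  \<open>\<iota>\<close> of \<open>k\<close> in \<open>K\<close>; the two carriers may have different types.\<close>

definition field_extension :: "'a ring \<Rightarrow> 'b ring \<Rightarrow> ('a \<Rightarrow> 'b) \<Rightarrow> bool" where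
  "field_extension k K \<iota> \<longleftrightarrow> field k \<and> field K \<and> \<iota> \<in> ring_hom k K"

definition extension_degree :: "'a ring \<Rightarrow> 'b ring \<Rightarrow> ('a \<Rightarrow> 'b) \<Rightarrow> nat \<Rightarrow> bool" where
  "extension_degree k K \<iota> d \<longleftrightarrow> ring.dimension K d (\<iota> ` carrier k) (carrier K)"

definition algebraic_extension :: "'a ring \<Rightarrow> 'b ring \<Rightarrow> ('a \<Rightarrow> 'b) \<Rightarrow> bool" where
  "algebraic_extension k K \<iota> \<longleftrightarrow>
     field_extension k K \<iota> \<and>
     (\<forall>x \<in> carrier K. (ring.algebraic K over (\<iota> ` carrier k)) x)"

definition simple_algebraic_extension :: "'a ring \<Rightarrow> 'b ring \<Rightarrow> ('a \<Rightarrow> 'b) \<Rightarrow> bool" where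
  "simple_algebraic_extension k K \<iota> \<longleftrightarrow>
     algebraic_extension k K \<iota> \<and>
     (\<exists>x \<in> carrier K. generate_field K (insert x (\<iota> ` carrier k)) = carrier K)"

text \<open>\<open>p\<close> is a polynomial over \<open>K\<close>, in the list representation of HOL-Algebra.\<close>

definition no_multiple_roots :: "'b ring \<Rightarrow> 'b list \<Rightarrow> bool" where
  "no_multiple_roots K p \<longleftrightarrow>
     (\<forall>a \<in> carrier (field.alg_closure K).
        ring.alg_mult (field.alg_closure K) (map (ring.indexed_const K) p) a \<le> 1)"

text \<open>Here \<open>ring.Irr K (\<iota> ` carrier k) x\<close> is the minimal polynomial of \<open>x\<close> over \<open>k\<close>.
  As \<open>K\<close> is algebraic over \<open>k\<close>, an algebraic closure of \<open>K\<close> is also one of \<open>k\<close>.\<close>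

definition separable_extension :: "'a ring \<Rightarrow> 'b ring \<Rightarrow> ('a \<Rightarrow> 'b) \<Rightarrow> bool" where
  "separable_extension k K \<iota> \<longleftrightarrow>
     algebraic_extension k K \<iota> \<and>
     (\<forall>x \<in> carrier K. no_multiple_roots K (ring.Irr K (\<iota> ` carrier k) x))"


section \<open>Valuation rings\<close>

definition valuation_ring :: "'a ring \<Rightarrow> 'a set \<Rightarrow> bool" where
  "valuation_ring F V \<longleftrightarrow>
     subring V F \<and> (\<forall>x \<in> carrier F - {\<zero>\<^bsub>F\<^esub>}. x \<in> V \<or> inv\<^bsub>F\<^esub> x \<in> V)"

text \<open>The rank one discrete valuation rings with quotient field \<open>F\<close> are the valuation rings
  of the valuations of \<open>F\<close> with value group the integers. The value \<open>v \<zero>\<close> (infinity) is left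
  unspecified.\<close>

definition discrete_valuation :: "'a ring \<Rightarrow> ('a \<Rightarrow> int) \<Rightarrow> bool" where
  "discrete_valuation F v \<longleftrightarrow>
     v ` (carrier F - {\<zero>\<^bsub>F\<^esub>}) = UNIV \<and>
     (\<forall>x \<in> carrier F - {\<zero>\<^bsub>F\<^esub>}. \<forall>y \<in> carrier F - {\<zero>\<^bsub>F\<^esub>}.
        v (x \<otimes>\<^bsub>F\<^esub> y) = v x + v y \<and>
        (x \<oplus>\<^bsub>F\<^esub> y \<noteq> \<zero>\<^bsub>F\<^esub> \<longrightarrow> v (x \<oplus>\<^bsub>F\<^esub> y) \<ge> min (v x) (v y)))"

definition DVR :: "'a ring \<Rightarrow> 'a set \<Rightarrow> bool" where
  "DVR F V \<longleftrightarrow>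
     (\<exists>v. discrete_valuation F v \<and> V = {x \<in> carrier F. x = \<zero>\<^bsub>F\<^esub> \<or> v x \<ge> 0})"

text \<open>The maximal ideal of a valuation ring is its set of nonunits; see
  \<open>valuation_ring_maximalideal_iff\<close> below.\<close>

definition max_ideal :: "'a ring \<Rightarrow> 'a set \<Rightarrow> 'a set" where
  "max_ideal F V = V - Units (F\<lparr>carrier := V\<rparr>)"

definition residue_field :: "'a ring \<Rightarrow> 'a set \<Rightarrow> 'a set ring" where
  "residue_field F V = (F\<lparr>carrier := V\<rparr>) Quot (max_ideal F V)"

definition residue_class :: "'a ring \<Rightarrow> 'a set \<Rightarrow> 'a \<Rightarrow> 'a set" where
  "residue_class F V x = max_ideal F V +>\<^bsub>F\<lparr>carrier := V\<rparr>\<^esub> x"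

text \<open>In the following, \<open>L\<close> is an extension of \<open>F\<close> with embedding \<open>\<phi>\<close>, \<open>V\<close> is a valuation
  ring of \<open>F\<close>, and \<open>W\<close> is a valuation ring of \<open>L\<close>.\<close>

definition extensions_of_valuation_ring ::
  "'a ring \<Rightarrow> 'a set \<Rightarrow> 'l ring \<Rightarrow> ('a \<Rightarrow> 'l) \<Rightarrow> 'l set set" where
  "extensions_of_valuation_ring F V L \<phi> =
     {W. valuation_ring L W \<and> W \<inter> \<phi> ` carrier F = \<phi> ` V}"

definition ramification_index ::
  "'a ring \<Rightarrow> 'a set \<Rightarrow> 'l ring \<Rightarrow> ('a \<Rightarrow> 'l) \<Rightarrow> 'l set \<Rightarrow> nat \<Rightarrow> bool" where
  "ramification_index F V L \<phi> W e \<longleftrightarrow>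
     Idl\<^bsub>L\<lparr>carrier := W\<rparr>\<^esub> (\<phi> ` max_ideal F V) =
       max_ideal L W [^]\<^bsub>ideals_set (L\<lparr>carrier := W\<rparr>)\<^esub> e"

text \<open>\<open>K\<close>, with embedding \<open>\<iota>\<close>, is an extension of the residue field of \<open>V\<close>. The isomorphism
  fixes that field: it commutes with \<open>\<iota>\<close> and with the embedding
  \<open>residue_class F V x \<mapsto> residue_class L W (\<phi> x)\<close> induced by \<open>\<phi>\<close>.\<close>

definition residue_field_isomorphic ::
  "'a ring \<Rightarrow> 'a set \<Rightarrow> 'l ring \<Rightarrow> ('a \<Rightarrow> 'l) \<Rightarrow> 'l set \<Rightarrow> 'k ring \<Rightarrow> ('a set \<Rightarrow> 'k) \<Rightarrow> bool" where
  "residue_field_isomorphic F V L \<phi> W K \<iota> \<longleftrightarrow>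
     (\<exists>\<psi> \<in> ring_iso (residue_field L W) K.
        \<forall>x \<in> V. \<psi> (residue_class L W (\<phi> x)) = \<iota> (residue_class F V x))"


section \<open>Consistent systems and realizations\<close>

text \<open>The triples \<open>(K, f, e)\<close>, where the extension field \<open>K\<close> comes with the embedding of the
  residue field (whose elements are cosets). The finite family of triples attached to one
  valuation ring is a list. Valuation rings are indexed by \<open>i < n\<close>, triples from \<open>0\<close>.\<close>

type_synonym ('a, 'k) triple = "('k ring \<times> ('a set \<Rightarrow> 'k)) \<times> nat \<times> nat"

definition consistent_system ::
  "'a ring \<Rightarrow> nat \<Rightarrow> (nat \<Rightarrow> 'a set) \<Rightarrow> nat \<Rightarrow> (nat \<Rightarrow> ('a, 'k) triple list) \<Rightarrow> bool" where
  "consistent_system F n V m S \<longleftrightarrow>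
     m > 0 \<and>
     (\<forall>i<n. S i \<noteq> [] \<and>
        (\<forall>((K, \<iota>), f, e) \<in> set (S i).
           simple_algebraic_extension (residue_field F (V i)) K \<iota> \<and>
           extension_degree (residue_field F (V i)) K \<iota> f \<and> e > 0) \<and>
        (\<Sum>((K, \<iota>), f, e) \<leftarrow> S i. e * f) = m)"

definition realization ::
  "'a ring \<Rightarrow> nat \<Rightarrow> (nat \<Rightarrow> 'a set) \<Rightarrow> nat \<Rightarrow> (nat \<Rightarrow> ('a, 'k) triple list) \<Rightarrow>
     'l ring \<Rightarrow> ('a \<Rightarrow> 'l) \<Rightarrow> bool" where
  "realization F n V m S L \<phi> \<longleftrightarrow>
     separable_extension F L \<phi> \<and>
     extension_degree F L \<phi> m \<and>
     (\<forall>i<n. \<exists>W.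
        bij_betw W {..<length (S i)} (extensions_of_valuation_ring F (V i) L \<phi>) \<and>
        (\<forall>j<length (S i). case S i ! j of ((K, \<iota>), f, e) \<Rightarrow>
           residue_field_isomorphic F (V i) L \<phi> (W j) K \<iota> \<and>
           ramification_index F (V i) L \<phi> (W j) e))"

text \<open>HOL cannot quantify existentially over the type of \<open>L\<close>. The type fixed here is that of
  the quotients \<open>F[X]/(p)\<close> (\<open>rupture\<close>), so by the primitive element theorem every
  finite separable extension of \<open>F\<close> has an isomorphic copy of this type.\<close>

definition realizable ::
  "'a ring \<Rightarrow> nat \<Rightarrow> (nat \<Rightarrow> 'a set) \<Rightarrow> nat \<Rightarrow> (nat \<Rightarrow> ('a, 'k) triple list) \<Rightarrow> bool" where
  "realizable F n V m S \<longleftrightarrow>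
     (\<exists>(L :: 'a list set ring) \<phi>. realization F n V m S L \<phi>)"

definition star_system ::
  "nat \<Rightarrow> (nat \<Rightarrow> ('a, 'k) triple list) \<Rightarrow> nat \<Rightarrow> ('a, 'k) triple list" where
  "star_system m S i = map (\<lambda>(K, f, e). (K, f, m * e)) (S i)"


section \<open>Sanity checks\<close>

lemma valuation_ring_nonunit_add:
  assumes "field F" and V: "valuation_ring F V"
    and a: "a \<in> max_ideal F V" and b: "b \<in> max_ideal F V"
    and c: "a \<noteq> \<zero>\<^bsub>F\<^esub>" "b \<noteq> \<zero>\<^bsub>F\<^esub>" "a \<otimes>\<^bsub>F\<^esub> inv\<^bsub>F\<^esub> b \<in> V"
  shows "a \<oplus>\<^bsub>F\<^esub> b \<in> max_ideal F V"
proof -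
  interpret field F by fact
  have sr: "subring V F" using V by (simp add: valuation_ring_def)
  interpret R: cring "F\<lparr>carrier := V\<rparr>"
    using subcring_iff[of V] sr subringE(1)[OF sr] subcringI'[OF sr] by blast
  have ab: "a \<in> V" "b \<in> V" "a \<in> carrier F" "b \<in> carrier F" "b \<in> Units F"
    using a b c subringE(1)[OF sr] field_Units by (auto simp: max_ideal_def)
  let ?u = "(a \<otimes>\<^bsub>F\<^esub> inv\<^bsub>F\<^esub> b) \<oplus>\<^bsub>F\<^esub> \<one>\<^bsub>F\<^esub>"
  have u: "?u \<in> V" using c subringE[OF sr] by blast
  have eq: "a \<oplus>\<^bsub>F\<^esub> b = b \<otimes>\<^bsub>F\<^esub> ?u"
    using ab by (simp add: r_distr m_lcomm)
  have "b \<otimes>\<^bsub>F\<^esub> ?u \<notin> Units (F\<lparr>carrier := V\<rparr>)"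
    using R.unit_factor[of b ?u] ab u b by (auto simp: max_ideal_def)
  thus ?thesis using eq ab u subringE(6)[OF sr] by (auto simp: max_ideal_def)
qed

lemma valuation_ring_maximalideal_iff:
  assumes "field F" and V: "valuation_ring F V"
  shows "maximalideal N (F\<lparr>carrier := V\<rparr>) \<longleftrightarrow> N = max_ideal F V"
proof -
  interpret field F by fact
  have sr: "subring V F" using V by (simp add: valuation_ring_def)
  interpret R: cring "F\<lparr>carrier := V\<rparr>"
    using subcring_iff[of V] sr subringE(1)[OF sr] subcringI'[OF sr] by blast
  let ?R = "F\<lparr>carrier := V\<rparr>" and ?N = "max_ideal F V"
  have VF: "V \<subseteq> carrier F" by (rule subringE(1)[OF sr])
  have zero: "\<zero>\<^bsub>F\<^esub> \<in> ?N"
    using subringE(2)[OF sr] VF by (auto simp: max_ideal_def Units_def)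
  have mult: "x \<otimes>\<^bsub>F\<^esub> a \<in> ?N" if "a \<in> ?N" "x \<in> V" for a x
  proof -
    have "a \<otimes>\<^bsub>F\<^esub> x \<notin> Units ?R"
      using R.unit_factor[of a x] that by (auto simp: max_ideal_def)
    moreover have "a \<otimes>\<^bsub>F\<^esub> x = x \<otimes>\<^bsub>F\<^esub> a"
      using that VF by (auto simp: max_ideal_def intro!: m_comm)
    ultimately show ?thesis
      using that subringE(6)[OF sr] by (auto simp: max_ideal_def)
  qed
  have add: "a \<oplus>\<^bsub>F\<^esub> b \<in> ?N" if a: "a \<in> ?N" and b: "b \<in> ?N" for a b
  proof -
    have ab: "a \<in> carrier F" "b \<in> carrier F"
      using a b VF by (auto simp: max_ideal_def)
    consider "a = \<zero>\<^bsub>F\<^esub>" | "b = \<zero>\<^bsub>F\<^esub>" | "a \<noteq> \<zero>\<^bsub>F\<^esub>" "b \<noteq> \<zero>\<^bsub>F\<^esub>" by blast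
    then show ?thesis
    proof cases
      case 3
      have U: "a \<in> Units F" "b \<in> Units F" using 3 ab field_Units by auto
      have q: "a \<otimes>\<^bsub>F\<^esub> inv\<^bsub>F\<^esub> b \<in> carrier F - {\<zero>\<^bsub>F\<^esub>}"
        using U field_Units Units_m_closed Units_inv_Units by blast
      have "inv\<^bsub>F\<^esub> (a \<otimes>\<^bsub>F\<^esub> inv\<^bsub>F\<^esub> b) = b \<otimes>\<^bsub>F\<^esub> inv\<^bsub>F\<^esub> a"
      proof (rule comm_inv_char)
        have "(a \<otimes>\<^bsub>F\<^esub> inv\<^bsub>F\<^esub> b) \<otimes>\<^bsub>F\<^esub> (b \<otimes>\<^bsub>F\<^esub> inv\<^bsub>F\<^esub> a)
            = (a \<otimes>\<^bsub>F\<^esub> inv\<^bsub>F\<^esub> a) \<otimes>\<^bsub>F\<^esub> (b \<otimes>\<^bsub>F\<^esub> inv\<^bsub>F\<^esub> b)"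
          using U ab Units_inv_closed by (simp add: m_ac del: Units_r_inv Units_l_inv)
        thus "(a \<otimes>\<^bsub>F\<^esub> inv\<^bsub>F\<^esub> b) \<otimes>\<^bsub>F\<^esub> (b \<otimes>\<^bsub>F\<^esub> inv\<^bsub>F\<^esub> a) = \<one>\<^bsub>F\<^esub>"
          using U by simp
      qed (use U ab in auto)
      hence "a \<otimes>\<^bsub>F\<^esub> inv\<^bsub>F\<^esub> b \<in> V \<or> b \<otimes>\<^bsub>F\<^esub> inv\<^bsub>F\<^esub> a \<in> V"
        using V q by (metis valuation_ring_def)
      thus ?thesis
        using valuation_ring_nonunit_add[OF assms a b] valuation_ring_nonunit_add[OF assms b a] 3
          a_comm[OF ab] by auto
    qed (use a b ab in auto)
  qed
  have neg: "\<ominus>\<^bsub>F\<^esub> a \<in> ?N" if "a \<in> ?N" for a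
    using mult[OF that, of "\<ominus>\<^bsub>F\<^esub> \<one>\<^bsub>F\<^esub>"] that VF subringE(3,5)[OF sr]
    by (auto simp: max_ideal_def l_minus)
  have sub: "subgroup ?N (add_monoid ?R)"
  proof (rule R.add.subgroupI)
    show "?N \<subseteq> carrier ?R" by (auto simp: max_ideal_def)
  next
    fix a assume a: "a \<in> ?N"
    hence "a \<in> V" by (auto simp: max_ideal_def)
    hence "\<ominus>\<^bsub>?R\<^esub> a = \<ominus>\<^bsub>F\<^esub> a"
      using VF subringE(5)[OF sr] by (intro R.minus_equality) (auto simp: l_neg)
    with neg[OF a] show "\<ominus>\<^bsub>?R\<^esub> a \<in> ?N" by simp
  qed (use zero add in auto)
  have ideal: "ideal ?N ?R"
  proof (rule idealI)
    show "x \<otimes>\<^bsub>?R\<^esub> a \<in> ?N" if "a \<in> ?N" "x \<in> carrier ?R" for a x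
      using mult that by simp
    show "a \<otimes>\<^bsub>?R\<^esub> x \<in> ?N" if "a \<in> ?N" "x \<in> carrier ?R" for a x
      using mult[of a x] that VF m_comm[of a x] subsetD[OF VF, of a] subsetD[OF VF, of x]
      by (auto simp: max_ideal_def)
  qed (use sub R.ring_axioms in auto)
  have le: "J \<subseteq> ?N" if "ideal J ?R" "J \<noteq> V" for J
  proof
    fix x assume x: "x \<in> J"
    interpret J: ideal J ?R by fact
    have JV: "J \<subseteq> V" using J.a_subset by simp
    have "x \<notin> Units ?R"
    proof
      assume "x \<in> Units ?R"
      then obtain y where "y \<in> V" "y \<otimes>\<^bsub>F\<^esub> x = \<one>\<^bsub>F\<^esub>" by (auto simp: Units_def)
      hence "\<one>\<^bsub>?R\<^esub> \<in> J" using J.I_l_closed[OF x, of y] by simp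
      hence "J = V" using J.one_imp_carrier by simp
      thus False using that by simp
    qed
    thus "x \<in> ?N" using x JV by (auto simp: max_ideal_def)
  qed
  have N_ne: "?N \<noteq> V"
    using R.Units_one_closed subringE(3)[OF sr] by (auto simp: max_ideal_def)
  have max: "maximalideal ?N ?R"
    by (rule maximalidealI[OF ideal]) (use N_ne le in auto)
  show ?thesis
  proof
    assume "maximalideal N ?R"
    then interpret N: maximalideal N ?R .
    have "N \<subseteq> ?N" using le N.is_ideal N.I_notcarr by auto
    thus "N = ?N" using N.I_maximal[OF ideal] N_ne by (auto simp: max_ideal_def)
  qed (use max in simp)
qed

lemma DVR_valuation_ring:
  assumes "field F" "DVR F V"
  shows "valuation_ring F V"
proof -
  interpret field F by fact
  obtain v where v: "discrete_valuation F v"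
    and V: "V = {x \<in> carrier F. x = \<zero>\<^bsub>F\<^esub> \<or> v x \<ge> 0}"
    using assms(2) by (auto simp: DVR_def)
  have vm: "v (x \<otimes>\<^bsub>F\<^esub> y) = v x + v y"
    if "x \<in> carrier F" "y \<in> carrier F" "x \<noteq> \<zero>\<^bsub>F\<^esub>" "y \<noteq> \<zero>\<^bsub>F\<^esub>" for x y
    using v that by (auto simp: discrete_valuation_def)
  have va: "v (x \<oplus>\<^bsub>F\<^esub> y) \<ge> min (v x) (v y)"
    if "x \<in> carrier F" "y \<in> carrier F" "x \<noteq> \<zero>\<^bsub>F\<^esub>" "y \<noteq> \<zero>\<^bsub>F\<^esub>" "x \<oplus>\<^bsub>F\<^esub> y \<noteq> \<zero>\<^bsub>F\<^esub>" for x y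
    using v that by (auto simp: discrete_valuation_def)
  have v1: "v \<one>\<^bsub>F\<^esub> = 0" using vm[of "\<one>\<^bsub>F\<^esub>" "\<one>\<^bsub>F\<^esub>"] by simp
  have vneg1: "v (\<ominus>\<^bsub>F\<^esub> \<one>\<^bsub>F\<^esub>) = 0"
    using vm[of "\<ominus>\<^bsub>F\<^esub> \<one>\<^bsub>F\<^esub>" "\<ominus>\<^bsub>F\<^esub> \<one>\<^bsub>F\<^esub>"] v1 by (simp add: l_minus r_minus)
  have vneg: "v (\<ominus>\<^bsub>F\<^esub> x) = v x" if "x \<in> carrier F" "x \<noteq> \<zero>\<^bsub>F\<^esub>" for x
    using vm[of "\<ominus>\<^bsub>F\<^esub> \<one>\<^bsub>F\<^esub>" x] that vneg1 by (simp add: l_minus)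
  have "subring V F"
  proof (rule subringI)
    show "\<ominus>\<^bsub>F\<^esub> h \<in> V" if "h \<in> V" for h using that vneg[of h] by (auto simp: V)
    show "h1 \<otimes>\<^bsub>F\<^esub> h2 \<in> V" if "h1 \<in> V" "h2 \<in> V" for h1 h2
      using that vm[of h1 h2] by (cases "h1 = \<zero>\<^bsub>F\<^esub> \<or> h2 = \<zero>\<^bsub>F\<^esub>") (auto simp: V)
    show "h1 \<oplus>\<^bsub>F\<^esub> h2 \<in> V" if "h1 \<in> V" "h2 \<in> V" for h1 h2
      using that va[of h1 h2] by (cases "h1 = \<zero>\<^bsub>F\<^esub> \<or> h2 = \<zero>\<^bsub>F\<^esub>") (auto simp: V)
  qed (auto simp: V v1)
  moreover have "x \<in> V \<or> inv\<^bsub>F\<^esub> x \<in> V" if "x \<in> carrier F - {\<zero>\<^bsub>F\<^esub>}" for x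
  proof -
    have U: "x \<in> Units F" using that field_Units by simp
    hence "inv\<^bsub>F\<^esub> x \<in> carrier F - {\<zero>\<^bsub>F\<^esub>}" using Units_inv_Units field_Units by blast
    moreover have "v x + v (inv\<^bsub>F\<^esub> x) = 0"
      using vm[of x "inv\<^bsub>F\<^esub> x"] that U calculation v1 by auto
    ultimately show ?thesis using that by (auto simp: V)
  qed
  ultimately show ?thesis by (simp add: valuation_ring_def)
qed

end

theory Submission
  imports Defs
begin

text \<open>The extension is built by two applications of one construction, due in spirit to Krull.

Suppose that a consistent system of degree \<open>m\<close> prescribes at one of the valuations
a single place with \<open>f = 1\<close>, hence with \<open>e = m\<close>. Such a system is realizable. For a triple
\<open>(K\<^sub>j, f\<^sub>j, e\<^sub>j)\<close> at a valuation \<open>v\<close> with uniformizer \<open>\<pi>\<close>, take a generator \<open>y\<^sub>j\<close> of \<open>K\<^sub>j\<close>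
and lift its monic relation of degree \<open>f\<^sub>j\<close> to a polynomial \<open>G(Y)\<close> over the valuation ring. Substitute
\<open>Y = X\<^sup>e / \<pi>\<^sup>a\<close>, where \<open>e = e\<^sub>j\<close> and \<open>a = e j + 1\<close>, and clear denominators. The result
\<open>P\<^sub>j\<close> is monic of degree \<open>e\<^sub>j f\<^sub>j\<close>; at its roots \<open>X\<close> has value \<open>a/e = j + 1/e\<close>, whose
denominator forces ramification \<open>e\<close>, while \<open>X\<^sup>e / \<pi>\<^sup>a\<close> forces the residue \<open>y\<^sub>j\<close>. The numbers
\<open>j + 1/e\<^sub>j\<close> are distinct for distinct \<open>j\<close>, so the product \<open>Q\<close> of the \<open>P\<^sub>j\<close> keeps these places apart.
By weak approximation there is one monic polynomial \<open>p\<close> of degree \<open>m\<close> whose coefficients are close,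
at each of the given valuations, to those of the corresponding \<open>Q\<close>, and whose coefficient at \<open>X\<close> is
not zero. At the totally ramified place \<open>p\<close> is an Eisenstein polynomial; it is therefore irreducible, and
\<open>L = F[X]/(p)\<close> is a field of degree \<open>m\<close> over \<open>F\<close>.

For each \<open>j\<close> the place of \<open>L\<close> is read off from a Gauss valuation on \<open>F[X]\<close> that gives \<open>X\<close> the value
\<open>j + 1/e\<^sub>j\<close>. Integral polynomials have a residue in \<open>K\<^sub>j\<close>, namely the reduction with respect to
\<open>X\<^sup>e / \<pi>\<^sup>a\<close>, evaluated at \<open>y\<^sub>j\<close>. As \<open>p\<close> agrees to high order with a multiple of \<open>P\<^sub>j\<close>, integral
multiples of \<open>p\<close> have residue zero (\<open>rho_kernel\<close>); so the residue passes to the ring \<open>R\<close> of those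
fractions of images in \<open>L\<close> whose denominator has nonzero residue. The image of \<open>X/\<pi>\<^sup>j\<close> generates the
maximal ideal of \<open>R\<close>, which makes \<open>R\<close> a discrete valuation ring with the prescribed data
(\<open>place_exists\<close>). Conversely, let \<open>B\<close> be a valuation ring of \<open>L\<close> over that of \<open>v\<close>. If the image of
every \<open>P\<^sub>j\<close> divided, in \<open>B\<close>, the power of \<open>\<pi>\<close> that it divides at all foreign places, then the image of
\<open>Q\<close> would divide a fixed power of \<open>\<pi>\<close>; but in \<open>L\<close> this image equals that of \<open>Q - p\<close>, which is divisible
by a larger power. Hence some \<open>P\<^sub>j\<close> does not, and this forces \<open>B\<close> to contain the ring \<open>R\<close> of that \<open>j\<close>;
being a discrete valuation ring, \<open>R\<close> is a maximal proper subring and \<open>B = R\<close> (\<open>family_complete\<close>).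

For the theorem, in a first step prescribe at \<open>V\<^sub>0\<close> one place with \<open>e = m\<close>, \<open>f = 1\<close>, and the given
triples at the other \<open>V\<^sub>i\<close>. In a second step, over the field \<open>L\<^sub>1\<close> just found, prescribe the triples of
\<open>V\<^sub>0\<close> at the place above \<open>V\<^sub>0\<close>, and one place with \<open>e = m\<close>, \<open>f = 1\<close> at each place above another \<open>V\<^sub>i\<close>.
Since \<open>n > 1\<close>, in both steps some place is totally ramified, as the construction demands. Ramification
indices multiply, so each index \<open>e\<^sub>i\<^sub>j\<close> becomes \<open>m e\<^sub>i\<^sub>j\<close>, the residue fields are as prescribed, and
the degree is \<open>m\<^sup>2\<close> (\<open>star_system_realization\<close>).

As to separability, it is convenient to carry through the tower the following condition on \<open>L\<close> over \<open>F\<close>: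
if \<open>l\<close> is prime and zero in \<open>L\<close>, no proper subring of \<open>L\<close> contains \<open>F\<close> and all \<open>l\<close>-th powers. It is
transitive for trivial reasons, it holds for \<open>F[X]/(p)\<close> because \<open>p\<close> has a nonzero coefficient at \<open>X\<close>, and
for finite extensions it implies separability (\<open>separable_extension_criterion\<close>).\<close>

section \<open>Discrete valuations\<close>

lemma (in field) field_inv:
  assumes "x \<in> carrier R" "x \<noteq> \<zero>"
  shows "inv x \<in> carrier R" "inv x \<noteq> \<zero>" "x \<otimes> inv x = \<one>" "inv x \<otimes> x = \<one>"
proof -
  have U: "x \<in> Units R" using assms field_Units by simp
  then show "inv x \<in> carrier R" "x \<otimes> inv x = \<one>" "inv x \<otimes> x = \<one>" by auto
  show "inv x \<noteq> \<zero>" using Units_inv_Units[OF U] field_Units by blast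
qed

lemma (in field) field_inv_pow:
  assumes "x \<in> carrier R" "x \<noteq> \<zero>"
  shows "x [^] (k::nat) \<noteq> \<zero>" "inv (x [^] k) = inv x [^] k"
proof -
  have U: "x \<in> Units R" using assms field_Units by simp
  show "x [^] k \<noteq> \<zero>" using Units_pow_closed[OF U, of k] field_Units by blast
  have "inv x [^] k \<otimes> x [^] k = \<one>"
    using field_inv[OF assms] assms by (metis nat_pow_distrib m_comm nat_pow_one)
  then show "inv (x [^] k) = inv x [^] k"
    using assms field_inv[OF assms] by (intro inv_unique'[symmetric]) (auto simp: m_comm)
qed

lemma (in field) inv_mult:
  assumes "x \<in> carrier R" "x \<noteq> \<zero>" "y \<in> carrier R" "y \<noteq> \<zero>"
  shows "inv (x \<otimes> y) = inv x \<otimes> inv y"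
proof -
  note [simp] = field_inv[OF assms(1,2)] field_inv[OF assms(3,4)]
  have "(x \<otimes> y) \<otimes> (inv x \<otimes> inv y) = (x \<otimes> inv x) \<otimes> (y \<otimes> inv y)"
    using assms field_inv(1)[OF assms(1,2)] field_inv(1)[OF assms(3,4)]
    by (simp add: m_ac del: field_inv)
  then have "(x \<otimes> y) \<otimes> (inv x \<otimes> inv y) = \<one>" by simp
  then show ?thesis
    using assms by (intro comm_inv_char[symmetric] comm_inv_char) auto
qed

text \<open>The fractional ideals of the valuation ring. The value of zero is unspecified,
  so zero has to be put in by hand.\<close>

definition val_ge :: "'a ring \<Rightarrow> ('a \<Rightarrow> int) \<Rightarrow> int \<Rightarrow> 'a set" where
  "val_ge F v k = {x \<in> carrier F. x = \<zero>\<^bsub>F\<^esub> \<or> v x \<ge> k}"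

abbreviation val_ring :: "'a ring \<Rightarrow> ('a \<Rightarrow> int) \<Rightarrow> 'a set" where
  "val_ring F v \<equiv> val_ge F v 0"

locale dval = field F for F :: "'a ring" (structure) +
  fixes v :: "'a \<Rightarrow> int"
  assumes dv: "discrete_valuation F v"
begin

lemma v_mult:
  assumes "x \<in> carrier F" "x \<noteq> \<zero>" "y \<in> carrier F" "y \<noteq> \<zero>"
  shows "v (x \<otimes> y) = v x + v y"
  using dv assms by (auto simp: discrete_valuation_def)

lemma v_one: "v \<one> = 0"
  using v_mult[of \<one> \<one>] by simp

lemma v_inv:
  assumes "x \<in> carrier F" "x \<noteq> \<zero>"
  shows "v (inv x) = - v x"
  using v_mult[OF assms, of "inv x"] field_inv[OF assms] v_one by simp

lemma v_pow:
  assumes "x \<in> carrier F" "x \<noteq> \<zero>"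
  shows "v (x [^] (k::nat)) = int k * v x"
proof (induction k)
  case (Suc k)
  then show ?case using v_mult[of "x [^] k" x] assms field_inv_pow[OF assms] by (simp add: algebra_simps)
qed (simp add: v_one)

lemma v_neg:
  assumes "x \<in> carrier F" "x \<noteq> \<zero>"
  shows "v (\<ominus> x) = v x"
proof -
  have n0: "\<ominus> \<one> \<noteq> \<zero>" by (metis minus_minus minus_zero one_closed zero_not_one)
  have "v ((\<ominus> \<one>) \<otimes> (\<ominus> \<one>)) = 2 * v (\<ominus> \<one>)" using n0 by (subst v_mult) auto
  moreover have "(\<ominus> \<one>) \<otimes> (\<ominus> \<one>) = \<one>" by (simp add: l_minus)
  ultimately have "v (\<ominus> \<one>) = 0" by (simp add: v_one)
  then show ?thesis using v_mult[of "\<ominus> \<one>" x] n0 assms by (simp add: l_minus)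
qed

lemma v_surj: obtains x where "x \<in> carrier F" "x \<noteq> \<zero>" "v x = k"
proof -
  have "k \<in> v ` (carrier F - {\<zero>})" using dv unfolding discrete_valuation_def by blast
  then show ?thesis using that by auto
qed

lemma val_ge_carrier: "val_ge F v k \<subseteq> carrier F"
  by (auto simp: val_ge_def)

lemma val_geD: "x \<in> val_ge F v k \<Longrightarrow> x \<in> carrier F"
  by (auto simp: val_ge_def)

lemma val_ge_iff: "x \<noteq> \<zero> \<Longrightarrow> x \<in> val_ge F v k \<longleftrightarrow> x \<in> carrier F \<and> v x \<ge> k"
  by (auto simp: val_ge_def)

lemma val_ge_zero [simp]: "\<zero> \<in> val_ge F v k"
  by (auto simp: val_ge_def)

lemma val_ge_mono: "x \<in> val_ge F v k \<Longrightarrow> l \<le> k \<Longrightarrow> x \<in> val_ge F v l"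
  by (auto simp: val_ge_def)

lemma val_ge_add:
  assumes "x \<in> val_ge F v k" "y \<in> val_ge F v k"
  shows "x \<oplus> y \<in> val_ge F v k"
proof (cases "x = \<zero> \<or> y = \<zero> \<or> x \<oplus> y = \<zero>")
  case False
  then have "v (x \<oplus> y) \<ge> min (v x) (v y)"
    using dv assms by (auto simp: discrete_valuation_def val_ge_def)
  then show ?thesis using False assms by (auto simp: val_ge_def)
qed (use assms in \<open>auto simp: val_ge_def\<close>)

lemma val_ge_neg: "x \<in> val_ge F v k \<Longrightarrow> \<ominus> x \<in> val_ge F v k"
  using v_neg[of x] by (cases "x = \<zero>") (auto simp: val_ge_def)

lemma val_ge_minus: "x \<in> val_ge F v k \<Longrightarrow> y \<in> val_ge F v k \<Longrightarrow> x \<ominus> y \<in> val_ge F v k"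
  unfolding a_minus_def by (intro val_ge_add val_ge_neg)

lemma val_ge_mult:
  assumes "x \<in> val_ge F v k" "y \<in> val_ge F v l"
  shows "x \<otimes> y \<in> val_ge F v (k + l)"
  using assms v_mult[of x y] by (cases "x = \<zero> \<or> y = \<zero>") (auto simp: val_ge_def)

lemma val_ge_mult':
  assumes "x \<in> val_ge F v k" "y \<in> val_ge F v l" "j \<le> k + l"
  shows "x \<otimes> y \<in> val_ge F v j"
  using val_ge_mult[OF assms(1,2)] val_ge_mono assms(3) by blast

lemma val_ge_self: "x \<in> carrier F \<Longrightarrow> x \<in> val_ge F v (v x)"
  by (auto simp: val_ge_def)

lemma val_ge_one [simp]: "\<one> \<in> val_ge F v 0"
  by (auto simp: val_ge_def v_one)

lemma val_ge_finsum:
  assumes "\<And>i. i \<in> A \<Longrightarrow> f i \<in> val_ge F v k"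
  shows "finsum F f A \<in> val_ge F v k"
proof (cases "finite A")
  case True
  then show ?thesis using assms
  proof (induction A rule: finite_induct)
    case (insert a A)
    have "f \<in> A \<rightarrow> carrier F" "f a \<in> carrier F" using insert.prems val_geD by blast+
    then show ?case using insert val_ge_add by (simp add: finsum_insert)
  qed simp
qed (simp add: finsum_infinite)

lemma val_ge_exact_add:
  assumes "x \<in> carrier F" "x \<noteq> \<zero>" "y \<in> val_ge F v (v x + 1)"
  shows "x \<oplus> y \<noteq> \<zero>" "v (x \<oplus> y) = v x"
proof -
  have y: "y \<in> carrier F" using assms by (simp add: val_geD)
  have x: "x \<notin> val_ge F v (v x + 1)" using assms by (auto simp: val_ge_def)
  have eq: "x = (x \<oplus> y) \<ominus> y" using assms y by (simp add: a_minus_def a_assoc r_neg)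
  have nin: "x \<oplus> y \<notin> val_ge F v (v x + 1)"
    using x eq val_ge_minus[OF _ assms(3)] by metis
  then show nz: "x \<oplus> y \<noteq> \<zero>" by auto
  have "x \<oplus> y \<in> val_ge F v (v x)"
    using val_ge_add val_ge_self[OF assms(1)] val_ge_mono[OF assms(3)] by simp
  then show "v (x \<oplus> y) = v x" using nz nin by (auto simp: val_ge_def)
qed

lemma val_ring_subring: "subring (val_ring F v) F"
  by (rule subringI) (auto intro: val_ge_carrier val_ge_neg val_ge_add val_ge_mult' simp: val_geD)

lemma val_unit:
  assumes "x \<in> val_ring F v" "x \<notin> val_ge F v 1"
  shows "x \<in> carrier F" "x \<noteq> \<zero>" "v x = 0" "inv x \<in> val_ring F v"
proof -
  show x: "x \<in> carrier F" "x \<noteq> \<zero>" "v x = 0" using assms by (auto simp: val_ge_def)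
  show "inv x \<in> val_ring F v" using field_inv[OF x(1,2)] v_inv[OF x(1,2)] x by (auto simp: val_ge_def)
qed

lemma val_ring_proper: "val_ring F v \<noteq> carrier F"
proof -
  obtain x where "x \<in> carrier F" "x \<noteq> \<zero>" "v x = -1" by (rule v_surj)
  then show ?thesis by (auto simp: val_ge_def)
qed

text \<open>An element \<open>b\<close> of negative value generates everything: since the value group is archimedean,
  \<open>x / b\<^sup>n\<close> is integral for large \<open>n\<close>. Two different discrete valuation rings are therefore
  incomparable, and valuation rings will be identified by proving one inclusion.\<close>

lemma dval_maximal:
  assumes "subring B F" "val_ring F v \<subseteq> B" "B \<noteq> carrier F"
  shows "B = val_ring F v"
proof (rule ccontr)
  assume "B \<noteq> val_ring F v"
  then obtain b where b: "b \<in> B" "b \<notin> val_ring F v" using assms by blast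
  have bc: "b \<in> carrier F" using b subringE(1)[OF assms(1)] by auto
  then have b0: "b \<noteq> \<zero>" "v b < 0" using b by (auto simp: val_ge_def)
  have pw: "b [^] (n::nat) \<in> B" for n
    by (induction n) (auto simp: subringE[OF assms(1)] b)
  have "x \<in> B" if x: "x \<in> carrier F" for x
  proof (cases "x = \<zero>")
    case False
    define n where "n = nat \<bar>v x\<bar>"
    have bn: "b [^] n \<in> carrier F" "b [^] n \<noteq> \<zero>" using bc field_inv_pow b0 by auto
    note ib = field_inv[OF bn]
    have "v (x \<otimes> inv (b [^] n)) = v x - int n * v b"
      using v_mult[OF x False ib(1,2)] v_inv[OF bn] v_pow[OF bc b0(1)] by simp
    also have "\<dots> \<ge> 0"
    proof -
      have "int n * v b \<le> int n * (-1)" using b0 by (intro mult_left_mono) auto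
      then show ?thesis by (simp add: n_def)
    qed
    finally have "x \<otimes> inv (b [^] n) \<in> val_ring F v" using x ib by (auto simp: val_ge_def)
    then have "(x \<otimes> inv (b [^] n)) \<otimes> b [^] n \<in> B" using assms(2) pw subringE(6)[OF assms(1)] by blast
    moreover have "(x \<otimes> inv (b [^] n)) \<otimes> b [^] n = x" using x ib bn by (simp add: m_assoc)
    ultimately show ?thesis by simp
  qed (use subringE(2)[OF assms(1)] in auto)
  then show False using assms(3) subringE(1)[OF assms(1)] by auto
qed

end

section \<open>Weak approximation\<close>

context dval
begin

lemma v_one_plus_pow:
  assumes z: "z \<in> carrier F" "z \<noteq> \<zero>" and r: "r > (0::nat)"
  shows "v z < 0 \<Longrightarrow> \<one> \<oplus> z [^] r \<noteq> \<zero> \<and> v (\<one> \<oplus> z [^] r) = int r * v z"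
    and "v z > 0 \<Longrightarrow> \<one> \<oplus> z [^] r \<noteq> \<zero> \<and> v (\<one> \<oplus> z [^] r) = 0"
proof -
  have zr: "z [^] r \<in> carrier F" "z [^] r \<noteq> \<zero>" "v (z [^] r) = int r * v z"
    using z field_inv_pow v_pow by auto
  {
    assume "v z < 0"
    then have "int r * v z < 0" using r by (simp add: mult_pos_neg)
    then have "v (z [^] r) + 1 \<le> 0" using zr by simp
    then have "\<one> \<in> val_ge F v (v (z [^] r) + 1)" using v_one by (simp add: val_ge_iff)
    from val_ge_exact_add[OF zr(1,2) this]
    show "\<one> \<oplus> z [^] r \<noteq> \<zero> \<and> v (\<one> \<oplus> z [^] r) = int r * v z"
      using zr by (simp add: a_comm)
  }
  {
    assume "v z > 0"
    then have "int r * v z > 0" using r by simp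
    then have "v (z [^] r) \<ge> v \<one> + 1" using zr v_one by simp
    then have "z [^] r \<in> val_ge F v (v \<one> + 1)" using zr by (auto simp: val_ge_def)
    from val_ge_exact_add[OF one_closed _ this]
    show "\<one> \<oplus> z [^] r \<noteq> \<zero> \<and> v (\<one> \<oplus> z [^] r) = 0"
      using v_one by simp
  }
qed

text \<open>As \<open>r\<close> grows, \<open>z\<^sup>r / (1 + z\<^sup>r)\<close> tends to \<open>1\<close> where \<open>z\<close> has a pole and to \<open>0\<close> where
  \<open>z\<close> has a zero.\<close>

lemma v_frac_pow:
  assumes z: "z \<in> carrier F" "z \<noteq> \<zero>" and r: "r > (0::nat)" and nz: "v z \<noteq> 0"
  defines "e \<equiv> z [^] r \<otimes> inv (\<one> \<oplus> z [^] r)"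
  shows "e \<in> carrier F" "e \<noteq> \<zero>" "v z < 0 \<Longrightarrow> v e = 0" "v z > 0 \<Longrightarrow> v e = int r * v z"
    "v z < 0 \<Longrightarrow> e \<ominus> \<one> \<in> val_ge F v (int r)"
proof -
  have zr: "z [^] r \<in> carrier F" "z [^] r \<noteq> \<zero>" "v (z [^] r) = int r * v z"
    using z field_inv_pow v_pow by auto
  let ?d = "\<one> \<oplus> z [^] r"
  have d: "?d \<in> carrier F" "?d \<noteq> \<zero>" using zr v_one_plus_pow[OF z r] nz by (auto simp: neq_iff)
  note di = field_inv[OF d]
  show e: "e \<in> carrier F" "e \<noteq> \<zero>" using zr di by (auto simp: e_def integral_iff)
  have ve: "v e = int r * v z - v ?d"
    unfolding e_def using zr di v_inv[OF d] by (simp add: v_mult)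
  then show "v z < 0 \<Longrightarrow> v e = 0" "v z > 0 \<Longrightarrow> v e = int r * v z"
    using v_one_plus_pow[OF z r] by auto
  assume neg: "v z < 0"
  have "e \<ominus> \<one> = (z [^] r \<otimes> inv ?d) \<ominus> (?d \<otimes> inv ?d)" using di by (simp add: e_def)
  also have "\<dots> = (z [^] r \<ominus> ?d) \<otimes> inv ?d"
    using zr d di(1) by (simp add: a_minus_def l_distr l_minus)
  also have "z [^] r \<ominus> ?d = \<ominus> \<one>"
    using zr(1) by (simp add: a_minus_def minus_add r_neg a_lcomm[of "z [^] r"])
  also have "\<ominus> \<one> \<otimes> inv ?d = \<ominus> (inv ?d)" using di by (simp add: l_minus)
  finally have "e \<ominus> \<one> = \<ominus> (inv ?d)" .
  moreover have "v (inv ?d) \<ge> int r"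
  proof -
    have "int r * v z \<le> int r * (-1)" using neg by (intro mult_left_mono) auto
    then show ?thesis using v_inv[OF d] v_one_plus_pow(1)[OF z r neg] by simp
  qed
  ultimately show "e \<ominus> \<one> \<in> val_ge F v (int r)"
    using di val_ge_neg[of "inv ?d"] by (auto simp: val_ge_def)
qed

end

context
  fixes F :: "'a ring" (structure) and v :: "'i \<Rightarrow> 'a \<Rightarrow> int" and I :: "'i set"
  assumes F: "field F" and fin: "finite I"
    and dvs: "\<And>i. i \<in> I \<Longrightarrow> dval F (v i)"
    and inj: "inj_on (\<lambda>i. val_ring F (v i)) I"
begin

interpretation field F by (rule F)

text \<open>By maximality neither valuation ring contains the other; divide an element of the second
  that is not in the first by one of the first that is not in the second.\<close>

lemma separate_two:
  assumes i: "i \<in> I" and j: "j \<in> I" and ij: "i \<noteq> j"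
  shows "\<exists>z. z \<in> carrier F \<and> z \<noteq> \<zero> \<and> v i z < 0 \<and> v j z > 0"
proof -
  interpret Vi: dval F "v i" by (rule dvs[OF i])
  interpret Vj: dval F "v j" by (rule dvs[OF j])
  have ne: "val_ring F (v i) \<noteq> val_ring F (v j)" using inj i j ij by (auto dest: inj_onD)
  have "\<not> val_ring F (v i) \<subseteq> val_ring F (v j)"
    using Vi.dval_maximal[OF Vj.val_ring_subring] Vj.val_ring_proper ne by metis
  then obtain a where a0: "a \<in> val_ring F (v i)" "a \<notin> val_ring F (v j)" by blast
  then have "a \<noteq> \<zero>" by auto
  with a0 have a: "a \<in> carrier F" "a \<noteq> \<zero>" "v i a \<ge> 0" "v j a < 0"
    by (auto simp: val_ge_def)
  have "\<not> val_ring F (v j) \<subseteq> val_ring F (v i)"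
    using Vj.dval_maximal[OF Vi.val_ring_subring] Vi.val_ring_proper ne by metis
  then obtain b where b0: "b \<in> val_ring F (v j)" "b \<notin> val_ring F (v i)" by blast
  then have "b \<noteq> \<zero>" by auto
  with b0 have b: "b \<in> carrier F" "b \<noteq> \<zero>" "v j b \<ge> 0" "v i b < 0"
    by (auto simp: val_ge_def)
  note ai = field_inv[OF a(1,2)]
  have "v i (b \<otimes> inv a) < 0" "v j (b \<otimes> inv a) > 0"
    using a b ai by (simp_all add: Vi.v_mult Vj.v_mult Vi.v_inv Vj.v_inv)
  moreover have "b \<otimes> inv a \<noteq> \<zero>" using a b ai by (simp add: integral_iff)
  ultimately show ?thesis using a b ai by (intro exI[of _ "b \<otimes> inv a"]) auto
qed

text \<open>Induction on \<open>J\<close>. Let \<open>z\<close> separate \<open>i\<close> from \<open>J\<close>, and \<open>y\<close> separate \<open>i\<close> from the new index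
  \<open>j\<^sub>0\<close>. If \<open>z\<close> has no pole at \<open>j\<^sub>0\<close>, then \<open>z\<^sup>r y\<close> works for large \<open>r\<close>. Otherwise replace \<open>z\<^sup>r\<close> by
  \<open>z\<^sup>r / (1 + z\<^sup>r)\<close>, which is a unit at \<open>i\<close> and at \<open>j\<^sub>0\<close> and still very small on \<open>J\<close>.\<close>

lemma separate_one_from_many:
  assumes i: "i \<in> I" and "finite J" and "J \<subseteq> I - {i}"
  shows "\<exists>z. z \<in> carrier F \<and> z \<noteq> \<zero> \<and> v i z < 0 \<and> (\<forall>j\<in>J. v j z > 0)"
  using assms(2,3)
proof (induction J rule: finite_induct)
  case empty
  interpret Vi: dval F "v i" by (rule dvs[OF i])
  obtain z where "z \<in> carrier F" "z \<noteq> \<zero>" "v i z = -1" by (rule Vi.v_surj)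
  then show ?case by auto
next
  case (insert j0 J)
  interpret Vi: dval F "v i" by (rule dvs[OF i])
  have j0: "j0 \<in> I" "j0 \<noteq> i" using insert by auto
  interpret V0: dval F "v j0" by (rule dvs[OF j0(1)])
  obtain z where z: "z \<in> carrier F" "z \<noteq> \<zero>" "v i z < 0" "\<And>j. j \<in> J \<Longrightarrow> v j z > 0"
    using insert by auto
  obtain y where y: "y \<in> carrier F" "y \<noteq> \<zero>" "v i y < 0" "v j0 y > 0"
    using separate_two[OF i j0(1)] j0 by auto
  define r where "r = Suc (\<Sum>j\<in>J. nat \<bar>v j y\<bar>)"
  have r0: "r > 0" by (simp add: r_def)
  have rJ: "int r * v j z + v j y > 0" if j: "j \<in> J" for j
  proof -
    have "nat \<bar>v j y\<bar> \<le> (\<Sum>j\<in>J. nat \<bar>v j y\<bar>)"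
      using j insert.hyps by (intro member_le_sum) auto
    then have "int r > \<bar>v j y\<bar>" unfolding r_def by linarith
    moreover have "int r * v j z \<ge> int r * 1" using z(4)[OF j] by (intro mult_left_mono) auto
    ultimately show ?thesis by linarith
  qed
  have zr: "z [^] r \<in> carrier F" "z [^] r \<noteq> \<zero>" using z field_inv_pow by auto
  show ?case
  proof (cases "v j0 z \<ge> 0")
    case True
    have "v j (z [^] r \<otimes> y) = int r * v j z + v j y" if "j \<in> I" for j
    proof -
      interpret Vj: dval F "v j" by (rule dvs[OF that])
      show ?thesis using zr y z by (simp add: Vj.v_mult Vj.v_pow)
    qed
    note val = this
    have "v i (z [^] r \<otimes> y) < 0"
      using val[OF i] y z r0 mult_pos_neg[of "int r" "v i z"] by simp
    moreover have "v j0 (z [^] r \<otimes> y) > 0"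
      using val[OF j0(1)] y True by (simp add: add_nonneg_pos)
    moreover have "v j (z [^] r \<otimes> y) > 0" if "j \<in> J" for j
      using val[of j] rJ[OF that] that insert.prems by auto
    ultimately show ?thesis
      using zr y by (intro exI[of _ "z [^] r \<otimes> y"]) (auto simp: integral_iff)
  next
    case False
    define e where "e = z [^] r \<otimes> inv (\<one> \<oplus> z [^] r)"
    note ei = Vi.v_frac_pow[OF z(1,2) r0, folded e_def]
    note e0 = V0.v_frac_pow[OF z(1,2) r0, folded e_def]
    have e: "e \<in> carrier F" "e \<noteq> \<zero>" using ei z by auto
    have "v i (e \<otimes> y) < 0" using ei z e y by (simp add: Vi.v_mult)
    moreover have "v j0 (e \<otimes> y) > 0" using e0 False e y by (simp add: V0.v_mult)
    moreover have "v j (e \<otimes> y) > 0" if j: "j \<in> J" for j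
    proof -
      interpret Vj: dval F "v j" using dvs j insert.prems by auto
      show ?thesis
        using Vj.v_frac_pow(4)[OF z(1,2) r0, folded e_def] z(4)[OF j] rJ[OF j] e y
        by (simp add: Vj.v_mult)
    qed
    ultimately show ?thesis
      using e y by (intro exI[of _ "e \<otimes> y"]) (auto simp: integral_iff)
  qed
qed

lemma approximate_idempotent:
  assumes i: "i \<in> I" and N: "N > (0::nat)"
  shows "\<exists>e. e \<in> carrier F \<and> e \<ominus> \<one> \<in> val_ge F (v i) (int N) \<and>
             (\<forall>j\<in>I - {i}. e \<in> val_ge F (v j) (int N))"
proof -
  interpret Vi: dval F "v i" by (rule dvs[OF i])
  obtain z where z: "z \<in> carrier F" "z \<noteq> \<zero>" "v i z < 0" "\<And>j. j \<in> I - {i} \<Longrightarrow> v j z > 0"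
    using separate_one_from_many[OF i, of "I - {i}"] fin by auto
  define e where "e = z [^] N \<otimes> inv (\<one> \<oplus> z [^] N)"
  note ei = Vi.v_frac_pow[OF z(1,2) N, folded e_def]
  have "e \<in> val_ge F (v j) (int N)" if j: "j \<in> I - {i}" for j
  proof -
    interpret Vj: dval F "v j" using dvs j by auto
    have "int N * v j z \<ge> int N * 1" using z(4)[OF j] by (intro mult_left_mono) auto
    then show ?thesis
      using Vj.v_frac_pow(1,2,4)[OF z(1,2) N, folded e_def] z(4)[OF j] by (auto simp: val_ge_def)
  qed
  then show ?thesis using ei z by (intro exI[of _ e]) auto
qed

text \<open>Combine the targets with the approximate idempotents; their precision \<open>M\<close> also has to absorb
  the poles of the targets.\<close>

lemma weak_approximation:
  assumes a: "\<And>i. i \<in> I \<Longrightarrow> a i \<in> carrier F"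
  shows "\<exists>x. x \<in> carrier F \<and> (\<forall>i\<in>I. x \<ominus> a i \<in> val_ge F (v i) (int N))"
proof -
  define M where "M = Suc (N + (\<Sum>i\<in>I. \<Sum>j\<in>I. nat \<bar>v j (a i)\<bar>))"
  have M: "int M + v j (a i) \<ge> int N" if "i \<in> I" "j \<in> I" for i j
  proof -
    have "nat \<bar>v j (a i)\<bar> \<le> (\<Sum>j\<in>I. nat \<bar>v j (a i)\<bar>)"
      using that fin by (intro member_le_sum) auto
    also have "\<dots> \<le> (\<Sum>i\<in>I. \<Sum>j\<in>I. nat \<bar>v j (a i)\<bar>)"
      using that fin by (intro member_le_sum[of i I "\<lambda>i. \<Sum>j\<in>I. nat \<bar>v j (a i)\<bar>"]) auto
    finally show ?thesis unfolding M_def by linarith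
  qed
  have "\<forall>i\<in>I. \<exists>e. e \<in> carrier F \<and> e \<ominus> \<one> \<in> val_ge F (v i) (int M) \<and>
             (\<forall>j\<in>I - {i}. e \<in> val_ge F (v j) (int M))"
    using approximate_idempotent[where N = M] by (auto simp: M_def simp del: of_nat_Suc)
  then obtain e where e: "\<And>i. i \<in> I \<Longrightarrow> e i \<in> carrier F"
    "\<And>i. i \<in> I \<Longrightarrow> e i \<ominus> \<one> \<in> val_ge F (v i) (int M)"
    "\<And>i j. i \<in> I \<Longrightarrow> j \<in> I - {i} \<Longrightarrow> e i \<in> val_ge F (v j) (int M)"
    by metis
  define x where "x = finsum F (\<lambda>i. e i \<otimes> a i) I"
  have ea: "(\<lambda>i. e i \<otimes> a i) \<in> I \<rightarrow> carrier F" using e(1) a by auto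
  have "x \<ominus> a j \<in> val_ge F (v j) (int N)" if j: "j \<in> I" for j
  proof -
    interpret Vj: dval F "v j" by (rule dvs[OF j])
    let ?y = "finsum F (\<lambda>i. e i \<otimes> a i) (I - {j})"
    have y: "?y \<in> val_ge F (v j) (int N)"
      using e(3) j a M by (intro Vj.val_ge_finsum Vj.val_ge_mult'[OF _ Vj.val_ge_self]) auto
    have "x = (e j \<otimes> a j) \<oplus> ?y"
      unfolding x_def using j fin ea finsum_insert[of "I - {j}" j "\<lambda>i. e i \<otimes> a i"]
      by (auto simp: insert_absorb)
    then have "x \<ominus> a j = ((e j \<ominus> \<one>) \<otimes> a j) \<oplus> ?y"
      using e(1)[OF j] a[OF j] Vj.val_geD[OF y]
      by (simp add: a_minus_def l_distr l_minus a_ac)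
    then show ?thesis
      using y Vj.val_ge_mult'[OF e(2)[OF j] Vj.val_ge_self[OF a[OF j]] M[OF j j]] Vj.val_ge_add
      by simp
  qed
  then show ?thesis using ea by (intro exI[of _ x]) (auto simp: x_def)
qed

text \<open>Zero is a solution only if all targets have value at least \<open>N\<close>. Then an element of value exactly \<open>N\<close>
  at each \<open>i\<close>, found by approximation once more, is another solution.\<close>

lemma weak_approximation_nonzero:
  assumes a: "\<And>i. i \<in> I \<Longrightarrow> a i \<in> carrier F" and ne: "I \<noteq> {}"
  shows "\<exists>x. x \<in> carrier F \<and> x \<noteq> \<zero> \<and> (\<forall>i\<in>I. x \<ominus> a i \<in> val_ge F (v i) (int N))"
proof -
  obtain x where x: "x \<in> carrier F" "\<And>i. i \<in> I \<Longrightarrow> x \<ominus> a i \<in> val_ge F (v i) (int N)"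
    using weak_approximation[of a N] a by blast
  show ?thesis
  proof (cases "x = \<zero>")
    case True
    have "\<forall>i\<in>I. \<exists>c. c \<in> carrier F \<and> c \<noteq> \<zero> \<and> v i c = int N"
    proof
      fix i assume i: "i \<in> I"
      interpret Vi: dval F "v i" by (rule dvs[OF i])
      obtain c where "c \<in> carrier F" "c \<noteq> \<zero>" "v i c = int N" by (rule Vi.v_surj)
      then show "\<exists>c. c \<in> carrier F \<and> c \<noteq> \<zero> \<and> v i c = int N" by blast
    qed
    then obtain c where c: "\<And>i. i \<in> I \<Longrightarrow> c i \<in> carrier F" "\<And>i. i \<in> I \<Longrightarrow> c i \<noteq> \<zero>"
      "\<And>i. i \<in> I \<Longrightarrow> v i (c i) = int N"
      by metis
    obtain z where z: "z \<in> carrier F" "\<And>i. i \<in> I \<Longrightarrow> z \<ominus> c i \<in> val_ge F (v i) (int (Suc N))"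
      using weak_approximation[of c, OF c(1)] by blast
    have zv: "z \<noteq> \<zero> \<and> z \<in> val_ge F (v i) (int N)" if i: "i \<in> I" for i
    proof -
      interpret Vi: dval F "v i" by (rule dvs[OF i])
      have "z = c i \<oplus> (z \<ominus> c i)"
        using z(1) c(1)[OF i] by (simp add: a_minus_def a_lcomm r_neg)
      moreover have "z \<ominus> c i \<in> val_ge F (v i) (v i (c i) + 1)"
        using z(2)[OF i] c(3)[OF i] by (simp add: add.commute)
      note Vi.val_ge_exact_add[OF c(1)[OF i] c(2)[OF i] this]
      ultimately have "z \<noteq> \<zero>" "v i z = int N" using c(3)[OF i] by simp_all
      then show ?thesis using z(1) by (auto simp: val_ge_def)
    qed
    have "z \<ominus> a i \<in> val_ge F (v i) (int N)" if i: "i \<in> I" for i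
    proof -
      interpret Vi: dval F "v i" by (rule dvs[OF i])
      have "z \<ominus> a i = z \<oplus> (x \<ominus> a i)" using True a[OF i] z by (simp add: a_minus_def)
      then show ?thesis using Vi.val_ge_add zv[OF i] x(2)[OF i] by simp
    qed
    then show ?thesis using zv ne z by blast
  qed (use x in auto)
qed

end

section \<open>Polynomials and their coefficients\<close>

text \<open>The list representation stores the leading coefficient first and allows no leading zeros,
  whence the reversal and the normalization.\<close>

definition (in ring) poly_of_fun :: "nat \<Rightarrow> (nat \<Rightarrow> 'a) \<Rightarrow> 'a list" where
  "poly_of_fun n f = normalize (map f (rev [0..<n]))"

definition (in ring) mono :: "'a \<Rightarrow> nat \<Rightarrow> 'a list" where
  "mono c n = poly_of_fun (Suc n) (\<lambda>k. if k = n then c else \<zero>)"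

context domain
begin

abbreviation FX where "FX \<equiv> (carrier R)[X]"

lemma FX_domain: "domain FX"
  by (rule univ_poly_is_domain[OF carrier_is_subring])

interpretation FX: domain FX
  by (rule FX_domain)

lemma FX_set: "p \<in> carrier FX \<Longrightarrow> set p \<subseteq> carrier R"
  using polynomial_in_carrier[OF carrier_is_subring] univ_poly_carrier by blast

lemma FX_coeff [simp, intro]: "p \<in> carrier FX \<Longrightarrow> coeff p k \<in> carrier R"
  using FX_set by simp

lemma FX_eqI:
  assumes "p \<in> carrier FX" "q \<in> carrier FX" "\<And>k. coeff p k = coeff q k"
  shows "p = q"
  using assms coeff_iff_polynomial_cond[of "carrier R" p q] by (auto simp: univ_poly_carrier)

lemma FX_zero: "\<zero>\<^bsub>FX\<^esub> = []"
  by (simp add: univ_poly_zero)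

lemma coeff_FX_zero [simp]: "coeff \<zero>\<^bsub>FX\<^esub> k = \<zero>"
  by (simp add: FX_zero)

lemma coeff_FX_add [simp]:
  "p \<in> carrier FX \<Longrightarrow> q \<in> carrier FX \<Longrightarrow> coeff (p \<oplus>\<^bsub>FX\<^esub> q) k = coeff p k \<oplus> coeff q k"
  using poly_add_coeff[of p q] FX_set by (simp add: univ_poly_add del: poly_add.simps)

lemma coeff_FX_neg [simp]:
  assumes "p \<in> carrier FX"
  shows "coeff (\<ominus>\<^bsub>FX\<^esub> p) k = \<ominus> coeff p k"
proof -
  have "coeff (p \<oplus>\<^bsub>FX\<^esub> \<ominus>\<^bsub>FX\<^esub> p) k = \<zero>" using assms by (simp add: FX.r_neg)
  then have "coeff p k \<oplus> coeff (\<ominus>\<^bsub>FX\<^esub> p) k = \<zero>" using assms by simp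
  then show ?thesis using assms
    by (metis FX.a_inv_closed FX_coeff add.inv_comm minus_equality)
qed

lemma coeff_FX_minus [simp]:
  "p \<in> carrier FX \<Longrightarrow> q \<in> carrier FX \<Longrightarrow> coeff (p \<ominus>\<^bsub>FX\<^esub> q) k = coeff p k \<ominus> coeff q k"
  by (simp add: a_minus_def)

lemma coeff_FX_mult:
  "p \<in> carrier FX \<Longrightarrow> q \<in> carrier FX \<Longrightarrow>
    coeff (p \<otimes>\<^bsub>FX\<^esub> q) k = (\<Oplus>i\<in>{..k}. coeff p i \<otimes> coeff q (k - i))"
  using poly_mult_coeff[of p q] FX_set by (simp add: univ_poly_mult)

lemma poly_of_fun:
  assumes "\<And>k. k < n \<Longrightarrow> f k \<in> carrier R"
  shows "poly_of_fun n f \<in> carrier FX" "coeff (poly_of_fun n f) k = (if k < n then f k else \<zero>)"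
    "length (poly_of_fun n f) \<le> n"
proof -
  have set: "set (map f (rev [0..<n])) \<subseteq> carrier R" using assms by auto
  show "poly_of_fun n f \<in> carrier FX"
    using normalize_gives_polynomial[OF set] by (simp add: poly_of_fun_def univ_poly_carrier)
  have "coeff (poly_of_fun n f) k = coeff (map f (rev [0..<n])) k"
    unfolding poly_of_fun_def by (rule fun_cong[OF normalize_coeff[symmetric]])
  also have "\<dots> = (if k < n then f k else \<zero>)"
    using coeff_nth[of k "map f (rev [0..<n])"] coeff_length[of "map f (rev [0..<n])" k]
    by (auto simp: rev_nth)
  finally show "coeff (poly_of_fun n f) k = (if k < n then f k else \<zero>)" .
  show "length (poly_of_fun n f) \<le> n"
    unfolding poly_of_fun_def using normalize_length_le[of "map f (rev [0..<n])"] by simp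
qed

lemma mono:
  assumes "c \<in> carrier R"
  shows "mono c n \<in> carrier FX" "coeff (mono c n) k = (if k = n then c else \<zero>)"
    "length (mono c n) \<le> Suc n"
  using poly_of_fun[of "Suc n" "\<lambda>k. if k = n then c else \<zero>"] assms unfolding mono_def by auto

lemma FX_length_le_iff:
  assumes "p \<in> carrier FX"
  shows "length p \<le> n \<longleftrightarrow> (\<forall>k\<ge>n. coeff p k = \<zero>)"
proof
  show "length p \<le> n \<Longrightarrow> \<forall>k\<ge>n. coeff p k = \<zero>" using coeff_length[of p] by auto
next
  assume *: "\<forall>k\<ge>n. coeff p k = \<zero>"
  show "length p \<le> n"
  proof (rule ccontr)
    assume n: "\<not> length p \<le> n"
    then have ne: "p \<noteq> []" by auto
    then have "coeff p (length p - 1) = hd p" by (rule lead_coeff_simp)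
    moreover have "hd p \<noteq> \<zero>" using assms ne by (auto simp: univ_poly_carrier[symmetric] polynomial_def)
    moreover have "length p - 1 \<ge> n" using n by linarith
    ultimately show False using * by auto
  qed
qed

lemma coeff_mono_mult:
  assumes c: "c \<in> carrier R" and p: "p \<in> carrier FX"
  shows "coeff (mono c n \<otimes>\<^bsub>FX\<^esub> p) k = (if n \<le> k then c \<otimes> coeff p (k - n) else \<zero>)"
proof -
  have "coeff (mono c n \<otimes>\<^bsub>FX\<^esub> p) k = (\<Oplus>i\<in>{..k}. (if i = n then c \<otimes> coeff p (k - n) else \<zero>))"
    unfolding coeff_FX_mult[OF mono(1)[OF c] p]
    using c p by (intro add.finprod_cong') (auto simp: mono)
  also have "\<dots> = (if n \<le> k then c \<otimes> coeff p (k - n) else \<zero>)"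
    using add.finprod_singleton_swap[of n "{..k}" "\<lambda>_. c \<otimes> coeff p (k - n)"] c p
    by (auto intro!: add.finprod_one_eqI simp: if_distrib cong: if_cong)
  finally show ?thesis .
qed

lemma mono_mult:
  assumes "c \<in> carrier R" "d \<in> carrier R"
  shows "mono c n \<otimes>\<^bsub>FX\<^esub> mono d k = mono (c \<otimes> d) (n + k)"
  by (rule FX_eqI) (use assms in \<open>auto simp: coeff_mono_mult mono\<close>)

lemma mono_add:
  assumes "c \<in> carrier R" "d \<in> carrier R"
  shows "mono c n \<oplus>\<^bsub>FX\<^esub> mono d n = mono (c \<oplus> d) n"
  by (rule FX_eqI) (use assms in \<open>auto simp: mono\<close>)

lemma mono_one: "mono \<one> 0 = \<one>\<^bsub>FX\<^esub>"
  by (simp add: mono_def poly_of_fun_def univ_poly_one)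

lemma mono_pow: "c \<in> carrier R \<Longrightarrow> mono c n [^]\<^bsub>FX\<^esub> (k::nat) = mono (c [^] k) (n * k)"
  by (induction k) (simp_all add: mono_one mono_mult add.commute)

lemma mono_zero [simp]: "mono \<zero> n = \<zero>\<^bsub>FX\<^esub>"
  by (rule FX_eqI) (auto simp: mono)

lemma mono_const_hom: "(\<lambda>c. mono c 0) \<in> ring_hom R FX"
  by (rule ring_hom_memI) (auto simp: mono mono_mult mono_add mono_one)

lemma poly_split_lead:
  assumes p: "p \<in> carrier FX" "length p \<le> Suc n"
  defines "q \<equiv> p \<ominus>\<^bsub>FX\<^esub> mono (coeff p n) n"
  shows "q \<in> carrier FX" "p = mono (coeff p n) n \<oplus>\<^bsub>FX\<^esub> q" "length q \<le> n"
    "coeff q k = (if k = n then \<zero> else coeff p k)"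
proof -
  note m = mono(1)[OF FX_coeff[OF p(1)], of n n]
  show q: "q \<in> carrier FX" using p m by (simp add: q_def)
  show "p = mono (coeff p n) n \<oplus>\<^bsub>FX\<^esub> q"
    using p(1) m by (simp add: q_def a_minus_def FX.a_lcomm FX.r_neg)
  show c: "coeff q k = (if k = n then \<zero> else coeff p k)" for k
    using p(1) m by (auto simp: q_def mono a_minus_def r_neg)
  show "length q \<le> n"
    using FX_length_le_iff[OF q] FX_length_le_iff[OF p(1)] p(2) c by (auto simp: Suc_le_eq)
qed

text \<open>Induction on polynomials through their monomials; only the monomials that occur in \<open>p\<close> have to be
  considered.\<close>

lemma poly_closure:
  assumes p: "p \<in> carrier FX"
    and zero: "\<zero>\<^bsub>FX\<^esub> \<in> M"
    and add: "\<And>a b. a \<in> M \<Longrightarrow> b \<in> M \<Longrightarrow> a \<in> carrier FX \<Longrightarrow> b \<in> carrier FX \<Longrightarrow> a \<oplus>\<^bsub>FX\<^esub> b \<in> M"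
    and monic_const_value: "\<And>k. mono (coeff p k) k \<in> M"
  shows "p \<in> M"
proof -
  have "length q \<le> n \<Longrightarrow> q \<in> carrier FX \<Longrightarrow> (\<And>k. mono (coeff q k) k \<in> M) \<Longrightarrow> q \<in> M" for n q
  proof (induction n arbitrary: q)
    case 0
    then show ?case using zero by (simp add: FX_zero)
  next
    case (Suc n)
    note s = poly_split_lead[OF Suc.prems(2,1)]
    have "q \<ominus>\<^bsub>FX\<^esub> mono (coeff q n) n \<in> M"
    proof (rule Suc.IH[OF s(3,1)])
      show "mono (coeff (q \<ominus>\<^bsub>FX\<^esub> mono (coeff q n) n) k) k \<in> M" for k
        unfolding s(4) using zero Suc.prems(3) by auto
    qed
    then have "mono (coeff q n) n \<oplus>\<^bsub>FX\<^esub> (q \<ominus>\<^bsub>FX\<^esub> mono (coeff q n) n) \<in> M"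
      using Suc.prems s by (intro add) (auto simp: mono)
    then show ?case using s(2) by simp
  qed
  then show ?thesis using p monic_const_value by blast
qed

lemma eval_as_finsum:
  assumes "p \<in> carrier FX" "length p \<le> n" "y \<in> carrier R"
  shows "eval p y = (\<Oplus>k\<in>{..<n}. coeff p k \<otimes> y [^] k)"
proof -
  have "eval l y = (\<Oplus>k\<in>{..<length l}. coeff l k \<otimes> y [^] k)" if "set l \<subseteq> carrier R" for l
    using that
  proof (induction l)
    case (Cons a l)
    have "(\<Oplus>k\<in>{..<length l}. coeff (a # l) k \<otimes> y [^] k) = (\<Oplus>k\<in>{..<length l}. coeff l k \<otimes> y [^] k)"
      using Cons.prems assms(3) by (intro add.finprod_cong') auto
    moreover have "(\<lambda>k. coeff (a # l) k \<otimes> y [^] k) \<in> {..<length l} \<rightarrow> carrier R"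
      using Cons.prems assms(3) coeff_in_carrier[of "a # l"] by auto
    ultimately show ?case
      using Cons assms(3) by (simp add: lessThan_Suc)
  qed simp
  then have "eval p y = (\<Oplus>k\<in>{..<length p}. coeff p k \<otimes> y [^] k)"
    using FX_set assms by simp
  also have "\<dots> = (\<Oplus>k\<in>{..<n}. coeff p k \<otimes> y [^] k)"
    by (rule add.finprod_mono_neutral_cong_left)
       (use assms coeff_length[of p] in auto)
  finally show ?thesis .
qed

lemma FX_monicI:
  assumes p: "p \<in> carrier FX" "coeff p n \<noteq> \<zero>" "\<And>k. k > n \<Longrightarrow> coeff p k = \<zero>"
  shows "length p = Suc n"
proof -
  have "length p \<le> Suc n" using FX_length_le_iff[OF p(1)] p(3) by auto
  moreover have "\<not> length p \<le> n" using FX_length_le_iff[OF p(1)] p(2) by auto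
  ultimately show ?thesis by simp
qed

end

section \<open>Gauss valuations of rational slope\<close>

text \<open>The Gauss valuation on \<open>F[X]\<close> that extends \<open>v\<close> and gives \<open>X\<close> the value \<open>a/e\<close>, where
  \<open>a = e l + 1\<close>. All values are multiplied by \<open>e\<close> to keep them integral: a monomial \<open>c X\<^sup>k\<close> has value
  \<open>e v(c) + a k\<close>. The integer part \<open>l\<close> of the slope serves to tell several such valuations apart.\<close>

locale gauss = dval F v for F :: "'a ring" (structure) and v +
  fixes e l :: nat and \<pi> :: 'a
  assumes e_pos: "e > 0" and pi: "\<pi> \<in> carrier F" "\<pi> \<noteq> \<zero>" "v \<pi> = 1"
begin

interpretation FX: domain FX
  by (rule FX_domain)

definition slope :: nat where "slope = e * l + 1"

abbreviation "a \<equiv> slope"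

text \<open>The least integer \<open>x\<close> with \<open>e x + a k \<ge> d\<close>; the negated floor is a ceiling.\<close>

definition coeff_bound :: "int \<Rightarrow> nat \<Rightarrow> int" where
  "coeff_bound d k = - ((int (a * k) - d) div int e)"

lemma coeff_bound_iff: "x \<ge> coeff_bound d k \<longleftrightarrow> int e * x + int (a * k) \<ge> d"
proof -
  have 1: "x \<ge> coeff_bound d k \<longleftrightarrow> (int (a * k) - d) div int e \<ge> - x" by (auto simp: coeff_bound_def)
  have 2: "(int (a * k) - d) div int e \<ge> - x \<longleftrightarrow> int (a * k) - d \<ge> int e * (- x)"
  proof
    assume "- x \<le> (int (a * k) - d) div int e"
    then have "int e * (- x) \<le> int e * ((int (a * k) - d) div int e)" by (intro mult_left_mono) auto
    moreover have "int e * ((int (a * k) - d) div int e) \<le> int (a * k) - d"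
      using e_pos pos_mod_sign[of "int e" "int (a * k) - d"] mult_div_mod_eq[of "int e" "int (a * k) - d"]
      by linarith
    ultimately show "int e * (- x) \<le> int (a * k) - d" by linarith
  next
    assume "int e * (- x) \<le> int (a * k) - d"
    then have "(int e * (- x)) div int e \<le> (int (a * k) - d) div int e"
      using e_pos by (intro zdiv_mono1) auto
    then have "(int e * (- x)) div int e \<le> (int (a * k) - d) div int e" .
    moreover have "(int e * (- x)) div int e = - x"
      by (rule nonzero_mult_div_cancel_left) (use e_pos in simp)
    ultimately show "- x \<le> (int (a * k) - d) div int e" by simp
  qed
  show ?thesis unfolding 1 2 by auto
qed

lemma coeff_bound_add: "coeff_bound (d + d') (k + k') \<le> coeff_bound d k + coeff_bound d' k'"
proof -
  have "int e * coeff_bound d k + int (a * k) \<ge> d" "int e * coeff_bound d' k' + int (a * k') \<ge> d'"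
    using coeff_bound_iff by blast+
  then have "int e * (coeff_bound d k + coeff_bound d' k') + int (a * (k + k')) \<ge> d + d'"
    by (simp add: algebra_simps)
  then show ?thesis by (simp add: coeff_bound_iff)
qed

lemma coeff_bound_mono: "d \<le> d' \<Longrightarrow> coeff_bound d k \<le> coeff_bound d' k"
  using coeff_bound_iff[of d k "coeff_bound d' k"] coeff_bound_iff[of d' k "coeff_bound d' k"] by linarith

text \<open>The polynomials of Gauss value at least \<open>d\<close>, where zero belongs to every \<open>Gs d\<close>. A polynomial
  that lies in \<open>Gs d\<close> but not in \<open>Gs (d + 1)\<close> has value exactly \<open>d\<close>.\<close>

definition Gs :: "int \<Rightarrow> 'a list set" where
  "Gs d = {h \<in> carrier FX. \<forall>k. coeff h k \<in> val_ge F v (coeff_bound d k)}"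

lemma GsD: "h \<in> Gs d \<Longrightarrow> h \<in> carrier FX"
  by (simp add: Gs_def)

lemma Gs_coeff: "h \<in> Gs d \<Longrightarrow> coeff h k \<in> val_ge F v (coeff_bound d k)"
  by (simp add: Gs_def)

lemma Gs_coeff_val: "h \<in> Gs d \<Longrightarrow> coeff h k \<noteq> \<zero> \<Longrightarrow> int e * v (coeff h k) + int (a * k) \<ge> d"
  using Gs_coeff[of h d k] by (auto simp: val_ge_def coeff_bound_iff)

lemma GsI:
  assumes "h \<in> carrier FX"
    "\<And>k. coeff h k \<noteq> \<zero> \<Longrightarrow> int e * v (coeff h k) + int (a * k) \<ge> d"
  shows "h \<in> Gs d"
  using assms by (auto simp: Gs_def val_ge_def coeff_bound_iff)

lemma Gs_mono: "h \<in> Gs d \<Longrightarrow> d' \<le> d \<Longrightarrow> h \<in> Gs d'"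
  unfolding Gs_def using coeff_bound_mono val_ge_mono by blast

lemma Gs_zero [simp]: "\<zero>\<^bsub>FX\<^esub> \<in> Gs d"
  by (simp add: Gs_def)

lemma Gs_add: "h \<in> Gs d \<Longrightarrow> h' \<in> Gs d \<Longrightarrow> h \<oplus>\<^bsub>FX\<^esub> h' \<in> Gs d"
  by (simp add: Gs_def val_ge_add)

lemma Gs_neg: "h \<in> Gs d \<Longrightarrow> \<ominus>\<^bsub>FX\<^esub> h \<in> Gs d"
  by (simp add: Gs_def val_ge_neg)

lemma Gs_minus: "h \<in> Gs d \<Longrightarrow> h' \<in> Gs d \<Longrightarrow> h \<ominus>\<^bsub>FX\<^esub> h' \<in> Gs d"
  by (simp add: a_minus_def Gs_add Gs_neg)

lemma Gs_mult:
  assumes "h \<in> Gs d" "h' \<in> Gs d'"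
  shows "h \<otimes>\<^bsub>FX\<^esub> h' \<in> Gs (d + d')"
proof -
  have "coeff (h \<otimes>\<^bsub>FX\<^esub> h') k \<in> val_ge F v (coeff_bound (d + d') k)" for k
    unfolding coeff_FX_mult[OF assms[THEN GsD]]
  proof (rule val_ge_finsum)
    fix i assume i: "i \<in> {..k}"
    then have "coeff_bound (d + d') k \<le> coeff_bound d i + coeff_bound d' (k - i)" using coeff_bound_add[of d d' i "k - i"] by simp
    then show "coeff h i \<otimes> coeff h' (k - i) \<in> val_ge F v (coeff_bound (d + d') k)"
      using val_ge_mult' assms Gs_coeff by blast
  qed
  then show ?thesis using assms by (simp add: Gs_def)
qed

lemma Gs_mult': "h \<in> Gs d \<Longrightarrow> h' \<in> Gs d' \<Longrightarrow> c \<le> d + d' \<Longrightarrow> h \<otimes>\<^bsub>FX\<^esub> h' \<in> Gs c"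
  using Gs_mult Gs_mono by blast

lemma Gs_mono_iff:
  "c \<in> carrier F \<Longrightarrow> mono c k \<in> Gs d \<longleftrightarrow> c = \<zero> \<or> int e * v c + int (a * k) \<ge> d"
  by (auto simp: Gs_def mono val_ge_def coeff_bound_iff)

text \<open>Gauss's lemma. In each factor choose the first monomial of least value; in the product the
  corresponding coefficient has a single summand of least value.\<close>

lemma Gs_exact_mult:
  assumes h: "h \<in> Gs d" "h \<notin> Gs (d + 1)" and h': "h' \<in> Gs d'" "h' \<notin> Gs (d' + 1)"
  shows "h \<otimes>\<^bsub>FX\<^esub> h' \<notin> Gs (d + d' + 1)"
proof
  assume prod: "h \<otimes>\<^bsub>FX\<^esub> h' \<in> Gs (d + d' + 1)"
  have least: "\<exists>k. coeff h k \<noteq> \<zero> \<and> int e * v (coeff h k) + int (a * k) = d \<and>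
      (\<forall>i<k. coeff h i \<in> val_ge F v (coeff_bound (d + 1) i))"
    if h: "h \<in> Gs d" "h \<notin> Gs (d + 1)" for h d
  proof -
    have ex: "\<exists>k. coeff h k \<notin> val_ge F v (coeff_bound (d + 1) k)" using h by (auto simp: Gs_def)
    define k where "k = (LEAST k. coeff h k \<notin> val_ge F v (coeff_bound (d + 1) k))"
    have k: "coeff h k \<notin> val_ge F v (coeff_bound (d + 1) k)" unfolding k_def by (rule LeastI_ex[OF ex])
    have "coeff h i \<in> val_ge F v (coeff_bound (d + 1) i)" if "i < k" for i
      using not_less_Least that unfolding k_def by blast
    moreover have nz: "coeff h k \<noteq> \<zero>" using k by auto
    moreover have "int e * v (coeff h k) + int (a * k) = d"
      using Gs_coeff_val[OF h(1) nz] k h(1) by (auto simp: val_ge_def coeff_bound_iff GsD)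
    ultimately show ?thesis by blast
  qed
  obtain k where k: "coeff h k \<noteq> \<zero>" "int e * v (coeff h k) + int (a * k) = d"
      "\<And>i. i < k \<Longrightarrow> coeff h i \<in> val_ge F v (coeff_bound (d + 1) i)"
    using least[OF h] by blast
  obtain k' where k': "coeff h' k' \<noteq> \<zero>" "int e * v (coeff h' k') + int (a * k') = d'"
      "\<And>i. i < k' \<Longrightarrow> coeff h' i \<in> val_ge F v (coeff_bound (d' + 1) i)"
    using least[OF h'] by blast
  let ?n = "k + k'"
  let ?f = "\<lambda>i. coeff h i \<otimes> coeff h' (?n - i)"
  note hc = GsD[OF h(1)] GsD[OF h'(1)]
  have f: "?f \<in> {..?n} \<rightarrow> carrier F" using hc by auto
  have rest: "(\<Oplus>i\<in>{..?n} - {k}. ?f i) \<in> val_ge F v (coeff_bound (d + d' + 1) ?n)"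
  proof (rule val_ge_finsum)
    fix i assume i: "i \<in> {..?n} - {k}"
    show "?f i \<in> val_ge F v (coeff_bound (d + d' + 1) ?n)"
    proof (cases "i < k")
      case True
      then show ?thesis
        using k(3)[OF True] Gs_coeff[OF h'(1), of "?n - i"] coeff_bound_add[of "d + 1" d' i "?n - i"] i
        by (intro val_ge_mult') (auto simp: algebra_simps)
    next
      case False
      then have "?n - i < k'" using i by auto
      from k'(3)[OF this] show ?thesis
        using Gs_coeff[OF h(1), of i] coeff_bound_add[of d "d' + 1" i "?n - i"] i
        by (intro val_ge_mult') (auto simp: algebra_simps)
    qed
  qed
  have "coeff (h \<otimes>\<^bsub>FX\<^esub> h') ?n = ?f k \<oplus> (\<Oplus>i\<in>{..?n} - {k}. ?f i)"
  proof -
    have "insert k ({..?n} - {k}) = {..?n}" by auto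
    moreover have "?f \<in> {..?n} - {k} \<rightarrow> carrier F" "?f k \<in> carrier F" using f hc by auto
    ultimately show ?thesis
      unfolding coeff_FX_mult[OF hc] using finsum_insert[of "{..?n} - {k}" k ?f] by simp
  qed
  then have "?f k = coeff (h \<otimes>\<^bsub>FX\<^esub> h') ?n \<ominus> (\<Oplus>i\<in>{..?n} - {k}. ?f i)"
    using f hc val_geD[OF rest] by (simp add: a_minus_def a_assoc r_neg)
  then have "?f k \<in> val_ge F v (coeff_bound (d + d' + 1) ?n)"
    using val_ge_minus[OF Gs_coeff[OF prod] rest] by simp
  moreover have "?f k \<noteq> \<zero>" using k k' hc by (simp add: integral_iff)
  moreover have "int e * v (?f k) + int (a * ?n) = d + d'"
    using k k' hc by (simp add: v_mult algebra_simps)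
  ultimately show False by (auto simp: val_ge_def coeff_bound_iff)
qed

lemma Gs_exact_exists:
  assumes "h \<in> carrier FX" "h \<noteq> \<zero>\<^bsub>FX\<^esub>"
  shows "\<exists>d. h \<in> Gs d \<and> h \<notin> Gs (d + 1)"
proof -
  define A where "A = (\<lambda>k. int e * v (coeff h k) + int (a * k)) ` {k. coeff h k \<noteq> \<zero>}"
  have "{k. coeff h k \<noteq> \<zero>} \<subseteq> {..<length h}" using coeff_length[of h] not_less by blast
  then have fin: "finite A" unfolding A_def by (metis finite_lessThan finite_subset finite_imageI)
  have "\<exists>k. coeff h k \<noteq> \<zero>" using FX_eqI[OF assms(1), of "\<zero>\<^bsub>FX\<^esub>"] assms(2) by auto
  then have ne: "A \<noteq> {}" by (auto simp: A_def)
  have "h \<in> Gs (Min A)"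
    using fin by (intro GsI[OF assms(1)]) (auto simp: A_def)
  moreover have "h \<notin> Gs (Min A + 1)"
  proof
    assume *: "h \<in> Gs (Min A + 1)"
    have "Min A \<in> A" using fin ne by simp
    then show False using Gs_coeff_val[OF *] unfolding A_def by fastforce
  qed
  ultimately show ?thesis by blast
qed

text \<open>Dividing by a polynomial of exact value \<open>d\<close> lowers values by exactly \<open>d\<close>.\<close>

lemma Gs_cancel:
  assumes "h \<in> Gs d" "h \<notin> Gs (d + 1)" "h' \<in> carrier FX" "h \<otimes>\<^bsub>FX\<^esub> h' \<in> Gs (d + d')"
  shows "h' \<in> Gs d'"
proof (cases "h' = \<zero>\<^bsub>FX\<^esub>")
  case False
  then obtain c where c: "h' \<in> Gs c" "h' \<notin> Gs (c + 1)" using Gs_exact_exists assms by blast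
  have "\<not> d + c + 1 \<le> d + d'"
    using Gs_exact_mult[OF assms(1,2) c] Gs_mono[OF assms(4)] by blast
  then show ?thesis using c Gs_mono by simp
qed simp

end

section \<open>Residues of integral polynomials\<close>

text \<open>The residue extension \<open>K\<close> as the construction uses it: \<open>\<tau>\<close> is the residue map of \<open>v\<close>, followed by the
  embedding in \<open>K\<close>, and \<open>1, y, \<dots>, y\<^bsup>f-1\<^esup>\<close> is a basis of \<open>K\<close>. Spanning and independence are stated
  with coefficients in the valuation ring, which are what has to be lifted to \<open>F[X]\<close>. The generator has to be
  nonzero, because \<open>X\<^sup>e / \<pi>\<^sup>a\<close>, whose residue it will be, has to become a unit.\<close>

definition residue_basis ::
  "'a ring \<Rightarrow> ('a \<Rightarrow> int) \<Rightarrow> 'k ring \<Rightarrow> ('a \<Rightarrow> 'k) \<Rightarrow> 'k \<Rightarrow> nat \<Rightarrow> bool" where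
  "residue_basis F v K \<tau> y f \<longleftrightarrow>
     field K \<and> \<tau> \<in> ring_hom (F\<lparr>carrier := val_ring F v\<rparr>) K \<and>
     (\<forall>x\<in>val_ring F v. \<tau> x = \<zero>\<^bsub>K\<^esub> \<longleftrightarrow> x \<in> val_ge F v 1) \<and>
     y \<in> carrier K \<and> y \<noteq> \<zero>\<^bsub>K\<^esub> \<and>
     (\<forall>z\<in>carrier K. \<exists>b. (\<forall>k. b k \<in> val_ring F v) \<and>
        z = (\<Oplus>\<^bsub>K\<^esub>k\<in>{..<f}. \<tau> (b k) \<otimes>\<^bsub>K\<^esub> y [^]\<^bsub>K\<^esub> k)) \<and>
     (\<forall>b. (\<forall>k. b k \<in> val_ring F v) \<longrightarrow>
        (\<Oplus>\<^bsub>K\<^esub>k\<in>{..<f}. \<tau> (b k) \<otimes>\<^bsub>K\<^esub> y [^]\<^bsub>K\<^esub> k) = \<zero>\<^bsub>K\<^esub> \<longrightarrow> (\<forall>k<f. b k \<in> val_ge F v 1))"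

locale residual = gauss F v e l \<pi> + K: field K
  for F :: "'a ring" (structure) and v e l \<pi> and K :: "'k ring" +
  fixes \<tau> :: "'a \<Rightarrow> 'k" and y :: 'k and f :: nat
  assumes rb: "residue_basis F v K \<tau> y f"
begin

interpretation FX: domain FX
  by (rule FX_domain)

interpretation KX: domain K.FX
  by (rule K.FX_domain)

abbreviation "V \<equiv> val_ring F v"

lemma
  shows tau_closed: "x \<in> V \<Longrightarrow> \<tau> x \<in> carrier K"
    and tau_mult: "x \<in> V \<Longrightarrow> x' \<in> V \<Longrightarrow> \<tau> (x \<otimes> x') = \<tau> x \<otimes>\<^bsub>K\<^esub> \<tau> x'"
    and tau_add: "x \<in> V \<Longrightarrow> x' \<in> V \<Longrightarrow> \<tau> (x \<oplus> x') = \<tau> x \<oplus>\<^bsub>K\<^esub> \<tau> x'"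
    and tau_one: "\<tau> \<one> = \<one>\<^bsub>K\<^esub>"
  using rb ring_hom_memE[of \<tau> "F\<lparr>carrier := V\<rparr>" K] by (auto simp: residue_basis_def)

lemma tau_ker: "x \<in> V \<Longrightarrow> \<tau> x = \<zero>\<^bsub>K\<^esub> \<longleftrightarrow> x \<in> val_ge F v 1"
  using rb by (auto simp: residue_basis_def)

lemma tau_zero [simp]: "\<tau> \<zero> = \<zero>\<^bsub>K\<^esub>"
  using tau_ker[of \<zero>] by simp

lemma y: "y \<in> carrier K" "y \<noteq> \<zero>\<^bsub>K\<^esub>"
  using rb by (auto simp: residue_basis_def)

lemma y_span:
  assumes "z \<in> carrier K"
  obtains b where "\<And>k. b k \<in> V" "z = (\<Oplus>\<^bsub>K\<^esub>k\<in>{..<f}. \<tau> (b k) \<otimes>\<^bsub>K\<^esub> y [^]\<^bsub>K\<^esub> k)"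
  using rb assms unfolding residue_basis_def by blast

lemma y_indep:
  assumes "\<And>k. k < f \<Longrightarrow> b k \<in> V" "(\<Oplus>\<^bsub>K\<^esub>k\<in>{..<f}. \<tau> (b k) \<otimes>\<^bsub>K\<^esub> y [^]\<^bsub>K\<^esub> k) = \<zero>\<^bsub>K\<^esub>" "k < f"
  shows "b k \<in> val_ge F v 1"
proof -
  let ?b = "\<lambda>k. if k < f then b k else \<zero>"
  have "(\<Oplus>\<^bsub>K\<^esub>k\<in>{..<f}. \<tau> (?b k) \<otimes>\<^bsub>K\<^esub> y [^]\<^bsub>K\<^esub> k) = (\<Oplus>\<^bsub>K\<^esub>k\<in>{..<f}. \<tau> (b k) \<otimes>\<^bsub>K\<^esub> y [^]\<^bsub>K\<^esub> k)"
    using assms(1) tau_closed y by (intro K.add.finprod_cong') auto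
  then have sum0: "(\<Oplus>\<^bsub>K\<^esub>k\<in>{..<f}. \<tau> (?b k) \<otimes>\<^bsub>K\<^esub> y [^]\<^bsub>K\<^esub> k) = \<zero>\<^bsub>K\<^esub>"
    using assms(2) by simp
  have all: "\<forall>b. (\<forall>k. b k \<in> V) \<longrightarrow>
        (\<Oplus>\<^bsub>K\<^esub>k\<in>{..<f}. \<tau> (b k) \<otimes>\<^bsub>K\<^esub> y [^]\<^bsub>K\<^esub> k) = \<zero>\<^bsub>K\<^esub> \<longrightarrow> (\<forall>k<f. b k \<in> val_ge F v 1)"
    using rb unfolding residue_basis_def by (elim conjE)
  have "?b k \<in> val_ge F v 1"
    by (rule all[rule_format, OF _ sum0 assms(3)]) (use assms(1) in auto)
  then show ?thesis using assms(3) by simp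
qed

lemma f_pos: "f > 0"
proof (rule ccontr)
  assume "\<not> f > 0"
  moreover obtain b where "\<one>\<^bsub>K\<^esub> = (\<Oplus>\<^bsub>K\<^esub>k\<in>{..<f}. \<tau> (b k) \<otimes>\<^bsub>K\<^esub> y [^]\<^bsub>K\<^esub> k)"
    by (rule y_span[OF K.one_closed])
  ultimately show False by simp
qed

lemma pip: "\<pi> [^] (n::nat) \<in> carrier F" "\<pi> [^] (n::nat) \<noteq> \<zero>" "v (\<pi> [^] (n::nat)) = int n"
  using pi field_inv_pow v_pow by auto

lemma pinv: "inv (\<pi> [^] (n::nat)) \<in> carrier F" "inv (\<pi> [^] (n::nat)) \<noteq> \<zero>"
  "v (inv (\<pi> [^] (n::nat))) = - int n"
  "\<pi> [^] n \<otimes> inv (\<pi> [^] n) = \<one>" "inv (\<pi> [^] n) \<otimes> \<pi> [^] n = \<one>"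
  using field_inv[OF pip(1,2)] v_inv[OF pip(1,2)] pip(3) by auto

text \<open>A monomial of Gauss value zero has exponent divisible by \<open>e\<close>, because \<open>a\<close> is prime to \<open>e\<close>. So the
  reduction of an integral polynomial is a polynomial in \<open>Y = X\<^sup>e / \<pi>\<^sup>a\<close>, and these are its coefficients
  before reduction.\<close>

definition digit :: "'a list \<Rightarrow> nat \<Rightarrow> 'a" where
  "digit h k = coeff h (e * k) \<otimes> \<pi> [^] (a * k)"

lemma digit_val:
  assumes "h \<in> Gs d" "int e * c \<le> d + int e - 1"
  shows "digit h k \<in> val_ge F v c"
proof (cases "coeff h (e * k) = \<zero>")
  case False
  have "int e * (v (coeff h (e * k)) + int (a * k)) \<ge> d"
    using Gs_coeff_val[OF assms(1) False] by (simp add: algebra_simps)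
  then have "int e * (v (coeff h (e * k)) + int (a * k) + 1) > int e * c" 
    using assms(2) by (simp add: algebra_simps)
  then have "v (coeff h (e * k)) + int (a * k) \<ge> c" using e_pos by simp
  then show ?thesis
    using False pip GsD[OF assms(1)] by (simp add: digit_def val_ge_def v_mult)
qed (simp add: digit_def pip)

lemma digit_V: "h \<in> Gs 0 \<Longrightarrow> digit h k \<in> V"
  using digit_val[of h 0 0] e_pos by simp

lemma digit_large:
  assumes "length h \<le> k"
  shows "digit h k = \<zero>"
proof -
  have "k \<le> e * k" using e_pos by simp
  then have "coeff h (e * k) = \<zero>" using coeff_length[of h "e * k"] assms le_trans by blast
  then show ?thesis using pip by (simp add: digit_def)
qed

definition reduction :: "'a list \<Rightarrow> 'k list" where
  "reduction h = K.poly_of_fun (length h) (\<lambda>k. \<tau> (digit h k))"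

lemma reduction:
  assumes "h \<in> Gs 0"
  shows "reduction h \<in> carrier K.FX" "K.coeff (reduction h) k = \<tau> (digit h k)"
  using K.poly_of_fun[of "length h" "\<lambda>k. \<tau> (digit h k)"] tau_closed[OF digit_V[OF assms]] digit_large[of h k]
  by (auto simp: reduction_def)

text \<open>The residue of an integral polynomial: its reduction in \<open>K[Y]\<close>, evaluated at \<open>y\<close>.\<close>

definition rho :: "'a list \<Rightarrow> 'k" where
  "rho h = K.eval (reduction h) y"

lemma rho_closed: "h \<in> Gs 0 \<Longrightarrow> rho h \<in> carrier K"
  unfolding rho_def using reduction(1) K.FX_set K.eval_in_carrier y by blast

lemma reduction_add:
  assumes "h \<in> Gs 0" "h' \<in> Gs 0"
  shows "reduction (h \<oplus>\<^bsub>FX\<^esub> h') = reduction h \<oplus>\<^bsub>K.FX\<^esub> reduction h'"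
proof (rule K.FX_eqI)
  fix k
  have "digit (h \<oplus>\<^bsub>FX\<^esub> h') k = digit h k \<oplus> digit h' k"
    using assms GsD pip by (simp add: digit_def l_distr)
  then show "K.coeff (reduction (h \<oplus>\<^bsub>FX\<^esub> h')) k = K.coeff (reduction h \<oplus>\<^bsub>K.FX\<^esub> reduction h') k"
    using assms reduction Gs_add tau_add digit_V by simp
qed (use assms reduction Gs_add in auto)

lemma tau_finsum:
  assumes "finite A" "\<And>i. i \<in> A \<Longrightarrow> x i \<in> V"
  shows "\<tau> (finsum F x A) = (\<Oplus>\<^bsub>K\<^esub>i\<in>A. \<tau> (x i))"
  using assms
proof (induction A rule: finite_induct)
  case (insert i A)
  have "x \<in> A \<rightarrow> carrier F" "x i \<in> carrier F" using insert.prems val_geD by blast+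
  moreover have "(\<lambda>i. \<tau> (x i)) \<in> A \<rightarrow> carrier K" "\<tau> (x i) \<in> carrier K"
    using insert.prems tau_closed by blast+
  moreover have "finsum F x A \<in> V" using insert.prems by (intro val_ge_finsum) auto
  ultimately show ?case using insert tau_add by (simp add: finsum_insert K.finsum_insert)
qed simp

text \<open>In a coefficient of the product at \<open>X\<^bsup>e k\<^esup>\<close>, the products of two coefficients whose exponents are not
  divisible by \<open>e\<close> have positive value and disappear in the reduction.\<close>

lemma reduction_mult:
  assumes h: "h \<in> Gs 0" "h' \<in> Gs 0"
  shows "reduction (h \<otimes>\<^bsub>FX\<^esub> h') = reduction h \<otimes>\<^bsub>K.FX\<^esub> reduction h'"
proof -
  note hc = GsD[OF h(1)] GsD[OF h(2)]
  have prod: "h \<otimes>\<^bsub>FX\<^esub> h' \<in> Gs 0" using Gs_mult[OF h] by simp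
  have "K.coeff (reduction (h \<otimes>\<^bsub>FX\<^esub> h')) k = K.coeff (reduction h \<otimes>\<^bsub>K.FX\<^esub> reduction h') k" for k
  proof -
  define T where "T i = (coeff h i \<otimes> coeff h' (e * k - i)) \<otimes> \<pi> [^] (a * k)" for i
  have Tc: "T i \<in> carrier F" for i using hc pip by (simp add: T_def)
  have TV: "T i \<in> V \<and> (\<not> e dvd i \<longrightarrow> T i \<in> val_ge F v 1)" if i: "i \<le> e * k" for i
  proof (cases "coeff h i = \<zero> \<or> coeff h' (e * k - i) = \<zero>")
    case False
    let ?A = "int e * v (coeff h i) + int (a * i)" and ?B = "int e * v (coeff h' (e * k - i)) + int (a * (e * k - i))"
    have AB: "?A \<ge> 0" "?B \<ge> 0" using Gs_coeff_val h False by blast+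
    have T: "T i \<noteq> \<zero>" "v (T i) = v (coeff h i) + v (coeff h' (e * k - i)) + int (a * k)"
      using False hc pip by (simp_all add: T_def v_mult integral_iff)
    have "a * i + a * (e * k - i) = a * (i + (e * k - i))" by (rule add_mult_distrib2[symmetric])
    then have "a * i + a * (e * k - i) = e * (a * k)" using i by (simp add: mult.left_commute)
    then have "int (a * i) + int (a * (e * k - i)) = int e * int (a * k)"
      by (metis of_nat_add of_nat_mult)
    then have eT: "int e * v (T i) = ?A + ?B"
      unfolding T(2) by (simp add: distrib_left)
    then have "v (T i) \<ge> 0" using AB e_pos by (smt (verit) mult_pos_neg of_nat_0_less_iff)
    moreover have "v (T i) \<ge> 1" if nd: "\<not> e dvd i"
    proof -
      have "?A \<noteq> 0"
      proof
        assume "?A = 0"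
        moreover have "?A = int e * (v (coeff h i) + int (l * i)) + int i"
          by (simp add: slope_def algebra_simps)
        ultimately have "int i = int e * (- (v (coeff h i) + int (l * i)))" by linarith
        then have "int e dvd int i" by (rule dvdI)
        then show False using nd by simp
      qed
      then have "int e * v (T i) > 0" using AB eT by linarith
      then show ?thesis by (simp add: zero_less_mult_iff)
    qed
    ultimately show ?thesis using T Tc by (auto simp: val_ge_def)
  qed (use hc pip in \<open>auto simp: T_def\<close>)
  have "digit (h \<otimes>\<^bsub>FX\<^esub> h') k = (\<Oplus>i\<in>{..e * k}. T i)"
    unfolding digit_def coeff_FX_mult[OF hc] T_def using hc pip by (simp add: finsum_ldistr)
  then have "\<tau> (digit (h \<otimes>\<^bsub>FX\<^esub> h') k) = (\<Oplus>\<^bsub>K\<^esub>i\<in>{..e * k}. \<tau> (T i))"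
    using tau_finsum[of "{..e * k}" T] TV by simp
  also have "\<dots> = (\<Oplus>\<^bsub>K\<^esub>i\<in>(\<lambda>j. e * j) ` {..k}. \<tau> (T i))"
  proof (rule K.add.finprod_mono_neutral_cong_right)
    show "\<tau> (T i) = \<zero>\<^bsub>K\<^esub>" if i: "i \<in> {..e * k} - (\<lambda>j. e * j) ` {..k}" for i
    proof -
      have "\<not> e dvd i"
      proof
        assume "e dvd i"
        then obtain j where "i = e * j" by (rule dvdE)
        then show False using i e_pos by auto
      qed
      then show "\<tau> (T i) = \<zero>\<^bsub>K\<^esub>" using TV[of i] tau_ker i by simp
    qed
  qed (use TV tau_closed in auto)
  also have "\<dots> = (\<Oplus>\<^bsub>K\<^esub>j\<in>{..k}. \<tau> (T (e * j)))"
    by (rule K.add.finprod_reindex) (use e_pos TV tau_closed in \<open>auto intro!: inj_onI\<close>)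
  also have "\<dots> = (\<Oplus>\<^bsub>K\<^esub>j\<in>{..k}. K.coeff (reduction h) j \<otimes>\<^bsub>K\<^esub> K.coeff (reduction h') (k - j))"
  proof (rule K.add.finprod_cong')
    fix j assume j: "j \<in> {..k}"
    have "a * k = a * (j + (k - j))" using j by simp
    then have "a * k = a * j + a * (k - j)" by (simp only: add_mult_distrib2)
    then have "\<pi> [^] (a * k) = \<pi> [^] (a * j) \<otimes> \<pi> [^] (a * (k - j))"
      using pi by (simp add: nat_pow_mult)
    moreover have "e * k - e * j = e * (k - j)" by (simp add: diff_mult_distrib2)
    ultimately have "T (e * j) = digit h j \<otimes> digit h' (k - j)"
      using hc pip by (simp add: T_def digit_def m_ac)
    then show "\<tau> (T (e * j)) = K.coeff (reduction h) j \<otimes>\<^bsub>K\<^esub> K.coeff (reduction h') (k - j)"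
      using reduction h digit_V tau_mult by simp
  qed (use reduction h tau_closed[OF digit_V] in auto)
  finally show ?thesis
    using reduction prod h K.coeff_FX_mult by simp
  qed
  then show ?thesis using reduction prod h by (intro K.FX_eqI) auto
qed

lemma rho_add: "h \<in> Gs 0 \<Longrightarrow> h' \<in> Gs 0 \<Longrightarrow> rho (h \<oplus>\<^bsub>FX\<^esub> h') = rho h \<oplus>\<^bsub>K\<^esub> rho h'"
  and rho_mult: "h \<in> Gs 0 \<Longrightarrow> h' \<in> Gs 0 \<Longrightarrow> rho (h \<otimes>\<^bsub>FX\<^esub> h') = rho h \<otimes>\<^bsub>K\<^esub> rho h'"
  using ring_hom_memE[OF K.eval_is_hom[OF K.carrier_is_subring y(1)]] reduction
  by (simp_all add: rho_def reduction_add reduction_mult)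

lemma rho_zero_of_Gs1:
  assumes "h \<in> Gs 1"
  shows "rho h = \<zero>\<^bsub>K\<^esub>"
proof -
  have h0: "h \<in> Gs 0" using Gs_mono assms by simp
  have "reduction h = \<zero>\<^bsub>K.FX\<^esub>"
  proof (rule K.FX_eqI)
    show "K.coeff (reduction h) k = K.coeff \<zero>\<^bsub>K.FX\<^esub> k" for k
      using reduction(2)[OF h0] digit_val[OF assms, of 1] tau_ker digit_V[OF h0] by simp
  qed (use reduction h0 in auto)
  then show ?thesis by (simp add: rho_def K.FX_zero)
qed

lemma rho_as_finsum:
  assumes h: "h \<in> Gs 0" and n: "length h \<le> e * n"
  shows "rho h = (\<Oplus>\<^bsub>K\<^esub>k\<in>{..<n}. \<tau> (digit h k) \<otimes>\<^bsub>K\<^esub> y [^]\<^bsub>K\<^esub> k)"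
proof -
  have "length (reduction h) \<le> n"
    unfolding K.FX_length_le_iff[OF reduction(1)[OF h]] reduction(2)[OF h]
  proof (intro allI impI)
    fix k assume "n \<le> k"
    then have "length h \<le> e * k" using n mult_le_mono2 le_trans by blast
    then have "digit h k = \<zero>" using coeff_length[of h "e * k"] pip by (simp add: digit_def)
    then show "\<tau> (digit h k) = \<zero>\<^bsub>K\<^esub>" by simp
  qed
  then show ?thesis
    unfolding rho_def using K.eval_as_finsum[OF reduction(1)[OF h] _ y(1), of n] reduction(2)[OF h] by simp
qed

text \<open>The polynomial \<open>\<Sum> b\<^sub>k Y\<^sup>k\<close> with \<open>Y = X\<^sup>e / \<pi>\<^sup>a\<close>.\<close>

definition lift :: "nat \<Rightarrow> (nat \<Rightarrow> 'a) \<Rightarrow> 'a list" where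
  "lift n b = poly_of_fun (e * n) (\<lambda>j. if e dvd j then b (j div e) \<otimes> inv (\<pi> [^] (a * (j div e))) else \<zero>)"

lemma lift:
  assumes b: "\<And>k. k < n \<Longrightarrow> b k \<in> carrier F"
  shows "lift n b \<in> carrier FX" "length (lift n b) \<le> e * n"
    "coeff (lift n b) j = (if e dvd j \<and> j < e * n then b (j div e) \<otimes> inv (\<pi> [^] (a * (j div e))) else \<zero>)"
    "k < n \<Longrightarrow> digit (lift n b) k = b k"
proof -
  have *: "b (j div e) \<in> carrier F" if "j < e * n" for j
    using that b[of "j div e"] by (simp add: less_mult_imp_div_less mult.commute)
  show 1: "lift n b \<in> carrier FX" "length (lift n b) \<le> e * n"
    "coeff (lift n b) j = (if e dvd j \<and> j < e * n then b (j div e) \<otimes> inv (\<pi> [^] (a * (j div e))) else \<zero>)" for j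
    unfolding lift_def using * pinv by (subst poly_of_fun; auto)+
  show "k < n \<Longrightarrow> digit (lift n b) k = b k"
    using 1(3)[of "e * k"] e_pos b[of k] pip pinv by (simp add: digit_def m_assoc)
qed

lemma lift_Gs:
  assumes b: "\<And>k. k < n \<Longrightarrow> b k \<in> V"
  shows "lift n b \<in> Gs 0"
    "rho (lift n b) = (\<Oplus>\<^bsub>K\<^esub>k\<in>{..<n}. \<tau> (b k) \<otimes>\<^bsub>K\<^esub> y [^]\<^bsub>K\<^esub> k)"
proof -
  have bc: "\<And>k. k < n \<Longrightarrow> b k \<in> carrier F" using b val_geD by blast
  note L = lift(1,2,3)[of n b, OF bc] and L4 = lift(4)[of n b, OF bc]
  show G: "lift n b \<in> Gs 0"
  proof (rule GsI[OF L(1)])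
    fix j assume nz: "coeff (lift n b) j \<noteq> \<zero>"
    then have j: "e dvd j" "j < e * n" using L(3) by metis+
    then obtain k where k: "j = e * k" "k < n" by (auto elim!: dvdE)
    have c: "coeff (lift n b) j = b k \<otimes> inv (\<pi> [^] (a * k))" using L(3)[of j] k e_pos by simp
    then have "b k \<noteq> \<zero>" using nz pinv by auto
    then have "v (coeff (lift n b) j) = v (b k) - int (a * k)" "v (b k) \<ge> 0"
      using c b[OF k(2)] pinv bc[OF k(2)] by (auto simp: v_mult val_ge_def)
    then have "int e * v (coeff (lift n b) j) + int (a * j) = int e * v (b k)"
      by (simp only: k) (simp add: algebra_simps)
    then show "0 \<le> int e * v (coeff (lift n b) j) + int (a * j)"
      using \<open>v (b k) \<ge> 0\<close> by simp
  qed
  have "(\<Oplus>\<^bsub>K\<^esub>k\<in>{..<n}. \<tau> (digit (lift n b) k) \<otimes>\<^bsub>K\<^esub> y [^]\<^bsub>K\<^esub> k)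
      = (\<Oplus>\<^bsub>K\<^esub>k\<in>{..<n}. \<tau> (b k) \<otimes>\<^bsub>K\<^esub> y [^]\<^bsub>K\<^esub> k)"
    using L4 b tau_closed y by (intro K.add.finprod_cong') auto
  then show "rho (lift n b) = (\<Oplus>\<^bsub>K\<^esub>k\<in>{..<n}. \<tau> (b k) \<otimes>\<^bsub>K\<^esub> y [^]\<^bsub>K\<^esub> k)"
    using rho_as_finsum[OF G L(2)] by simp
qed

lemma rho_surj:
  assumes "z \<in> carrier K"
  obtains h where "h \<in> Gs 0" "rho h = z"
proof -
  obtain b where b: "\<And>k. b k \<in> V" "z = (\<Oplus>\<^bsub>K\<^esub>k\<in>{..<f}. \<tau> (b k) \<otimes>\<^bsub>K\<^esub> y [^]\<^bsub>K\<^esub> k)"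
    using y_span[OF assms] by blast
  then show ?thesis using that[OF lift_Gs(1) ] lift_Gs(2)[of f b] by blast
qed

end

section \<open>A polynomial with prescribed slope and residue\<close>

context residual
begin

interpretation FX: domain FX
  by (rule FX_domain)

lemma exists_relation:
  "\<exists>g. (\<forall>k. g k \<in> V) \<and> g f = \<one> \<and> (\<Oplus>\<^bsub>K\<^esub>k\<in>{..<Suc f}. \<tau> (g k) \<otimes>\<^bsub>K\<^esub> y [^]\<^bsub>K\<^esub> k) = \<zero>\<^bsub>K\<^esub>"
proof -
  have yf: "y [^]\<^bsub>K\<^esub> f \<in> carrier K" using y by simp
  obtain b where b: "\<And>k. b k \<in> V"
    "\<ominus>\<^bsub>K\<^esub> (y [^]\<^bsub>K\<^esub> f) = (\<Oplus>\<^bsub>K\<^esub>k\<in>{..<f}. \<tau> (b k) \<otimes>\<^bsub>K\<^esub> y [^]\<^bsub>K\<^esub> k)"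
    by (rule y_span[OF K.a_inv_closed[OF yf]]) blast
  let ?g = "b(f := \<one>)"
  have c: "(\<lambda>k. \<tau> (?g k) \<otimes>\<^bsub>K\<^esub> y [^]\<^bsub>K\<^esub> k) \<in> {..<f} \<rightarrow> carrier K"
    using tau_closed b(1) y by auto
  have "(\<Oplus>\<^bsub>K\<^esub>k\<in>{..<f}. \<tau> (?g k) \<otimes>\<^bsub>K\<^esub> y [^]\<^bsub>K\<^esub> k)
      = (\<Oplus>\<^bsub>K\<^esub>k\<in>{..<f}. \<tau> (b k) \<otimes>\<^bsub>K\<^esub> y [^]\<^bsub>K\<^esub> k)"
    using tau_closed b(1) y by (intro K.add.finprod_cong') auto
  then have "(\<Oplus>\<^bsub>K\<^esub>k\<in>{..<Suc f}. \<tau> (?g k) \<otimes>\<^bsub>K\<^esub> y [^]\<^bsub>K\<^esub> k) = \<zero>\<^bsub>K\<^esub>"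
    using c tau_one yf b(2)[symmetric] by (simp add: lessThan_Suc K.r_neg)
  then show ?thesis using b(1) by (intro exI[of _ ?g]) auto
qed

text \<open>Lifts of the coefficients of the minimal polynomial of \<open>y\<close>.\<close>

definition relation_coeff :: "nat \<Rightarrow> 'a" where
  "relation_coeff = (SOME g. (\<forall>k. g k \<in> V) \<and> g f = \<one> \<and>
     (\<Oplus>\<^bsub>K\<^esub>k\<in>{..<Suc f}. \<tau> (g k) \<otimes>\<^bsub>K\<^esub> y [^]\<^bsub>K\<^esub> k) = \<zero>\<^bsub>K\<^esub>)"

lemma relation_coeff: "relation_coeff k \<in> V" "relation_coeff f = \<one>"
  "(\<Oplus>\<^bsub>K\<^esub>k\<in>{..<Suc f}. \<tau> (relation_coeff k) \<otimes>\<^bsub>K\<^esub> y [^]\<^bsub>K\<^esub> k) = \<zero>\<^bsub>K\<^esub>"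
  using someI_ex[OF exists_relation] unfolding relation_coeff_def[symmetric] by blast+

lemma relation_coeff_carrier: "relation_coeff k \<in> carrier F"
  using relation_coeff(1) val_geD by blast

text \<open>If the constant coefficient vanished, division by \<open>y\<close> would give a relation of degree less than \<open>f\<close>.\<close>

lemma relation_coeff_0: "relation_coeff 0 \<notin> val_ge F v 1"
proof
  assume "relation_coeff 0 \<in> val_ge F v 1"
  then have 0: "\<tau> (relation_coeff 0) = \<zero>\<^bsub>K\<^esub>" using tau_ker relation_coeff(1) by blast
  obtain f' where f': "f = Suc f'" using f_pos by (cases f) auto
  let ?t = "\<lambda>k. \<tau> (relation_coeff k) \<otimes>\<^bsub>K\<^esub> y [^]\<^bsub>K\<^esub> k"
  let ?s = "\<lambda>k. \<tau> (relation_coeff (Suc k)) \<otimes>\<^bsub>K\<^esub> y [^]\<^bsub>K\<^esub> k"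
  have tc: "?t k \<in> carrier K" "?s k \<in> carrier K" for k using tau_closed relation_coeff(1) y by auto
  have "\<zero>\<^bsub>K\<^esub> = (\<Oplus>\<^bsub>K\<^esub>k\<in>{..Suc f'}. ?t k)"
    using relation_coeff(3) f' lessThan_Suc_atMost by simp
  also have "\<dots> = (\<Oplus>\<^bsub>K\<^esub>k\<in>{..f'}. ?t (Suc k)) \<oplus>\<^bsub>K\<^esub> ?t 0"
    using tc by (intro K.add.finprod_Suc2) auto
  also have "?t 0 = \<zero>\<^bsub>K\<^esub>" using 0 y by simp
  also have "(\<Oplus>\<^bsub>K\<^esub>k\<in>{..f'}. ?t (Suc k)) = (\<Oplus>\<^bsub>K\<^esub>k\<in>{..f'}. y \<otimes>\<^bsub>K\<^esub> ?s k)"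
    using tc y tau_closed relation_coeff(1) by (intro K.add.finprod_cong') (auto simp: K.m_ac)
  also have "\<dots> = y \<otimes>\<^bsub>K\<^esub> (\<Oplus>\<^bsub>K\<^esub>k\<in>{..f'}. ?s k)"
    using tc y by (intro K.finsum_rdistr[symmetric]) auto
  finally have "y \<otimes>\<^bsub>K\<^esub> (\<Oplus>\<^bsub>K\<^esub>k\<in>{..f'}. ?s k) = \<zero>\<^bsub>K\<^esub>"
    using y tc by (simp add: K.finsum_closed)
  then have "(\<Oplus>\<^bsub>K\<^esub>k\<in>{..<f}. ?s k) = \<zero>\<^bsub>K\<^esub>"
    using y tc K.integral[of y "(\<Oplus>\<^bsub>K\<^esub>k\<in>{..f'}. ?s k)"] f' lessThan_Suc_atMost by auto
  from y_indep[OF relation_coeff(1) this, of f'] have "relation_coeff f \<in> val_ge F v 1" using f' by simp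
  then show False using relation_coeff(2) v_one by (simp add: val_ge_iff)
qed

text \<open>The polynomial \<open>G(Y)\<close> of the introduction, with \<open>Y = X\<^sup>e / \<pi>\<^sup>a\<close>.\<close>

definition residual_factor :: "'a list" where "residual_factor = lift (Suc f) relation_coeff"

lemma residual_factor: "residual_factor \<in> carrier FX" "residual_factor \<in> Gs 0" "rho residual_factor = \<zero>\<^bsub>K\<^esub>"
  using lift(1)[of "Suc f" relation_coeff] lift_Gs[of "Suc f" relation_coeff] relation_coeff relation_coeff_carrier by (auto simp: residual_factor_def)

lemma residual_factor_coeff:
  "coeff residual_factor j = (if e dvd j \<and> j \<le> e * f then relation_coeff (j div e) \<otimes> inv (\<pi> [^] (a * (j div e))) else \<zero>)"
proof -
  have "e dvd j \<and> j < e * Suc f \<longleftrightarrow> e dvd j \<and> j \<le> e * f"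
    using e_pos by (auto elim!: dvdE simp del: mult_Suc_right)
  then show ?thesis unfolding residual_factor_def using lift(3)[of "Suc f" relation_coeff j] relation_coeff_carrier by simp
qed

lemma residual_factor_lead: "coeff residual_factor (e * f) = inv (\<pi> [^] (a * f))" "j > e * f \<Longrightarrow> coeff residual_factor j = \<zero>"
  using residual_factor_coeff[of "e * f"] residual_factor_coeff[of j] e_pos relation_coeff pinv by auto

lemma residual_factor_not_Gs1: "residual_factor \<notin> Gs 1"
proof
  assume *: "residual_factor \<in> Gs 1"
  have "coeff residual_factor (e * f) \<noteq> \<zero>" using residual_factor_lead pinv by simp
  from Gs_coeff_val[OF * this] show False unfolding residual_factor_lead pinv by (simp add: algebra_simps)
qed

text \<open>Division with remainder by \<open>residual_factor\<close> keeps integrality, since the leading coefficient of \<open>residual_factor\<close> is the inverse of a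
  power of \<open>\<pi>\<close>, and its leading monomial has Gauss value zero.\<close>

lemma residual_factor_division:
  assumes "h \<in> Gs 0"
  shows "\<exists>q\<in>Gs 0. \<exists>r\<in>Gs 0. h = (residual_factor \<otimes>\<^bsub>FX\<^esub> q) \<oplus>\<^bsub>FX\<^esub> r \<and> length r \<le> e * f"
proof -
  have "length h \<le> n \<Longrightarrow> h \<in> Gs 0 \<Longrightarrow>
      \<exists>q\<in>Gs 0. \<exists>r\<in>Gs 0. h = (residual_factor \<otimes>\<^bsub>FX\<^esub> q) \<oplus>\<^bsub>FX\<^esub> r \<and> length r \<le> e * f" for h n
  proof (induction n arbitrary: h)
    case 0
    then show ?case using GsD residual_factor by (intro bexI[of _ "\<zero>\<^bsub>FX\<^esub>"] bexI[of _ h]) auto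
  next
    case (Suc n)
    note hc = GsD[OF Suc.prems(2)]
    show ?case
    proof (cases "Suc n \<le> e * f")
      case True
      then show ?thesis
        using Suc.prems GsD residual_factor by (intro bexI[of _ "\<zero>\<^bsub>FX\<^esub>"] bexI[of _ h]) auto
    next
      case False
      then have n: "e * f \<le> n" by simp
      define c where "c = coeff h n \<otimes> \<pi> [^] (a * f)"
      have c: "c \<in> carrier F" using hc pip by (simp add: c_def)
      let ?m = "mono c (n - e * f)"
      have m: "?m \<in> Gs 0"
      proof (cases "coeff h n = \<zero>")
        case False
        have "int (a * (n - e * f)) = int (a * n) - int e * int (a * f)"
          using n by (simp add: of_nat_diff algebra_simps)
        then show ?thesis
          using Gs_coeff_val[OF Suc.prems(2) False] False hc pip c
          by (simp add: Gs_mono_iff c_def v_mult distrib_left)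
      qed (use pip c_def in simp)
      define h' where "h' = h \<ominus>\<^bsub>FX\<^esub> (residual_factor \<otimes>\<^bsub>FX\<^esub> ?m)"
      have mG: "residual_factor \<otimes>\<^bsub>FX\<^esub> ?m \<in> Gs 0" using Gs_mult'[OF residual_factor(2) m] by simp
      have h': "h' \<in> Gs 0" unfolding h'_def using Gs_minus[OF Suc.prems(2) mG] .
      have "length h' \<le> n"
        unfolding FX_length_le_iff[OF GsD[OF h']]
      proof (intro allI impI)
        fix k assume k: "n \<le> k"
        have "coeff (residual_factor \<otimes>\<^bsub>FX\<^esub> ?m) k = c \<otimes> coeff residual_factor (k - (n - e * f))"
          using coeff_mono_mult[OF c residual_factor(1), of "n - e * f" k] FX.m_comm[OF residual_factor(1) GsD[OF m]] k
            le_trans[OF diff_le_self k] by simp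
        moreover have "c \<otimes> coeff residual_factor (k - (n - e * f)) = coeff h k"
        proof (cases "k = n")
          case True
          then show ?thesis using n residual_factor_lead(1) hc pip pinv by (simp add: c_def m_assoc)
        next
          case False
          then have "k - (n - e * f) > e * f" "length h \<le> k" using k n Suc.prems by auto
          then show ?thesis using residual_factor_lead(2) c coeff_length[of h k] by simp
        qed
        ultimately show "coeff h' k = \<zero>"
          using hc GsD[OF mG] by (simp add: h'_def a_minus_def r_neg)
      qed
      from Suc.IH[OF this h'] obtain q r where qr: "q \<in> Gs 0" "r \<in> Gs 0"
        "h' = (residual_factor \<otimes>\<^bsub>FX\<^esub> q) \<oplus>\<^bsub>FX\<^esub> r" "length r \<le> e * f" by blast
      have "h = h' \<oplus>\<^bsub>FX\<^esub> (residual_factor \<otimes>\<^bsub>FX\<^esub> ?m)"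
        using hc GsD[OF mG] by (simp add: h'_def a_minus_def FX.a_assoc FX.l_neg)
      also have "\<dots> = (residual_factor \<otimes>\<^bsub>FX\<^esub> (q \<oplus>\<^bsub>FX\<^esub> ?m)) \<oplus>\<^bsub>FX\<^esub> r"
        using GsD[OF qr(1)] GsD[OF qr(2)] GsD[OF m] residual_factor(1)
        by (simp add: qr(3) FX.r_distr FX.a_ac)
      finally show ?thesis using qr Gs_add[OF qr(1) m] by blast
    qed
  qed
  then show ?thesis using assms by blast
qed

text \<open>The kernel of the residue is generated by \<open>residual_factor\<close> and the polynomials of positive value. After division by \<open>residual_factor\<close>
  the remainder has at most \<open>f\<close> digits, and these vanish in the residue field by the independence of the powers of
  \<open>y\<close>.\<close>

lemma rho_zero_imp:
  assumes "h \<in> Gs 0" "rho h = \<zero>\<^bsub>K\<^esub>"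
  obtains q r where "q \<in> Gs 0" "r \<in> Gs 1" "h = (residual_factor \<otimes>\<^bsub>FX\<^esub> q) \<oplus>\<^bsub>FX\<^esub> r"
proof -
  obtain q r where qr: "q \<in> Gs 0" "r \<in> Gs 0" "h = (residual_factor \<otimes>\<^bsub>FX\<^esub> q) \<oplus>\<^bsub>FX\<^esub> r" "length r \<le> e * f"
    using residual_factor_division[OF assms(1)] by blast
  have "residual_factor \<otimes>\<^bsub>FX\<^esub> q \<in> Gs 0" using Gs_mult'[OF residual_factor(2) qr(1)] by simp
  then have "rho h = (rho residual_factor \<otimes>\<^bsub>K\<^esub> rho q) \<oplus>\<^bsub>K\<^esub> rho r"
    using qr by (simp add: rho_add rho_mult residual_factor(2))
  then have "rho r = \<zero>\<^bsub>K\<^esub>" using assms(2) residual_factor(3) rho_closed qr by simp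
  then have sum: "(\<Oplus>\<^bsub>K\<^esub>k\<in>{..<f}. \<tau> (digit r k) \<otimes>\<^bsub>K\<^esub> y [^]\<^bsub>K\<^esub> k) = \<zero>\<^bsub>K\<^esub>"
    using rho_as_finsum[OF qr(2,4)] by simp
  have "r \<in> Gs 1"
  proof (rule GsI[OF GsD[OF qr(2)]])
    fix j assume nz: "coeff r j \<noteq> \<zero>"
    note ge0 = Gs_coeff_val[OF qr(2) nz]
    show "1 \<le> int e * v (coeff r j) + int (a * j)"
    proof (rule ccontr)
      assume "\<not> ?thesis"
      then have eq: "int e * v (coeff r j) + int (a * j) = 0" using ge0 by linarith
      then have "int j = int e * (- (v (coeff r j) + int (l * j)))"
        by (simp add: slope_def algebra_simps)
      then have "int e dvd int j" by (rule dvdI)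
      then obtain k where k: "j = e * k" by auto
      have "k < f"
      proof (rule ccontr)
        assume "\<not> k < f"
        then have "length r \<le> j" using qr(4) k by (metis le_trans mult_le_mono2 not_less)
        then show False using nz coeff_length by simp
      qed
      from y_indep[OF digit_V[OF qr(2)] sum this] have d: "digit r k \<in> val_ge F v 1" .
      have "digit r k \<noteq> \<zero>" "v (digit r k) = v (coeff r j) + int (a * k)"
        using nz pip GsD[OF qr(2)] k by (auto simp: digit_def v_mult integral_iff)
      then have "v (coeff r j) + int (a * k) \<ge> 1" using d by (simp add: val_ge_iff)
      then have "int e * (v (coeff r j) + int (a * k)) > 0" using e_pos by (simp add: zero_less_mult_iff)
      then show False using eq k by (simp add: algebra_simps)
    qed
  qed
  then show ?thesis using that qr by blast
qed

text \<open>The factor \<open>P\<^sub>j\<close> of the introduction: \<open>residual_factor\<close> made monic.\<close>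

definition local_factor :: "'a list" where "local_factor = mono (\<pi> [^] (a * f)) 0 \<otimes>\<^bsub>FX\<^esub> residual_factor"

lemma local_factor: "local_factor \<in> carrier FX" "coeff local_factor (e * f) = \<one>" "j > e * f \<Longrightarrow> coeff local_factor j = \<zero>"
    "coeff local_factor j \<in> V" "coeff local_factor 0 \<noteq> \<zero>" "v (coeff local_factor 0) = int (a * f)"
proof -
  show "local_factor \<in> carrier FX" using mono residual_factor pip by (simp add: local_factor_def)
  have c: "coeff local_factor j = \<pi> [^] (a * f) \<otimes> coeff residual_factor j" for j
    unfolding local_factor_def using coeff_mono_mult[OF pip(1) residual_factor(1), of "a * f" 0 j] by simp
  show "coeff local_factor (e * f) = \<one>" "j > e * f \<Longrightarrow> coeff local_factor j = \<zero>"
    using c residual_factor_lead pip pinv by auto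
  have 0: "coeff residual_factor 0 = relation_coeff 0" using residual_factor_coeff[of 0] relation_coeff_carrier by simp
  note u = val_unit[OF relation_coeff(1) relation_coeff_0]
  show "coeff local_factor 0 \<noteq> \<zero>" "v (coeff local_factor 0) = int (a * f)"
    unfolding c 0 using u pip by (simp_all add: integral_iff v_mult)
  show "coeff local_factor j \<in> V"
  proof (cases "coeff residual_factor j = \<zero>")
    case False
    then have "e dvd j \<and> j \<le> e * f" using residual_factor_coeff[of j] by metis
    then obtain k where k: "j = e * k" "k \<le> f" using e_pos by (auto elim!: dvdE)
    have G: "coeff residual_factor j = relation_coeff k \<otimes> inv (\<pi> [^] (a * k))" using residual_factor_coeff[of j] k e_pos by simp
    then have g0: "relation_coeff k \<noteq> \<zero>" using False pinv by auto
    then have "v (relation_coeff k) \<ge> 0" using relation_coeff(1)[of k] by (simp add: val_ge_iff)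
    moreover have "v (coeff local_factor j) = v (relation_coeff k) + int (a * f) - int (a * k)"
      unfolding c G using g0 relation_coeff_carrier pip pinv by (simp add: v_mult integral_iff)
    moreover have "int (a * k) \<le> int (a * f)" using k(2) by (simp del: of_nat_mult)
    moreover have "coeff local_factor j \<in> carrier F" using c G relation_coeff_carrier pip pinv by simp
    ultimately show ?thesis by (auto simp: val_ge_def)
  qed (use c pip in simp)
qed

end

section \<open>Local subrings of a field\<close>

lemma (in ring) add_closed_finsum:
  assumes "\<zero> \<in> M" "M \<subseteq> carrier R" "\<And>x y. x \<in> M \<Longrightarrow> y \<in> M \<Longrightarrow> x \<oplus> y \<in> M" "\<And>i. i \<in> A \<Longrightarrow> t i \<in> M"
  shows "finsum R t A \<in> M"
proof (cases "finite A")
  case True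
  then show ?thesis using assms(4)
  proof (induction A rule: finite_induct)
    case (insert i A)
    have "t \<in> A \<rightarrow> carrier R" "t i \<in> carrier R" using insert.prems assms(2) by blast+
    then show ?case using insert assms(3) by (simp add: finsum_insert)
  qed (use assms in simp)
qed (use assms in \<open>simp add: finsum_infinite\<close>)

text \<open>A subring of a field that is local with maximal ideal \<open>M\<close>. Arguments about the factors have to be made
  both in rings not yet known to be valuation rings and in arbitrary valuation rings; this is what these
  have in common.\<close>

locale local_subring = field L for L :: "'l ring" (structure) +
  fixes B M :: "'l set"
  assumes B: "subring B L" and M_sub: "M \<subseteq> B" and M_zero: "\<zero> \<in> M"
    and M_add: "\<And>x y. x \<in> M \<Longrightarrow> y \<in> M \<Longrightarrow> x \<oplus> y \<in> M"
    and M_mult: "\<And>x y. x \<in> B \<Longrightarrow> y \<in> M \<Longrightarrow> x \<otimes> y \<in> M"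
    and unit: "\<And>x. x \<in> B \<Longrightarrow> x \<notin> M \<Longrightarrow> inv x \<in> B"
    and M_one: "\<one> \<notin> M"
begin

lemma B_carrier: "x \<in> B \<Longrightarrow> x \<in> carrier L"
  using subringE(1)[OF B] by auto

lemma M_carrier: "x \<in> M \<Longrightarrow> x \<in> carrier L"
  using B_carrier M_sub by auto

lemma B_pow: "x \<in> B \<Longrightarrow> x [^] (n::nat) \<in> B"
  by (induction n) (auto simp: subringE[OF B])

lemma M_neg: "x \<in> M \<Longrightarrow> \<ominus> x \<in> M"
  using M_mult[of "\<ominus> \<one>" x] subringE(3,5)[OF B] M_carrier[of x] by (simp add: l_minus)

lemma M_finsum: "(\<And>i. i \<in> A \<Longrightarrow> t i \<in> M) \<Longrightarrow> finsum L t A \<in> M"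
  by (rule add_closed_finsum[of M]) (use M_zero M_carrier M_add in auto)

lemma B_finsum: "(\<And>i. i \<in> A \<Longrightarrow> t i \<in> B) \<Longrightarrow> finsum L t A \<in> B"
  by (rule add_closed_finsum[of B]) (use subringE[OF B] in auto)

lemma not_M_add: "x \<in> B \<Longrightarrow> x \<notin> M \<Longrightarrow> z \<in> M \<Longrightarrow> x \<oplus> z \<notin> M"
proof
  assume x: "x \<in> B" "x \<notin> M" "z \<in> M" "x \<oplus> z \<in> M"
  then have "(x \<oplus> z) \<oplus> \<ominus> z \<in> M" using M_add M_neg by blast
  moreover have "(x \<oplus> z) \<oplus> \<ominus> z = x" using B_carrier M_carrier x by (simp add: a_assoc r_neg)
  ultimately show False using x by simp
qed

lemma unit_nz: "x \<notin> M \<Longrightarrow> x \<noteq> \<zero>"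
  using M_zero by auto

lemma not_M_if_inv:
  assumes "x \<in> B" "z \<in> B" "x \<otimes> z = \<one>"
  shows "x \<notin> M"
  using M_mult[of z x] M_one assms B_carrier[of x] B_carrier[of z] m_comm[of x z] by auto

lemma not_M_mult:
  assumes "x \<in> B" "x \<notin> M" "z \<in> B" "z \<notin> M"
  shows "x \<otimes> z \<notin> M"
proof
  assume "x \<otimes> z \<in> M"
  then have "inv x \<otimes> (x \<otimes> z) \<in> M" using M_mult unit assms by blast
  moreover have "inv x \<otimes> (x \<otimes> z) = z"
    using field_inv[of x] unit_nz[of x] assms B_carrier by (simp add: m_assoc[symmetric])
  ultimately show False using assms by simp
qed

end

section \<open>Recognizing discrete valuation rings\<close>

text \<open>A subring \<open>B\<close> with a residue map \<open>r\<close> is a discrete valuation ring if the kernel of \<open>r\<close> is generated by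
  one element \<open>t\<close>, the elements outside the kernel are invertible, and every element of the field has a
  power of \<open>t\<close> as denominator.\<close>

locale dvr_data = field L for L :: "'l ring" (structure) +
  fixes B :: "'l set" and K :: "'k ring" and r :: "'l \<Rightarrow> 'k" and t :: 'l
  assumes K: "field K" and B: "subring B L" and r: "r \<in> ring_hom (L\<lparr>carrier := B\<rparr>) K"
    and unit: "\<And>x. x \<in> B \<Longrightarrow> r x \<noteq> \<zero>\<^bsub>K\<^esub> \<Longrightarrow> x \<noteq> \<zero> \<Longrightarrow> inv x \<in> B"
    and t: "t \<in> B" "t \<noteq> \<zero>" "r t = \<zero>\<^bsub>K\<^esub>"
    and ker: "\<And>x. x \<in> B \<Longrightarrow> r x = \<zero>\<^bsub>K\<^esub> \<Longrightarrow> x \<otimes> inv t \<in> B"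
    and denom: "\<And>x. x \<in> carrier L \<Longrightarrow> \<exists>k::nat. x \<otimes> t [^] k \<in> B"
begin

interpretation K: field K by (rule K)

lemma Bc: "x \<in> B \<Longrightarrow> x \<in> carrier L" using subringE(1)[OF B] by auto

lemma
  shows r_closed: "x \<in> B \<Longrightarrow> r x \<in> carrier K"
    and r_mult: "x \<in> B \<Longrightarrow> y \<in> B \<Longrightarrow> r (x \<otimes> y) = r x \<otimes>\<^bsub>K\<^esub> r y"
    and r_one: "r \<one> = \<one>\<^bsub>K\<^esub>"
  using ring_hom_memE[OF r] by auto

lemma r_zero: "r \<zero> = \<zero>\<^bsub>K\<^esub>"
  using r_mult[of t \<zero>] t r_closed subringE(2)[OF B] Bc by simp

definition U :: "'l set" where "U = {x \<in> B. r x \<noteq> \<zero>\<^bsub>K\<^esub>}"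

lemma UD: "x \<in> U \<Longrightarrow> x \<in> B" "x \<in> U \<Longrightarrow> x \<in> carrier L" "x \<in> U \<Longrightarrow> x \<noteq> \<zero>" "x \<in> U \<Longrightarrow> r x \<noteq> \<zero>\<^bsub>K\<^esub>"
  using Bc r_zero by (auto simp: U_def)

lemma U_mult: "x \<in> U \<Longrightarrow> y \<in> U \<Longrightarrow> x \<otimes> y \<in> U"
  using r_mult r_closed subringE(6)[OF B] by (auto simp: U_def K.integral_iff)

lemma U_one: "\<one> \<in> U"
  using r_one subringE(3)[OF B] by (auto simp: U_def)

lemma t_pow: "t [^] (n::nat) \<in> B" "t [^] n \<in> carrier L" "t [^] n \<noteq> \<zero>"
  subgoal by (induction n) (auto simp: subringE[OF B] t)
  using t Bc field_inv_pow by auto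

lemma t_pow_add: "t [^] (n + k :: nat) = t [^] n \<otimes> t [^] k"
  using t Bc by (simp add: nat_pow_mult)

lemma tpU_unique:
  assumes "z \<in> U" "z' \<in> U" "t [^] (n::nat) \<otimes> z = t [^] (n'::nat) \<otimes> z'"
  shows "n = n'"
proof -
  have False if "n < n'" "z \<in> U" "z' \<in> U" "t [^] n \<otimes> z = t [^] n' \<otimes> z'" for n n' :: nat and z z'
  proof -
    obtain d where d: "n' = n + Suc d" using less_imp_Suc_add[OF \<open>n < n'\<close>] by auto
    have "t [^] n \<otimes> z = t [^] n \<otimes> (t [^] Suc d \<otimes> z')"
      using that(4) t_pow t_pow_add[of n d] UD(2)[OF that(3)] Bc[OF t(1)] unfolding d by (simp add: m_assoc)
    then have "z = t [^] Suc d \<otimes> z'"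
      using t_pow UD that Bc[OF t(1)] by (subst (asm) m_lcancel) auto
    also have "\<dots> = t \<otimes> (t [^] d \<otimes> z')"
      using t_pow UD(2)[OF that(3)] t Bc by (simp add: m_ac)
    finally have "r z = r t \<otimes>\<^bsub>K\<^esub> r (t [^] d \<otimes> z')"
      using r_mult t t_pow UD(1)[OF that(3)] subringE(6)[OF B] by simp
    then show False
      using t r_closed t_pow UD(1)[OF that(3)] UD(4)[OF that(2)] subringE(6)[OF B] by simp
  qed
  then show ?thesis using assms by (metis linorder_neqE_nat)
qed

text \<open>Divide by \<open>t\<close> as long as the residue is zero. This ends, because \<open>x\<close> divides some power of \<open>t\<close>, a
  denominator of \<open>1/x\<close>.\<close>

lemma factor_B:
  assumes "x \<in> B" "x \<noteq> \<zero>"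
  shows "\<exists>n z. z \<in> U \<and> x = t [^] (n::nat) \<otimes> z"
proof -
  have "x \<in> B \<Longrightarrow> c \<in> B \<Longrightarrow> x \<otimes> c = t [^] k \<Longrightarrow> \<exists>n z. z \<in> U \<and> x = t [^] (n::nat) \<otimes> z" for k :: nat and x c
  proof (induction k arbitrary: x)
    case 0
    have "r x \<otimes>\<^bsub>K\<^esub> r c = \<one>\<^bsub>K\<^esub>" using r_mult[of x c] r_one 0 by simp
    then have "r x \<noteq> \<zero>\<^bsub>K\<^esub>" using r_closed 0 by auto
    then show ?case using 0 Bc by (intro exI[of _ "0::nat"] exI[of _ x]) (auto simp: U_def)
  next
    case (Suc k)
    show ?case
    proof (cases "r x = \<zero>\<^bsub>K\<^esub>")
      case True
      let ?x = "x \<otimes> inv t"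
      note ti = field_inv[OF Bc[OF t(1)] t(2)]
      have x: "x = t \<otimes> ?x" using ti(1,3) Bc[OF t(1)] Bc[OF Suc.prems(1)] by (simp add: m_lcomm[of t x])
      have "t \<otimes> (?x \<otimes> c) = t \<otimes> t [^] k"
        using Suc.prems x ti t Bc t_pow by (metis m_assoc m_closed m_comm nat_pow_Suc)
      then have "?x \<otimes> c = t [^] k" using t Bc Suc.prems ti t_pow by (subst (asm) m_lcancel) auto
      from Suc.IH[OF ker[OF Suc.prems(1) True] Suc.prems(2) this]
      obtain n z where n: "z \<in> U" "?x = t [^] (n::nat) \<otimes> z" by blast
      then have "x = t [^] Suc n \<otimes> z" using x t Bc t_pow UD(2)[OF n(1)] by (simp add: m_ac)
      then show ?thesis using n by blast
    next
      case False
      then show ?thesis using Suc.prems Bc by (intro exI[of _ "0::nat"] exI[of _ x]) (auto simp: U_def)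
    qed
  qed
  note * = this
  note xi = field_inv[OF Bc[OF assms(1)] assms(2)]
  obtain k where k: "inv x \<otimes> t [^] (k::nat) \<in> B" using denom xi by blast
  have "x \<otimes> (inv x \<otimes> t [^] k) = t [^] k" using xi t_pow Bc assms by (simp add: m_assoc[symmetric])
  then show ?thesis using *[OF assms(1) k] by blast
qed

text \<open>That is, \<open>x = t\<^bsup>a-b\<^esup> z\<close> with a unit \<open>z\<close>, multiplied out.\<close>

definition wrel :: "'l \<Rightarrow> int \<Rightarrow> bool" where
  "wrel x n \<longleftrightarrow> (\<exists>a b z. z \<in> U \<and> x \<otimes> t [^] (b::nat) = t [^] (a::nat) \<otimes> z \<and> n = int a - int b)"

lemma wrel_ex:
  assumes "x \<in> carrier L" "x \<noteq> \<zero>"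
  shows "\<exists>n. wrel x n"
proof -
  obtain b where b: "x \<otimes> t [^] (b::nat) \<in> B" using denom assms by blast
  moreover have "x \<otimes> t [^] b \<noteq> \<zero>" using assms t_pow by (simp add: integral_iff)
  ultimately obtain a z where "z \<in> U" "x \<otimes> t [^] b = t [^] (a::nat) \<otimes> z" using factor_B by blast
  then show ?thesis by (auto simp: wrel_def)
qed

lemma wrel_unique:
  assumes x: "x \<in> carrier L" and "wrel x n" "wrel x n'"
  shows "n = n'"
proof -
  obtain a b z where 1: "z \<in> U" "x \<otimes> t [^] (b::nat) = t [^] (a::nat) \<otimes> z" "n = int a - int b"
    using assms by (auto simp: wrel_def)
  obtain a' b' z' where 2: "z' \<in> U" "x \<otimes> t [^] (b'::nat) = t [^] (a'::nat) \<otimes> z'" "n' = int a' - int b'"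
    using assms by (auto simp: wrel_def)
  have "t [^] (a + b') \<otimes> z = (t [^] a \<otimes> z) \<otimes> t [^] b'"
    using t_pow UD(2)[OF 1(1)] by (simp add: t_pow_add m_ac)
  also have "\<dots> = (x \<otimes> t [^] b') \<otimes> t [^] b" unfolding 1(2)[symmetric] using x t_pow by (simp add: m_ac)
  also have "\<dots> = t [^] (a' + b) \<otimes> z'" unfolding 2(2)
    using t_pow UD(2)[OF 2(1)] by (simp add: t_pow_add m_ac)
  finally have "a + b' = a' + b" using tpU_unique[OF 1(1) 2(1)] by blast
  then show ?thesis using 1 2 by simp
qed

definition w :: "'l \<Rightarrow> int" where "w x = (THE n. wrel x n)"

lemma w_eq: "x \<in> carrier L \<Longrightarrow> wrel x n \<Longrightarrow> w x = n"
  unfolding w_def using wrel_unique by blast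

lemma w_wrel: "x \<in> carrier L \<Longrightarrow> x \<noteq> \<zero> \<Longrightarrow> wrel x (w x)"
  using wrel_ex w_eq by blast

lemma w_mult:
  assumes x: "x \<in> carrier L" "x \<noteq> \<zero>" and y: "y \<in> carrier L" "y \<noteq> \<zero>"
  shows "w (x \<otimes> y) = w x + w y"
proof -
  obtain a b z where 1: "z \<in> U" "x \<otimes> t [^] (b::nat) = t [^] (a::nat) \<otimes> z" "w x = int a - int b"
    using w_wrel[OF x] by (auto simp: wrel_def)
  obtain a' b' z' where 2: "z' \<in> U" "y \<otimes> t [^] (b'::nat) = t [^] (a'::nat) \<otimes> z'" "w y = int a' - int b'"
    using w_wrel[OF y] by (auto simp: wrel_def)
  have "(x \<otimes> y) \<otimes> t [^] (b + b') = (x \<otimes> t [^] b) \<otimes> (y \<otimes> t [^] b')"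
    using x y t_pow by (simp add: t_pow_add m_ac)
  also have "\<dots> = t [^] (a + a') \<otimes> (z \<otimes> z')" unfolding 1(2) 2(2)
    using t_pow UD(2)[OF 1(1)] UD(2)[OF 2(1)] by (simp add: t_pow_add m_ac)
  finally have "wrel (x \<otimes> y) (w x + w y)"
    unfolding wrel_def using U_mult[OF 1(1) 2(1)] 1(3) 2(3)
    by (intro exI[of _ "a + a'"] exI[of _ "b + b'"] exI[of _ "z \<otimes> z'"]) auto
  then show ?thesis using w_eq x y by simp
qed

lemma w_U: "x \<in> U \<Longrightarrow> w x = 0"
  using UD by (intro w_eq) (auto simp: wrel_def intro!: exI[of _ "0::nat"] exI[of _ x])

lemma w_t: "w t = 1"
proof (rule w_eq[OF Bc[OF t(1)]])
  have "t \<otimes> t [^] (0::nat) = t [^] (1::nat) \<otimes> \<one>" using t Bc by simp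
  then show "wrel t 1" unfolding wrel_def using U_one by (metis of_nat_0 of_nat_1 diff_zero)
qed

lemma w_one: "w \<one> = 0" using w_U U_one by simp

lemma w_inv: "x \<in> carrier L \<Longrightarrow> x \<noteq> \<zero> \<Longrightarrow> w (inv x) = - w x"
  using w_mult[of x "inv x"] field_inv[of x] w_one by simp

lemma w_tp: "w (t [^] (n::nat)) = int n"
proof (induction n)
  case (Suc n)
  then show ?case using w_mult[OF t_pow(2)[of n] t_pow(3)[of n] Bc[OF t(1)] t(2)] w_t by simp
qed (simp add: w_one)

lemma w_nonneg:
  assumes x: "x \<in> carrier L" "x \<noteq> \<zero>"
  shows "w x \<ge> 0 \<longleftrightarrow> x \<in> B"
proof
  assume "x \<in> B"
  then obtain n z where n: "z \<in> U" "x = t [^] (n::nat) \<otimes> z" using factor_B x by blast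
  then show "w x \<ge> 0" using w_mult[of "t [^] n" z] t_pow UD w_tp w_U by simp
next
  assume w: "w x \<ge> 0"
  obtain a b z where 1: "z \<in> U" "x \<otimes> t [^] (b::nat) = t [^] (a::nat) \<otimes> z" "w x = int a - int b"
    using w_wrel[OF x] by (auto simp: wrel_def)
  obtain c where c: "a = b + c" using w 1(3) by (metis le_add_diff_inverse of_nat_le_iff diff_ge_0_iff_ge)
  have "t [^] b \<otimes> x = t [^] b \<otimes> (t [^] c \<otimes> z)"
    using 1 x t_pow UD(2)[OF 1(1)] by (simp add: c t_pow_add m_ac)
  then have "x = t [^] c \<otimes> z" using x t_pow UD(2)[OF 1(1)] by (subst (asm) m_lcancel) auto
  then show "x \<in> B" using t_pow UD(1)[OF 1(1)] subringE(6)[OF B] by simp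
qed

lemma w_ker:
  assumes "x \<in> B" "x \<noteq> \<zero>"
  shows "r x = \<zero>\<^bsub>K\<^esub> \<longleftrightarrow> w x \<ge> 1"
proof
  assume r0: "r x = \<zero>\<^bsub>K\<^esub>"
  note ti = field_inv[OF Bc[OF t(1)] t(2)]
  have "x \<otimes> inv t \<in> B" "x \<otimes> inv t \<noteq> \<zero>" using ker r0 assms ti Bc by (auto simp: integral_iff)
  then have "w (x \<otimes> inv t) \<ge> 0" using w_nonneg Bc by blast
  then show "w x \<ge> 1" using w_mult w_inv[of t] w_t t Bc assms ti by simp
qed (use w_U assms in \<open>force simp: U_def\<close>)

lemma discrete: "discrete_valuation L w"
proof -
  have "n \<in> w ` (carrier L - {\<zero>})" for n
  proof (cases "n \<ge> 0")
    case True
    then obtain k where "n = int k" using nonneg_int_cases by blast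
    then show ?thesis using w_tp[of k] t_pow[of k] by (intro image_eqI[of _ _ "t [^] k"]) auto
  next
    case False
    then obtain k where k: "n = - int k" by (metis int_cases2 of_nat_0_le_iff)
    show ?thesis using w_tp[of k] w_inv[OF t_pow(2,3)[of k]] field_inv[OF t_pow(2,3)[of k]] k
      by (intro image_eqI[of _ _ "inv (t [^] k)"]) auto
  qed
  moreover have add: "w (x \<oplus> y) \<ge> w x"
    if x: "x \<in> carrier L" "x \<noteq> \<zero>" and y: "y \<in> carrier L" "y \<noteq> \<zero>" and s: "x \<oplus> y \<noteq> \<zero>" and le: "w x \<le> w y" for x y
  proof -
    note xi = field_inv[OF x]
    have "w (y \<otimes> inv x) \<ge> 0" "y \<otimes> inv x \<noteq> \<zero>" using w_mult w_inv x y xi le by (auto simp: integral_iff)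
    then have "y \<otimes> inv x \<in> B" using w_nonneg x y xi by simp
    then have b: "\<one> \<oplus> y \<otimes> inv x \<in> B" using subringE(3,7)[OF B] by simp
    have "x \<oplus> y = x \<otimes> (\<one> \<oplus> y \<otimes> inv x)" using x y xi by (simp add: r_distr m_lcomm[of x y])
    moreover have "\<one> \<oplus> y \<otimes> inv x \<noteq> \<zero>" using calculation s x by auto
    ultimately show ?thesis using w_mult[OF x, of "\<one> \<oplus> y \<otimes> inv x"] w_nonneg b Bc by simp
  qed
  moreover have "w (x \<oplus> y) \<ge> min (w x) (w y)"
    if "x \<in> carrier L" "x \<noteq> \<zero>" "y \<in> carrier L" "y \<noteq> \<zero>" "x \<oplus> y \<noteq> \<zero>" for x y
    using add[of x y] add[of y x] that a_comm[of x y] by (cases "w x \<le> w y") auto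
  ultimately show ?thesis using w_mult by (auto simp: discrete_valuation_def)
qed

lemma val_ring_w: "val_ring L w = B"
  using w_nonneg Bc subringE(2)[OF B] by (auto simp: val_ge_def)

lemma w_ker': "x \<in> B \<Longrightarrow> r x = \<zero>\<^bsub>K\<^esub> \<longleftrightarrow> x \<in> val_ge L w 1"
  using w_ker r_zero Bc subringE(2)[OF B] by (auto simp: val_ge_def)

end

section \<open>Evaluation in an extension field\<close>

text \<open>A homomorphism \<open>\<epsilon>\<close> from \<open>F[X]\<close> to a field \<open>L\<close>; it restricts to the embedding \<open>\<phi>\<close> of the constants.
  The element \<open>u\<close> below is the image of \<open>Y = X\<^sup>e / \<pi>\<^sup>a\<close>.\<close>

locale residual_ext = residual F v e l \<pi> K \<tau> y f + L: field L
  for F :: "'a ring" (structure) and v e l \<pi> and K :: "'k ring" and \<tau> y f and L :: "'l ring" +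
  fixes \<epsilon> :: "'a list \<Rightarrow> 'l"
  assumes eps: "\<epsilon> \<in> ring_hom ((carrier F)[X]) L"
begin

interpretation FX: domain FX
  by (rule FX_domain)

lemma
  shows eps_closed [simp]: "h \<in> carrier FX \<Longrightarrow> \<epsilon> h \<in> carrier L"
    and eps_mult: "h \<in> carrier FX \<Longrightarrow> h' \<in> carrier FX \<Longrightarrow> \<epsilon> (h \<otimes>\<^bsub>FX\<^esub> h') = \<epsilon> h \<otimes>\<^bsub>L\<^esub> \<epsilon> h'"
    and eps_add: "h \<in> carrier FX \<Longrightarrow> h' \<in> carrier FX \<Longrightarrow> \<epsilon> (h \<oplus>\<^bsub>FX\<^esub> h') = \<epsilon> h \<oplus>\<^bsub>L\<^esub> \<epsilon> h'"
    and eps_one: "\<epsilon> \<one>\<^bsub>FX\<^esub> = \<one>\<^bsub>L\<^esub>"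
  using ring_hom_memE[OF eps] by auto

lemma eps_ring_hom: "ring_hom_ring FX L \<epsilon>"
  using ring_hom_ringI2[OF FX.ring_axioms L.ring_axioms eps] .

interpretation eh: ring_hom_ring FX L \<epsilon>
  by (rule eps_ring_hom)

lemma eps_zero [simp]: "\<epsilon> \<zero>\<^bsub>FX\<^esub> = \<zero>\<^bsub>L\<^esub>"
  using eh.hom_zero by simp

lemma eps_neg: "h \<in> carrier FX \<Longrightarrow> \<epsilon> (\<ominus>\<^bsub>FX\<^esub> h) = \<ominus>\<^bsub>L\<^esub> \<epsilon> h"
  using eh.hom_a_inv by simp

lemma eps_pow: "h \<in> carrier FX \<Longrightarrow> \<epsilon> (h [^]\<^bsub>FX\<^esub> (n::nat)) = \<epsilon> h [^]\<^bsub>L\<^esub> n"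
  using ring_hom_ring.hom_nat_pow[OF eps_ring_hom] by simp

definition \<phi> :: "'a \<Rightarrow> 'l" where "\<phi> c = \<epsilon> (mono c 0)"

lemma phi_hom: "\<phi> \<in> ring_hom F L"
  using ring_hom_trans[OF mono_const_hom eps] by (simp add: \<phi>_def[abs_def] comp_def)

lemma
  shows phi_closed [simp]: "c \<in> carrier F \<Longrightarrow> \<phi> c \<in> carrier L"
    and phi_mult: "c \<in> carrier F \<Longrightarrow> c' \<in> carrier F \<Longrightarrow> \<phi> (c \<otimes> c') = \<phi> c \<otimes>\<^bsub>L\<^esub> \<phi> c'"
    and phi_one [simp]: "\<phi> \<one> = \<one>\<^bsub>L\<^esub>"
  using ring_hom_memE[OF phi_hom] by auto

lemma phi_zero [simp]: "\<phi> \<zero> = \<zero>\<^bsub>L\<^esub>"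
  by (simp add: \<phi>_def)

lemma phi_nz: "c \<in> carrier F \<Longrightarrow> c \<noteq> \<zero> \<Longrightarrow> \<phi> c \<noteq> \<zero>\<^bsub>L\<^esub>"
  using phi_mult[of c "inv c"] field_inv[of c] by auto

lemma phi_inv:
  assumes "c \<in> carrier F" "c \<noteq> \<zero>"
  shows "\<phi> (inv c) = inv\<^bsub>L\<^esub> \<phi> c"
proof -
  have "\<phi> c \<otimes>\<^bsub>L\<^esub> \<phi> (inv c) = \<one>\<^bsub>L\<^esub>" using phi_mult[of c "inv c"] field_inv[OF assms] assms by simp
  then show ?thesis
    using L.comm_inv_char[of "\<phi> c" "\<phi> (inv c)"] field_inv[OF assms] assms by simp
qed

lemma phi_pow: "c \<in> carrier F \<Longrightarrow> \<phi> (c [^] (n::nat)) = \<phi> c [^]\<^bsub>L\<^esub> n"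
  by (induction n) (simp_all add: phi_mult)

definition u :: 'l where "u = \<epsilon> (mono (inv (\<pi> [^] a)) e)"

lemma u_closed [simp]: "u \<in> carrier L"
  using mono pinv by (simp add: u_def)

lemma eps_mono_u:
  assumes "c \<in> carrier F"
  shows "\<epsilon> (mono (c \<otimes> inv (\<pi> [^] (a * k))) (e * k)) = \<phi> c \<otimes>\<^bsub>L\<^esub> u [^]\<^bsub>L\<^esub> k"
proof -
  have "inv (\<pi> [^] (a * k)) = inv (\<pi> [^] a) [^] k"
    using field_inv_pow(2)[OF pip(1,2), of a k] pi by (simp add: nat_pow_pow)
  then have "mono (c \<otimes> inv (\<pi> [^] (a * k))) (e * k) = mono c 0 \<otimes>\<^bsub>FX\<^esub> (mono (inv (\<pi> [^] a)) e [^]\<^bsub>FX\<^esub> k)"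
    using assms pinv mono_pow[of "inv (\<pi> [^] a)" e k] mono_mult[OF assms, of "inv (\<pi> [^] a) [^] k" 0 "e * k"]
    by simp
  then show ?thesis using mono assms pinv by (simp add: eps_mult eps_pow \<phi>_def u_def)
qed

lemma eps_lift:
  assumes b: "\<And>k. b k \<in> carrier F"
  shows "\<epsilon> (lift n b) = (\<Oplus>\<^bsub>L\<^esub>k\<in>{..<n}. \<phi> (b k) \<otimes>\<^bsub>L\<^esub> u [^]\<^bsub>L\<^esub> k)"
proof (induction n)
  case 0
  have "lift 0 b = \<zero>\<^bsub>FX\<^esub>" using lift(2)[of 0 b] by (simp add: FX_zero)
  then show ?case by simp
next
  case (Suc n)
  let ?m = "mono (b n \<otimes> inv (\<pi> [^] (a * n))) (e * n)"
  have bm: "b n \<otimes> inv (\<pi> [^] (a * n)) \<in> carrier F" using b pinv by simp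
  have L: "lift k b \<in> carrier FX" for k using lift(1) b by blast
  have "lift (Suc n) b = ?m \<oplus>\<^bsub>FX\<^esub> lift n b"
  proof (rule FX_eqI)
    fix j
    have 1: "e dvd j \<and> j < e * Suc n \<longleftrightarrow> j = e * n \<or> (e dvd j \<and> j < e * n)"
      using e_pos by (auto elim!: dvdE simp: less_Suc_eq simp del: mult_Suc_right)
    have Lc: "coeff (lift n b) j = (if e dvd j \<and> j < e * n then b (j div e) \<otimes> inv (\<pi> [^] (a * (j div e))) else \<zero>)" for n
      using lift(3) b by blast
    show "coeff (lift (Suc n) b) j = coeff (?m \<oplus>\<^bsub>FX\<^esub> lift n b) j"
      unfolding coeff_FX_add[OF mono(1)[OF bm] L] mono(2)[OF bm] Lc 1
      using e_pos b pinv by auto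
  qed (use L mono bm in auto)
  then have "\<epsilon> (lift (Suc n) b) = \<epsilon> ?m \<oplus>\<^bsub>L\<^esub> \<epsilon> (lift n b)" using L mono bm eps_add by simp
  then show ?case using Suc eps_mono_u[OF b, of n] b by (simp add: lessThan_Suc)
qed

text \<open>At a place where \<open>u\<close> is not a unit, the value of \<open>G(u)\<close> is decided by one term: by the constant term,
  a unit, if \<open>u\<close> lies in \<open>M\<close>, and by the leading term if \<open>1/u\<close> does. If \<open>u\<close> is a unit, everything depends on the
  residue of \<open>u\<close>, and the third alternative makes the assumption.\<close>

lemma residual_factor_inverse_in_local_subring:
  assumes loc: "local_subring L B M" and V: "\<And>c. c \<in> V \<Longrightarrow> \<phi> c \<in> B"
    and cases: "u \<in> M \<or> (u \<noteq> \<zero>\<^bsub>L\<^esub> \<and> inv\<^bsub>L\<^esub> u \<in> M) \<or> (u \<in> B \<and> u \<notin> M \<and> \<epsilon> residual_factor \<notin> M)"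
  shows "\<exists>x\<in>B. \<epsilon> residual_factor \<otimes>\<^bsub>L\<^esub> x = \<one>\<^bsub>L\<^esub>"
proof -
  interpret loc: local_subring L B M by (rule loc)
  have unitM: "\<phi> c \<notin> M" if "c \<in> V" "c \<notin> val_ge F v 1" for c
  proof -
    note c = val_unit[OF that]
    show ?thesis
      using loc.not_M_if_inv[of "\<phi> c" "\<phi> (inv c)"] V that c field_inv[OF c(1,2)] phi_mult[of c "inv c"] by simp
  qed
  let ?t = "\<lambda>k. \<phi> (relation_coeff k) \<otimes>\<^bsub>L\<^esub> u [^]\<^bsub>L\<^esub> k"
  have tc: "?t k \<in> carrier L" for k using relation_coeff_carrier by simp
  have G: "\<epsilon> residual_factor = (\<Oplus>\<^bsub>L\<^esub>k\<in>{..<Suc f}. ?t k)" unfolding residual_factor_def by (rule eps_lift) (rule relation_coeff_carrier)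
  have inv_ok: "\<exists>x\<in>B. \<epsilon> residual_factor \<otimes>\<^bsub>L\<^esub> x = \<one>\<^bsub>L\<^esub>" if "\<epsilon> residual_factor \<in> B" "\<epsilon> residual_factor \<notin> M"
    using loc.unit[OF that] L.field_inv[OF loc.B_carrier[OF that(1)] loc.unit_nz[OF that(2)]] by blast
  have GB: "\<epsilon> residual_factor \<in> B" if "u \<in> B"
    unfolding G using V relation_coeff(1) loc.B_pow[OF that] subringE(6)[OF loc.B] by (intro loc.B_finsum) auto
  consider "u \<in> M" | "u \<noteq> \<zero>\<^bsub>L\<^esub>" "inv\<^bsub>L\<^esub> u \<in> M" | "u \<in> B" "u \<notin> M" "\<epsilon> residual_factor \<notin> M" using cases by blast
  then show ?thesis
  proof cases
    case 1
    then have uB: "u \<in> B" using loc.M_sub by auto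
    have "\<epsilon> residual_factor = (\<Oplus>\<^bsub>L\<^esub>k\<in>{..f}. ?t k)" unfolding G lessThan_Suc_atMost ..
    also obtain f' where f': "Suc f' = f" using f_pos by (cases f) auto
    have "(\<Oplus>\<^bsub>L\<^esub>k\<in>{..f}. ?t k) = (\<Oplus>\<^bsub>L\<^esub>k\<in>{..f'}. ?t (Suc k)) \<oplus>\<^bsub>L\<^esub> ?t 0"
      using L.add.finprod_Suc2[of ?t f'] tc unfolding f' by auto
    also have "\<dots> = \<phi> (relation_coeff 0) \<oplus>\<^bsub>L\<^esub> (\<Oplus>\<^bsub>L\<^esub>k\<in>{..f'}. ?t (Suc k))"
      using tc relation_coeff_carrier by (simp add: L.a_comm L.finsum_closed del: L.nat_pow_Suc)
    finally have "\<epsilon> residual_factor = \<phi> (relation_coeff 0) \<oplus>\<^bsub>L\<^esub> (\<Oplus>\<^bsub>L\<^esub>k\<in>{..f'}. ?t (Suc k))" .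
    moreover have "(\<Oplus>\<^bsub>L\<^esub>k\<in>{..f'}. ?t (Suc k)) \<in> M"
    proof (rule loc.M_finsum)
      fix k
      have "?t (Suc k) = (\<phi> (relation_coeff (Suc k)) \<otimes>\<^bsub>L\<^esub> u [^]\<^bsub>L\<^esub> k) \<otimes>\<^bsub>L\<^esub> u" using relation_coeff_carrier by (simp add: L.m_assoc)
      then show "?t (Suc k) \<in> M"
        using loc.M_mult 1 V relation_coeff(1) loc.B_pow[OF uB] subringE(6)[OF loc.B] by simp
    qed
    ultimately have "\<epsilon> residual_factor \<notin> M" using loc.not_M_add[OF V[OF relation_coeff(1)] unitM[OF relation_coeff(1) relation_coeff_0]] by simp
    then show ?thesis using inv_ok GB uB by blast
  next
    case 2
    note ui = L.field_inv[OF u_closed 2(1)]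
    have iB: "inv\<^bsub>L\<^esub> u \<in> B" using 2 loc.M_sub by auto
    define s where "s = \<epsilon> residual_factor \<otimes>\<^bsub>L\<^esub> inv\<^bsub>L\<^esub> u [^]\<^bsub>L\<^esub> f"
    have up: "u [^]\<^bsub>L\<^esub> k \<otimes>\<^bsub>L\<^esub> inv\<^bsub>L\<^esub> u [^]\<^bsub>L\<^esub> k = \<one>\<^bsub>L\<^esub>" for k :: nat
      using ui L.nat_pow_distrib[of u "inv\<^bsub>L\<^esub> u" k] L.nat_pow_one by simp
    have "s = (\<Oplus>\<^bsub>L\<^esub>k\<in>{..<Suc f}. ?t k \<otimes>\<^bsub>L\<^esub> inv\<^bsub>L\<^esub> u [^]\<^bsub>L\<^esub> f)"
      unfolding s_def G using tc ui by (intro L.finsum_ldistr) auto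
    also have "\<dots> = (?t f \<otimes>\<^bsub>L\<^esub> inv\<^bsub>L\<^esub> u [^]\<^bsub>L\<^esub> f) \<oplus>\<^bsub>L\<^esub> (\<Oplus>\<^bsub>L\<^esub>k\<in>{..<f}. ?t k \<otimes>\<^bsub>L\<^esub> inv\<^bsub>L\<^esub> u [^]\<^bsub>L\<^esub> f)"
      using tc ui by (simp add: lessThan_Suc)
    also have "?t f \<otimes>\<^bsub>L\<^esub> inv\<^bsub>L\<^esub> u [^]\<^bsub>L\<^esub> f = \<one>\<^bsub>L\<^esub>" using up relation_coeff(2) by simp
    finally have s: "s = \<one>\<^bsub>L\<^esub> \<oplus>\<^bsub>L\<^esub> (\<Oplus>\<^bsub>L\<^esub>k\<in>{..<f}. ?t k \<otimes>\<^bsub>L\<^esub> inv\<^bsub>L\<^esub> u [^]\<^bsub>L\<^esub> f)" .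
    have "(\<Oplus>\<^bsub>L\<^esub>k\<in>{..<f}. ?t k \<otimes>\<^bsub>L\<^esub> inv\<^bsub>L\<^esub> u [^]\<^bsub>L\<^esub> f) \<in> M"
    proof (rule loc.M_finsum)
      fix k assume "k \<in> {..<f}"
      then obtain d where d: "f = k + Suc d" using less_imp_Suc_add[of k f] by auto
      have "?t k \<otimes>\<^bsub>L\<^esub> inv\<^bsub>L\<^esub> u [^]\<^bsub>L\<^esub> f
          = (\<phi> (relation_coeff k) \<otimes>\<^bsub>L\<^esub> inv\<^bsub>L\<^esub> u [^]\<^bsub>L\<^esub> d) \<otimes>\<^bsub>L\<^esub> inv\<^bsub>L\<^esub> u \<otimes>\<^bsub>L\<^esub> (u [^]\<^bsub>L\<^esub> k \<otimes>\<^bsub>L\<^esub> inv\<^bsub>L\<^esub> u [^]\<^bsub>L\<^esub> k)"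
        using relation_coeff_carrier ui(1) unfolding d by (simp add: L.nat_pow_mult[symmetric] L.m_ac)
      also have "\<dots> = (\<phi> (relation_coeff k) \<otimes>\<^bsub>L\<^esub> inv\<^bsub>L\<^esub> u [^]\<^bsub>L\<^esub> d) \<otimes>\<^bsub>L\<^esub> inv\<^bsub>L\<^esub> u"
        unfolding up using relation_coeff_carrier ui(1) by simp
      finally show "?t k \<otimes>\<^bsub>L\<^esub> inv\<^bsub>L\<^esub> u [^]\<^bsub>L\<^esub> f \<in> M"
        using loc.M_mult[OF _ 2(2)] V relation_coeff(1) loc.B_pow[OF iB] subringE(6)[OF loc.B] by simp
    qed
    then have sM: "s \<in> B" "s \<notin> M"
      unfolding s using loc.not_M_add[OF subringE(3)[OF loc.B] loc.M_one] loc.M_sub subringE(3,7)[OF loc.B] by auto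
    note si = L.field_inv[OF loc.B_carrier[OF sM(1)] loc.unit_nz[OF sM(2)]]
    have "\<epsilon> residual_factor \<otimes>\<^bsub>L\<^esub> (inv\<^bsub>L\<^esub> u [^]\<^bsub>L\<^esub> f \<otimes>\<^bsub>L\<^esub> inv\<^bsub>L\<^esub> s) = s \<otimes>\<^bsub>L\<^esub> inv\<^bsub>L\<^esub> s"
      unfolding s_def using residual_factor ui si(1)[unfolded s_def] by (simp add: L.m_assoc)
    then show ?thesis
      using si loc.unit[OF sM] loc.B_pow[OF iB, of f] subringE(6)[OF loc.B] by metis
  next
    case 3
    then show ?thesis using inv_ok GB by blast
  qed
qed

lemma local_factor_divides_in_local_subring:
  assumes "\<exists>x\<in>B. \<epsilon> residual_factor \<otimes>\<^bsub>L\<^esub> x = \<one>\<^bsub>L\<^esub>" "B \<subseteq> carrier L"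
  shows "\<exists>x\<in>B. \<epsilon> local_factor \<otimes>\<^bsub>L\<^esub> x = \<phi> (\<pi> [^] (a * f))"
proof -
  obtain x where x: "x \<in> B" "x \<in> carrier L" "\<epsilon> residual_factor \<otimes>\<^bsub>L\<^esub> x = \<one>\<^bsub>L\<^esub>" using assms by blast
  have "\<epsilon> local_factor = \<phi> (\<pi> [^] (a * f)) \<otimes>\<^bsub>L\<^esub> \<epsilon> residual_factor"
    using mono pip residual_factor by (simp add: local_factor_def eps_mult \<phi>_def)
  then have "\<epsilon> local_factor \<otimes>\<^bsub>L\<^esub> x = \<phi> (\<pi> [^] (a * f))" using x pip residual_factor by (simp add: L.m_assoc)
  then show ?thesis using x by blast
qed

end

section \<open>The place attached to a factor\<close>

text \<open>The situation after approximation: \<open>p\<close> generates the kernel of \<open>\<epsilon>\<close> and differs from the product \<open>local_factor q\<close>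
  by a polynomial \<open>sm\<close> divisible by \<open>\<pi>\<^sup>N\<close>, where \<open>N\<close> exceeds the value of the constant term of \<open>local_factor q\<close>.\<close>

locale place = residual_ext F v e l \<pi> K \<tau> y f L \<epsilon>
  for F :: "'a ring" (structure) and v e l \<pi> and K :: "'k ring" and \<tau> y f and L :: "'l ring" and \<epsilon> +
  fixes p q sm :: "'a list" and S N :: nat
  assumes eps_surj: "\<epsilon> ` carrier ((carrier F)[X]) = carrier L"
    and p: "p \<in> carrier ((carrier F)[X])" "\<epsilon> p = \<zero>\<^bsub>L\<^esub>"
    and p_ker: "\<And>h. h \<in> carrier ((carrier F)[X]) \<Longrightarrow> \<epsilon> h = \<zero>\<^bsub>L\<^esub> \<Longrightarrow>
        \<exists>g\<in>carrier ((carrier F)[X]). h = p \<otimes>\<^bsub>(carrier F)[X]\<^esub> g"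
    and q: "q \<in> carrier ((carrier F)[X])" and sm: "sm \<in> carrier ((carrier F)[X])"
    and p_eq: "p = (local_factor \<otimes>\<^bsub>(carrier F)[X]\<^esub> q) \<oplus>\<^bsub>(carrier F)[X]\<^esub> sm"
    and sm_small: "\<And>k. coeff sm k \<in> val_ge F v (int N)"
    and S_lt_N: "S < N"
    and Q0: "coeff (local_factor \<otimes>\<^bsub>(carrier F)[X]\<^esub> q) 0 \<noteq> \<zero>" "v (coeff (local_factor \<otimes>\<^bsub>(carrier F)[X]\<^esub> q) 0) \<le> int S"
begin

interpretation FX: domain FX
  by (rule FX_domain)

text \<open>Let \<open>h = p g\<close> be integral. The value \<open>D\<close> of \<open>local_factor q\<close> is at most that of its constant term, hence less than
  that of \<open>sm\<close>; so \<open>p\<close> also has value \<open>D\<close>, and \<open>g\<close> has value at least \<open>-D\<close>. Therefore \<open>sm g\<close> has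
  positive value and does not contribute to the residue, and \<open>local_factor q g\<close> is \<open>residual_factor\<close> times an integral polynomial,
  whose residue is zero.\<close>

lemma rho_kernel:
  assumes h: "h \<in> Gs 0" "\<epsilon> h = \<zero>\<^bsub>L\<^esub>"
  shows "rho h = \<zero>\<^bsub>K\<^esub>"
proof -
  obtain g where g: "g \<in> carrier FX" "h = p \<otimes>\<^bsub>FX\<^esub> g" using p_ker GsD h by blast
  let ?Q = "local_factor \<otimes>\<^bsub>FX\<^esub> q"
  have Qc: "?Q \<in> carrier FX" using local_factor q by simp
  have "?Q \<noteq> \<zero>\<^bsub>FX\<^esub>" using Q0 by auto
  then obtain D where D: "?Q \<in> Gs D" "?Q \<notin> Gs (D + 1)" using Gs_exact_exists Qc by blast
  have "D \<le> int e * int S"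
  proof -
    have "D \<le> int e * v (coeff ?Q 0)" using Gs_coeff_val[OF D(1) Q0(1)] by simp
    moreover have "int e * v (coeff ?Q 0) \<le> int e * int S" using Q0(2) by (intro mult_left_mono) auto
    ultimately show ?thesis by linarith
  qed
  moreover have "int e * int S + 1 \<le> int e * int N"
  proof -
    have "e * S < e * N" using S_lt_N e_pos by simp
    then have "int (e * S) < int (e * N)" by (simp only: of_nat_less_iff)
    then show ?thesis by simp
  qed
  ultimately have DN: "D + 1 \<le> int e * int N" by linarith
  have smG: "sm \<in> Gs (D + 1)"
  proof (rule GsI[OF sm])
    fix k assume nz: "coeff sm k \<noteq> \<zero>"
    have "int e * int N \<le> int e * v (coeff sm k)"
      using sm_small[of k] nz by (intro mult_left_mono) (auto simp: val_ge_iff)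
    then show "D + 1 \<le> int e * v (coeff sm k) + int (a * k)" using DN by linarith
  qed
  have pG: "p \<in> Gs D" unfolding p_eq using D(1) Gs_mono[OF smG] by (intro Gs_add) auto
  have "?Q = p \<ominus>\<^bsub>FX\<^esub> sm" unfolding p_eq using Qc sm by (simp add: a_minus_def FX.a_assoc FX.r_neg)
  then have pG': "p \<notin> Gs (D + 1)" using D(2) smG Gs_minus by metis
  have gG: "g \<in> Gs (- D)"
    by (rule Gs_cancel[OF pG pG' g(1)]) (use h g in simp)
  have smg: "sm \<otimes>\<^bsub>FX\<^esub> g \<in> Gs 1" using Gs_mult'[OF smG gG] by simp
  let ?X = "mono (\<pi> [^] (a * f)) 0 \<otimes>\<^bsub>FX\<^esub> q \<otimes>\<^bsub>FX\<^esub> g"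
  have mc: "mono (\<pi> [^] (a * f)) 0 \<in> carrier FX" using mono pip by simp
  have Xc: "?X \<in> carrier FX" using mc q g by simp
  have QX: "?Q \<otimes>\<^bsub>FX\<^esub> g = residual_factor \<otimes>\<^bsub>FX\<^esub> ?X" unfolding local_factor_def using mc q g residual_factor by (simp add: FX.m_ac)
  have "?Q \<otimes>\<^bsub>FX\<^esub> g \<in> Gs 0" using Gs_mult'[OF D(1) gG] by simp
  then have XG: "?X \<in> Gs 0" using Gs_cancel[of residual_factor 0 ?X 0] residual_factor residual_factor_not_Gs1 Xc QX by simp
  have "h = (residual_factor \<otimes>\<^bsub>FX\<^esub> ?X) \<oplus>\<^bsub>FX\<^esub> (sm \<otimes>\<^bsub>FX\<^esub> g)"
    unfolding QX[symmetric] g(2) p_eq using Qc sm g by (simp add: FX.l_distr)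
  then have "rho h = (rho residual_factor \<otimes>\<^bsub>K\<^esub> rho ?X) \<oplus>\<^bsub>K\<^esub> rho (sm \<otimes>\<^bsub>FX\<^esub> g)"
    using rho_add rho_mult residual_factor XG Gs_mult'[OF residual_factor(2) XG] Gs_mono[OF smg] by simp
  then show ?thesis using residual_factor(3) rho_closed[OF XG] rho_zero_of_Gs1[OF smg] by simp
qed

lemma eps_nz: "h \<in> Gs 0 \<Longrightarrow> rho h \<noteq> \<zero>\<^bsub>K\<^esub> \<Longrightarrow> \<epsilon> h \<noteq> \<zero>\<^bsub>L\<^esub>"
  using rho_kernel by blast

text \<open>A fraction of images of integral polynomials whose denominator has nonzero residue. The equation is
  multiplied out, which makes the representatives easy to combine.\<close>

definition frac :: "'l \<Rightarrow> 'a list \<Rightarrow> 'a list \<Rightarrow> bool" where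
  "frac x h b \<longleftrightarrow> x \<in> carrier L \<and> h \<in> Gs 0 \<and> b \<in> Gs 0 \<and> rho b \<noteq> \<zero>\<^bsub>K\<^esub> \<and> x \<otimes>\<^bsub>L\<^esub> \<epsilon> b = \<epsilon> h"

definition R :: "'l set" where "R = {x. \<exists>h b. frac x h b}"

definition res :: "'l \<Rightarrow> 'k" where
  "res x = (THE z. \<exists>h b. frac x h b \<and> z = rho h \<otimes>\<^bsub>K\<^esub> inv\<^bsub>K\<^esub> rho b)"

lemma res_eq:
  assumes "frac x h b"
  shows "res x = rho h \<otimes>\<^bsub>K\<^esub> inv\<^bsub>K\<^esub> rho b"
  unfolding res_def
proof (rule the_equality)
  show "\<exists>h' b'. frac x h' b' \<and> rho h \<otimes>\<^bsub>K\<^esub> inv\<^bsub>K\<^esub> rho b = rho h' \<otimes>\<^bsub>K\<^esub> inv\<^bsub>K\<^esub> rho b'"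
    using assms by blast
next
  fix z assume "\<exists>h b. frac x h b \<and> z = rho h \<otimes>\<^bsub>K\<^esub> inv\<^bsub>K\<^esub> rho b"
  then obtain h' b' where h': "frac x h' b'" and z: "z = rho h' \<otimes>\<^bsub>K\<^esub> inv\<^bsub>K\<^esub> rho b'" by blast
  note 1 = assms[unfolded frac_def] h'[unfolded frac_def]
  have cs: "h \<in> carrier FX" "b \<in> carrier FX" "h' \<in> carrier FX" "b' \<in> carrier FX" using 1 GsD by auto
  have G: "h \<otimes>\<^bsub>FX\<^esub> b' \<in> Gs 0" "h' \<otimes>\<^bsub>FX\<^esub> b \<in> Gs 0" using 1 Gs_mult'[of _ 0 _ 0 0] by auto
  have "\<epsilon> h \<otimes>\<^bsub>L\<^esub> \<epsilon> b' = \<epsilon> h' \<otimes>\<^bsub>L\<^esub> \<epsilon> b"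
  proof -
    have x: "x \<in> carrier L" and ex: "\<epsilon> h = x \<otimes>\<^bsub>L\<^esub> \<epsilon> b" "\<epsilon> h' = x \<otimes>\<^bsub>L\<^esub> \<epsilon> b'" using 1 by auto
    show ?thesis unfolding ex using x cs by (simp add: L.m_ac)
  qed
  then have "\<epsilon> ((h \<otimes>\<^bsub>FX\<^esub> b') \<ominus>\<^bsub>FX\<^esub> (h' \<otimes>\<^bsub>FX\<^esub> b)) = \<zero>\<^bsub>L\<^esub>"
    using cs by (simp add: a_minus_def eps_add eps_neg eps_mult L.r_neg)
  then have d: "rho ((h \<otimes>\<^bsub>FX\<^esub> b') \<ominus>\<^bsub>FX\<^esub> (h' \<otimes>\<^bsub>FX\<^esub> b)) = \<zero>\<^bsub>K\<^esub>"
    using rho_kernel Gs_minus[OF G] by blast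
  have "h \<otimes>\<^bsub>FX\<^esub> b' = ((h \<otimes>\<^bsub>FX\<^esub> b') \<ominus>\<^bsub>FX\<^esub> (h' \<otimes>\<^bsub>FX\<^esub> b)) \<oplus>\<^bsub>FX\<^esub> (h' \<otimes>\<^bsub>FX\<^esub> b)"
    using cs by (simp add: a_minus_def FX.a_assoc FX.l_neg)
  then have "rho (h \<otimes>\<^bsub>FX\<^esub> b') = \<zero>\<^bsub>K\<^esub> \<oplus>\<^bsub>K\<^esub> rho (h' \<otimes>\<^bsub>FX\<^esub> b)"
    using rho_add[OF Gs_minus[OF G] G(2)] d by simp
  then have e: "rho h \<otimes>\<^bsub>K\<^esub> rho b' = rho h' \<otimes>\<^bsub>K\<^esub> rho b"
    using rho_mult 1 rho_closed[OF G(2)] by simp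
  note c = rho_closed[of h] rho_closed[of h'] rho_closed[of b] rho_closed[of b']
  note bi = K.field_inv[of "rho b"] K.field_inv[of "rho b'"]
  have "rho h' \<otimes>\<^bsub>K\<^esub> inv\<^bsub>K\<^esub> rho b' = rho h' \<otimes>\<^bsub>K\<^esub> rho b \<otimes>\<^bsub>K\<^esub> inv\<^bsub>K\<^esub> rho b \<otimes>\<^bsub>K\<^esub> inv\<^bsub>K\<^esub> rho b'"
    using 1 c bi by (simp add: K.m_assoc)
  also have "\<dots> = rho h \<otimes>\<^bsub>K\<^esub> inv\<^bsub>K\<^esub> rho b \<otimes>\<^bsub>K\<^esub> (rho b' \<otimes>\<^bsub>K\<^esub> inv\<^bsub>K\<^esub> rho b')"
    unfolding e[symmetric] using 1 c bi(1,5) by (simp add: K.m_ac)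
  also have "\<dots> = rho h \<otimes>\<^bsub>K\<^esub> inv\<^bsub>K\<^esub> rho b" using 1 c bi by simp
  finally show "z = rho h \<otimes>\<^bsub>K\<^esub> inv\<^bsub>K\<^esub> rho b" using z by simp
qed

lemma one_Gs: "\<one>\<^bsub>FX\<^esub> \<in> Gs 0" "rho \<one>\<^bsub>FX\<^esub> = \<one>\<^bsub>K\<^esub>"
  and const_Gs: "c \<in> V \<Longrightarrow> mono c 0 \<in> Gs 0" "c \<in> V \<Longrightarrow> rho (mono c 0) = \<tau> c"
  and u_Gs: "mono (inv (\<pi> [^] a)) e \<in> Gs 0" "rho (mono (inv (\<pi> [^] a)) e) = y"
proof -
  have *: "mono c 0 \<in> Gs 0 \<and> rho (mono c 0) = \<tau> c" if c: "c \<in> V" for c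
  proof -
    have cc: "c \<in> carrier F" using c val_geD by blast
    have "coeff (lift 1 (\<lambda>_. c)) j = coeff (mono c 0) j" for j
      unfolding lift(3)[of 1 "\<lambda>_. c", OF cc] mono(2)[OF cc] using cc e_pos
      by (auto elim!: dvdE)
    then have "lift 1 (\<lambda>_. c) = mono c 0"
      using lift(1)[of 1 "\<lambda>_. c", OF cc] mono(1)[OF cc] FX_eqI by blast
    moreover have "rho (lift 1 (\<lambda>_. c)) = \<tau> c" using lift_Gs(2)[of 1 "\<lambda>_. c"] c tau_closed by (simp add: lessThan_Suc)
    ultimately show ?thesis using lift_Gs(1)[of 1 "\<lambda>_. c"] c by simp
  qed
  from * show "c \<in> V \<Longrightarrow> mono c 0 \<in> Gs 0" "c \<in> V \<Longrightarrow> rho (mono c 0) = \<tau> c" by auto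
  from *[OF val_ge_one] show "\<one>\<^bsub>FX\<^esub> \<in> Gs 0" "rho \<one>\<^bsub>FX\<^esub> = \<one>\<^bsub>K\<^esub>" by (auto simp: mono_one tau_one)
  let ?b = "\<lambda>k::nat. if k = 1 then \<one> else \<zero>"
  have bV: "?b k \<in> V" for k by simp
  have bc: "?b k \<in> carrier F" for k by simp
  have "coeff (lift 2 ?b) j = coeff (mono (inv (\<pi> [^] a)) e) j" for j
  proof -
    have "e dvd j \<and> j < e * 2 \<and> j div e = 1 \<longleftrightarrow> j = e" using e_pos by (auto elim!: dvdE)
    then show ?thesis
      unfolding lift(3)[of 2 ?b, OF bc] mono(2)[OF pinv(1)] using e_pos pinv by auto
  qed
  then have eq: "lift 2 ?b = mono (inv (\<pi> [^] a)) e"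
    using lift(1)[of 2 ?b, OF bc] mono(1)[OF pinv(1)] FX_eqI by blast
  have "rho (lift 2 ?b) = y"
    using lift_Gs(2)[of 2 ?b, OF bV] tau_one y by (simp add: numeral_2_eq_2 lessThan_Suc)
  then show "rho (mono (inv (\<pi> [^] a)) e) = y" "mono (inv (\<pi> [^] a)) e \<in> Gs 0"
    using eq lift_Gs(1)[of 2 ?b, OF bV] by auto
qed

lemma frac_eps: "h \<in> Gs 0 \<Longrightarrow> frac (\<epsilon> h) h \<one>\<^bsub>FX\<^esub>"
  using one_Gs GsD eps_one by (simp add: frac_def)

lemma R_eps: "h \<in> Gs 0 \<Longrightarrow> \<epsilon> h \<in> R" "h \<in> Gs 0 \<Longrightarrow> res (\<epsilon> h) = rho h"
  using frac_eps res_eq[OF frac_eps] one_Gs rho_closed by (auto simp: R_def)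

lemma R_carrier: "x \<in> R \<Longrightarrow> x \<in> carrier L"
  by (auto simp: R_def frac_def)

lemma R_mult_add:
  assumes "x \<in> R" "x' \<in> R"
  shows "x \<otimes>\<^bsub>L\<^esub> x' \<in> R \<and> res (x \<otimes>\<^bsub>L\<^esub> x') = res x \<otimes>\<^bsub>K\<^esub> res x' \<and>
    x \<oplus>\<^bsub>L\<^esub> x' \<in> R \<and> res (x \<oplus>\<^bsub>L\<^esub> x') = res x \<oplus>\<^bsub>K\<^esub> res x'"
proof -
  obtain h b h' b' where f: "frac x h b" "frac x' h' b'" using assms by (auto simp: R_def)
  note 1 = f[unfolded frac_def]
  have cs: "h \<in> carrier FX" "b \<in> carrier FX" "h' \<in> carrier FX" "b' \<in> carrier FX"
    "x \<in> carrier L" "x' \<in> carrier L" using 1 GsD by auto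
  have G: "h \<otimes>\<^bsub>FX\<^esub> b' \<in> Gs 0" "h' \<otimes>\<^bsub>FX\<^esub> b \<in> Gs 0" "h \<otimes>\<^bsub>FX\<^esub> h' \<in> Gs 0" "b \<otimes>\<^bsub>FX\<^esub> b' \<in> Gs 0"
    using 1 Gs_mult'[of _ 0 _ 0 0] by auto
  have c: "rho h \<in> carrier K" "rho h' \<in> carrier K" "rho b \<in> carrier K" "rho b' \<in> carrier K"
    using rho_closed 1 by auto
  note bi = K.field_inv[OF c(3)] K.field_inv[OF c(4)]
  have bb: "rho (b \<otimes>\<^bsub>FX\<^esub> b') = rho b \<otimes>\<^bsub>K\<^esub> rho b'" "rho b \<noteq> \<zero>\<^bsub>K\<^esub>" "rho b' \<noteq> \<zero>\<^bsub>K\<^esub>"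
    using rho_mult 1 by auto
  then have bbi: "inv\<^bsub>K\<^esub> rho (b \<otimes>\<^bsub>FX\<^esub> b') = inv\<^bsub>K\<^esub> rho b \<otimes>\<^bsub>K\<^esub> inv\<^bsub>K\<^esub> rho b'"
    using K.inv_mult c by simp
  have fm: "frac (x \<otimes>\<^bsub>L\<^esub> x') (h \<otimes>\<^bsub>FX\<^esub> h') (b \<otimes>\<^bsub>FX\<^esub> b')"
  proof -
    have "(x \<otimes>\<^bsub>L\<^esub> x') \<otimes>\<^bsub>L\<^esub> (\<epsilon> b \<otimes>\<^bsub>L\<^esub> \<epsilon> b') = (x \<otimes>\<^bsub>L\<^esub> \<epsilon> b) \<otimes>\<^bsub>L\<^esub> (x' \<otimes>\<^bsub>L\<^esub> \<epsilon> b')"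
      using cs by (simp add: L.m_ac)
    then show ?thesis using 1 cs G bb c by (simp add: frac_def eps_mult K.integral_iff)
  qed
  have fa: "frac (x \<oplus>\<^bsub>L\<^esub> x') ((h \<otimes>\<^bsub>FX\<^esub> b') \<oplus>\<^bsub>FX\<^esub> (h' \<otimes>\<^bsub>FX\<^esub> b)) (b \<otimes>\<^bsub>FX\<^esub> b')"
  proof -
    have "(x \<oplus>\<^bsub>L\<^esub> x') \<otimes>\<^bsub>L\<^esub> (\<epsilon> b \<otimes>\<^bsub>L\<^esub> \<epsilon> b') = (x \<otimes>\<^bsub>L\<^esub> \<epsilon> b) \<otimes>\<^bsub>L\<^esub> \<epsilon> b' \<oplus>\<^bsub>L\<^esub> (x' \<otimes>\<^bsub>L\<^esub> \<epsilon> b') \<otimes>\<^bsub>L\<^esub> \<epsilon> b"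
      using cs by (simp add: L.l_distr) (simp add: L.m_ac)
    then show ?thesis
      using 1 cs G bb c Gs_add[OF G(1,2)] by (simp add: frac_def eps_mult eps_add K.integral_iff)
  qed
  have "res (x \<otimes>\<^bsub>L\<^esub> x') = res x \<otimes>\<^bsub>K\<^esub> res x'"
    unfolding res_eq[OF fm] res_eq[OF f(1)] res_eq[OF f(2)] bbi
    using 1 c bi(1,5) bb rho_mult by (simp add: K.m_ac)
  moreover have "res (x \<oplus>\<^bsub>L\<^esub> x') = res x \<oplus>\<^bsub>K\<^esub> res x'"
  proof -
    have "rho ((h \<otimes>\<^bsub>FX\<^esub> b') \<oplus>\<^bsub>FX\<^esub> (h' \<otimes>\<^bsub>FX\<^esub> b)) \<otimes>\<^bsub>K\<^esub> inv\<^bsub>K\<^esub> rho (b \<otimes>\<^bsub>FX\<^esub> b')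
      = (rho h \<otimes>\<^bsub>K\<^esub> inv\<^bsub>K\<^esub> rho b) \<otimes>\<^bsub>K\<^esub> (rho b' \<otimes>\<^bsub>K\<^esub> inv\<^bsub>K\<^esub> rho b') \<oplus>\<^bsub>K\<^esub> (rho h' \<otimes>\<^bsub>K\<^esub> inv\<^bsub>K\<^esub> rho b') \<otimes>\<^bsub>K\<^esub> (rho b \<otimes>\<^bsub>K\<^esub> inv\<^bsub>K\<^esub> rho b)"
    proof -
      have "rho ((h \<otimes>\<^bsub>FX\<^esub> b') \<oplus>\<^bsub>FX\<^esub> (h' \<otimes>\<^bsub>FX\<^esub> b)) = rho h \<otimes>\<^bsub>K\<^esub> rho b' \<oplus>\<^bsub>K\<^esub> rho h' \<otimes>\<^bsub>K\<^esub> rho b"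
        using rho_add[OF G(1,2)] rho_mult 1 by simp
      then show ?thesis unfolding bbi using c bi(1,5) bb by (simp add: K.l_distr) (simp add: K.m_ac)
    qed
    also have "\<dots> = rho h \<otimes>\<^bsub>K\<^esub> inv\<^bsub>K\<^esub> rho b \<oplus>\<^bsub>K\<^esub> rho h' \<otimes>\<^bsub>K\<^esub> inv\<^bsub>K\<^esub> rho b'"
      using c bi bb by simp
    finally show ?thesis unfolding res_eq[OF fa] res_eq[OF f(1)] res_eq[OF f(2)] .
  qed
  ultimately show ?thesis using fm fa by (auto simp: R_def)
qed

lemma R_phi: "c \<in> V \<Longrightarrow> \<phi> c \<in> R" "c \<in> V \<Longrightarrow> res (\<phi> c) = \<tau> c"
  using R_eps const_Gs by (auto simp: \<phi>_def)

lemma R_one: "\<one>\<^bsub>L\<^esub> \<in> R" "res \<one>\<^bsub>L\<^esub> = \<one>\<^bsub>K\<^esub>"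
  using R_eps[OF one_Gs(1)] one_Gs eps_one by auto

lemma R_subring: "subring R L"
proof (rule L.subringI)
  fix x assume x: "x \<in> R"
  have "\<ominus>\<^bsub>FX\<^esub> \<one>\<^bsub>FX\<^esub> \<in> Gs 0" using one_Gs Gs_neg by simp
  then have "\<epsilon> (\<ominus>\<^bsub>FX\<^esub> \<one>\<^bsub>FX\<^esub>) \<otimes>\<^bsub>L\<^esub> x \<in> R" using R_eps R_mult_add x by blast
  then show "\<ominus>\<^bsub>L\<^esub> x \<in> R" using R_carrier[OF x] by (simp add: eps_neg eps_one L.l_minus)
qed (use R_carrier R_one R_mult_add in auto)

lemma res_closed: "x \<in> R \<Longrightarrow> res x \<in> carrier K"
proof -
  assume "x \<in> R"
  then obtain h b where f: "frac x h b" by (auto simp: R_def)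
  then show ?thesis
    unfolding res_eq[OF f] using rho_closed K.field_inv by (simp add: frac_def)
qed

lemma res_hom: "res \<in> ring_hom (L\<lparr>carrier := R\<rparr>) K"
  by (rule ring_hom_memI) (use res_closed R_mult_add R_one in auto)

lemma res_surj: "res ` R = carrier K"
proof
  show "carrier K \<subseteq> res ` R"
  proof
    fix z assume "z \<in> carrier K"
    then obtain h where "h \<in> Gs 0" "rho h = z" by (rule rho_surj)
    then show "z \<in> res ` R" using R_eps by (metis image_eqI)
  qed
qed (use res_closed in auto)

lemma res_zero: "res \<zero>\<^bsub>L\<^esub> = \<zero>\<^bsub>K\<^esub>"
  using R_phi(2)[of \<zero>] by simp

lemma R_unit:
  assumes "x \<in> R" "res x \<noteq> \<zero>\<^bsub>K\<^esub>"
  shows "inv\<^bsub>L\<^esub> x \<in> R"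
proof -
  obtain h b where f: "frac x h b" using assms by (auto simp: R_def)
  note 1 = f[unfolded frac_def]
  have bc: "rho h \<in> carrier K" "rho b \<in> carrier K" using rho_closed 1 by auto
  have h0: "rho h \<noteq> \<zero>\<^bsub>K\<^esub>" using assms(2) res_eq[OF f] K.field_inv bc 1 by auto
  have x: "x \<in> carrier L" "x \<noteq> \<zero>\<^bsub>L\<^esub>" using 1 assms(2) res_zero by auto
  note xi = L.field_inv[OF x]
  have "\<epsilon> b \<in> carrier L" using 1 GsD eps_closed by blast
  then have "inv\<^bsub>L\<^esub> x \<otimes>\<^bsub>L\<^esub> (x \<otimes>\<^bsub>L\<^esub> \<epsilon> b) = \<epsilon> b"
    using L.m_assoc[OF xi(1) x(1)] xi(4) by simp
  then have "frac (inv\<^bsub>L\<^esub> x) b h" using 1 xi h0 by (simp add: frac_def)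
  then show ?thesis by (auto simp: R_def)
qed

lemma R_local: "local_subring L R {x \<in> R. res x = \<zero>\<^bsub>K\<^esub>}"
proof (intro local_subring.intro local_subring_axioms.intro)
  show "field L" by unfold_locales
  show "subring R L" by (rule R_subring)
  show "\<zero>\<^bsub>L\<^esub> \<in> {x \<in> R. res x = \<zero>\<^bsub>K\<^esub>}" using res_zero subringE(2)[OF R_subring] by simp
  show "\<one>\<^bsub>L\<^esub> \<notin> {x \<in> R. res x = \<zero>\<^bsub>K\<^esub>}" using R_one by simp
  show "x \<oplus>\<^bsub>L\<^esub> z \<in> {x \<in> R. res x = \<zero>\<^bsub>K\<^esub>}"
    if "x \<in> {x \<in> R. res x = \<zero>\<^bsub>K\<^esub>}" "z \<in> {x \<in> R. res x = \<zero>\<^bsub>K\<^esub>}" for x z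
    using R_mult_add[of x z] that by simp
  show "x \<otimes>\<^bsub>L\<^esub> z \<in> {x \<in> R. res x = \<zero>\<^bsub>K\<^esub>}"
    if "x \<in> R" "z \<in> {x \<in> R. res x = \<zero>\<^bsub>K\<^esub>}" for x z
    using R_mult_add[of x z] res_closed[of x] that by simp
  show "inv\<^bsub>L\<^esub> x \<in> R" if "x \<in> R" "x \<notin> {x \<in> R. res x = \<zero>\<^bsub>K\<^esub>}" for x
    using R_unit that by simp
qed blast

definition t :: 'l where "t = \<epsilon> (mono (inv (\<pi> [^] l)) 1)"

lemma t_Gs: "mono (inv (\<pi> [^] l)) 1 \<in> Gs 1"
  using pinv[of l] by (simp add: Gs_mono_iff slope_def algebra_simps)

lemma t: "t \<in> R" "res t = \<zero>\<^bsub>K\<^esub>" "t \<in> carrier L"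
proof -
  have G: "mono (inv (\<pi> [^] l)) 1 \<in> Gs 0" by (rule Gs_mono[OF t_Gs]) simp
  show "t \<in> R" "res t = \<zero>\<^bsub>K\<^esub>"
    unfolding t_def using R_eps[OF G] rho_zero_of_Gs1[OF t_Gs] by simp_all
  then show "t \<in> carrier L" using R_carrier by simp
qed

lemma u: "u \<in> R" "res u = y" "res u \<noteq> \<zero>\<^bsub>K\<^esub>" "u \<noteq> \<zero>\<^bsub>L\<^esub>" "inv\<^bsub>L\<^esub> u \<in> R"
proof -
  show 1: "u \<in> R" "res u = y" unfolding u_def using R_eps[OF u_Gs(1)] u_Gs(2) by simp_all
  then show 2: "res u \<noteq> \<zero>\<^bsub>K\<^esub>" using y(2) by simp
  then show "u \<noteq> \<zero>\<^bsub>L\<^esub>" using res_zero by metis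
  show "inv\<^bsub>L\<^esub> u \<in> R" by (rule R_unit[OF 1(1) 2])
qed

text \<open>From \<open>t = X / \<pi>\<^sup>l\<close> and \<open>a = e l + 1\<close>. As \<open>u\<close> is a unit, this is where the ramification index comes from.\<close>

lemma t_pow_e: "t [^]\<^bsub>L\<^esub> e = \<phi> \<pi> \<otimes>\<^bsub>L\<^esub> u"
proof -
  have "inv (\<pi> [^] l) [^] e = inv (\<pi> [^] (l * e))"
    using field_inv_pow(2)[OF pip(1,2), of l e] pi by (simp add: nat_pow_pow)
  moreover have "\<pi> \<otimes> inv (\<pi> [^] a) = inv (\<pi> [^] (l * e))"
  proof -
    have "\<pi> [^] a = \<pi> [^] (l * e) \<otimes> \<pi>" by (simp add: slope_def mult.commute)
    then have "inv (\<pi> [^] a) = inv (\<pi> [^] (l * e)) \<otimes> inv \<pi>" using inv_mult[OF pip(1,2) pi(1,2)] by simp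
    then show ?thesis using pinv(1) pi(1) field_inv(1,3)[OF pi(1,2)] m_lcomm[OF pi(1) pinv(1)] by simp
  qed
  ultimately have "mono (inv (\<pi> [^] l)) 1 [^]\<^bsub>FX\<^esub> e = mono \<pi> 0 \<otimes>\<^bsub>FX\<^esub> mono (inv (\<pi> [^] a)) e"
    using mono_pow[OF pinv(1), of l 1 e] mono_mult[OF pi(1) pinv(1), of 0 a e] by simp
  then show ?thesis
    unfolding t_def \<phi>_def u_def
    using eps_pow[OF mono(1)[OF pinv(1)], of l 1 e] eps_mult[OF mono(1)[OF pi(1)] mono(1)[OF pinv(1)], of 0 a e] by simp
qed

lemma t_nz: "t \<noteq> \<zero>\<^bsub>L\<^esub>"
proof
  assume "t = \<zero>\<^bsub>L\<^esub>"
  then have "\<phi> \<pi> \<otimes>\<^bsub>L\<^esub> u = \<zero>\<^bsub>L\<^esub>" using t_pow_e e_pos L.nat_pow_zero by simp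
  then show False using u phi_nz pi by (simp add: L.integral_iff)
qed

lemma phi_pi_eq: "\<phi> \<pi> = t [^]\<^bsub>L\<^esub> e \<otimes>\<^bsub>L\<^esub> inv\<^bsub>L\<^esub> u"
  unfolding t_pow_e using L.field_inv[OF u_closed u(4)] pi(1) by (simp add: L.m_assoc)

lemma t_inv: "inv\<^bsub>L\<^esub> t \<in> carrier L" "t \<otimes>\<^bsub>L\<^esub> inv\<^bsub>L\<^esub> t = \<one>\<^bsub>L\<^esub>"
  using L.field_inv[OF t(3) t_nz] by auto

lemma R_mult: "x \<in> R \<Longrightarrow> x' \<in> R \<Longrightarrow> x \<otimes>\<^bsub>L\<^esub> x' \<in> R"
  using R_mult_add by blast

lemma R_pow: "x \<in> R \<Longrightarrow> x [^]\<^bsub>L\<^esub> (n::nat) \<in> R"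
  by (induction n) (use R_one R_mult in auto)

lemma phi_pi_tR: "\<phi> \<pi> \<otimes>\<^bsub>L\<^esub> inv\<^bsub>L\<^esub> t \<in> R"
proof -
  obtain e' where e': "e = Suc e'" using e_pos by (cases e) auto
  have "\<phi> \<pi> \<otimes>\<^bsub>L\<^esub> inv\<^bsub>L\<^esub> t = (t [^]\<^bsub>L\<^esub> e' \<otimes>\<^bsub>L\<^esub> inv\<^bsub>L\<^esub> u) \<otimes>\<^bsub>L\<^esub> (t \<otimes>\<^bsub>L\<^esub> inv\<^bsub>L\<^esub> t)"
    unfolding phi_pi_eq using t t_inv(1) R_carrier[OF u(5)] by (simp add: e' L.m_ac)
  then show ?thesis using t_inv t u R_pow R_mult R_carrier[OF u(5)] by simp
qed

text \<open>It suffices to look at monomials. One that contains \<open>X\<close> loses the factor \<open>X / \<pi>\<^sup>l\<close> and with it exactly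
  one unit of Gauss value; a constant of positive value is a multiple of \<open>\<pi>\<close>, hence of \<open>t\<^sup>e\<close>.\<close>

lemma Gs1_tR:
  assumes "h \<in> Gs 1"
  shows "\<epsilon> h \<otimes>\<^bsub>L\<^esub> inv\<^bsub>L\<^esub> t \<in> R"
proof -
  let ?M = "{h \<in> carrier FX. \<epsilon> h \<otimes>\<^bsub>L\<^esub> inv\<^bsub>L\<^esub> t \<in> R}"
  have "h \<in> ?M"
  proof (rule poly_closure[OF GsD[OF assms]])
    show "\<zero>\<^bsub>FX\<^esub> \<in> ?M" using t_inv subringE(2)[OF R_subring] by simp
    show "a \<oplus>\<^bsub>FX\<^esub> b \<in> ?M" if "a \<in> ?M" "b \<in> ?M" for a b
      using that t_inv R_mult_add by (simp add: eps_add L.l_distr)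
    fix k
    have ck: "coeff h k \<in> carrier F" using GsD[OF assms] by simp
    show "mono (coeff h k) k \<in> ?M"
    proof (cases "coeff h k = \<zero>")
      case True
      then show ?thesis using t_inv subringE(2)[OF R_subring] by simp
    next
      case False
      note val = Gs_coeff_val[OF assms False]
      have "\<epsilon> (mono (coeff h k) k) \<otimes>\<^bsub>L\<^esub> inv\<^bsub>L\<^esub> t \<in> R"
      proof (cases k)
        case 0
        define c where "c = coeff h k \<otimes> inv \<pi>"
        note pinv1 = field_inv[OF pi(1,2)]
        have "int e * v (coeff h k) \<ge> 1" using val 0 by simp
        then have "v (coeff h k) \<ge> 1" by (smt (verit) mult_nonneg_nonpos of_nat_0_le_iff)
        then have "v c \<ge> 0" using False ck pi pinv1 by (simp add: c_def v_mult v_inv)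
        then have c: "c \<in> V" using ck pinv1 by (simp add: c_def val_ge_def)
        have "coeff h k = \<pi> \<otimes> c" using ck pi(1) pinv1(1,3) m_lcomm[OF pi(1) ck] by (simp add: c_def)
        then have "\<epsilon> (mono (coeff h k) k) = \<phi> \<pi> \<otimes>\<^bsub>L\<^esub> \<phi> c"
          using 0 phi_mult[OF pi(1) val_geD[OF c]] by (simp add: \<phi>_def)
        then have "\<epsilon> (mono (coeff h k) k) \<otimes>\<^bsub>L\<^esub> inv\<^bsub>L\<^esub> t = \<phi> c \<otimes>\<^bsub>L\<^esub> (\<phi> \<pi> \<otimes>\<^bsub>L\<^esub> inv\<^bsub>L\<^esub> t)"
          using t_inv pi val_geD[OF c] by (simp add: L.m_ac)
        then show ?thesis using phi_pi_tR R_phi(1)[OF c] R_mult by simp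
      next
        case (Suc k')
        define c where "c = coeff h k \<otimes> \<pi> [^] l"
        have c: "c \<in> carrier F" using ck pip by (simp add: c_def)
        have "v c = v (coeff h k) + int l" using False ck pip by (simp add: c_def v_mult)
        then have "int e * v c + int (a * k') \<ge> 0"
          using val Suc by (simp add: slope_def algebra_simps)
        then have G: "mono c k' \<in> Gs 0" using Gs_mono_iff[OF c] by simp
        have "coeff h k = c \<otimes> inv (\<pi> [^] l)" using ck pip pinv by (simp add: c_def m_assoc)
        then have "mono (coeff h k) k = mono c k' \<otimes>\<^bsub>FX\<^esub> mono (inv (\<pi> [^] l)) 1"
          using mono_mult[OF c pinv(1)[of l], of k' 1] Suc by simp
        then have "\<epsilon> (mono (coeff h k) k) = \<epsilon> (mono c k') \<otimes>\<^bsub>L\<^esub> t"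
          unfolding t_def using eps_mult mono(1)[OF c] mono(1)[OF pinv(1)] by simp
        then have "\<epsilon> (mono (coeff h k) k) \<otimes>\<^bsub>L\<^esub> inv\<^bsub>L\<^esub> t = \<epsilon> (mono c k')"
          using t_inv t R_carrier[OF R_eps(1)[OF G]] by (simp add: L.m_assoc)
        then show ?thesis using R_eps(1)[OF G] by simp
      qed
      then show ?thesis using mono ck by simp
    qed
  qed
  then show ?thesis by simp
qed

text \<open>Multiplication by \<open>\<pi>\<^sup>k\<close> makes any polynomial integral, and \<open>\<pi>\<close> is \<open>t\<^sup>e\<close> up to a unit.\<close>

lemma denominators:
  assumes "x \<in> carrier L"
  shows "\<exists>k::nat. x \<otimes>\<^bsub>L\<^esub> t [^]\<^bsub>L\<^esub> k \<in> R"
proof -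
  obtain h where h: "h \<in> carrier FX" "x = \<epsilon> h" using assms eps_surj by auto
  have "\<exists>d. h \<in> Gs d"
    using Gs_exact_exists[OF h(1)] Gs_zero by (cases "h = \<zero>\<^bsub>FX\<^esub>") auto
  then obtain d where d: "h \<in> Gs d" ..
  define k where "k = nat \<bar>d\<bar>"
  have "mono (\<pi> [^] k) 0 \<in> Gs (int e * int k)" using pip by (simp add: Gs_mono_iff)
  moreover have "int k \<le> int e * int k" using e_pos by (simp add: mult_le_cancel_right1)
  ultimately have G: "mono (\<pi> [^] k) 0 \<otimes>\<^bsub>FX\<^esub> h \<in> Gs 0"
    using d by (elim Gs_mult') (auto simp: k_def)
  have "x \<otimes>\<^bsub>L\<^esub> t [^]\<^bsub>L\<^esub> (e * k) = x \<otimes>\<^bsub>L\<^esub> (\<phi> (\<pi> [^] k) \<otimes>\<^bsub>L\<^esub> u [^]\<^bsub>L\<^esub> k)"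
    using t pi phi_pow[OF pi(1)] t_pow_e L.nat_pow_pow[OF t(3), of e k] L.nat_pow_distrib[of "\<phi> \<pi>" u k] by simp
  also have "\<dots> = \<epsilon> (mono (\<pi> [^] k) 0 \<otimes>\<^bsub>FX\<^esub> h) \<otimes>\<^bsub>L\<^esub> u [^]\<^bsub>L\<^esub> k"
    using h mono pip by (simp add: eps_mult \<phi>_def L.m_ac)
  also have "\<dots> \<in> R" using R_eps(1)[OF G] R_pow[OF u(1)] R_mult by simp
  finally show ?thesis by blast
qed

definition W :: "'l \<Rightarrow> int" where "W = dvr_data.w L R K res t"

text \<open>By \<open>rho_zero_imp\<close> and \<open>Gs1_tR\<close>, the kernel of the residue map is generated by \<open>t\<close> once \<open>t\<close> is known to
  divide the image of \<open>residual_factor\<close>. For this the assumption on \<open>q\<close> is used: in \<open>L\<close>, the product of \<open>\<pi>\<^bsup>a f\<^esup>\<close>, of \<open>residual_factor\<close>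
  and of \<open>q\<close> equals the image of \<open>-sm\<close>, which \<open>\<pi>\<^sup>N\<close> divides, while \<open>q\<close> divides \<open>\<pi>\<^bsup>S'\<^esup>\<close>. So already
  \<open>\<pi>\<close> divides the image of \<open>residual_factor\<close>.\<close>

theorem place_exists:
  assumes q_div: "\<exists>x\<in>R. \<epsilon> q \<otimes>\<^bsub>L\<^esub> x = \<phi> (\<pi> [^] S')" and S': "a * f + S' < N"
  shows "discrete_valuation L W" "val_ring L W = R" "\<And>x. x \<in> R \<Longrightarrow> res x = \<zero>\<^bsub>K\<^esub> \<longleftrightarrow> x \<in> val_ge L W 1"
    "W t = 1" "W u = 0" "\<And>c. c \<in> carrier F \<Longrightarrow> c \<noteq> \<zero> \<Longrightarrow> W (\<phi> c) = int e * v c"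
proof -
  have GutR: "\<epsilon> residual_factor \<otimes>\<^bsub>L\<^esub> inv\<^bsub>L\<^esub> t \<in> R"
  proof -
    obtain x where x: "x \<in> R" "\<epsilon> q \<otimes>\<^bsub>L\<^esub> x = \<phi> (\<pi> [^] S')" using q_div by blast
    have xc: "x \<in> carrier L" using R_carrier x by simp
    \<comment> \<open>the small polynomial, divided by \<open>\<pi>\<^sup>N\<close>\<close>
    define sm' where "sm' = mono (inv (\<pi> [^] N)) 0 \<otimes>\<^bsub>FX\<^esub> sm"
    have smc: "sm' \<in> carrier FX" using mono pinv sm by (simp add: sm'_def)
    have "sm' \<in> Gs 0"
    proof (rule GsI[OF smc])
      fix k assume nz: "coeff sm' k \<noteq> \<zero>"
      have c: "coeff sm' k = inv (\<pi> [^] N) \<otimes> coeff sm k"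
        unfolding sm'_def using coeff_mono_mult[OF pinv(1) sm, of N 0 k] by simp
      then have "coeff sm k \<noteq> \<zero>" using nz pinv by auto
      then have "v (coeff sm' k) \<ge> 0" using c sm_small[of k] pinv by (simp add: v_mult val_ge_iff)
      then show "0 \<le> int e * v (coeff sm' k) + int (a * k)" by simp
    qed
    then have sR: "\<epsilon> sm' \<in> R" by (rule R_eps)
    have "mono (\<pi> [^] N) 0 \<otimes>\<^bsub>FX\<^esub> sm' = sm"
      unfolding sm'_def using mono_mult[OF pip(1) pinv(1), of N 0 N 0] mono(1)[OF pip(1)] mono(1)[OF pinv(1)] sm pinv
      by (simp add: FX.m_assoc[symmetric] mono_one)
    then have es: "\<epsilon> sm = \<phi> (\<pi> [^] N) \<otimes>\<^bsub>L\<^esub> \<epsilon> sm'"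
      unfolding \<phi>_def using eps_mult[OF mono(1)[OF pip(1)] smc, of N 0] by simp
    have "\<epsilon> local_factor \<otimes>\<^bsub>L\<^esub> \<epsilon> q \<oplus>\<^bsub>L\<^esub> \<epsilon> sm = \<zero>\<^bsub>L\<^esub>"
      using p(2) unfolding p_eq using local_factor q sm by (simp add: eps_add eps_mult)
    then have "\<epsilon> local_factor \<otimes>\<^bsub>L\<^esub> \<epsilon> q = \<ominus>\<^bsub>L\<^esub> \<epsilon> sm" using local_factor q sm by (simp add: L.minus_equality)
    moreover have "\<epsilon> local_factor = \<phi> (\<pi> [^] (a * f)) \<otimes>\<^bsub>L\<^esub> \<epsilon> residual_factor"
      using mono pip residual_factor by (simp add: local_factor_def eps_mult \<phi>_def)
    ultimately have "\<phi> (\<pi> [^] (a * f)) \<otimes>\<^bsub>L\<^esub> \<epsilon> residual_factor \<otimes>\<^bsub>L\<^esub> \<epsilon> q \<otimes>\<^bsub>L\<^esub> x = \<ominus>\<^bsub>L\<^esub> (\<phi> (\<pi> [^] N) \<otimes>\<^bsub>L\<^esub> \<epsilon> sm') \<otimes>\<^bsub>L\<^esub> x"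
      using es by simp
    also have "\<phi> (\<pi> [^] (a * f)) \<otimes>\<^bsub>L\<^esub> \<epsilon> residual_factor \<otimes>\<^bsub>L\<^esub> \<epsilon> q \<otimes>\<^bsub>L\<^esub> x = \<phi> (\<pi> [^] (a * f)) \<otimes>\<^bsub>L\<^esub> \<phi> (\<pi> [^] S') \<otimes>\<^bsub>L\<^esub> \<epsilon> residual_factor"
      unfolding x(2)[symmetric] using xc q residual_factor pip by (simp add: L.m_ac)
    also have "\<dots> = \<phi> (\<pi> [^] (a * f + S')) \<otimes>\<^bsub>L\<^esub> \<epsilon> residual_factor"
      using pip pi phi_mult[OF pip(1) pip(1), of "a * f" S'] by (simp add: nat_pow_mult)
    finally have eq: "\<phi> (\<pi> [^] (a * f + S')) \<otimes>\<^bsub>L\<^esub> \<epsilon> residual_factor = \<ominus>\<^bsub>L\<^esub> (\<phi> (\<pi> [^] N) \<otimes>\<^bsub>L\<^esub> \<epsilon> sm') \<otimes>\<^bsub>L\<^esub> x" .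
    obtain d where d: "N = (a * f + S') + Suc d" using less_imp_Suc_add[OF S'] by auto
    let ?A = "\<phi> (\<pi> [^] (a * f + S'))"
    let ?z = "\<ominus>\<^bsub>L\<^esub> (\<phi> (\<pi> [^] d) \<otimes>\<^bsub>L\<^esub> \<epsilon> sm' \<otimes>\<^bsub>L\<^esub> x)"
    have A: "?A \<in> carrier L" "?A \<noteq> \<zero>\<^bsub>L\<^esub>" using pip phi_nz by auto
    have zR: "?z \<in> R" using R_mult R_phi(1)[of "\<pi> [^] d"] sR x pip subringE(5)[OF R_subring]
      by (simp add: val_ge_def)
    have "\<phi> (\<pi> [^] N) = ?A \<otimes>\<^bsub>L\<^esub> (\<phi> \<pi> \<otimes>\<^bsub>L\<^esub> \<phi> (\<pi> [^] d))"
      unfolding phi_mult[OF pi(1) pip(1), symmetric] phi_mult[OF pip(1) m_closed[OF pi(1) pip(1)], symmetric] d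
      using pi by (simp add: nat_pow_mult[symmetric] m_ac)
    then have "\<ominus>\<^bsub>L\<^esub> (\<phi> (\<pi> [^] N) \<otimes>\<^bsub>L\<^esub> \<epsilon> sm') \<otimes>\<^bsub>L\<^esub> x = ?A \<otimes>\<^bsub>L\<^esub> (\<phi> \<pi> \<otimes>\<^bsub>L\<^esub> ?z)"
      using A(1) pip pi smc xc by (simp add: L.m_ac L.l_minus L.r_minus)
    then have "\<epsilon> residual_factor = \<phi> \<pi> \<otimes>\<^bsub>L\<^esub> ?z"
      using eq A residual_factor R_carrier[OF zR] pi L.m_lcancel[OF A(2,1), of "\<epsilon> residual_factor" "\<phi> \<pi> \<otimes>\<^bsub>L\<^esub> ?z"] by simp
    then have "\<epsilon> residual_factor \<otimes>\<^bsub>L\<^esub> inv\<^bsub>L\<^esub> t = (\<phi> \<pi> \<otimes>\<^bsub>L\<^esub> inv\<^bsub>L\<^esub> t) \<otimes>\<^bsub>L\<^esub> ?z"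
      using R_carrier[OF zR] pi t_inv by (simp add: L.m_ac)
    then show ?thesis using phi_pi_tR zR R_mult by simp
  qed
  interpret D: dvr_data L R K res t
  proof (intro dvr_data.intro dvr_data_axioms.intro)
    show "field L" "field K" by unfold_locales
    show "subring R L" "res \<in> ring_hom (L\<lparr>carrier := R\<rparr>) K" "t \<in> R" "t \<noteq> \<zero>\<^bsub>L\<^esub>" "res t = \<zero>\<^bsub>K\<^esub>"
      using R_subring res_hom t t_nz by blast+
    show "\<And>x. x \<in> R \<Longrightarrow> res x \<noteq> \<zero>\<^bsub>K\<^esub> \<Longrightarrow> x \<noteq> \<zero>\<^bsub>L\<^esub> \<Longrightarrow> inv\<^bsub>L\<^esub> x \<in> R" by (rule R_unit)
    show "\<And>x. x \<in> carrier L \<Longrightarrow> \<exists>k::nat. x \<otimes>\<^bsub>L\<^esub> t [^]\<^bsub>L\<^esub> k \<in> R" by (rule denominators)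
    fix x assume x: "x \<in> R" "res x = \<zero>\<^bsub>K\<^esub>"
    obtain h b where f: "frac x h b" using x by (auto simp: R_def)
    note 1 = f[unfolded frac_def]
    have bc: "rho h \<in> carrier K" "rho b \<in> carrier K" using rho_closed 1 by auto
    have "rho h = \<zero>\<^bsub>K\<^esub>"
      using x(2) 1 bc K.field_inv[of "rho b"] unfolding res_eq[OF f] by (simp add: K.integral_iff)
    then obtain g r where g: "g \<in> Gs 0" "r \<in> Gs 1" "h = (residual_factor \<otimes>\<^bsub>FX\<^esub> g) \<oplus>\<^bsub>FX\<^esub> r"
      using rho_zero_imp 1 by blast
    have cs: "\<epsilon> g \<in> carrier L" "\<epsilon> r \<in> carrier L" "\<epsilon> residual_factor \<in> carrier L" using g GsD residual_factor by auto
    have "\<epsilon> h \<otimes>\<^bsub>L\<^esub> inv\<^bsub>L\<^esub> t = (\<epsilon> residual_factor \<otimes>\<^bsub>L\<^esub> inv\<^bsub>L\<^esub> t) \<otimes>\<^bsub>L\<^esub> \<epsilon> g \<oplus>\<^bsub>L\<^esub> \<epsilon> r \<otimes>\<^bsub>L\<^esub> inv\<^bsub>L\<^esub> t"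
    proof -
      have "\<epsilon> h = \<epsilon> residual_factor \<otimes>\<^bsub>L\<^esub> \<epsilon> g \<oplus>\<^bsub>L\<^esub> \<epsilon> r"
        using g GsD[OF g(1)] GsD[OF g(2)] residual_factor(1) by (simp add: eps_add eps_mult)
      then show ?thesis using cs t_inv(1) by (simp add: L.l_distr) (simp add: L.m_ac)
    qed
    then have hR: "\<epsilon> h \<otimes>\<^bsub>L\<^esub> inv\<^bsub>L\<^esub> t \<in> R" using R_mult_add[OF R_mult[OF GutR R_eps(1)[OF g(1)]] Gs1_tR[OF g(2)]] by simp
    have bR: "inv\<^bsub>L\<^esub> (\<epsilon> b) \<in> R" using R_unit[of "\<epsilon> b"] R_eps 1 by simp
    have eb: "\<epsilon> b \<in> carrier L" "\<epsilon> b \<noteq> \<zero>\<^bsub>L\<^esub>" using 1 GsD eps_nz by auto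
    note ebi = L.field_inv[OF eb]
    have xc: "x \<in> carrier L" and xe: "\<epsilon> h = x \<otimes>\<^bsub>L\<^esub> \<epsilon> b" using 1 by auto
    have "\<epsilon> h \<otimes>\<^bsub>L\<^esub> inv\<^bsub>L\<^esub> (\<epsilon> b) = x"
      unfolding xe using L.m_assoc[OF xc eb(1) ebi(1)] ebi(3) xc by simp
    then have "x \<otimes>\<^bsub>L\<^esub> inv\<^bsub>L\<^esub> t = (\<epsilon> h \<otimes>\<^bsub>L\<^esub> inv\<^bsub>L\<^esub> (\<epsilon> b)) \<otimes>\<^bsub>L\<^esub> inv\<^bsub>L\<^esub> t" by simp
    also have "\<dots> = (\<epsilon> h \<otimes>\<^bsub>L\<^esub> inv\<^bsub>L\<^esub> t) \<otimes>\<^bsub>L\<^esub> inv\<^bsub>L\<^esub> (\<epsilon> b)"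
      using xc eb(1) t_inv(1) ebi(1) unfolding xe by (simp add: L.m_ac)
    finally have "x \<otimes>\<^bsub>L\<^esub> inv\<^bsub>L\<^esub> t = (\<epsilon> h \<otimes>\<^bsub>L\<^esub> inv\<^bsub>L\<^esub> t) \<otimes>\<^bsub>L\<^esub> inv\<^bsub>L\<^esub> (\<epsilon> b)" .
    then show "x \<otimes>\<^bsub>L\<^esub> inv\<^bsub>L\<^esub> t \<in> R" using hR bR R_mult by simp
  qed
  show "discrete_valuation L W" "val_ring L W = R" "\<And>x. x \<in> R \<Longrightarrow> res x = \<zero>\<^bsub>K\<^esub> \<longleftrightarrow> x \<in> val_ge L W 1"
    and Wt: "W t = 1"
    unfolding W_def using D.discrete D.val_ring_w D.w_ker' D.w_t by auto
  have Wu0: "W x = 0" if "x \<in> R" "res x \<noteq> \<zero>\<^bsub>K\<^esub>" for x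
    unfolding W_def using D.w_U that by (simp add: D.U_def)
  then show Wu: "W u = 0" using u by simp
  interpret DW: dval L W
    by unfold_locales fact
  have Wpi: "W (\<phi> \<pi>) = int e"
  proof -
    have "W (\<phi> \<pi> \<otimes>\<^bsub>L\<^esub> u) = int e" unfolding t_pow_e[symmetric] using DW.v_pow[OF t(3) t_nz] Wt by simp
    then show ?thesis using DW.v_mult[of "\<phi> \<pi>" u] phi_nz pi u Wu by simp
  qed
  have pos: "W (\<phi> c) = int e * v c" if c: "c \<in> carrier F" "c \<noteq> \<zero>" "v c \<ge> 0" for c
  proof -
    obtain n where n: "v c = int n" using c(3) nonneg_int_cases by blast
    define c0 where "c0 = c \<otimes> inv (\<pi> [^] n)"
    have c0: "c0 \<in> carrier F" "c0 \<noteq> \<zero>" "v c0 = 0"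
      using c n pinv by (simp_all add: c0_def integral_iff v_mult)
    then have c0V: "c0 \<in> V" "c0 \<notin> val_ge F v 1" by (auto simp: val_ge_def)
    then have W0: "W (\<phi> c0) = 0" using Wu0[OF R_phi(1)[OF c0V(1)]] R_phi(2)[OF c0V(1)] tau_ker[OF c0V(1)] by simp
    have "c = c0 \<otimes> \<pi> [^] n" using c pip pinv by (simp add: c0_def m_assoc)
    then have "\<phi> c = \<phi> c0 \<otimes>\<^bsub>L\<^esub> \<phi> \<pi> [^]\<^bsub>L\<^esub> n"
      using phi_mult[OF c0(1) pip(1)[of n]] phi_pow[OF pi(1), of n] by simp
    moreover have "W (\<phi> c0 \<otimes>\<^bsub>L\<^esub> \<phi> \<pi> [^]\<^bsub>L\<^esub> n) = W (\<phi> c0) + W (\<phi> \<pi> [^]\<^bsub>L\<^esub> n)"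
      using phi_nz[OF c0(1,2)] phi_nz[OF pi(1,2)] L.field_inv_pow(1) c0 pi(1)
      by (intro DW.v_mult) auto
    ultimately show ?thesis
      using W0 DW.v_pow[OF phi_closed[OF pi(1)] phi_nz[OF pi(1,2)], of n] Wpi n by simp
  qed
  show "W (\<phi> c) = int e * v c" if c: "c \<in> carrier F" "c \<noteq> \<zero>" for c
  proof (cases "v c \<ge> 0")
    case False
    note ci = field_inv[OF c]
    have "W (\<phi> (inv c)) = int e * v (inv c)" using pos[OF ci(1,2)] v_inv[OF c] False by simp
    then show ?thesis using phi_inv[OF c] DW.v_inv[of "\<phi> c"] phi_nz[OF c] c v_inv[OF c] by simp
  qed (use pos c in simp)
qed

end

section \<open>All places of the extension\<close>

lemma valuation_ring_local:
  assumes L: "field L" and W: "valuation_ring L W"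
  shows "local_subring L W (max_ideal L W)"
    and "\<And>x. x \<in> carrier L \<Longrightarrow> x \<notin> W \<Longrightarrow> inv\<^bsub>L\<^esub> x \<in> max_ideal L W"
proof -
  interpret L: field L by fact
  have sr: "subring W L" using W by (simp add: valuation_ring_def)
  have "maximalideal (max_ideal L W) (L\<lparr>carrier := W\<rparr>)"
    using valuation_ring_maximalideal_iff[OF L W] by simp
  then interpret M: maximalideal "max_ideal L W" "L\<lparr>carrier := W\<rparr>" .
  have sub: "max_ideal L W \<subseteq> W" by (auto simp: max_ideal_def)
  have one: "\<one>\<^bsub>L\<^esub> \<notin> max_ideal L W"
    using subringE(3)[OF sr] L.l_one[OF L.one_closed] by (auto simp: max_ideal_def Units_def intro!: bexI[of _ "\<one>\<^bsub>L\<^esub>"])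
  have unit: "inv\<^bsub>L\<^esub> x \<in> W" if xW: "x \<in> W" "x \<notin> max_ideal L W" for x
  proof -
    obtain z where z: "z \<in> W" "x \<otimes>\<^bsub>L\<^esub> z = \<one>\<^bsub>L\<^esub>" using xW unfolding max_ideal_def Units_def by auto
    have "inv\<^bsub>L\<^esub> x = z"
      using L.comm_inv_char[of x z] z xW subringE(1)[OF sr] by auto
    then show ?thesis using z by simp
  qed
  show loc: "local_subring L W (max_ideal L W)"
  proof (intro local_subring.intro local_subring_axioms.intro)
    show "x \<oplus>\<^bsub>L\<^esub> y \<in> max_ideal L W" if "x \<in> max_ideal L W" "y \<in> max_ideal L W" for x y
      using additive_subgroup.a_closed[OF M.additive_subgroup_axioms, of x y] that by simp
    show "x \<otimes>\<^bsub>L\<^esub> y \<in> max_ideal L W" if "x \<in> W" "y \<in> max_ideal L W" for x y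
      using M.I_l_closed[of y x] that by simp
    show "\<zero>\<^bsub>L\<^esub> \<in> max_ideal L W" using additive_subgroup.zero_closed[OF M.additive_subgroup_axioms] by simp
  qed (use L sr sub one unit in auto)
  interpret loc: local_subring L W "max_ideal L W" by (rule loc)
  fix x assume x: "x \<in> carrier L" "x \<notin> W"
  have x0: "x \<noteq> \<zero>\<^bsub>L\<^esub>" using x subringE(2)[OF sr] by auto
  note xi = L.field_inv[OF x(1) x0]
  have "inv\<^bsub>L\<^esub> x \<in> W" using W x x0 by (auto simp: valuation_ring_def)
  moreover have "inv\<^bsub>L\<^esub> (inv\<^bsub>L\<^esub> x) = x" using L.comm_inv_char[OF xi(1) x(1)] xi by simp
  ultimately show "inv\<^bsub>L\<^esub> x \<in> max_ideal L W" using unit[of "inv\<^bsub>L\<^esub> x"] x by auto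
qed

context local_subring
begin

text \<open>The value of \<open>x\<close> ought to be \<open>n' - n\<close> times that of \<open>t\<close>. This is stated for local rings because it is applied to
  the ring \<open>R\<close> of a place before \<open>R\<close> is known to be a valuation ring.\<close>

lemma compare_powers:
  assumes t: "t \<in> M" "t \<noteq> \<zero>" and z: "z \<in> B" "z \<notin> M" "z' \<in> B" "z' \<notin> M"
    and x: "x \<in> carrier L" and eq: "x \<otimes> (t [^] (n::nat) \<otimes> z) = t [^] (n'::nat) \<otimes> z'"
  shows "n < n' \<Longrightarrow> x \<in> M" "n' < n \<Longrightarrow> x \<noteq> \<zero> \<and> inv x \<in> M"
proof -
  have tB: "t \<in> B" using t M_sub by auto
  have tn: "t [^] k \<in> carrier L" "t [^] k \<noteq> \<zero>" for k :: nat
    using field_inv_pow(1)[OF B_carrier[OF tB] t(2)] B_carrier[OF tB] by auto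
  have tM: "t [^] Suc k \<in> M" for k using M_mult[OF B_pow[OF tB] t(1), of k] by simp
  note zc = B_carrier[OF z(1)] B_carrier[OF z(3)]
  note zi = field_inv[OF zc(1) unit_nz[OF z(2)]] field_inv[OF zc(2) unit_nz[OF z(4)]]
  note ziB = unit[OF z(1,2)] unit[OF z(3,4)]
  {
    assume "n < n'"
    then obtain d where d: "n' = n + Suc d" using less_imp_Suc_add by auto
    have "t [^] n \<otimes> (x \<otimes> z) = t [^] n \<otimes> (t [^] Suc d \<otimes> z')"
      using eq x zc tn B_carrier[OF tB] unfolding d by (simp add: nat_pow_mult[symmetric] m_ac)
    then have "x \<otimes> z = t [^] Suc d \<otimes> z'"
      using x zc tn B_carrier[OF tB] m_lcancel[OF tn(2,1)[of n], of "x \<otimes> z" "t [^] Suc d \<otimes> z'"] by simp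
    then have "x \<otimes> z \<otimes> inv z = (z' \<otimes> inv z) \<otimes> t [^] Suc d"
      using zi(1) zc tn(1)[of "Suc d"] by (simp add: m_ac del: nat_pow_Suc)
    moreover have "x \<otimes> z \<otimes> inv z = x" using m_assoc[OF x zc(1) zi(1)] zi(3) x by simp
    ultimately show "x \<in> M" using M_mult[OF _ tM, of "z' \<otimes> inv z" d] z ziB subringE(6)[OF B] by simp
  }
  {
    assume "n' < n"
    then obtain d where d: "n = n' + Suc d" using less_imp_Suc_add by auto
    have "t [^] n' \<otimes> (x \<otimes> (t [^] Suc d \<otimes> z)) = t [^] n' \<otimes> z'"
      using eq x zc tn B_carrier[OF tB] unfolding d by (simp add: nat_pow_mult[symmetric] m_ac)
    then have 1: "x \<otimes> (t [^] Suc d \<otimes> z) = z'"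
      using x zc tn B_carrier[OF tB] m_lcancel[OF tn(2,1)[of n'], of "x \<otimes> (t [^] Suc d \<otimes> z)" z'] by simp
    let ?w = "(z \<otimes> inv z') \<otimes> t [^] Suc d"
    have "x \<otimes> ?w = (x \<otimes> (t [^] Suc d \<otimes> z)) \<otimes> inv z'"
      using x zc zi(5) tn(1)[of "Suc d"] by (simp add: m_ac del: nat_pow_Suc)
    then have "x \<otimes> ?w = z' \<otimes> inv z'" unfolding 1 .
    then have xw: "x \<otimes> ?w = \<one>" using zi by simp
    have wM: "?w \<in> M" using M_mult[OF _ tM, of "z \<otimes> inv z'" d] z ziB subringE(6)[OF B] by simp
    have "inv x = ?w" by (rule comm_inv_char[OF x M_carrier[OF wM] xw])
    moreover have "x \<noteq> \<zero>" using xw M_carrier[OF wM] by auto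
    ultimately show "x \<noteq> \<zero> \<and> inv x \<in> M" using wM by simp
  }
qed

end

context place
begin

interpretation FX: domain FX
  by (rule FX_domain)

text \<open>In a valuation ring membership can be tested on powers. The \<open>e\<close>-th power of a monomial \<open>c X\<^sup>k\<close> of
  nonnegative value is \<open>u\<^sup>k\<close> times a constant in the valuation ring of \<open>v\<close>; thus the images of integral
  polynomials lie in \<open>B\<close>, those of polynomials of positive value in \<open>M\<close>, and, since \<open>residual_factor\<close> goes to \<open>M\<close>, so do those of
  residue zero. It follows that polynomials of nonzero residue become units of \<open>B\<close>.\<close>

lemma R_below_valuation_ring:
  assumes loc: "local_subring L B M" and val: "\<And>x. x \<in> carrier L \<Longrightarrow> x \<notin> B \<Longrightarrow> inv\<^bsub>L\<^esub> x \<in> M"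
    and VB: "\<And>c. c \<in> V \<Longrightarrow> \<phi> c \<in> B" and NM: "\<And>c. c \<in> val_ge F v 1 \<Longrightarrow> \<phi> c \<in> M"
    and uB: "u \<in> B" and GuM: "\<epsilon> residual_factor \<in> M"
  shows "R \<subseteq> B"
proof
  interpret loc: local_subring L B M by (rule loc)
  have power: "(z \<in> B \<longleftrightarrow> z [^]\<^bsub>L\<^esub> e \<in> B) \<and> (z \<in> B \<longrightarrow> z \<in> M \<longleftrightarrow> z [^]\<^bsub>L\<^esub> e \<in> M)"
    if z: "z \<in> carrier L" for z
  proof -
    obtain e' where e': "e = Suc e'" using e_pos by (cases e) auto
    have MM: "z [^]\<^bsub>L\<^esub> e \<in> M" if "z \<in> M" for z
      using loc.M_mult[OF loc.B_pow, of z z e'] that loc.M_sub by (auto simp: e')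
    have "z \<in> B" if zB: "z [^]\<^bsub>L\<^esub> e \<in> B"
    proof (rule ccontr)
      assume nz: "z \<notin> B"
      then have z0: "z \<noteq> \<zero>\<^bsub>L\<^esub>" using subringE(2)[OF loc.B] by auto
      have "inv\<^bsub>L\<^esub> z [^]\<^bsub>L\<^esub> e \<in> M" using MM val[OF z nz] by simp
      then have "z [^]\<^bsub>L\<^esub> e \<otimes>\<^bsub>L\<^esub> inv\<^bsub>L\<^esub> z [^]\<^bsub>L\<^esub> e \<in> M" using loc.M_mult zB by simp
      then show False
        using L.nat_pow_distrib[of z "inv\<^bsub>L\<^esub> z" e] L.field_inv[OF z z0] z loc.M_one L.nat_pow_one by simp
    qed
    moreover have "z \<in> M" if "z \<in> B" "z [^]\<^bsub>L\<^esub> e \<in> M"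
    proof (rule ccontr)
      assume nM: "z \<notin> M"
      have "z [^]\<^bsub>L\<^esub> k \<notin> M" for k :: nat
        by (induction k) (use loc.M_one loc.not_M_mult loc.B_pow \<open>z \<in> B\<close> nM in auto)
      then show False using that by blast
    qed
    ultimately show ?thesis using loc.B_pow[of z e] MM by blast
  qed
  have mono_in: "(d = 0 \<longrightarrow> \<epsilon> (mono c k) \<in> B) \<and> (d = 1 \<longrightarrow> \<epsilon> (mono c k) \<in> M)"
    if c: "c \<in> carrier F" and G: "mono c k \<in> Gs d" and d: "d = 0 \<or> d = 1" for c k d
  proof (cases "c = \<zero>")
    case True
    then show ?thesis using loc.M_zero loc.M_sub by auto
  next
    case False
    have val: "int e * v c + int (a * k) \<ge> d" using G False c by (simp add: Gs_mono_iff)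
    define c' where "c' = c [^] e \<otimes> \<pi> [^] (a * k)"
    have ce: "c [^] e \<in> carrier F" "c [^] e \<noteq> \<zero>" using c False field_inv_pow by auto
    have c': "c' \<in> val_ge F v d"
      unfolding c'_def using ce pip v_pow[OF c False, of e] val by (simp add: val_ge_def v_mult)
    have cd: "c [^] e = c' \<otimes> inv (\<pi> [^] (a * k))" unfolding c'_def using ce pip pinv by (simp add: m_assoc)
    have mc: "mono c k \<in> carrier FX" using c mono by simp
    have "\<epsilon> (mono c k) [^]\<^bsub>L\<^esub> e = \<epsilon> (mono (c [^] e) (e * k))"
      using eps_pow[OF mc, of e] mono_pow[OF c, of k e] by (simp add: mult.commute)
    also have "\<dots> = u [^]\<^bsub>L\<^esub> k \<otimes>\<^bsub>L\<^esub> \<phi> c'"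
      unfolding cd using eps_mono_u[OF val_geD[OF c'], of k] val_geD[OF c'] by (simp add: L.m_comm)
    finally have eq: "\<epsilon> (mono c k) [^]\<^bsub>L\<^esub> e = u [^]\<^bsub>L\<^esub> k \<otimes>\<^bsub>L\<^esub> \<phi> c'" .
    note pw = power[OF eps_closed[OF mc]]
    have B1: "\<epsilon> (mono c k) [^]\<^bsub>L\<^esub> e \<in> B"
      unfolding eq using loc.B_pow[OF uB] VB[OF val_ge_mono[OF c']] d subringE(6)[OF loc.B] by auto
    moreover have "\<epsilon> (mono c k) [^]\<^bsub>L\<^esub> e \<in> M" if "d = 1"
      unfolding eq using loc.B_pow[OF uB] NM[of c'] c' that loc.M_mult by simp
    ultimately show ?thesis using pw by blast
  qed
  have G0: "\<epsilon> h \<in> B" if "h \<in> Gs 0" for h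
  proof -
    have "h \<in> {h \<in> carrier FX. \<epsilon> h \<in> B}"
    proof (rule poly_closure[OF GsD[OF that]])
      fix k
      have c: "coeff h k \<in> carrier F" using GsD[OF that] by simp
      have "mono (coeff h k) k \<in> Gs 0" using Gs_coeff_val[OF that] c by (auto simp: Gs_mono_iff)
      then show "mono (coeff h k) k \<in> {h \<in> carrier FX. \<epsilon> h \<in> B}" using mono_in[OF c] GsD by blast
    qed (use subringE[OF loc.B] in \<open>auto simp: eps_add\<close>)
    then show ?thesis by simp
  qed
  have G1: "\<epsilon> h \<in> M" if "h \<in> Gs 1" for h
  proof -
    have "h \<in> {h \<in> carrier FX. \<epsilon> h \<in> M}"
    proof (rule poly_closure[OF GsD[OF that]])
      fix k
      have c: "coeff h k \<in> carrier F" using GsD[OF that] by simp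
      have "mono (coeff h k) k \<in> Gs 1" using Gs_coeff_val[OF that] c by (auto simp: Gs_mono_iff)
      then show "mono (coeff h k) k \<in> {h \<in> carrier FX. \<epsilon> h \<in> M}" using mono_in[OF c] GsD by blast
    qed (use loc.M_add loc.M_zero in \<open>auto simp: eps_add\<close>)
    then show ?thesis by simp
  qed
  have rho0: "\<epsilon> h \<in> M" if h0: "h \<in> Gs 0" "rho h = \<zero>\<^bsub>K\<^esub>" for h
  proof -
    obtain g r where g: "g \<in> Gs 0" "r \<in> Gs 1" "h = (residual_factor \<otimes>\<^bsub>FX\<^esub> g) \<oplus>\<^bsub>FX\<^esub> r"
      by (rule rho_zero_imp[OF h0]) blast
    have "\<epsilon> h = \<epsilon> g \<otimes>\<^bsub>L\<^esub> \<epsilon> residual_factor \<oplus>\<^bsub>L\<^esub> \<epsilon> r"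
      using g GsD[OF g(1)] GsD[OF g(2)] residual_factor(1) by (simp add: eps_add eps_mult L.m_comm)
    then show ?thesis using loc.M_add[OF loc.M_mult[OF G0[OF g(1)] GuM] G1[OF g(2)]] by simp
  qed
  fix x assume "x \<in> R"
  then obtain h b where f: "frac x h b" by (auto simp: R_def)
  note 1 = f[unfolded frac_def]
  have bG: "b \<in> Gs 0" "rho b \<noteq> \<zero>\<^bsub>K\<^esub>" and hG: "h \<in> Gs 0" using 1 by auto
  have "\<epsilon> b \<notin> M"
  proof
    assume bM: "\<epsilon> b \<in> M"
    note ri = K.field_inv[OF rho_closed[OF bG(1)] bG(2)]
    obtain b' where b': "b' \<in> Gs 0" "rho b' = inv\<^bsub>K\<^esub> rho b" by (rule rho_surj[OF ri(1)])
    have bb: "b' \<otimes>\<^bsub>FX\<^esub> b \<in> Gs 0" using Gs_mult'[OF b'(1) bG(1)] by simp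
    have "rho (b' \<otimes>\<^bsub>FX\<^esub> b) = \<one>\<^bsub>K\<^esub>" using rho_mult[OF b'(1) bG(1)] b' ri by simp
    let ?h = "\<one>\<^bsub>FX\<^esub> \<ominus>\<^bsub>FX\<^esub> (b' \<otimes>\<^bsub>FX\<^esub> b)"
    have hh: "?h \<in> Gs 0" using Gs_minus one_Gs bb by blast
    have eq: "\<one>\<^bsub>FX\<^esub> = ?h \<oplus>\<^bsub>FX\<^esub> (b' \<otimes>\<^bsub>FX\<^esub> b)"
      using GsD[OF bb] by (simp add: a_minus_def FX.a_assoc FX.l_neg)
    have "rho \<one>\<^bsub>FX\<^esub> = rho ?h \<oplus>\<^bsub>K\<^esub> rho (b' \<otimes>\<^bsub>FX\<^esub> b)"
      using rho_add[OF hh bb] eq by simp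
    then have "\<one>\<^bsub>K\<^esub> = rho ?h \<oplus>\<^bsub>K\<^esub> \<one>\<^bsub>K\<^esub>" using one_Gs \<open>rho (b' \<otimes>\<^bsub>FX\<^esub> b) = \<one>\<^bsub>K\<^esub>\<close> by simp
    then have "rho ?h = \<zero>\<^bsub>K\<^esub>"
      using K.add.l_cancel_one[of "\<one>\<^bsub>K\<^esub>" "rho ?h"] rho_closed[OF hh] K.a_comm by simp
    then have "\<epsilon> ?h \<in> M" using rho0 hh by blast
    moreover have "\<epsilon> (b' \<otimes>\<^bsub>FX\<^esub> b) \<in> M"
      using eps_mult[OF GsD[OF b'(1)] GsD[OF bG(1)]] loc.M_mult[OF G0[OF b'(1)] bM] by simp
    ultimately have "\<epsilon> \<one>\<^bsub>FX\<^esub> \<in> M"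
      using eps_add[OF GsD[OF hh] GsD[OF bb]] loc.M_add eq by metis
    then show False using eps_one loc.M_one by simp
  qed
  then have bi: "inv\<^bsub>L\<^esub> (\<epsilon> b) \<in> B" using loc.unit G0[OF bG(1)] by blast
  have xc: "x \<in> carrier L" and xe: "\<epsilon> h = x \<otimes>\<^bsub>L\<^esub> \<epsilon> b" using 1 by auto
  have eb: "\<epsilon> b \<in> carrier L" "\<epsilon> b \<noteq> \<zero>\<^bsub>L\<^esub>" using GsD[OF bG(1)] eps_nz[OF bG] by auto
  have "\<epsilon> h \<otimes>\<^bsub>L\<^esub> inv\<^bsub>L\<^esub> (\<epsilon> b) = x"
    unfolding xe using L.m_assoc[OF xc eb(1)] L.field_inv[OF eb] xc by simp
  then show "x \<in> B" using G0[OF hG] bi subringE(6)[OF loc.B] by metis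
qed

end

section \<open>The polynomial for all places of one valuation\<close>

text \<open>The data of all places over \<open>v\<close>. The \<open>j\<close>-th place gets the slope \<open>(e\<^sub>j j + 1) / e\<^sub>j = j + 1/e\<^sub>j\<close>. These
  slopes are distinct, since \<open>j + 1/e\<^sub>j\<close> lies in the half-open interval from \<open>j\<close> (excluded) to \<open>j + 1\<close>.\<close>

locale family = dval F v for F :: "'a ring" (structure) and v +
  fixes \<pi> :: 'a and s :: nat and e f :: "nat \<Rightarrow> nat" and K :: "nat \<Rightarrow> 'k ring" and \<tau> :: "nat \<Rightarrow> 'a \<Rightarrow> 'k" and y :: "nat \<Rightarrow> 'k"
  assumes res: "\<And>j. j < s \<Longrightarrow> residual F v (e j) \<pi> (K j) (\<tau> j) (y j) (f j)"
begin

interpretation FX: domain FX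
  by (rule FX_domain)

definition P :: "nat \<Rightarrow> 'a list" where "P j = residual.local_factor F v (e j) j \<pi> (K j) (\<tau> j) (y j) (f j)"

text \<open>The value of the constant term of \<open>P j\<close>.\<close>

definition A :: "nat \<Rightarrow> nat" where "A j = (e j * j + 1) * f j"

definition monic_const_value :: "nat \<Rightarrow> nat \<Rightarrow> 'a list \<Rightarrow> bool" where
  "monic_const_value d c h \<longleftrightarrow> h \<in> carrier FX \<and> coeff h d = \<one> \<and> (\<forall>k>d. coeff h k = \<zero>) \<and>
     (\<forall>k. coeff h k \<in> val_ring F v) \<and> coeff h 0 \<noteq> \<zero> \<and> v (coeff h 0) = int c"

lemma mon_P: "j < s \<Longrightarrow> monic_const_value (e j * f j) (A j) (P j)"
proof -
  assume "j < s"
  then interpret residual F v "e j" j \<pi> "K j" "\<tau> j" "y j" "f j" by (rule res)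
  show ?thesis unfolding monic_const_value_def P_def A_def using local_factor by (simp add: slope_def)
qed

lemma mon_length: "monic_const_value d c h \<Longrightarrow> length h = Suc d"
  using FX_monicI[of h d] by (auto simp: monic_const_value_def)

lemma mon_mult:
  assumes h: "monic_const_value d c h" and h': "monic_const_value d' c' h'"
  shows "monic_const_value (d + d') (c + c') (h \<otimes>\<^bsub>FX\<^esub> h')"
proof -
  have hc: "h \<in> carrier FX" "h' \<in> carrier FX" using assms by (auto simp: monic_const_value_def)
  have pol: "polynomial (carrier F) h" "polynomial (carrier F) h'" using hc by (simp_all add: univ_poly_carrier)
  have ne: "h \<noteq> []" "h' \<noteq> []" using mon_length[OF h] mon_length[OF h'] by auto
  let ?p = "h \<otimes>\<^bsub>FX\<^esub> h'"
  have pc: "?p \<in> carrier FX" using hc by simp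
  have hd: "hd h = \<one>" "hd h' = \<one>"
    using h h' lead_coeff_simp[OF ne(1)] lead_coeff_simp[OF ne(2)] mon_length[OF h] mon_length[OF h']
    by (auto simp: monic_const_value_def)
  have len: "length ?p - 1 = d + d'"
    using poly_mult_degree_eq[OF carrier_is_subring pol] ne mon_length[OF h] mon_length[OF h']
    by (simp add: univ_poly_mult del: poly_mult.simps)
  have "?p \<noteq> \<zero>\<^bsub>FX\<^esub>" using FX.integral[of h h'] hc ne by (auto simp: FX_zero)
  then have pne: "?p \<noteq> []" by (simp add: FX_zero)
  have "hd ?p = \<one>"
    using poly_mult_lead_coeff[OF carrier_is_subring pol ne] hd by (simp add: univ_poly_mult del: poly_mult.simps)
  then have lead: "coeff ?p (d + d') = \<one>" using lead_coeff_simp[OF pne] len by simp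
  have zero: "coeff ?p k = \<zero>" if "k > d + d'" for k
    using coeff_length[of ?p k] len that by simp
  have V: "coeff ?p k \<in> val_ring F v" for k
    unfolding coeff_FX_mult[OF hc] using h h' by (intro val_ge_finsum val_ge_mult') (auto simp: monic_const_value_def)
  have "coeff ?p 0 = coeff h 0 \<otimes> coeff h' 0" unfolding coeff_FX_mult[OF hc] using hc by simp
  then have "coeff ?p 0 \<noteq> \<zero>" "v (coeff ?p 0) = int (c + c')"
    using h h' by (auto simp: monic_const_value_def integral_iff v_mult)
  then show ?thesis using pc lead zero V by (simp add: monic_const_value_def)
qed

lemma mon_one: "monic_const_value 0 0 \<one>\<^bsub>FX\<^esub>"
  using mono[of \<one> 0] v_one by (auto simp: monic_const_value_def mono_one)

definition Qs :: "nat set \<Rightarrow> 'a list" where "Qs J = finprod FX P J"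

lemma mon_Qs:
  assumes "J \<subseteq> {..<s}"
  shows "monic_const_value (\<Sum>j\<in>J. e j * f j) (\<Sum>j\<in>J. A j) (Qs J)"
proof -
  have "finite J" using assms finite_subset by blast
  then show ?thesis using assms
  proof (induction J rule: finite_induct)
    case (insert j J)
    have Pc: "P \<in> J \<rightarrow> carrier FX" "P j \<in> carrier FX" using insert.prems mon_P by (auto simp: monic_const_value_def)
    have "Qs (insert j J) = P j \<otimes>\<^bsub>FX\<^esub> Qs J" unfolding Qs_def using insert Pc by (simp add: FX.finprod_insert)
    then show ?case using insert mon_mult[OF mon_P[of j]] by simp
  qed (simp add: Qs_def mon_one)
qed

lemma Qs_split: "j < s \<Longrightarrow> Qs {..<s} = P j \<otimes>\<^bsub>FX\<^esub> Qs ({..<s} - {j})"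
proof -
  assume j: "j < s"
  have "P \<in> {..<s} - {j} \<rightarrow> carrier FX" "P j \<in> carrier FX" using j mon_P by (auto simp: monic_const_value_def)
  moreover have "insert j ({..<s} - {j}) = {..<s}" using j by auto
  ultimately show ?thesis unfolding Qs_def using FX.finprod_insert[of "{..<s} - {j}" j P] by simp
qed

definition S :: nat where "S = (\<Sum>j<s. A j)"

end

locale family_ext = family F v \<pi> s e f K \<tau> y + L: field L
  for F :: "'a ring" (structure) and v \<pi> s e f and K :: "nat \<Rightarrow> 'k ring" and \<tau> y and L :: "'l ring" +
  fixes \<epsilon> :: "'a list \<Rightarrow> 'l" and p :: "'a list" and N :: nat
  assumes eps: "\<epsilon> \<in> ring_hom ((carrier F)[X]) L"
    and eps_surj: "\<epsilon> ` carrier ((carrier F)[X]) = carrier L"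
    and p: "p \<in> carrier ((carrier F)[X])" "\<epsilon> p = \<zero>\<^bsub>L\<^esub>"
    and p_ker: "\<And>h. h \<in> carrier ((carrier F)[X]) \<Longrightarrow> \<epsilon> h = \<zero>\<^bsub>L\<^esub> \<Longrightarrow>
        \<exists>g\<in>carrier ((carrier F)[X]). h = p \<otimes>\<^bsub>(carrier F)[X]\<^esub> g"
    and p_close: "\<And>k. coeff p k \<ominus> coeff (Qs {..<s}) k \<in> val_ge F v (int N)"
    and p_monic: "length p = Suc (\<Sum>j<s. e j * f j)" "coeff p (\<Sum>j<s. e j * f j) = \<one>"
    and S_lt_N: "S < N" and s_pos: "s > 0"
begin

interpretation FX: domain FX
  by (rule FX_domain)

lemma place: "j < s \<Longrightarrow> place F v (e j) j \<pi> (K j) (\<tau> j) (y j) (f j) L \<epsilon> p (Qs ({..<s} - {j})) (p \<ominus>\<^bsub>FX\<^esub> Qs {..<s}) S N"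
proof -
  assume j: "j < s"
  interpret residual F v "e j" j \<pi> "K j" "\<tau> j" "y j" "f j" by (rule res[OF j])
  have Q: "monic_const_value (\<Sum>j<s. e j * f j) S (Qs {..<s})" using mon_Qs[of "{..<s}"] by (simp add: S_def)
  have Q': "Qs ({..<s} - {j}) \<in> carrier FX" using mon_Qs[of "{..<s} - {j}"] by (auto simp: monic_const_value_def)
  have Qeq: "local_factor \<otimes>\<^bsub>FX\<^esub> Qs ({..<s} - {j}) = Qs {..<s}" using Qs_split[OF j] by (simp add: P_def)
  have Qc: "Qs {..<s} \<in> carrier FX" using Q by (simp add: monic_const_value_def)
  show ?thesis
  proof (intro place.intro residual_ext.intro residual_ext_axioms.intro place_axioms.intro)
    show "residual F v (e j) \<pi> (K j) (\<tau> j) (y j) (f j)" by (rule res[OF j])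
    show "field L" by unfold_locales
    show "p = (local_factor \<otimes>\<^bsub>FX\<^esub> Qs ({..<s} - {j})) \<oplus>\<^bsub>FX\<^esub> (p \<ominus>\<^bsub>FX\<^esub> Qs {..<s})"
      unfolding Qeq using p Qc by (simp add: a_minus_def FX.a_lcomm FX.r_neg)
    show "coeff (p \<ominus>\<^bsub>FX\<^esub> Qs {..<s}) k \<in> val_ge F v (int N)" for k
      using p_close[of k] p Qc by simp
    show "coeff (local_factor \<otimes>\<^bsub>FX\<^esub> Qs ({..<s} - {j})) 0 \<noteq> \<zero>"
      "v (coeff (local_factor \<otimes>\<^bsub>FX\<^esub> Qs ({..<s} - {j})) 0) \<le> int S"
      unfolding Qeq using Q by (auto simp: monic_const_value_def)
    show "Qs ({..<s} - {j}) \<in> carrier FX" "p \<ominus>\<^bsub>FX\<^esub> Qs {..<s} \<in> carrier FX" using Q' Qc p by auto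
  qed (use eps eps_surj p p_ker S_lt_N in auto)
qed

abbreviation "RR j \<equiv> place.R F v (e j) j \<pi> (K j) (\<tau> j) (y j) L \<epsilon>"
abbreviation "rr j \<equiv> place.res F v (e j) j \<pi> (K j) (\<tau> j) (y j) L \<epsilon>"
abbreviation "WW j \<equiv> place.W F v (e j) j \<pi> (K j) (\<tau> j) (y j) L \<epsilon>"
abbreviation "uu j \<equiv> residual_ext.u F (e j) j \<pi> \<epsilon>"
abbreviation "tt j \<equiv> place.t F j \<pi> \<epsilon>"
abbreviation "ph \<equiv> residual_ext.\<phi> F \<epsilon>"
abbreviation "MM j \<equiv> {x \<in> RR j. rr j x = \<zero>\<^bsub>K j\<^esub>}"

text \<open>At the \<open>j\<close>-th place the normalized generator \<open>u\<^sub>k\<close> is not a unit: up to units it is the power of \<open>t\<^sub>j\<close> with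
  exponent \<open>(e\<^sub>k + e\<^sub>j j e\<^sub>k) - e\<^sub>j (e\<^sub>k k + 1)\<close>, and this is not zero because the slopes differ.\<close>

lemma slopes_differ:
  assumes j: "j < s" and k: "k < s" and jk: "j \<noteq> k"
  shows "uu k \<in> MM j \<or> (uu k \<noteq> \<zero>\<^bsub>L\<^esub> \<and> inv\<^bsub>L\<^esub> uu k \<in> MM j)"
proof -
  interpret J: place F v "e j" j \<pi> "K j" "\<tau> j" "y j" "f j" L \<epsilon> p "Qs ({..<s} - {j})" "p \<ominus>\<^bsub>FX\<^esub> Qs {..<s}" S N
    by (rule place[OF j])
  interpret k: place F v "e k" k \<pi> "K k" "\<tau> k" "y k" "f k" L \<epsilon> p "Qs ({..<s} - {k})" "p \<ominus>\<^bsub>FX\<^esub> Qs {..<s}" S N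
    by (rule place[OF k])
  interpret loc: local_subring L J.R "MM j" by (rule J.R_local)
  define \<theta> where "\<theta> = \<epsilon> (mono \<one> 1)"
  have m1: "mono \<one> 1 \<in> carrier FX" using mono by simp
  have th: "\<theta> \<in> carrier L" unfolding \<theta>_def using J.eps_closed m1 by simp
  let ?q = "ph \<pi>"
  have q: "?q \<in> carrier L" "?q \<noteq> \<zero>\<^bsub>L\<^esub>" using J.pi J.phi_nz by auto
  have qn: "ph (\<pi> [^] n) = ?q [^]\<^bsub>L\<^esub> n" for n :: nat using J.phi_pow[OF J.pi(1)] .
  have scaled: "\<epsilon> (mono (inv (\<pi> [^] n)) i) \<otimes>\<^bsub>L\<^esub> ?q [^]\<^bsub>L\<^esub> n = \<theta> [^]\<^bsub>L\<^esub> i" for n i :: nat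
  proof -
    have "mono (inv (\<pi> [^] n)) i \<otimes>\<^bsub>FX\<^esub> mono (\<pi> [^] n) 0 = mono \<one> 1 [^]\<^bsub>FX\<^esub> i"
      using mono_mult[OF J.pinv(1) J.pip(1), of n i n 0] mono_pow[OF one_closed, of 1 i] J.pinv by simp
    then have "\<epsilon> (mono (inv (\<pi> [^] n)) i) \<otimes>\<^bsub>L\<^esub> ph (\<pi> [^] n) = \<theta> [^]\<^bsub>L\<^esub> i"
      unfolding \<theta>_def J.\<phi>_def using J.eps_mult[OF mono(1)[OF J.pinv(1)] mono(1)[OF J.pip(1)], of n i n 0] J.eps_pow[OF m1, of i]
      by simp
    then show ?thesis unfolding qn .
  qed
  have uk: "uu k \<otimes>\<^bsub>L\<^esub> ?q [^]\<^bsub>L\<^esub> (e k * k + 1) = \<theta> [^]\<^bsub>L\<^esub> e k"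
    unfolding k.u_def k.slope_def by (rule scaled)
  have tj: "tt j \<otimes>\<^bsub>L\<^esub> ?q [^]\<^bsub>L\<^esub> j = \<theta>" unfolding J.t_def using scaled[of j 1] th by simp
  have ukc: "uu k \<in> carrier L" by simp
  have tjc: "tt j \<in> carrier L" by (rule J.t(3))
  have tM: "tt j \<in> MM j" "tt j \<noteq> \<zero>\<^bsub>L\<^esub>" using J.t J.t_nz by auto
  let ?w = "inv\<^bsub>L\<^esub> uu j"
  have qw: "?q = tt j [^]\<^bsub>L\<^esub> e j \<otimes>\<^bsub>L\<^esub> ?w" by (rule J.phi_pi_eq)
  have w: "?w \<in> J.R" "?w \<notin> MM j"
  proof -
    show "?w \<in> J.R" by (rule J.u(5))
    then show "?w \<notin> MM j"
      using loc.not_M_if_inv[of ?w "uu j"] J.u(1) L.field_inv[OF J.u_closed J.u(4)] by blast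
  qed
  have wc: "?w \<in> carrier L" using w J.R_carrier by blast
  have qp: "?q [^]\<^bsub>L\<^esub> n = tt j [^]\<^bsub>L\<^esub> (e j * n) \<otimes>\<^bsub>L\<^esub> ?w [^]\<^bsub>L\<^esub> n" for n :: nat
    unfolding qw using tjc wc by (simp add: L.nat_pow_distrib L.nat_pow_pow)
  have wp: "?w [^]\<^bsub>L\<^esub> n \<in> J.R" "?w [^]\<^bsub>L\<^esub> n \<notin> MM j" for n :: nat
  proof -
    show "?w [^]\<^bsub>L\<^esub> n \<in> J.R" using loc.B_pow w by simp
    show "?w [^]\<^bsub>L\<^esub> n \<notin> MM j"
      by (induction n) (use loc.M_one loc.not_M_mult[OF loc.B_pow[OF w(1)] _ w] in auto)
  qed
  have "uu k \<otimes>\<^bsub>L\<^esub> ?q [^]\<^bsub>L\<^esub> (e k * k + 1) = (tt j \<otimes>\<^bsub>L\<^esub> ?q [^]\<^bsub>L\<^esub> j) [^]\<^bsub>L\<^esub> e k" using uk tj by simp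
  also have "\<dots> = tt j [^]\<^bsub>L\<^esub> e k \<otimes>\<^bsub>L\<^esub> ?q [^]\<^bsub>L\<^esub> (j * e k)"
    using tjc q by (simp add: L.nat_pow_distrib L.nat_pow_pow)
  also have "\<dots> = tt j [^]\<^bsub>L\<^esub> (e k + e j * (j * e k)) \<otimes>\<^bsub>L\<^esub> ?w [^]\<^bsub>L\<^esub> (j * e k)"
    unfolding qp using tjc wc by (simp add: L.nat_pow_mult[symmetric] L.m_assoc)
  finally have eq: "uu k \<otimes>\<^bsub>L\<^esub> (tt j [^]\<^bsub>L\<^esub> (e j * (e k * k + 1)) \<otimes>\<^bsub>L\<^esub> ?w [^]\<^bsub>L\<^esub> (e k * k + 1))
      = tt j [^]\<^bsub>L\<^esub> (e k + e j * (j * e k)) \<otimes>\<^bsub>L\<^esub> ?w [^]\<^bsub>L\<^esub> (j * e k)"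
    unfolding qp .
  note cmp = loc.compare_powers[OF tM wp wp ukc eq]
  have ne: "e j * (e k * k + 1) < e k + e j * (j * e k) \<or> e k + e j * (j * e k) < e j * (e k * k + 1)"
  proof -
    have 1: "e j * (e k * k + 1) = e j * e k * k + e j" "e k + e j * (j * e k) = e j * e k * j + e k"
      by (simp_all add: algebra_simps)
    have 2: "e j * e k * (j + 1) = e j * e k * j + e j * e k" "e j * e k * (k + 1) = e j * e k * k + e j * e k"
      by (simp_all add: algebra_simps)
    show ?thesis
  proof (cases "j < k")
    case True
    then have "e j * e k * (j + 1) \<le> e j * e k * k" by (intro mult_le_mono2) simp
    moreover have "e k \<le> e j * e k" using J.e_pos by simp
    ultimately have "e k + e j * (j * e k) < e j * (e k * k + 1)" unfolding 1 2 using J.e_pos by linarith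
    then show ?thesis by simp
  next
    case False
    then have "e j * e k * (k + 1) \<le> e j * e k * j" using jk by (intro mult_le_mono2) simp
    moreover have "e j \<le> e j * e k" using k.e_pos by simp
    ultimately have "e j * (e k * k + 1) < e k + e j * (j * e k)" unfolding 1 2 using k.e_pos by linarith
    then show ?thesis by simp
  qed
  qed
  then show ?thesis using cmp by blast
qed

lemma product_divides:
  assumes loc: "local_subring L B M" and J: "J \<subseteq> {..<s}"
    and div: "\<And>k. k \<in> J \<Longrightarrow> \<exists>x\<in>B. \<epsilon> (P k) \<otimes>\<^bsub>L\<^esub> x = ph (\<pi> [^] A k)"
  shows "\<exists>x\<in>B. \<epsilon> (Qs J) \<otimes>\<^bsub>L\<^esub> x = ph (\<pi> [^] (\<Sum>k\<in>J. A k))"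
proof -
  interpret loc: local_subring L B M by (rule loc)
  interpret J: place F v "e 0" 0 \<pi> "K 0" "\<tau> 0" "y 0" "f 0" L \<epsilon> p "Qs ({..<s} - {0})" "p \<ominus>\<^bsub>FX\<^esub> Qs {..<s}" S N
    by (rule place[OF s_pos])
  have "finite J" using J finite_subset by blast
  then show ?thesis using J div
  proof (induction J rule: finite_induct)
    case empty
    then show ?case using subringE(3)[OF loc.B] J.eps_one by (intro bexI[of _ "\<one>\<^bsub>L\<^esub>"]) (auto simp: Qs_def)
  next
    case (insert j J)
    have Pc: "P \<in> J \<rightarrow> carrier FX" "P j \<in> carrier FX" using insert.prems mon_P by (auto simp: monic_const_value_def)
    have Qc: "Qs J \<in> carrier FX" using mon_Qs[of J] insert.prems by (auto simp: monic_const_value_def)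
    have Q: "Qs (insert j J) = P j \<otimes>\<^bsub>FX\<^esub> Qs J" unfolding Qs_def using insert Pc by (simp add: FX.finprod_insert)
    obtain x where x: "x \<in> B" "\<epsilon> (Qs J) \<otimes>\<^bsub>L\<^esub> x = ph (\<pi> [^] (\<Sum>k\<in>J. A k))" using insert by auto
    obtain z where z: "z \<in> B" "\<epsilon> (P j) \<otimes>\<^bsub>L\<^esub> z = ph (\<pi> [^] A j)" using insert by auto
    have "\<epsilon> (Qs (insert j J)) \<otimes>\<^bsub>L\<^esub> (z \<otimes>\<^bsub>L\<^esub> x) = (\<epsilon> (P j) \<otimes>\<^bsub>L\<^esub> z) \<otimes>\<^bsub>L\<^esub> (\<epsilon> (Qs J) \<otimes>\<^bsub>L\<^esub> x)"
      unfolding Q using Pc Qc loc.B_carrier[OF x(1)] loc.B_carrier[OF z(1)] by (simp add: J.eps_mult L.m_ac)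
    also have "\<dots> = ph (\<pi> [^] (\<Sum>k\<in>insert j J. A k))"
      unfolding x(2) z(2) using insert.hyps J.phi_mult[OF J.pip(1) J.pip(1), symmetric] J.pi(1)
      by (simp add: nat_pow_mult)
    finally show ?case using x z subringE(6)[OF loc.B] by blast
  qed
qed

lemma
  assumes j: "j < s"
  shows family_dval: "discrete_valuation L (WW j)" and family_val_ring: "val_ring L (WW j) = RR j"
    and family_ker: "x \<in> RR j \<Longrightarrow> rr j x = \<zero>\<^bsub>K j\<^esub> \<longleftrightarrow> x \<in> val_ge L (WW j) 1"
    and family_ram: "c \<in> carrier F \<Longrightarrow> c \<noteq> \<zero> \<Longrightarrow> WW j (ph c) = int (e j) * v c"
    and family_hom: "rr j \<in> ring_hom (L\<lparr>carrier := RR j\<rparr>) (K j)" and family_surj: "rr j ` RR j = carrier (K j)"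
    and family_res: "c \<in> val_ring F v \<Longrightarrow> ph c \<in> RR j \<and> rr j (ph c) = \<tau> j c"
proof -
  interpret J: place F v "e j" j \<pi> "K j" "\<tau> j" "y j" "f j" L \<epsilon> p "Qs ({..<s} - {j})" "p \<ominus>\<^bsub>FX\<^esub> Qs {..<s}" S N
    by (rule place[OF j])
  have "\<exists>x\<in>J.R. \<epsilon> (Qs ({..<s} - {j})) \<otimes>\<^bsub>L\<^esub> x = ph (\<pi> [^] (\<Sum>k\<in>{..<s} - {j}. A k))"
  proof (rule product_divides[OF J.R_local])
    fix k assume k: "k \<in> {..<s} - {j}"
    then interpret k: place F v "e k" k \<pi> "K k" "\<tau> k" "y k" "f k" L \<epsilon> p "Qs ({..<s} - {k})" "p \<ominus>\<^bsub>FX\<^esub> Qs {..<s}" S N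
      by (intro place) auto
    have "\<exists>x\<in>J.R. \<epsilon> k.residual_factor \<otimes>\<^bsub>L\<^esub> x = \<one>\<^bsub>L\<^esub>"
      by (rule k.residual_factor_inverse_in_local_subring[OF J.R_local J.R_phi(1)]) (use slopes_differ[OF j, of k] k in auto)
    then have "\<exists>x\<in>J.R. \<epsilon> k.local_factor \<otimes>\<^bsub>L\<^esub> x = ph (\<pi> [^] (k.slope * f k))"
      by (rule k.local_factor_divides_in_local_subring) (use J.R_carrier in auto)
    then show "\<exists>x\<in>J.R. \<epsilon> (P k) \<otimes>\<^bsub>L\<^esub> x = ph (\<pi> [^] A k)"
      by (simp add: P_def A_def k.slope_def)
  qed blast
  moreover have "J.slope * f j + (\<Sum>k\<in>{..<s} - {j}. A k) < N"
  proof -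
    have "S = A j + (\<Sum>k\<in>{..<s} - {j}. A k)" unfolding S_def using j by (intro sum.remove) auto
    then show ?thesis using S_lt_N by (simp add: A_def J.slope_def)
  qed
  note pe = J.place_exists[OF calculation this]
  show "discrete_valuation L (WW j)" "val_ring L (WW j) = RR j"
    "x \<in> RR j \<Longrightarrow> rr j x = \<zero>\<^bsub>K j\<^esub> \<longleftrightarrow> x \<in> val_ge L (WW j) 1"
    "c \<in> carrier F \<Longrightarrow> c \<noteq> \<zero> \<Longrightarrow> WW j (ph c) = int (e j) * v c"
    by (fact pe(1), fact pe(2), erule pe(3), erule (1) pe(6))
  show "rr j \<in> ring_hom (L\<lparr>carrier := RR j\<rparr>) (K j)" "rr j ` RR j = carrier (K j)"
    "c \<in> val_ring F v \<Longrightarrow> ph c \<in> RR j \<and> rr j (ph c) = \<tau> j c"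
    using J.res_hom J.res_surj J.R_phi by auto
qed

text \<open>The element \<open>u\<^sub>k\<close> is a unit at the \<open>k\<close>-th place, but not at the \<open>j\<close>-th.\<close>

lemma family_inj: "inj_on RR {..<s}"
proof (rule inj_onI)
  fix j k assume jk: "j \<in> {..<s}" "k \<in> {..<s}" "RR j = RR k"
  show "j = k"
  proof (rule ccontr)
    assume ne: "j \<noteq> k"
    interpret J: place F v "e j" j \<pi> "K j" "\<tau> j" "y j" "f j" L \<epsilon> p "Qs ({..<s} - {j})" "p \<ominus>\<^bsub>FX\<^esub> Qs {..<s}" S N
      by (rule place) (use jk in auto)
    interpret k: place F v "e k" k \<pi> "K k" "\<tau> k" "y k" "f k" L \<epsilon> p "Qs ({..<s} - {k})" "p \<ominus>\<^bsub>FX\<^esub> Qs {..<s}" S N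
      by (rule place) (use jk in auto)
    interpret loc: local_subring L J.R "MM j" by (rule J.R_local)
    have 1: "uu k \<in> J.R" "inv\<^bsub>L\<^esub> uu k \<in> J.R" using k.u jk(3) by auto
    have 2: "uu k \<otimes>\<^bsub>L\<^esub> inv\<^bsub>L\<^esub> uu k = \<one>\<^bsub>L\<^esub>" "inv\<^bsub>L\<^esub> uu k \<otimes>\<^bsub>L\<^esub> uu k = \<one>\<^bsub>L\<^esub>"
      using L.field_inv[OF k.u_closed k.u(4)] by auto
    show False
      using slopes_differ[of j k] jk ne loc.not_M_if_inv[OF 1 2(1)] loc.not_M_if_inv[OF 1(2,1) 2(2)] by auto
  qed
qed

text \<open>Since \<open>p\<close> is monic with integral coefficients, the image \<open>\<theta>\<close> of \<open>X\<close> lies in \<open>B\<close>. If all places were foreign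
  to \<open>B\<close>, the image of the product \<open>Qs\<close> would divide \<open>\<pi>\<^sup>S\<close> in \<open>B\<close>; it is also divisible by \<open>\<pi>\<^sup>N\<close>, and
  \<open>N > S\<close>. So for some \<open>j\<close> the element \<open>u\<^sub>j\<close> is in \<open>B\<close> and \<open>residual_factor\<close> goes to the maximal ideal; then \<open>B\<close> contains the
  valuation ring of the \<open>j\<close>-th place, and equals it by maximality.\<close>

lemma family_complete:
  assumes B: "valuation_ring L B" and BF: "B \<inter> ph ` carrier F = ph ` val_ring F v"
  shows "\<exists>j<s. B = RR j"
proof -
  interpret J: place F v "e 0" 0 \<pi> "K 0" "\<tau> 0" "y 0" "f 0" L \<epsilon> p "Qs ({..<s} - {0})" "p \<ominus>\<^bsub>FX\<^esub> Qs {..<s}" S N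
    by (rule place[OF s_pos])
  define M where "M = max_ideal L B"
  have loc: "local_subring L B M" and val: "\<And>x. x \<in> carrier L \<Longrightarrow> x \<notin> B \<Longrightarrow> inv\<^bsub>L\<^esub> x \<in> M"
    unfolding M_def using valuation_ring_local[OF L.field_axioms B] by auto
  interpret loc: local_subring L B M by (rule loc)
  have VB: "ph c \<in> B" if "c \<in> val_ring F v" for c using BF that by blast
  have VB': "c \<in> val_ring F v" if c: "c \<in> carrier F" "ph c \<in> B" for c
  proof -
    obtain c' where c': "c' \<in> val_ring F v" "ph c = ph c'" using BF c by blast
    have d: "c \<ominus> c' \<in> carrier F" using c val_geD[OF c'(1)] by simp
    have "c = (c \<ominus> c') \<oplus> c'" using c(1) val_geD[OF c'(1)] by (simp add: a_minus_def a_assoc l_neg)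
    then have "ph c = ph (c \<ominus> c') \<oplus>\<^bsub>L\<^esub> ph c'"
      using ring_hom_memE(3)[OF J.phi_hom d val_geD[OF c'(1)]] by simp
    then have "ph (c \<ominus> c') = \<zero>\<^bsub>L\<^esub>"
      using c'(2) J.phi_closed[OF d] J.phi_closed[OF val_geD[OF c'(1)]] by (simp add: L.add.r_cancel_one)
    then have "c \<ominus> c' = \<zero>" using J.phi_nz d by blast
    then have "c = c'" using \<open>c = (c \<ominus> c') \<oplus> c'\<close> val_geD[OF c'(1)] by simp
    then show ?thesis using c' by simp
  qed
  have NM: "ph c \<in> M" if c: "c \<in> val_ge F v 1" for c
  proof (rule ccontr)
    assume nM: "ph c \<notin> M"
    have cB: "ph c \<in> B" using VB val_ge_mono[OF c] by simp
    have c0: "c \<noteq> \<zero>" using nM loc.M_zero by auto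
    have cc: "c \<in> carrier F" using c val_geD by blast
    have "ph (inv c) \<in> B" using loc.unit[OF cB nM] J.phi_inv[OF cc c0] by simp
    then have "inv c \<in> val_ring F v" using VB' field_inv(1)[OF cc c0] by blast
    then show False using c c0 v_inv[OF cc c0] field_inv[OF cc c0] by (simp add: val_ge_iff)
  qed
  define \<theta> where "\<theta> = \<epsilon> (mono \<one> 1)"
  have m1: "mono \<one> 1 \<in> carrier FX" using mono by simp
  have th: "\<theta> \<in> carrier L" unfolding \<theta>_def using J.eps_closed m1 by simp
  have eps_mono: "\<epsilon> (mono c k) = ph c \<otimes>\<^bsub>L\<^esub> \<theta> [^]\<^bsub>L\<^esub> k" if c: "c \<in> carrier F" for c k
  proof -
    have "mono c k = mono c 0 \<otimes>\<^bsub>FX\<^esub> (mono \<one> 1 [^]\<^bsub>FX\<^esub> k)"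
      using mono_pow[OF one_closed, of 1 k] mono_mult[OF c one_closed, of 0 k] c by simp
    then show ?thesis unfolding \<theta>_def J.\<phi>_def using J.eps_mult J.eps_pow m1 mono(1)[OF c] by simp
  qed
  have Q: "monic_const_value (\<Sum>j<s. e j * f j) S (Qs {..<s})" using mon_Qs[of "{..<s}"] by (simp add: S_def)
  have Qc: "Qs {..<s} \<in> carrier FX" using Q by (simp add: monic_const_value_def)
  let ?sm = "p \<ominus>\<^bsub>FX\<^esub> Qs {..<s}" and ?d = "\<Sum>j<s. e j * f j"
  have sm: "?sm \<in> carrier FX" "\<And>k. coeff ?sm k \<in> val_ge F v (int N)" using p Qc p_close by auto
  have p_V: "coeff p k \<in> val_ring F v" for k
  proof -
    have "coeff p k = (coeff p k \<ominus> coeff (Qs {..<s}) k) \<oplus> coeff (Qs {..<s}) k"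
      using p Qc by (simp add: a_minus_def a_assoc l_neg)
    moreover have "coeff (Qs {..<s}) k \<in> val_ring F v" using Q by (simp add: monic_const_value_def)
    moreover have "coeff p k \<ominus> coeff (Qs {..<s}) k \<in> val_ring F v" by (rule val_ge_mono[OF p_close]) simp
    ultimately show ?thesis using val_ge_add by metis
  qed
  have thB: "\<theta> \<in> B"
  proof (rule ccontr)
    assume nB: "\<theta> \<notin> B"
    define z where "z = inv\<^bsub>L\<^esub> \<theta>"
    have zM: "z \<in> M" unfolding z_def using val th nB by blast
    have th0: "\<theta> \<noteq> \<zero>\<^bsub>L\<^esub>" using nB subringE(2)[OF loc.B] by auto
    note zi = L.field_inv[OF th th0, folded z_def]
    have up: "\<theta> [^]\<^bsub>L\<^esub> k \<otimes>\<^bsub>L\<^esub> z [^]\<^bsub>L\<^esub> k = \<one>\<^bsub>L\<^esub>" for k :: nat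
      using zi th L.nat_pow_distrib[of \<theta> z k] L.nat_pow_one by simp
    have "length p \<le> Suc ?d" using p_monic by simp
    note sp = poly_split_lead[OF p(1) this, unfolded p_monic(2)]
    let ?q = "p \<ominus>\<^bsub>FX\<^esub> mono \<one> ?d"
    have zd: "z [^]\<^bsub>L\<^esub> ?d \<in> carrier L" using zi by simp
    have "?q \<in> {h \<in> carrier FX. \<epsilon> h \<otimes>\<^bsub>L\<^esub> z [^]\<^bsub>L\<^esub> ?d \<in> M}"
    proof (rule poly_closure[OF sp(1)])
      show "a \<oplus>\<^bsub>FX\<^esub> b \<in> {h \<in> carrier FX. \<epsilon> h \<otimes>\<^bsub>L\<^esub> z [^]\<^bsub>L\<^esub> ?d \<in> M}"
        if "a \<in> {h \<in> carrier FX. \<epsilon> h \<otimes>\<^bsub>L\<^esub> z [^]\<^bsub>L\<^esub> ?d \<in> M}" "b \<in> {h \<in> carrier FX. \<epsilon> h \<otimes>\<^bsub>L\<^esub> z [^]\<^bsub>L\<^esub> ?d \<in> M}" for a b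
        using that loc.M_add zd by (simp add: J.eps_add L.l_distr)
      show "\<zero>\<^bsub>FX\<^esub> \<in> {h \<in> carrier FX. \<epsilon> h \<otimes>\<^bsub>L\<^esub> z [^]\<^bsub>L\<^esub> ?d \<in> M}" using zd loc.M_zero by simp
      fix k
      define c where "c = coeff ?q k"
      have cV: "c \<in> val_ring F v" "k \<ge> ?d \<Longrightarrow> c = \<zero>"
        unfolding c_def sp(4) using p_V coeff_length[of ?q k] sp(3,4) by auto
      have cc: "c \<in> carrier F" using cV(1) val_geD by blast
      have "\<epsilon> (mono c k) \<otimes>\<^bsub>L\<^esub> z [^]\<^bsub>L\<^esub> ?d \<in> M"
      proof (cases "k < ?d")
        case True
        then obtain d' where d': "?d = k + Suc d'" using less_imp_Suc_add by auto
        have "\<epsilon> (mono c k) \<otimes>\<^bsub>L\<^esub> z [^]\<^bsub>L\<^esub> ?d = (ph c \<otimes>\<^bsub>L\<^esub> z [^]\<^bsub>L\<^esub> d') \<otimes>\<^bsub>L\<^esub> z \<otimes>\<^bsub>L\<^esub> (\<theta> [^]\<^bsub>L\<^esub> k \<otimes>\<^bsub>L\<^esub> z [^]\<^bsub>L\<^esub> k)"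
          unfolding d' eps_mono[OF cc] using th zi(1) J.phi_closed[OF cc]
          by (simp add: L.nat_pow_mult[symmetric] L.m_ac)
        then have "\<epsilon> (mono c k) \<otimes>\<^bsub>L\<^esub> z [^]\<^bsub>L\<^esub> ?d = (ph c \<otimes>\<^bsub>L\<^esub> z [^]\<^bsub>L\<^esub> d') \<otimes>\<^bsub>L\<^esub> z"
          unfolding up using zi(1) J.phi_closed[OF cc] by simp
        then show ?thesis
          using loc.M_mult[OF _ zM] VB[OF cV(1)] loc.B_pow[of z d'] loc.M_sub zM subringE(6)[OF loc.B] by auto
      next
        case False
        then show ?thesis using cV(2) zd loc.M_zero by simp
      qed
      then show "mono (coeff ?q k) k \<in> {h \<in> carrier FX. \<epsilon> h \<otimes>\<^bsub>L\<^esub> z [^]\<^bsub>L\<^esub> ?d \<in> M}"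
        using mono(1)[OF cc] by (simp add: c_def)
    qed
    then have qM: "\<epsilon> ?q \<otimes>\<^bsub>L\<^esub> z [^]\<^bsub>L\<^esub> ?d \<in> M" by simp
    have "\<epsilon> p = \<epsilon> (mono \<one> ?d) \<oplus>\<^bsub>L\<^esub> \<epsilon> ?q"
      using J.eps_add[OF mono(1)[OF one_closed] sp(1), of ?d] sp(2) by simp
    then have "\<zero>\<^bsub>L\<^esub> = \<theta> [^]\<^bsub>L\<^esub> ?d \<oplus>\<^bsub>L\<^esub> \<epsilon> ?q"
      using p(2) eps_mono[OF one_closed, of ?d] th by simp
    from arg_cong[OF this, of "\<lambda>x. x \<otimes>\<^bsub>L\<^esub> z [^]\<^bsub>L\<^esub> ?d"]
    have "\<zero>\<^bsub>L\<^esub> = (\<theta> [^]\<^bsub>L\<^esub> ?d \<oplus>\<^bsub>L\<^esub> \<epsilon> ?q) \<otimes>\<^bsub>L\<^esub> z [^]\<^bsub>L\<^esub> ?d"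
      using L.l_null[OF zd] by (simp only:)
    also have "\<dots> = \<one>\<^bsub>L\<^esub> \<oplus>\<^bsub>L\<^esub> \<epsilon> ?q \<otimes>\<^bsub>L\<^esub> z [^]\<^bsub>L\<^esub> ?d"
      using th zd sp(1) up by (simp add: L.l_distr)
    finally have 0: "\<zero>\<^bsub>L\<^esub> = \<one>\<^bsub>L\<^esub> \<oplus>\<^bsub>L\<^esub> \<epsilon> ?q \<otimes>\<^bsub>L\<^esub> z [^]\<^bsub>L\<^esub> ?d" .
    show False
      using loc.not_M_add[OF subringE(3)[OF loc.B] loc.M_one qM] loc.M_zero unfolding 0[symmetric] by blast
  qed
  have eB: "\<epsilon> h \<in> B" if h: "h \<in> carrier FX" "\<And>k. coeff h k \<in> val_ring F v" for h
  proof -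
    have "h \<in> {h \<in> carrier FX. \<epsilon> h \<in> B}"
    proof (rule poly_closure[OF h(1)])
      fix k
      have "\<epsilon> (mono (coeff h k) k) \<in> B"
        unfolding eps_mono[OF FX_coeff[OF h(1)]] using VB[OF h(2)] loc.B_pow[OF thB] subringE(6)[OF loc.B] by simp
      then show "mono (coeff h k) k \<in> {h \<in> carrier FX. \<epsilon> h \<in> B}" using mono(1)[OF FX_coeff[OF h(1)]] by simp
    qed (use subringE[OF loc.B] in \<open>auto simp: J.eps_add\<close>)
    then show ?thesis by simp
  qed
  have "\<exists>j<s. \<not> (uu j \<in> M \<or> (uu j \<noteq> \<zero>\<^bsub>L\<^esub> \<and> inv\<^bsub>L\<^esub> uu j \<in> M) \<or>
      (uu j \<in> B \<and> uu j \<notin> M \<and> \<epsilon> (residual.residual_factor F v (e j) j \<pi> (K j) (\<tau> j) (y j) (f j)) \<notin> M))"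
  proof (rule ccontr)
    assume all: "\<not> ?thesis"
    have "\<exists>x\<in>B. \<epsilon> (Qs {..<s}) \<otimes>\<^bsub>L\<^esub> x = ph (\<pi> [^] (\<Sum>k\<in>{..<s}. A k))"
    proof (rule product_divides[OF loc order_refl])
      fix k assume k: "k \<in> {..<s}"
      then interpret k: place F v "e k" k \<pi> "K k" "\<tau> k" "y k" "f k" L \<epsilon> p "Qs ({..<s} - {k})" "p \<ominus>\<^bsub>FX\<^esub> Qs {..<s}" S N
        by (intro place) auto
      have "\<exists>x\<in>B. \<epsilon> k.residual_factor \<otimes>\<^bsub>L\<^esub> x = \<one>\<^bsub>L\<^esub>"
        by (rule k.residual_factor_inverse_in_local_subring[OF loc VB]) (use all k in auto)
      then have "\<exists>x\<in>B. \<epsilon> k.local_factor \<otimes>\<^bsub>L\<^esub> x = ph (\<pi> [^] (k.slope * f k))"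
        by (rule k.local_factor_divides_in_local_subring) (use loc.B_carrier in auto)
      then show "\<exists>x\<in>B. \<epsilon> (P k) \<otimes>\<^bsub>L\<^esub> x = ph (\<pi> [^] A k)"
        by (simp add: P_def A_def k.slope_def)
    qed
    then obtain x where x: "x \<in> B" "\<epsilon> (Qs {..<s}) \<otimes>\<^bsub>L\<^esub> x = ph (\<pi> [^] S)" by (auto simp: S_def)
    \<comment> \<open>the small polynomial, divided by \<open>\<pi>\<^sup>N\<close>\<close>
    define sm' where "sm' = mono (inv (\<pi> [^] N)) 0 \<otimes>\<^bsub>FX\<^esub> ?sm"
    have smc: "sm' \<in> carrier FX" using mono(1)[OF J.pinv(1)] sm by (simp add: sm'_def)
    have "coeff sm' k \<in> val_ring F v" for k
    proof -
      have "coeff sm' k = inv (\<pi> [^] N) \<otimes> coeff ?sm k"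
        unfolding sm'_def using coeff_mono_mult[OF J.pinv(1) sm(1), of N 0 k] by simp
      moreover have "inv (\<pi> [^] N) \<in> val_ge F v (- int N)" using J.pinv by (simp add: val_ge_def)
      ultimately show ?thesis using val_ge_mult'[OF _ sm(2), of "inv (\<pi> [^] N)" "- int N" 0 k] by simp
    qed
    then have sB: "\<epsilon> sm' \<in> B" using eB smc by blast
    have "mono (\<pi> [^] N) 0 \<otimes>\<^bsub>FX\<^esub> sm' = ?sm"
      unfolding sm'_def using mono_mult[OF J.pip(1) J.pinv(1), of N 0 N 0] mono(1)[OF J.pip(1)] mono(1)[OF J.pinv(1)] sm(1) J.pinv
      by (simp add: FX.m_assoc[symmetric] mono_one)
    then have es: "\<epsilon> ?sm = ph (\<pi> [^] N) \<otimes>\<^bsub>L\<^esub> \<epsilon> sm'"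
      unfolding J.\<phi>_def using J.eps_mult[OF mono(1)[OF J.pip(1)] smc, of N 0] by simp
    note xc = loc.B_carrier[OF x(1)]
    have "Qs {..<s} \<oplus>\<^bsub>FX\<^esub> ?sm = p" using p Qc by (simp add: a_minus_def FX.a_lcomm FX.r_neg)
    then have "\<epsilon> (Qs {..<s}) \<oplus>\<^bsub>L\<^esub> \<epsilon> ?sm = \<zero>\<^bsub>L\<^esub>"
      unfolding J.eps_add[OF Qc sm(1), symmetric] using p(2) by simp
    then have "\<epsilon> (Qs {..<s}) = \<ominus>\<^bsub>L\<^esub> \<epsilon> ?sm" using L.minus_equality Qc sm by simp
    then have "ph (\<pi> [^] S) = \<ominus>\<^bsub>L\<^esub> (ph (\<pi> [^] N) \<otimes>\<^bsub>L\<^esub> \<epsilon> sm') \<otimes>\<^bsub>L\<^esub> x" using x(2) es by simp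
    then have eq: "ph (\<pi> [^] S) = ph (\<pi> [^] N) \<otimes>\<^bsub>L\<^esub> \<ominus>\<^bsub>L\<^esub> (\<epsilon> sm' \<otimes>\<^bsub>L\<^esub> x)"
      using J.phi_closed[OF J.pip(1)] smc xc by (simp add: L.l_minus L.r_minus L.m_assoc)
    define w where "w = \<ominus>\<^bsub>L\<^esub> (\<epsilon> sm' \<otimes>\<^bsub>L\<^esub> x)"
    have wB: "w \<in> B" unfolding w_def using sB x(1) subringE(5,6)[OF loc.B] by simp
    note wc = loc.B_carrier[OF wB]
    obtain d where d: "N = S + Suc d" using less_imp_Suc_add[OF S_lt_N] by auto
    let ?a = "ph (\<pi> [^] S)" and ?b = "ph (\<pi> [^] Suc d)"
    have ac: "?a \<in> carrier L" "?a \<noteq> \<zero>\<^bsub>L\<^esub>" "?b \<in> carrier L"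
      using J.phi_closed[OF J.pip(1)] J.phi_nz[OF J.pip(1,2)] by blast+
    have eqN: "ph (\<pi> [^] N) = ?a \<otimes>\<^bsub>L\<^esub> ?b"
      unfolding d J.phi_mult[OF J.pip(1) J.pip(1), symmetric] nat_pow_mult[OF J.pi(1)] ..
    have "?a \<otimes>\<^bsub>L\<^esub> \<one>\<^bsub>L\<^esub> = ?a" using ac by simp
    also have "?a = (?a \<otimes>\<^bsub>L\<^esub> ?b) \<otimes>\<^bsub>L\<^esub> w" using eq unfolding w_def[symmetric] eqN .
    also have "\<dots> = ?a \<otimes>\<^bsub>L\<^esub> (?b \<otimes>\<^bsub>L\<^esub> w)" by (rule L.m_assoc[OF ac(1,3) wc])
    finally have "\<one>\<^bsub>L\<^esub> = ?b \<otimes>\<^bsub>L\<^esub> w"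
      by (rule L.m_lcancel[OF ac(2,1) L.one_closed L.m_closed[OF ac(3) wc], THEN iffD1])
    moreover have "\<pi> [^] Suc d \<in> val_ge F v 1" using J.pip[of "Suc d"] by (simp add: val_ge_def del: nat_pow_Suc)
    then have "?b \<in> M" by (rule NM)
    then have "?b \<otimes>\<^bsub>L\<^esub> w \<in> M" using loc.M_mult[OF wB] L.m_comm[OF ac(3) wc] by simp
    ultimately show False using loc.M_one by simp
  qed
  then obtain j where j: "j < s" and nj: "uu j \<notin> M" "uu j = \<zero>\<^bsub>L\<^esub> \<or> inv\<^bsub>L\<^esub> uu j \<notin> M"
      "uu j \<notin> B \<or> \<epsilon> (residual.residual_factor F v (e j) j \<pi> (K j) (\<tau> j) (y j) (f j)) \<in> M" by blast
  interpret j: place F v "e j" j \<pi> "K j" "\<tau> j" "y j" "f j" L \<epsilon> p "Qs ({..<s} - {j})" "p \<ominus>\<^bsub>FX\<^esub> Qs {..<s}" S N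
    by (rule place[OF j])
  have uB: "uu j \<in> B"
    using nj(2) val[OF j.u_closed] subringE(2)[OF loc.B] by auto
  have "j.R \<subseteq> B"
    by (rule j.R_below_valuation_ring[OF loc val VB NM uB]) (use nj(3) uB in auto)
  moreover have "B \<noteq> carrier L"
  proof
    assume "B = carrier L"
    then have "val_ring F v = carrier F" using VB' J.phi_closed val_ge_carrier by blast
    then show False using val_ring_proper by simp
  qed
  moreover interpret Wj: dval L "WW j" by unfold_locales (rule family_dval[OF j])
  have "B = val_ring L (WW j)"
    by (rule Wj.dval_maximal[OF loc.B]) (use calculation family_val_ring[OF j] in auto)
  then show ?thesis using j family_val_ring[OF j] by auto
qed

end

section \<open>Powers and derivatives in prime characteristic\<close>

context cring
begin

lemma nmult_closed [simp]: "x \<in> carrier R \<Longrightarrow> (add_pow R (n::nat) x) \<in> carrier R"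
  by (rule add.nat_pow_closed)

lemma binomial_expansion:
  assumes x: "x \<in> carrier R" and y: "y \<in> carrier R"
  shows "(x \<oplus> y) [^] (n::nat) = (\<Oplus>k\<in>{..n}. (add_pow R (n choose k) (x [^] k \<otimes> y [^] (n - k))))"
proof (induction n)
  case 0
  then show ?case by simp
next
  case (Suc n)
  let ?A = "\<lambda>k. (add_pow R (n choose k) (x [^] Suc k \<otimes> y [^] (n - k)))"
  let ?B = "\<lambda>k. (add_pow R (n choose k) (x [^] k \<otimes> y [^] (Suc n - k)))"
  let ?T = "\<lambda>k. (add_pow R (Suc n choose k) (x [^] k \<otimes> y [^] (Suc n - k)))"
  have c: "?A k \<in> carrier R" "?B k \<in> carrier R" "?T k \<in> carrier R"
    "(add_pow R (n choose k) (x [^] k \<otimes> y [^] (n - k))) \<in> carrier R" for k using x y by auto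
  have A: "(\<Oplus>k\<in>{..n}. (add_pow R (n choose k) (x [^] k \<otimes> y [^] (n - k)))) \<otimes> x = (\<Oplus>k\<in>{..n}. ?A k)"
  proof -
    have "(\<Oplus>k\<in>{..n}. (add_pow R (n choose k) (x [^] k \<otimes> y [^] (n - k)))) \<otimes> x
        = (\<Oplus>k\<in>{..n}. (add_pow R (n choose k) (x [^] k \<otimes> y [^] (n - k))) \<otimes> x)"
      using c x by (intro finsum_ldistr) auto
    also have "\<dots> = (\<Oplus>k\<in>{..n}. ?A k)"
    proof (rule add.finprod_cong')
      fix k
      show "(add_pow R (n choose k) (x [^] k \<otimes> y [^] (n - k))) \<otimes> x = ?A k"
        using x y by (subst add_pow_ldistr) (auto simp: m_ac)
    qed (use c in auto)
    finally show ?thesis .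
  qed
  have B: "(\<Oplus>k\<in>{..n}. (add_pow R (n choose k) (x [^] k \<otimes> y [^] (n - k)))) \<otimes> y = (\<Oplus>k\<in>{..n}. ?B k)"
  proof -
    have "(\<Oplus>k\<in>{..n}. (add_pow R (n choose k) (x [^] k \<otimes> y [^] (n - k)))) \<otimes> y
        = (\<Oplus>k\<in>{..n}. (add_pow R (n choose k) (x [^] k \<otimes> y [^] (n - k))) \<otimes> y)"
      using c y by (intro finsum_ldistr) auto
    also have "\<dots> = (\<Oplus>k\<in>{..n}. ?B k)"
    proof (rule add.finprod_cong')
      fix k assume "k \<in> {..n}"
      then have "Suc n - k = Suc (n - k)" by auto
      then show "(add_pow R (n choose k) (x [^] k \<otimes> y [^] (n - k))) \<otimes> y = ?B k"
        using x y by (subst add_pow_ldistr) (auto simp: m_ac)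
    qed (use c in auto)
    finally show ?thesis .
  qed
  have B2: "(\<Oplus>k\<in>{..n}. ?B k) = (\<Oplus>k\<in>{..n}. ?B (Suc k)) \<oplus> ?B 0"
  proof -
    have "(\<Oplus>k\<in>{..n}. ?B (Suc k)) \<oplus> ?B 0 = (\<Oplus>k\<in>{..Suc n}. ?B k)"
      using c by (intro add.finprod_Suc2[symmetric]) auto
    also have "\<dots> = (\<Oplus>k\<in>{..n}. ?B k)"
      using c by (intro add.finprod_mono_neutral_cong_right) (auto simp: binomial_eq_0)
    finally show ?thesis by simp
  qed
  have "(\<Oplus>k\<in>{..Suc n}. ?T k) = (\<Oplus>k\<in>{..n}. ?T (Suc k)) \<oplus> ?T 0"
    using c by (intro add.finprod_Suc2) auto
  also have "(\<Oplus>k\<in>{..n}. ?T (Suc k)) = (\<Oplus>k\<in>{..n}. ?A k \<oplus> ?B (Suc k))"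
    using x y c by (intro add.finprod_cong') (auto simp: add.nat_pow_mult[symmetric])
  also have "\<dots> = (\<Oplus>k\<in>{..n}. ?A k) \<oplus> (\<Oplus>k\<in>{..n}. ?B (Suc k))"
    using c(1,2) c(2)[of "Suc _"] by (intro add.finprod_multf funcsetI)
  also have "\<dots> \<oplus> ?T 0 = (\<Oplus>k\<in>{..n}. ?A k) \<oplus> (\<Oplus>k\<in>{..n}. ?B k)"
  proof -
    have s: "(\<Oplus>k\<in>{..n}. ?A k) \<in> carrier R" "(\<Oplus>k\<in>{..n}. ?B (Suc k)) \<in> carrier R"
      by (intro finsum_closed funcsetI, rule c)+
    have T0: "?T 0 = ?B 0" by simp
    show ?thesis unfolding B2 T0 by (rule a_assoc[OF s c(2)])
  qed
  also have "\<dots> = (x \<oplus> y) [^] n \<otimes> x \<oplus> (x \<oplus> y) [^] n \<otimes> y"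
    using Suc A B by simp
  also have "\<dots> = (x \<oplus> y) [^] Suc n" using x y by (simp add: r_distr)
  finally show ?case by simp
qed

text \<open>The inner binomial coefficients are divisible by \<open>l\<close>.\<close>

lemma frobenius_add:
  assumes l: "Factorial_Ring.prime (l::nat)" and ch: "(add_pow R l \<one>) = \<zero>" and x: "x \<in> carrier R" and y: "y \<in> carrier R"
  shows "(x \<oplus> y) [^] l = x [^] l \<oplus> y [^] l"
proof -
  let ?T = "\<lambda>k. (add_pow R (l choose k) (x [^] k \<otimes> y [^] (l - k)))"
  have lz: "(add_pow R l z) = \<zero>" if z: "z \<in> carrier R" for z
    using add_pow_ldistr[of \<one> z l] z ch by simp
  have c: "?T k \<in> carrier R" for k using x y by simp
  have l2: "l \<ge> 2" using l prime_ge_2_nat by blast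
  have z: "?T k = \<zero>" if k: "0 < k" "k < l" for k
  proof -
    obtain d where d: "l choose k = l * d"
      using dvd_choose_prime[OF k(2) _ _ l] k by (auto elim!: dvdE)
    show ?thesis unfolding d using x y lz by (simp add: add.nat_pow_pow[symmetric])
  qed
  have "(x \<oplus> y) [^] l = (\<Oplus>k\<in>{..l}. ?T k)" using binomial_expansion[OF x y] .
  also have "\<dots> = (\<Oplus>k\<in>{0, l}. ?T k)"
    using c z l2 by (intro add.finprod_mono_neutral_cong_right) auto
  also have "\<dots> = ?T 0 \<oplus> ?T l" 
  proof -
    have "?T \<in> {l} \<rightarrow> carrier R" "?T \<in> {} \<rightarrow> carrier R" by (rule funcsetI, rule c)+
    moreover have "0 \<notin> {l}" using l2 by simp
    ultimately show ?thesis
      using finsum_insert[of "{l}" 0 ?T] finsum_insert[of "{}" l ?T] c[of 0] c[of l]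
      by (simp only: finite.intros finsum_empty r_zero empty_iff not_False_eq_True)
  qed
  also have "\<dots> = x [^] l \<oplus> y [^] l" using x y by (simp add: a_comm)
  finally show ?thesis .
qed

end

context field
begin

interpretation FX: domain FX
  by (rule FX_domain)

definition lin :: "'a \<Rightarrow> 'a list" where "lin x = mono \<one> 1 \<ominus>\<^bsub>FX\<^esub> mono x 0"

lemma lin_eq: "x \<in> carrier R \<Longrightarrow> lin x = [\<one>, \<ominus> x]"
proof (rule FX_eqI)
  assume x: "x \<in> carrier R"
  show "lin x \<in> carrier FX" using x mono by (simp add: lin_def)
  show "[\<one>, \<ominus> x] \<in> carrier FX" using x by (auto simp: univ_poly_carrier[symmetric] polynomial_def)
  show "coeff (lin x) k = coeff [\<one>, \<ominus> x] k" for k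
    using x mono[of \<one> 1] mono[of x 0] by (auto simp: lin_def a_minus_def)
qed

lemma lin_closed [simp]: "x \<in> carrier R \<Longrightarrow> lin x \<in> carrier FX"
  using mono by (simp add: lin_def)

lemma coeff_lin_mult:
  assumes "x \<in> carrier R" "p \<in> carrier FX"
  shows "coeff (lin x \<otimes>\<^bsub>FX\<^esub> p) k = (case k of 0 \<Rightarrow> \<zero> | Suc j \<Rightarrow> coeff p j) \<ominus> x \<otimes> coeff p k"
proof -
  have "lin x \<otimes>\<^bsub>FX\<^esub> p = (mono \<one> 1 \<otimes>\<^bsub>FX\<^esub> p) \<ominus>\<^bsub>FX\<^esub> (mono x 0 \<otimes>\<^bsub>FX\<^esub> p)"
    using assms mono by (simp add: lin_def a_minus_def FX.l_distr FX.l_minus)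
  then show ?thesis
    using assms mono coeff_mono_mult[OF one_closed assms(2), of 1 k] coeff_mono_mult[OF assms, of 0 k]
    by (cases k) simp_all
qed

lemma eval_hom_FX:
  assumes "x \<in> carrier R"
  shows "(\<lambda>p. eval p x) \<in> ring_hom FX R"
  by (rule eval_is_hom[OF carrier_is_subring assms])

lemma eval_FX:
  assumes "x \<in> carrier R" "p \<in> carrier FX" "q \<in> carrier FX"
  shows "eval (p \<otimes>\<^bsub>FX\<^esub> q) x = eval p x \<otimes> eval q x" "eval (p \<oplus>\<^bsub>FX\<^esub> q) x = eval p x \<oplus> eval q x"
    "eval p x \<in> carrier R"
  using ring_hom_memE[OF eval_hom_FX[OF assms(1)]] assms by auto

lemma eval_lin: "x \<in> carrier R \<Longrightarrow> eval (lin x) x = \<zero>"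
  by (simp add: lin_eq r_neg)

lemma lin_factor:
  assumes "p \<in> carrier FX" "x \<in> carrier R" "eval p x = \<zero>"
  shows "\<exists>q\<in>carrier FX. p = lin x \<otimes>\<^bsub>FX\<^esub> q"
proof (cases "p = []")
  case True
  then show ?thesis using assms by (intro bexI[of _ "\<zero>\<^bsub>FX\<^esub>"]) (auto simp: FX_zero[symmetric])
next
  case False
  then have "lin x pdivides p"
    using is_root_imp_pdivides[of p x] assms by (simp add: is_root_def lin_eq)
  then show ?thesis by (auto simp: pdivides_def factor_def)
qed

lemma lin_pow_lead:
  assumes x: "x \<in> carrier R"
  shows "coeff (lin x [^]\<^bsub>FX\<^esub> (n::nat)) n = \<one> \<and> (\<forall>k>n. coeff (lin x [^]\<^bsub>FX\<^esub> n) k = \<zero>)"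
proof (induction n)
  case 0
  then show ?case by (auto simp: univ_poly_one)
next
  case (Suc n)
  have "lin x [^]\<^bsub>FX\<^esub> Suc n = lin x \<otimes>\<^bsub>FX\<^esub> lin x [^]\<^bsub>FX\<^esub> n" using x by (simp add: FX.m_comm)
  then show ?case using Suc x by (auto simp: coeff_lin_mult a_minus_def split: nat.splits)
qed

lemma lin_pow_second:
  assumes x: "x \<in> carrier R"
  shows "coeff (lin x [^]\<^bsub>FX\<^esub> Suc n) n = \<ominus> ((add_pow R (Suc n) x))"
proof (induction n)
  case 0
  then show ?case using x lin_closed[OF x] by (simp add: lin_eq)
next
  case (Suc n)
  have eq: "lin x [^]\<^bsub>FX\<^esub> Suc (Suc n) = lin x \<otimes>\<^bsub>FX\<^esub> lin x [^]\<^bsub>FX\<^esub> Suc n"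
    using x FX.m_comm[of "lin x" "lin x [^]\<^bsub>FX\<^esub> Suc n"] by simp
  have "coeff (lin x [^]\<^bsub>FX\<^esub> Suc n) (Suc n) = \<one>" using lin_pow_lead[OF x, of "Suc n"] by blast
  then show ?case unfolding eq using Suc x
    by (simp add: coeff_lin_mult a_minus_def minus_add del: FX.nat_pow_Suc)
qed

text \<open>Unique factorization in the only case needed: a monic divisor of a power of \<open>X - x\<close> is a power of \<open>X - x\<close>.
  If \<open>x\<close> is a root of \<open>g\<close>, split off one linear factor; otherwise the cofactor absorbs it.\<close>

lemma lin_pow_divisor:
  assumes x: "x \<in> carrier R" and g: "g \<in> carrier FX" "coeff g d = \<one>" "\<And>k. k > d \<Longrightarrow> coeff g k = \<zero>"
    and q: "q \<in> carrier FX" and eq: "lin x [^]\<^bsub>FX\<^esub> (n::nat) = g \<otimes>\<^bsub>FX\<^esub> q"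
  shows "g = lin x [^]\<^bsub>FX\<^esub> d"
  using g q eq
proof (induction n arbitrary: g d q)
  case 0
  have gl: "length g = Suc d" using FX_monicI[of g d] 0 by simp
  have "g \<in> Units FX" using 0(4,5) 0(1) FX.m_comm[of g q] by (auto simp: Units_def)
  then have "length g = 1" unfolding univ_poly_carrier_units by auto
  then have d: "d = 0" using gl by simp
  have "g = \<one>\<^bsub>FX\<^esub>"
  proof (rule FX_eqI)
    show "coeff g k = coeff \<one>\<^bsub>FX\<^esub> k" for k
      using 0(2,3) d by (cases k) (auto simp: univ_poly_one)
  qed (use 0 in auto)
  then show ?case using d by simp
next
  case (Suc n)
  have lx: "lin x \<in> carrier FX" "lin x \<noteq> \<zero>\<^bsub>FX\<^esub>" using lin_closed[OF x] by (auto simp: lin_eq[OF x] FX_zero)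
  have ln: "lin x [^]\<^bsub>FX\<^esub> n \<in> carrier FX" using lx by simp
  have eqS: "lin x \<otimes>\<^bsub>FX\<^esub> lin x [^]\<^bsub>FX\<^esub> n = g \<otimes>\<^bsub>FX\<^esub> q" using Suc.prems(5) lx by (simp add: FX.m_comm)
  have "eval (lin x \<otimes>\<^bsub>FX\<^esub> lin x [^]\<^bsub>FX\<^esub> n) x = \<zero>"
    using eval_FX(1)[OF x lx(1) ln] eval_lin[OF x] eval_FX(3)[OF x ln ln] by simp
  then have "eval g x \<otimes> eval q x = \<zero>" unfolding eqS using eval_FX(1)[OF x Suc.prems(1,4)] by simp
  then consider "eval g x = \<zero>" | "eval q x = \<zero>"
    using eval_FX(3)[OF x] Suc.prems by (auto simp: integral_iff)
  then show ?case
  proof cases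
    case 1
    then obtain g' where g': "g' \<in> carrier FX" "g = lin x \<otimes>\<^bsub>FX\<^esub> g'"
      using lin_factor Suc.prems x by blast
    have "lin x \<otimes>\<^bsub>FX\<^esub> lin x [^]\<^bsub>FX\<^esub> n = lin x \<otimes>\<^bsub>FX\<^esub> (g' \<otimes>\<^bsub>FX\<^esub> q)"
      unfolding eqS g'(2) using lx g' Suc.prems by (simp add: FX.m_assoc)
    then have e: "lin x [^]\<^bsub>FX\<^esub> n = g' \<otimes>\<^bsub>FX\<^esub> q"
      using FX.m_lcancel[OF lx(2,1) ln] g' Suc.prems by simp
    have pol: "polynomial (carrier R) (lin x)" "polynomial (carrier R) g'" using lx g' by (simp_all add: univ_poly_carrier)
    have gl: "length g = Suc d" using FX_monicI[of g d] Suc.prems by simp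
    have g'0: "g' \<noteq> []"
    proof
      assume "g' = []"
      then have "g = \<zero>\<^bsub>FX\<^esub>" unfolding g'(2) using lx by (simp add: FX_zero[symmetric])
      then show False using gl by (simp add: FX_zero)
    qed
    have "length g - 1 = 1 + (length g' - 1)"
      unfolding g'(2) using poly_mult_degree_eq[OF carrier_is_subring pol] g'0
      by (simp add: univ_poly_mult lin_eq[OF x] del: poly_mult.simps)
    then obtain d' where d': "d = Suc d'" "length g' = Suc d'"
      using gl g'0 by (cases d) (auto simp: Suc_le_eq)
    have z: "coeff g' k = \<zero>" if "k > d'" for k using coeff_length[of g' k] that d' by simp
    have "coeff g' d' = \<one>"
      using Suc.prems(2) unfolding g'(2) coeff_lin_mult[OF x g'(1)] d'(1)
      using z[of "Suc d'"] x g' by (simp add: a_minus_def)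
    then have "g' = lin x [^]\<^bsub>FX\<^esub> d'" using Suc.IH[OF g'(1) _ z Suc.prems(4) e] by blast
    then show ?thesis unfolding g'(2) d'(1) using lx by (simp add: FX.m_comm)
  next
    case 2
    then obtain q' where q': "q' \<in> carrier FX" "q = lin x \<otimes>\<^bsub>FX\<^esub> q'"
      using lin_factor Suc.prems x by blast
    have "lin x \<otimes>\<^bsub>FX\<^esub> lin x [^]\<^bsub>FX\<^esub> n = lin x \<otimes>\<^bsub>FX\<^esub> (g \<otimes>\<^bsub>FX\<^esub> q')"
      unfolding eqS q'(2) using lx q' Suc.prems by (simp add: FX.m_lcomm)
    then have e: "lin x [^]\<^bsub>FX\<^esub> n = g \<otimes>\<^bsub>FX\<^esub> q'"
      using FX.m_lcancel[OF lx(2,1) ln] q' Suc.prems by simp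
    show ?thesis by (rule Suc.IH[OF Suc.prems(1-3) q'(1) e])
  qed
qed

lemma nmult_FX_coeff: "p \<in> carrier FX \<Longrightarrow> coeff ((add_pow FX (n::nat) p)) k = (add_pow R n (coeff p k))"
proof (induction n)
  case (Suc n)
  have "(add_pow FX n p) \<in> carrier FX" using FX.add.nat_pow_closed[OF Suc.prems] .
  then show ?case using Suc by simp
qed simp

lemma lin_pow_char:
  assumes x: "x \<in> carrier R" and l: "Factorial_Ring.prime (l::nat)" and ch: "(add_pow R l \<one>) = \<zero>"
  shows "lin x [^]\<^bsub>FX\<^esub> l = mono \<one> l \<ominus>\<^bsub>FX\<^esub> mono (x [^] l) 0"
proof -
  have m: "mono \<one> 1 \<in> carrier FX" "mono x 0 \<in> carrier FX" "\<ominus>\<^bsub>FX\<^esub> mono x 0 \<in> carrier FX" using mono x by auto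
  have chF: "(add_pow FX l \<one>\<^bsub>FX\<^esub>) = \<zero>\<^bsub>FX\<^esub>"
  proof (rule FX_eqI)
    show "(add_pow FX l \<one>\<^bsub>FX\<^esub>) \<in> carrier FX" using FX.add.nat_pow_closed[OF FX.one_closed] .
    show "coeff ((add_pow FX l \<one>\<^bsub>FX\<^esub>)) k = coeff \<zero>\<^bsub>FX\<^esub> k" for k
      using nmult_FX_coeff[OF FX.one_closed, of l k] ch by (simp add: univ_poly_one add.nat_pow_one)
  qed auto
  note fr = FX.frobenius_add[OF l chF]
  have "lin x [^]\<^bsub>FX\<^esub> l = mono \<one> 1 [^]\<^bsub>FX\<^esub> l \<oplus>\<^bsub>FX\<^esub> (\<ominus>\<^bsub>FX\<^esub> mono x 0) [^]\<^bsub>FX\<^esub> l"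
    unfolding lin_def a_minus_def by (rule fr[OF m(1,3)])
  also have "mono \<one> 1 [^]\<^bsub>FX\<^esub> l = mono \<one> l" using mono_pow[OF one_closed, of 1 l] by simp
  also have "(\<ominus>\<^bsub>FX\<^esub> mono x 0) [^]\<^bsub>FX\<^esub> l = \<ominus>\<^bsub>FX\<^esub> (mono x 0 [^]\<^bsub>FX\<^esub> l)"
  proof -
    have l0: "l \<noteq> 0" using l by auto
    have "\<zero>\<^bsub>FX\<^esub> = (mono x 0 \<oplus>\<^bsub>FX\<^esub> \<ominus>\<^bsub>FX\<^esub> mono x 0) [^]\<^bsub>FX\<^esub> l"
      using m l0 by (simp add: FX.r_neg FX.nat_pow_zero)
    also have "\<dots> = mono x 0 [^]\<^bsub>FX\<^esub> l \<oplus>\<^bsub>FX\<^esub> (\<ominus>\<^bsub>FX\<^esub> mono x 0) [^]\<^bsub>FX\<^esub> l" by (rule fr[OF m(2,3)])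
    finally have "(\<ominus>\<^bsub>FX\<^esub> mono x 0) [^]\<^bsub>FX\<^esub> l \<oplus>\<^bsub>FX\<^esub> mono x 0 [^]\<^bsub>FX\<^esub> l = \<zero>\<^bsub>FX\<^esub>" using m by (simp add: FX.a_comm)
    then show ?thesis using FX.minus_equality m by simp
  qed
  also have "mono x 0 [^]\<^bsub>FX\<^esub> l = mono (x [^] l) 0" using mono_pow[OF x, of 0 l] by simp
  finally show ?thesis by (simp add: a_minus_def)
qed

definition formal_derivative :: "'a list \<Rightarrow> 'a list" where
  "formal_derivative p = poly_of_fun (length p) (\<lambda>k. (add_pow R (Suc k) (coeff p (Suc k))))"

lemma formal_derivative:
  assumes "p \<in> carrier FX"
  shows "formal_derivative p \<in> carrier FX" "coeff (formal_derivative p) k = (add_pow R (Suc k) (coeff p (Suc k)))"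
proof -
  show "formal_derivative p \<in> carrier FX" unfolding formal_derivative_def using assms poly_of_fun(1) by simp
  have "coeff (formal_derivative p) k = (if k < length p then (add_pow R (Suc k) (coeff p (Suc k))) else \<zero>)"
    unfolding formal_derivative_def using assms by (intro poly_of_fun(2)) simp
  then show "coeff (formal_derivative p) k = (add_pow R (Suc k) (coeff p (Suc k)))"
    using coeff_length[of p "Suc k"] assms add.nat_pow_one[of "Suc k"] by (simp del: add.nat_pow_Suc)
qed

lemma formal_derivative_length: "p \<in> carrier FX \<Longrightarrow> length p = Suc n \<Longrightarrow> length (formal_derivative p) \<le> n"
  using FX_length_le_iff[OF formal_derivative(1)] formal_derivative(2) coeff_length[of p] add.nat_pow_one by (simp del: add.nat_pow_Suc)

text \<open>Write \<open>p = (X - x) s\<close>. The partial sums of \<open>p'(x)\<close> telescope to those of \<open>s(x)\<close>, up to a last term, so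
  that \<open>p'(x) = s(x) = 0\<close>.\<close>

lemma formal_derivative_double_root:
  assumes x: "x \<in> carrier R" and q: "q \<in> carrier FX" and p: "p = lin x \<otimes>\<^bsub>FX\<^esub> (lin x \<otimes>\<^bsub>FX\<^esub> q)"
  shows "eval (formal_derivative p) x = \<zero>"
proof -
  define s where "s = lin x \<otimes>\<^bsub>FX\<^esub> q"
  have s: "s \<in> carrier FX" using x q by (simp add: s_def)
  have pc: "p \<in> carrier FX" using p x s s_def by simp
  have es: "eval s x = \<zero>" unfolding s_def using eval_FX(1)[OF x lin_closed[OF x] q] eval_lin[OF x] eval_FX(3)[OF x q q] by simp
  let ?n = "length s + length p"
  have sum: "(\<Oplus>k\<in>{..<n}. coeff (formal_derivative p) k \<otimes> x [^] k) = (\<Oplus>k\<in>{..<n}. coeff s k \<otimes> x [^] k) \<ominus> (add_pow R n (coeff s n \<otimes> x [^] n))" for n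
  proof (induction n)
    case 0
    then show ?case using s x by (simp add: a_minus_def)
  next
    case (Suc n)
    let ?a = "coeff s n \<otimes> x [^] n" and ?b = "coeff s (Suc n) \<otimes> x [^] Suc n"
    let ?S = "\<Oplus>k\<in>{..<n}. coeff s k \<otimes> x [^] k"
    have ab: "?a \<in> carrier R" "?b \<in> carrier R" "?S \<in> carrier R" using s x by auto
    have d: "coeff (formal_derivative p) n \<otimes> x [^] n = (add_pow R (Suc n) ?a) \<ominus> (add_pow R (Suc n) ?b)"
    proof -
      have "coeff p (Suc n) = coeff s n \<ominus> x \<otimes> coeff s (Suc n)"
        unfolding p s_def[symmetric] coeff_lin_mult[OF x s] by simp
      then have "coeff (formal_derivative p) n \<otimes> x [^] n = (add_pow R (Suc n) ((coeff s n \<ominus> x \<otimes> coeff s (Suc n)) \<otimes> x [^] n))"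
        unfolding formal_derivative(2)[OF pc] using s x by (simp add: add_pow_ldistr del: add.nat_pow_Suc)
      also have "(coeff s n \<ominus> x \<otimes> coeff s (Suc n)) \<otimes> x [^] n = ?a \<oplus> \<ominus> ?b"
        using s x by (simp add: a_minus_def l_distr l_minus) (simp add: m_ac)
      also have "(add_pow R (Suc n) (?a \<oplus> \<ominus> ?b)) = (add_pow R (Suc n) ?a) \<oplus> (add_pow R (Suc n) (\<ominus> ?b))"
        using ab by (simp add: add.nat_pow_distrib del: add.nat_pow_Suc)
      also have "(add_pow R (Suc n) (\<ominus> ?b)) = \<ominus> ((add_pow R (Suc n) ?b))"
        using add.nat_pow_inv[OF ab(2)] by simp
      finally show ?thesis by (simp add: a_minus_def)
    qed
    have "(\<Oplus>k\<in>{..<Suc n}. coeff (formal_derivative p) k \<otimes> x [^] k)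
        = coeff (formal_derivative p) n \<otimes> x [^] n \<oplus> (\<Oplus>k\<in>{..<n}. coeff (formal_derivative p) k \<otimes> x [^] k)"
      using formal_derivative(1)[OF pc] x by (simp add: lessThan_Suc)
    also have "\<dots> = ((add_pow R (Suc n) ?a) \<ominus> (add_pow R (Suc n) ?b)) \<oplus> (?S \<ominus> (add_pow R n ?a))" unfolding d Suc ..
    also have "\<dots> = (?a \<oplus> ?S) \<ominus> (add_pow R (Suc n) ?b)"
    proof -
      have "(add_pow R n ?a) \<oplus> ?a \<oplus> \<ominus> ((add_pow R (Suc n) ?b)) \<oplus> (?S \<oplus> \<ominus> ((add_pow R n ?a))) = ((add_pow R n ?a) \<oplus> \<ominus> ((add_pow R n ?a))) \<oplus> (?a \<oplus> ?S \<oplus> \<ominus> ((add_pow R (Suc n) ?b)))"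
        using ab nmult_closed[OF ab(1), of n] nmult_closed[OF ab(2), of "Suc n"]
        by (simp add: a_ac del: add.nat_pow_Suc)
      then show ?thesis using ab nmult_closed[OF ab(1), of n] by (simp add: a_minus_def r_neg)
    qed
    also have "?a \<oplus> ?S = (\<Oplus>k\<in>{..<Suc n}. coeff s k \<otimes> x [^] k)" using s x by (simp add: lessThan_Suc)
    finally show ?case .
  qed
  have "eval (formal_derivative p) x = (\<Oplus>k\<in>{..<?n}. coeff (formal_derivative p) k \<otimes> x [^] k)"
    using poly_of_fun(3)[of "length p" "\<lambda>k. (add_pow R (Suc k) (coeff p (Suc k)))"] pc formal_derivative(1)[OF pc] x
    by (intro eval_as_finsum) (auto simp: formal_derivative_def simp del: add.nat_pow_Suc)
  also have "\<dots> = (\<Oplus>k\<in>{..<?n}. coeff s k \<otimes> x [^] k) \<ominus> (add_pow R (?n) (coeff s ?n \<otimes> x [^] ?n))" by (rule sum)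
  also have "coeff s ?n = \<zero>" using coeff_length[of s ?n] by simp
  also have "(\<Oplus>k\<in>{..<?n}. coeff s k \<otimes> x [^] k) = eval s x"
    using s x by (intro eval_as_finsum[symmetric]) auto
  finally show ?thesis using es x add.nat_pow_one[of ?n] by (simp add: a_minus_def)
qed

lemma subfield_poly_iff:
  assumes "K \<subseteq> carrier R"
  shows "p \<in> carrier (K[X]) \<longleftrightarrow> p \<in> carrier FX \<and> set p \<subseteq> K"
  using assms by (auto simp: univ_poly_carrier[symmetric] polynomial_def)

lemma subfield_polyI:
  assumes "K \<subseteq> carrier R" "p \<in> carrier FX" "\<And>k. coeff p k \<in> K"
  shows "p \<in> carrier (K[X])"
proof -
  have "set p \<subseteq> K" unfolding coeff_img_restrict[symmetric] using assms(3) by blast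
  then show ?thesis using subfield_poly_iff[OF assms(1)] assms(2) by blast
qed

lemma subfield_poly_coeff:
  assumes "subring K R" "p \<in> carrier (K[X])"
  shows "p \<in> carrier FX" "coeff p k \<in> K"
proof -
  show "p \<in> carrier FX" using assms subfield_poly_iff[OF subringE(1)] by blast
  have "set p \<subseteq> K" using assms subfield_poly_iff[OF subringE(1)] by blast
  then show "coeff p k \<in> K"
    using coeff_img_restrict[of p] coeff_length[of p k] subringE(2)[OF assms(1)] by (cases "k < length p") force+
qed

lemma nmult_one_eq_zero_dvd:
  assumes l: "Factorial_Ring.prime (l::nat)" and ch: "add_pow R l \<one> = \<zero>" and d: "add_pow R (d::nat) \<one> = \<zero>"
  shows "l dvd d"
proof (rule ccontr)
  assume "\<not> l dvd d"
  then have co: "coprime d l" using l by (metis coprime_commute prime_imp_coprime)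
  have "d \<noteq> 0" using \<open>\<not> l dvd d\<close> by (metis dvd_0_right)
  then obtain a b where "d * a = l * b + gcd d l" using bezout_nat by blast
  then have ab: "d * a = l * b + 1" using co by simp
  have z: "add_pow R (n * k) \<one> = \<zero>" if "add_pow R n \<one> = \<zero>" for n k :: nat
    using add.nat_pow_pow[of \<one> k n] that by (simp add: add.nat_pow_one)
  have "add_pow R (l * b + 1) \<one> = add_pow R (l * b) \<one> \<oplus> \<one>" by simp
  then have "\<zero> = \<one>" using z[OF d, of a] z[OF ch, of b] ab by simp
  then show False by simp
qed

lemma nmult_eq:
  assumes "x \<in> carrier R"
  shows "add_pow R (n::nat) x = add_pow R n \<one> \<otimes> x"
  using add_pow_ldistr[of \<one> x n] assms by simp

lemma subfield_nmult: "subring E R \<Longrightarrow> add_pow R (n::nat) \<one> \<in> E"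
  by (induction n) (auto simp: subringE)

text \<open>The minimal polynomial of \<open>x\<close> over \<open>E\<close> divides \<open>X\<^sup>l - x\<^sup>l = (X - x)\<^sup>l\<close>, hence is \<open>(X - x)\<^sup>d\<close> with \<open>d < l\<close>.
  Its second coefficient is \<open>-d x\<close>, and \<open>d\<close> is invertible.\<close>

lemma purely_inseparable_low_degree:
  assumes E: "subfield E R" and x: "x \<in> carrier R" and l: "Factorial_Ring.prime (l::nat)" and ch: "add_pow R l \<one> = \<zero>"
    and xl: "x [^] l \<in> E" and h: "h \<in> carrier (E[X])" "h \<noteq> []" "eval h x = \<zero>" "length h \<le> l"
  shows "x \<in> E"
proof -
  have Es: "subring E R" by (rule subfieldE(1)[OF E])
  have alg: "(algebraic over E) x" by (rule algebraicI[OF h(1-3)])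
  define g where "g = Irr E x"
  note g = IrrE[OF E x alg, folded g_def]
  have gF: "g \<in> carrier FX" "\<And>k. coeff g k \<in> E" using subfield_poly_coeff[OF Es g(1)] by auto
  have "g pdivides h" unfolding g_def by (rule Irr_minimal[OF E x alg h(1,3)])
  then have dl: "length g - 1 \<le> length h - 1" using pdivides_imp_degree_le[OF Es g(1) h(1,2)] by simp
  have d1: "length g - 1 \<ge> 1" by (rule pirreducible_degree[OF E g(1,2)])
  then obtain d where d: "length g = Suc (Suc d)" by (metis Suc_diff_1 Suc_eq_plus1 add.commute diff_0_eq_0 diff_Suc_1 gr0_conv_Suc le_add_diff_inverse not_one_le_zero zero_less_diff zero_less_iff_neq_zero)
  have gne: "g \<noteq> []" using d by auto
  have lead: "coeff g (Suc d) = \<one>" using lead_coeff_simp[OF gne] g(3) d by simp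
  have high: "coeff g k = \<zero>" if "k > Suc d" for k using coeff_length[of g k] that d by simp
  note lp = lin_pow_char[OF x l ch]
  have lc: "lin x [^]\<^bsub>FX\<^esub> l \<in> carrier FX" using x by simp
  have "lin x [^]\<^bsub>FX\<^esub> l \<in> carrier (E[X])"
  proof (rule subfield_polyI[OF subringE(1)[OF Es] lc])
    have xc: "x [^] l \<in> carrier R" using x by simp
    show "coeff (lin x [^]\<^bsub>FX\<^esub> l) k \<in> E" for k
      unfolding lp using mono[of \<one> l] mono[OF xc, of 0] subringE(2,3,5,7)[OF Es] xl
      by (auto simp: a_minus_def)
  qed
  moreover have "eval (lin x [^]\<^bsub>FX\<^esub> l) x = \<zero>"
  proof -
    obtain l' where l': "l = Suc l'" using l by (cases l) auto
    have "lin x [^]\<^bsub>FX\<^esub> l' \<in> carrier FX" using x by simp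
    then show ?thesis unfolding l' using eval_FX[OF x _ lin_closed[OF x]] eval_lin[OF x] by simp
  qed
  ultimately have "g pdivides lin x [^]\<^bsub>FX\<^esub> l" unfolding g_def by (intro Irr_minimal[OF E x alg])
  then obtain q where q: "q \<in> carrier FX" "lin x [^]\<^bsub>FX\<^esub> l = g \<otimes>\<^bsub>FX\<^esub> q"
    by (auto simp: pdivides_def factor_def)
  have "g = lin x [^]\<^bsub>FX\<^esub> Suc d" by (rule lin_pow_divisor[OF x gF(1) lead high q])
  then have "coeff g d = \<ominus> (add_pow R (Suc d) x)" using lin_pow_second[OF x, of d] by simp
  then have "\<ominus> (\<ominus> (add_pow R (Suc d) x)) \<in> E" using gF(2)[of d] subringE(5)[OF Es] by simp
  then have dx: "add_pow R (Suc d) \<one> \<otimes> x \<in> E"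
    using x nmult_eq[OF x, of "Suc d"] add.nat_pow_closed[OF x, of "Suc d"] by (simp del: add.nat_pow_Suc)
  let ?c = "add_pow R (Suc d) \<one>"
  have c: "?c \<in> carrier R" "?c \<in> E" using subfield_nmult[OF Es, of "Suc d"] add.nat_pow_closed[OF one_closed, of "Suc d"] by auto
  have c0: "?c \<noteq> \<zero>"
  proof
    assume "?c = \<zero>"
    then have "l dvd Suc d" by (rule nmult_one_eq_zero_dvd[OF l ch])
    then have "l \<le> Suc d" by (rule dvd_imp_le) simp
    moreover have "length h \<ge> 1" using h(2) by (cases h) auto
    ultimately show False using dl d h(4) by linarith
  qed
  have "inv ?c \<in> E" using subfield_m_inv(1)[OF E, of ?c] c c0 by simp
  then have "inv ?c \<otimes> (?c \<otimes> x) \<in> E" using dx subringE(6)[OF Es] by blast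
  moreover have "inv ?c \<otimes> (?c \<otimes> x) = x"
    using field_inv[OF c(1) c0] c(1) x by (simp add: m_assoc[symmetric] del: add.nat_pow_Suc)
  ultimately show ?thesis by simp
qed

text \<open>Divide \<open>h\<close> by \<open>X\<^sup>l - x\<^sup>l = (X - x)\<^sup>l\<close> over \<open>E\<close>. A nonzero remainder is a polynomial of degree less than \<open>l\<close> that
  vanishes at \<open>x\<close>, and \<open>x\<close> lies in \<open>E\<close>. If the remainder were zero, \<open>h\<close> would have \<open>x\<close> as a double root; its
  derivative, which is not zero because of the coefficient at \<open>X\<close>, would contradict the minimality of \<open>h\<close>.\<close>

lemma mem_of_separable_root:
  assumes E: "subfield E R" and K: "subring K R" "K \<subseteq> E" and x: "x \<in> carrier R"
    and l: "Factorial_Ring.prime (l::nat)" and ch: "add_pow R l \<one> = \<zero>" and xl: "x [^] l \<in> E"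
    and h: "h \<in> carrier (K[X])" "eval h x = \<zero>" "coeff h 1 \<noteq> \<zero>"
    and min: "\<And>g. g \<in> carrier (K[X]) \<Longrightarrow> g \<noteq> [] \<Longrightarrow> eval g x = \<zero> \<Longrightarrow> length g \<ge> length h"
  shows "x \<in> E"
proof -
  have Es: "subring E R" by (rule subfieldE(1)[OF E])
  note hF = subfield_poly_coeff[OF K(1) h(1)]
  have hE: "h \<in> carrier (E[X])" by (rule subfield_polyI[OF subringE(1)[OF Es] hF(1)]) (use hF(2) K(2) in auto)
  note lp = lin_pow_char[OF x l ch]
  let ?b = "lin x [^]\<^bsub>FX\<^esub> l"
  have bF: "?b \<in> carrier FX" using x by simp
  have xc: "x [^] l \<in> carrier R" using x by simp
  have bE: "?b \<in> carrier (E[X])"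
    by (rule subfield_polyI[OF subringE(1)[OF Es] bF], unfold lp)
       (use mono[of \<one> l] mono[OF xc, of 0] subringE(2,3,5,7)[OF Es] xl in \<open>auto simp: a_minus_def\<close>)
  have bl: "length ?b = Suc l" using FX_monicI[OF bF, of l] lin_pow_lead[OF x, of l] by simp
  have b0: "?b \<noteq> \<zero>\<^bsub>E[X]\<^esub>" using bl by (auto simp: univ_poly_zero)
  obtain q r where qr: "q \<in> carrier (E[X])" "r \<in> carrier (E[X])" "h = (?b \<otimes>\<^bsub>E[X]\<^esub> q) \<oplus>\<^bsub>E[X]\<^esub> r"
      "r = \<zero>\<^bsub>E[X]\<^esub> \<or> length r - 1 < length ?b - 1"
    using field_long_division_theorem_shell[OF E hE bE b0] by blast
  have qF: "q \<in> carrier FX" and rF: "r \<in> carrier FX" using subfield_poly_coeff(1)[OF Es] qr by auto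
  have heq: "h = (?b \<otimes>\<^bsub>FX\<^esub> q) \<oplus>\<^bsub>FX\<^esub> r" using qr(3) by (simp add: univ_poly_mult univ_poly_add)
  obtain l' where l': "l = Suc (Suc l')" using prime_ge_2_nat[OF l] by (metis add_2_eq_Suc le_Suc_ex)
  have b2: "?b = lin x \<otimes>\<^bsub>FX\<^esub> (lin x \<otimes>\<^bsub>FX\<^esub> lin x [^]\<^bsub>FX\<^esub> l')" unfolding l' using x by (simp add: FX.m_ac)
  have lnc: "lin x [^]\<^bsub>FX\<^esub> l' \<in> carrier FX" using x by simp
  have r0: "r \<noteq> []"
  proof
    assume "r = []"
    then have "h = ?b \<otimes>\<^bsub>FX\<^esub> q" unfolding heq using bF qF by (simp add: FX_zero[symmetric])
    then have hh: "h = lin x \<otimes>\<^bsub>FX\<^esub> (lin x \<otimes>\<^bsub>FX\<^esub> (lin x [^]\<^bsub>FX\<^esub> l' \<otimes>\<^bsub>FX\<^esub> q))"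
      unfolding b2 using lin_closed[OF x] lnc qF by (simp add: FX.m_assoc)
    have "eval (formal_derivative h) x = \<zero>" by (rule formal_derivative_double_root[OF x _ hh]) (use lnc qF in simp)
    moreover have "coeff (formal_derivative h) 0 = coeff h 1" using formal_derivative(2)[OF hF(1), of 0] hF(1) by simp
    then have "formal_derivative h \<noteq> []" using h(3) by auto
    moreover have "formal_derivative h \<in> carrier (K[X])"
    proof (rule subfield_polyI[OF subringE(1)[OF K(1)] formal_derivative(1)[OF hF(1)]])
      show "coeff (formal_derivative h) k \<in> K" for k
        unfolding formal_derivative(2)[OF hF(1)] nmult_eq[OF FX_coeff[OF hF(1)]]
        using subfield_nmult[OF K(1), of "Suc k"] hF(2) subringE(6)[OF K(1)] by blast
    qed
    ultimately have "length (formal_derivative h) \<ge> length h" using min by blast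
    moreover have "length h > 0" using h(3) by auto
    then have "length (formal_derivative h) \<le> length h - 1" using formal_derivative_length[OF hF(1), of "length h - 1"] by simp
    ultimately show False using \<open>length h > 0\<close> by linarith
  qed
  have "eval ?b x = \<zero>"
    unfolding b2 using eval_FX(1)[OF x lin_closed[OF x]] eval_lin[OF x] eval_FX(3)[OF x] lnc lin_closed[OF x] by simp
  then have "eval r x = \<zero>"
    using h(2) eval_FX(2)[OF x FX.m_closed[OF bF qF] rF] eval_FX(1)[OF x bF qF] eval_FX(3)[OF x qF qF] eval_FX(3)[OF x rF rF]
    unfolding heq by simp
  moreover have "length r \<le> l" using qr(4) r0 bl by (auto simp: univ_poly_zero)
  ultimately show ?thesis using purely_inseparable_low_degree[OF E x l ch xl qr(2) r0] by blast
qed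

text \<open>For \<open>R\<close> algebraic over a subfield \<open>K\<close> this says that \<open>R = K R\<^sup>l\<close>, the criterion of MacLane for separability. It
  is void in characteristic zero.\<close>

definition no_proper_power_subring :: "'a set \<Rightarrow> bool" where
  "no_proper_power_subring K \<longleftrightarrow> (\<forall>l E. Factorial_Ring.prime (l::nat) \<longrightarrow> add_pow R l \<one> = \<zero> \<longrightarrow>
     subring E R \<longrightarrow> K \<subseteq> E \<longrightarrow> (\<forall>x\<in>carrier R. x [^] l \<in> E) \<longrightarrow> E = carrier R)"

end

section \<open>A criterion for separability\<close>

context field
begin

interpretation FX: domain FX
  by (rule FX_domain)

text \<open>A list contains an independent list with the same span; if the dimension is the length of the whole list, nothing
  can have been dropped.\<close>

lemma spanning_independent:
  assumes K: "subfield K R" and Us: "set Us \<subseteq> carrier R" and dim: "dimension (length Us) K (Span K Us)"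
  shows "independent K Us"
proof -
  have "set Us \<subseteq> carrier R \<Longrightarrow> \<exists>Vs. independent K Vs \<and> Span K Vs = Span K Us \<and> length Vs \<le> length Us \<and>
      (length Vs = length Us \<longrightarrow> independent K Us)" for Us
  proof (induction Us)
    case Nil
    then show ?case by (intro exI[of _ "[]"]) auto
  next
    case (Cons u Us)
    then have u: "u \<in> carrier R" "set Us \<subseteq> carrier R" by auto
    obtain Vs where Vs: "independent K Vs" "Span K Vs = Span K Us" "length Vs \<le> length Us"
      "length Vs = length Us \<longrightarrow> independent K Us" using Cons.IH[OF u(2)] by blast
    show ?case
    proof (cases "u \<in> Span K Us")
      case True
      have "Span K (u # Us) = Span K Us"
      proof
        show "Span K (u # Us) \<subseteq> Span K Us"
          using mono_Span_subset[OF K, of "u # Us" Us] True Span_base_incl[OF K u(2)] u by auto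
        show "Span K Us \<subseteq> Span K (u # Us)"
          using mono_Span_subset[OF K, of Us "u # Us"] Span_base_incl[OF K, of "u # Us"] u by auto
      qed
      then show ?thesis using Vs by (intro exI[of _ Vs]) auto
    next
      case False
      then have "independent K (u # Vs)" using Vs u by (intro li_Cons) auto
      moreover have "Span K (u # Vs) = Span K (u # Us)" using Vs(2) by simp
      moreover have "length Vs = length Us \<Longrightarrow> independent K (u # Us)" using Vs(4) u False by (intro li_Cons) auto
      ultimately show ?thesis using Vs(3) by (intro exI[of _ "u # Vs"]) auto
    qed
  qed
  then obtain Vs where Vs: "independent K Vs" "Span K Vs = Span K Us" "length Vs \<le> length Us"
      "length Vs = length Us \<longrightarrow> independent K Us" using Us by blast
  have "dimension (length Vs) K (Span K Us)" using dimensionI[OF K Vs(1,2)] .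
  then have "length Vs = length Us" using dimension_is_inj[OF K dim] by simp
  then show ?thesis using Vs by blast
qed

lemma frobenius_combine:
  assumes l: "Factorial_Ring.prime (l::nat)" and ch: "add_pow R l \<one> = \<zero>"
    and "set Ks \<subseteq> carrier R" "set Us \<subseteq> carrier R"
  shows "(combine Ks Us) [^] l = combine (map (\<lambda>x. x [^] l) Ks) (map (\<lambda>x. x [^] l) Us)"
proof -
  have l0: "l \<noteq> 0" using l by auto
  show ?thesis
    using assms(3,4)
  proof (induction Ks Us rule: combine.induct)
    case (1 k Ks u Us)
    then show ?case
      using frobenius_add[OF l ch, of "k \<otimes> u" "combine Ks Us"] combine_in_carrier[of Ks Us]
      by (simp add: nat_pow_distrib)
  qed (use l0 in \<open>auto simp: nat_pow_zero\<close>)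
qed

lemma combine_mult_mem:
  assumes "set Ks \<subseteq> K" "set Us \<subseteq> carrier R" "K \<subseteq> carrier R" "c \<in> carrier R"
    and E: "\<zero> \<in> E" "\<And>a b. a \<in> E \<Longrightarrow> b \<in> E \<Longrightarrow> a \<oplus> b \<in> E" "\<And>k a. k \<in> K \<Longrightarrow> a \<in> E \<Longrightarrow> k \<otimes> a \<in> E"
    and U: "\<And>u. u \<in> set Us \<Longrightarrow> u \<otimes> c \<in> E"
  shows "combine Ks Us \<otimes> c \<in> E"
  using assms(1,2) U
proof (induction Ks Us rule: combine.induct)
  case (1 k Ks u Us)
  have c: "k \<in> carrier R" "u \<in> carrier R" "combine Ks Us \<in> carrier R"
    using 1 assms(3) combine_in_carrier[of Ks Us] by auto
  have "combine (k # Ks) (u # Us) \<otimes> c = k \<otimes> (u \<otimes> c) \<oplus> combine Ks Us \<otimes> c"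
    using c assms(4) by (simp add: l_distr m_assoc)
  then show ?case using 1 E by simp
qed (use E assms(4) in auto)

text \<open>Extend to a basis. The \<open>l\<close>-th powers of its members span a subring that contains \<open>K\<close> and all \<open>l\<close>-th powers,
  that is, everything; being as many as the dimension, they are independent.\<close>

lemma frobenius_independent:
  assumes K: "subfield K R" and dim: "dimension n K (carrier R)" and sep: "no_proper_power_subring K"
    and l: "Factorial_Ring.prime (l::nat)" and ch: "add_pow R l \<one> = \<zero>" and Us: "independent K Us"
  shows "independent K (map (\<lambda>x. x [^] l) Us)"
proof -
  let ?p = "\<lambda>x. x [^] l"
  have Kc: "K \<subseteq> carrier R" and Ks: "subring K R" using subfieldE[OF K] by auto
  have Uc: "set Us \<subseteq> carrier R" by (rule independent_in_carrier[OF Us])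
  obtain Vs where Vs: "length (Vs @ Us) = n" "independent K (Vs @ Us)" "Span K (Vs @ Us) = carrier R"
    using complete_base[OF K dim Us Uc] by blast
  let ?B = "Vs @ Us"
  have Bc: "set ?B \<subseteq> carrier R" by (rule independent_in_carrier[OF Vs(2)])
  let ?P = "map ?p ?B"
  have Pc: "set ?P \<subseteq> carrier R" using Bc by auto
  define E where "E = Span K ?P"
  note Ep = Span_subgroup_props[OF K Pc, folded E_def]
  have smult: "k \<otimes> a \<in> E" if "k \<in> K" "a \<in> E" for k a
    using Span_smult_closed[OF K Pc] that unfolding E_def by blast
  have comb: "combine Ks ?P \<in> E" if "set Ks \<subseteq> K" for Ks
    unfolding E_def using Span_eq_combine_set[OF K Pc] that by blast
  have pow: "?p x \<in> E" if x: "x \<in> carrier R" for x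
  proof -
    obtain Ks' where Ks': "set Ks' \<subseteq> K" "x = combine Ks' ?B"
      using x unfolding Vs(3)[symmetric] Span_eq_combine_set[OF K Bc] by blast
    have kp: "k [^] l \<in> K" if "k \<in> K" for k
    proof -
      have "k [^] j \<in> K" for j :: nat using that by (induction j) (auto simp: subringE[OF Ks])
      then show ?thesis .
    qed
    have "?p x = combine (map ?p Ks') ?P" unfolding Ks'(2) by (rule frobenius_combine[OF l ch]) (use Ks' Kc Bc in auto)
    moreover have "set (map ?p Ks') \<subseteq> K" using Ks'(1) kp by auto
    ultimately show ?thesis using comb by simp
  qed
  have multp: "z \<otimes> ?p x \<in> E" if z: "z \<in> E" and x: "x \<in> carrier R" for z x
  proof -
    obtain Ks' where Ks': "set Ks' \<subseteq> K" "z = combine Ks' ?P"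
      using z unfolding E_def Span_eq_combine_set[OF K Pc] by blast
    show ?thesis unfolding Ks'(2)
    proof (rule combine_mult_mem[OF Ks'(1) Pc Kc])
      show "u \<otimes> ?p x \<in> E" if uP: "u \<in> set ?P" for u
      proof -
        obtain b where b: "b \<in> set ?B" "u = ?p b" using uP by auto
        then have bc: "b \<in> carrier R" using Bc by blast
        have "u \<otimes> ?p x = ?p (b \<otimes> x)" using b bc x by (simp add: nat_pow_distrib)
        then show ?thesis using pow[of "b \<otimes> x"] bc x by simp
      qed
    qed (use Ep smult x in auto)
  qed
  have mult: "z \<otimes> w \<in> E" if z: "z \<in> E" and w: "w \<in> E" for z w
  proof -
    have zc: "z \<in> carrier R" using Ep(1) z by auto
    obtain Ks' where Ks': "set Ks' \<subseteq> K" "w = combine Ks' ?P"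
      using w unfolding E_def Span_eq_combine_set[OF K Pc] by blast
    have wz: "w \<otimes> z \<in> E" unfolding Ks'(2)
    proof (rule combine_mult_mem[OF Ks'(1) Pc Kc zc])
      show "u \<otimes> z \<in> E" if uP: "u \<in> set ?P" for u
      proof -
        obtain b where b: "b \<in> set ?B" "u = ?p b" using uP by auto
        then have bc: "b \<in> carrier R" using Bc by blast
        then have "z \<otimes> ?p b \<in> E" using multp z by blast
        then show ?thesis using b bc zc m_comm[of z "?p b"] by simp
      qed
    qed (use Ep smult in auto)
    have "w \<in> carrier R" using Ep(1) w by auto
    then show ?thesis using wz zc m_comm by simp
  qed
  have one: "\<one> \<in> E" using pow[OF one_closed] by simp
  have KE: "K \<subseteq> E"
  proof
    fix k assume k: "k \<in> K"
    then have "k \<otimes> \<one> \<in> E" using smult one by blast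
    then show "k \<in> E" using k Kc by auto
  qed
  have "subring E R"
    by (rule subringI) (use Ep one mult in auto)
  then have "E = carrier R"
    using sep[unfolded no_proper_power_subring_def, rule_format, OF l ch] KE pow by blast
  then have "dimension (length ?P) K (Span K ?P)" using dim Vs(1) unfolding E_def by simp
  then have "independent K (map ?p Vs @ map ?p Us)" using spanning_independent[OF K Pc] by simp
  then show ?thesis
  proof (induction "map ?p Vs" arbitrary: Vs)
    case (Cons v ws)
    then show ?case using independent_backwards(2)[of K] by (metis append_Cons list.map_disc_iff map_eq_Cons_D)
  qed simp
qed

end

lemma (in field) characteristic_prime:
  assumes "add_pow R (d::nat) \<one> = \<zero>" "d > 0"
  obtains l where "Factorial_Ring.prime (l::nat)" "add_pow R l \<one> = \<zero>"
proof -
  define l where "l = (LEAST l. l > 0 \<and> add_pow R (l::nat) \<one> = \<zero>)"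
  have l: "l > 0" "add_pow R l \<one> = \<zero>"
    using LeastI[of "\<lambda>l. l > 0 \<and> add_pow R (l::nat) \<one> = \<zero>" d] assms by (auto simp: l_def)
  have min: "l \<le> k" if "k > 0" "add_pow R k \<one> = \<zero>" for k
    unfolding l_def using that by (intro Least_le) simp
  have "l \<noteq> 1" using l by auto
  have "Factorial_Ring.prime l"
  proof (rule prime_natI)
    show "2 \<le> l" using l \<open>l \<noteq> 1\<close> by linarith
    fix a b assume ab: "l dvd a * b"
    have "add_pow R (a * b) \<one> = \<zero>"
    proof -
      obtain c where "a * b = l * c" using ab by auto
      then show ?thesis using add.nat_pow_pow[of \<one> c l] l by (simp add: add.nat_pow_one)
    qed
    moreover have "add_pow R (a * b) \<one> = add_pow R a \<one> \<otimes> add_pow R b \<one>"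
      using add.nat_pow_pow[of \<one> a b] nmult_eq[of "add_pow R b \<one>" a] add.nat_pow_pow[of \<one> b a] add.nat_pow_closed[OF one_closed] by (simp add: mult.commute)
    ultimately have "add_pow R a \<one> = \<zero> \<or> add_pow R b \<one> = \<zero>"
      using integral add.nat_pow_closed[OF one_closed] by metis
    moreover have "l dvd k" if k: "add_pow R k \<one> = \<zero>" for k
    proof -
      have "add_pow R k \<one> = add_pow R (l * (k div l)) \<one> \<oplus> add_pow R (k mod l) \<one>"
        using add.nat_pow_mult[of \<one> "l * (k div l)" "k mod l"] by simp
      moreover have "add_pow R (l * (k div l)) \<one> = \<zero>"
        using add.nat_pow_pow[of \<one> "k div l" l] l by (simp add: add.nat_pow_one)
      ultimately have "add_pow R (k mod l) \<one> = \<zero>" using k add.nat_pow_closed[OF one_closed, of "k mod l"] by simp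
      then have "k mod l = 0" using min[of "k mod l"] l(1) mod_less_divisor[OF l(1), of k] by (meson gr0I leD)
      then show ?thesis by auto
    qed
    ultimately show "l dvd a \<or> l dvd b" by blast
  qed
  then show ?thesis using that l by blast
qed

lemma (in domain) rupture_kernel:
  assumes K: "subring K R" and p: "p \<in> carrier (K[X])" and h: "h \<in> carrier (K[X])"
    and z: "rupture_surj K p h = \<zero>\<^bsub>Rupt K p\<^esub>"
  shows "\<exists>g\<in>carrier (K[X]). h = p \<otimes>\<^bsub>K[X]\<^esub> g"
proof -
  interpret UP: domain "K[X]" by (rule univ_poly_is_domain[OF K])
  interpret I: ideal "PIdl\<^bsub>K[X]\<^esub> p" "K[X]" using UP.cgenideal_ideal[OF p] .
  have "h \<in> PIdl\<^bsub>K[X]\<^esub> p"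
    using z I.rcos_const_imp_mem h by (simp add: rupture_def FactRing_def)
  then show ?thesis unfolding cgenideal_def using p UP.m_comm by auto
qed

lemma (in ring_hom_ring) map_poly_hom:
  assumes inj: "inj_on h (carrier R)" "domain R" "field S" and x: "x \<in> carrier S"
  shows "(\<lambda>p. eval (map h p) x) \<in> ring_hom (poly_ring R) S"
proof -
  interpret D: domain R by fact
  interpret S: field S by fact
  have set: "set p \<subseteq> carrier R" if "p \<in> carrier (poly_ring R)" for p using D.FX_set[OF that] .
  have hs: "set (map h p) \<subseteq> carrier S" if "p \<in> carrier (poly_ring R)" for p using set[OF that] by auto
  have en: "eval (normalize l) x = eval l x" if "set l \<subseteq> carrier S" for l
    using eval_normalize[OF that x] by simp
  show ?thesis
  proof (rule ring_hom_memI)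
    fix p q assume pq: "p \<in> carrier (poly_ring R)" "q \<in> carrier (poly_ring R)"
    show "eval (map h p) x \<in> carrier S" using eval_in_carrier[OF hs[OF pq(1)] x] .
    have mc: "set (map h (R.poly_mult p q)) \<subseteq> carrier S" "set (map h (R.poly_add p q)) \<subseteq> carrier S"
    proof -
      have "set (map h l) \<subseteq> carrier S" if "set l \<subseteq> carrier R" for l using that by auto
      then show "set (map h (R.poly_mult p q)) \<subseteq> carrier S" "set (map h (R.poly_add p q)) \<subseteq> carrier S"
        using R.poly_mult_in_carrier[OF set[OF pq(1)] set[OF pq(2)]] R.poly_add_in_carrier[OF set[OF pq(1)] set[OF pq(2)]] by blast+
    qed
    show "eval (map h (p \<otimes>\<^bsub>poly_ring R\<^esub> q)) x = eval (map h p) x \<otimes>\<^bsub>S\<^esub> eval (map h q) x"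
      using en[OF mc(1)] poly_mult_hom'[OF set[OF pq(1)] set[OF pq(2)]] S.eval_poly_mult[OF hs[OF pq(1)] hs[OF pq(2)] x]
      by (simp add: univ_poly_mult del: S.poly_mult.simps R.poly_mult.simps)
    show "eval (map h (p \<oplus>\<^bsub>poly_ring R\<^esub> q)) x = eval (map h p) x \<oplus>\<^bsub>S\<^esub> eval (map h q) x"
      using en[OF mc(2)] poly_add_hom'[OF set[OF pq(1)] set[OF pq(2)]] S.eval_poly_add[OF hs[OF pq(1)] hs[OF pq(2)] x]
      by (simp add: univ_poly_add del: S.poly_add.simps R.poly_add.simps)
  next
    show "eval (map h \<one>\<^bsub>poly_ring R\<^esub>) x = \<one>\<^bsub>S\<^esub>" using x by (simp add: univ_poly_one)
  qed
qed

lemma (in domain) rupture_surj_onto: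
  assumes z: "z \<in> carrier (Rupt K p)" shows "z \<in> rupture_surj K p ` carrier (K[X])"
proof -
  have "carrier (Rupt K p) = a_rcosets\<^bsub>K[X]\<^esub> (PIdl\<^bsub>K[X]\<^esub> p)" by (simp add: rupture_def FactRing_def)
  then have "z \<in> a_rcosets\<^bsub>K[X]\<^esub> (PIdl\<^bsub>K[X]\<^esub> p)" using z by blast
  then show ?thesis unfolding A_RCOSETS_def' by blast
qed

text \<open>Read off from the inverse of \<open>q\<close> in the field \<open>K[X]/(p)\<close>.\<close>

lemma (in field) pirreducible_bezout:
  assumes K: "subfield K R" and p: "p \<in> carrier (K[X])" "pirreducible K p"
    and q: "q \<in> carrier (K[X])" "\<not> p pdivides q"
  shows "\<exists>w\<in>carrier (K[X]). \<exists>h\<in>carrier (K[X]). \<one>\<^bsub>K[X]\<^esub> = (p \<otimes>\<^bsub>K[X]\<^esub> w) \<oplus>\<^bsub>K[X]\<^esub> (h \<otimes>\<^bsub>K[X]\<^esub> q)"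
proof -
  have Ks: "subring K R" by (rule subfieldE(1)[OF K])
  interpret FX: domain FX by (rule FX_domain)
  interpret KX: domain "K[X]" by (rule univ_poly_is_domain[OF Ks])
  define T where "T = Rupt K p"
  define s where "s = rupture_surj K p"
  interpret Q: field T using rupture_is_field_iff_pirreducible[OF K p(1)] p(2) by (simp add: T_def)
  interpret s: ring_hom_ring "K[X]" T s unfolding T_def s_def by (rule rupture_surj_hom(2)[OF Ks p(1)])
  have "s q \<noteq> \<zero>\<^bsub>T\<^esub>"
  proof
    assume "s q = \<zero>\<^bsub>T\<^esub>"
    then obtain h where h: "h \<in> carrier (K[X])" "q = p \<otimes>\<^bsub>K[X]\<^esub> h"
      using rupture_kernel[OF Ks p(1) q(1)] unfolding s_def T_def by blast
    have "h \<in> carrier FX" using subfield_poly_coeff(1)[OF Ks h(1)] .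
    then have "p pdivides q" using h(2) by (auto simp: pdivides_def factor_def univ_poly_mult)
    then show False using q(2) by simp
  qed
  moreover have sq: "s q \<in> carrier T" using q(1) by simp
  ultimately have inv: "inv\<^bsub>T\<^esub> (s q) \<in> carrier T" "inv\<^bsub>T\<^esub> (s q) \<otimes>\<^bsub>T\<^esub> s q = \<one>\<^bsub>T\<^esub>"
    using Q.field_inv by auto
  have "inv\<^bsub>T\<^esub> (s q) \<in> s ` carrier (K[X])" using rupture_surj_onto[of _ K p] inv(1) unfolding s_def T_def by blast
  then obtain h where h0: "inv\<^bsub>T\<^esub> (s q) = s h" and h: "h \<in> carrier (K[X])" by (rule imageE)
  have hd: "h \<otimes>\<^bsub>K[X]\<^esub> q \<in> carrier (K[X])" using h q(1) by simp
  have "s (h \<otimes>\<^bsub>K[X]\<^esub> q) = \<one>\<^bsub>T\<^esub>" using inv(2) unfolding h0 s.hom_mult[OF h q(1)] .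
  then have "s (\<one>\<^bsub>K[X]\<^esub> \<ominus>\<^bsub>K[X]\<^esub> (h \<otimes>\<^bsub>K[X]\<^esub> q)) = \<zero>\<^bsub>T\<^esub>"
    using hd by (simp add: a_minus_def Q.r_neg)
  moreover have d: "\<one>\<^bsub>K[X]\<^esub> \<ominus>\<^bsub>K[X]\<^esub> (h \<otimes>\<^bsub>K[X]\<^esub> q) \<in> carrier (K[X])" using hd by simp
  ultimately obtain w where w: "w \<in> carrier (K[X])" "\<one>\<^bsub>K[X]\<^esub> \<ominus>\<^bsub>K[X]\<^esub> (h \<otimes>\<^bsub>K[X]\<^esub> q) = p \<otimes>\<^bsub>K[X]\<^esub> w"
    using rupture_kernel[OF Ks p(1) d] unfolding s_def T_def by blast
  have "\<one>\<^bsub>K[X]\<^esub> = (p \<otimes>\<^bsub>K[X]\<^esub> w) \<oplus>\<^bsub>K[X]\<^esub> (h \<otimes>\<^bsub>K[X]\<^esub> q)"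
    unfolding w(2)[symmetric] using hd by (simp add: a_minus_def KX.a_assoc KX.l_neg)
  then show ?thesis using w(1) h by blast
qed

text \<open>Let \<open>g\<close> be the minimal polynomial of \<open>x\<close> and suppose that it has a multiple root \<open>a\<close>. Its derivative also vanishes at
  \<open>a\<close>; a Bezout relation between the two would give \<open>1 = 0\<close>, so the derivative is zero. Hence there is a prime \<open>l\<close> that is
  zero in the field, and \<open>g = h(X\<^sup>l)\<close> for some \<open>h\<close> of smaller degree \<open>r\<close>. Then \<open>1, x\<^sup>l, \<dots>, x\<^bsup>l r\<^esup>\<close> are dependent over
  \<open>K\<close>, although \<open>1, x, \<dots>, x\<^sup>r\<close> are independent, contrary to \<open>frobenius_independent\<close>. The root lies in some field
  \<open>A\<close> over \<open>R\<close>, which will be the algebraic closure.\<close>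

lemma (in field) minimal_polynomial_simple_roots:
  assumes K: "subfield K R" and dim: "dimension n K (carrier R)" and sep: "no_proper_power_subring K"
    and x: "x \<in> carrier R" and A: "field A" and i: "i \<in> ring_hom R A" and a: "a \<in> carrier A"
  shows "ring.alg_mult A (map i (Irr K x)) a \<le> 1"
proof (rule ccontr)
  assume am: "\<not> ?thesis"
  interpret FX: domain FX by (rule FX_domain)
  interpret A: field A by (rule A)
  interpret AX: domain A.FX by (rule A.FX_domain)
  interpret i: ring_hom_ring R A i using ring_hom_ringI2[OF ring_axioms A.ring_axioms i] .
  have Ks: "subring K R" by (rule subfieldE(1)[OF K])
  interpret KX: domain "K[X]" by (rule univ_poly_is_domain[OF Ks])
  have inj: "inj_on i (carrier R)"
  proof (rule i.non_trivial_field_hom_imp_inj[OF field_axioms])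
    have "\<one>\<^bsub>A\<^esub> \<in> i ` carrier R" using i.hom_one by (metis imageI one_closed)
    then show "i ` carrier R \<noteq> {\<zero>\<^bsub>A\<^esub>}" using A.one_not_zero by blast
  qed
  have alg: "(algebraic over K) x"
    using finite_dimension_imp_algebraic[OF K carrier_is_subring] finite_dimensionI[OF dim] x by simp
  define g where "g = Irr K x"
  note g = IrrE[OF K x alg, folded g_def]
  have gF: "g \<in> carrier FX" "\<And>k. coeff g k \<in> K" using subfield_poly_coeff[OF Ks g(1)] by auto
  obtain d where d: "length g = Suc (Suc d)"
    using pirreducible_degree[OF K g(1,2)] by (cases "length g"; cases "length g - 1") auto
  have gne: "g \<noteq> []" using d by auto
  have lead: "coeff g (Suc d) = \<one>" using lead_coeff_simp[OF gne] g(3) d by simp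
  have dK: "formal_derivative g \<in> carrier (K[X])"
  proof (rule subfield_polyI[OF subringE(1)[OF Ks] formal_derivative(1)[OF gF(1)]])
    show "coeff (formal_derivative g) k \<in> K" for k
      unfolding formal_derivative(2)[OF gF(1)] nmult_eq[OF FX_coeff[OF gF(1)]]
      using subfield_nmult[OF Ks, of "Suc k"] gF(2) subringE(6)[OF Ks] by blast
  qed
  have set: "set p \<subseteq> carrier R" if "p \<in> carrier FX" for p by (rule FX_set[OF that])
  have mc: "map i p \<in> carrier A.FX" if p: "p \<in> carrier FX" for p
  proof (cases "p = []")
    case False
    then have "hd p \<noteq> \<zero>" "hd p \<in> carrier R" using p set[OF p] by (auto simp: univ_poly_carrier[symmetric] polynomial_def)
    then have "i (hd p) \<noteq> \<zero>\<^bsub>A\<^esub>" using inj i.hom_zero by (metis inj_onD zero_closed)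
    moreover have "set (map i p) \<subseteq> carrier A" using set[OF p] by auto
    ultimately show ?thesis using False by (simp add: univ_poly_carrier[symmetric] polynomial_def hd_map)
  qed (simp add: A.FX_zero[symmetric])
  have cm: "A.coeff (map i p) k = i (coeff p k)" if "p \<in> carrier FX" for p k
    using i.coeff_hom'[OF set[OF that], of k] by simp
  define \<Psi> where "\<Psi> p = A.eval (map i p) a" for p
  have \<Psi>: "\<Psi> \<in> ring_hom FX A"
    using i.map_poly_hom[OF inj domain_axioms A a] by (simp add: \<Psi>_def[abs_def])
  have "A.lin a [^]\<^bsub>A.FX\<^esub> (2::nat) pdivides\<^bsub>A\<^esub> map i g"
    using A.le_alg_mult_imp_pdivides[OF a mc[OF gF(1)], of 2] am unfolding g_def A.lin_eq[OF a] by simp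
  then obtain q where q: "q \<in> carrier A.FX" "map i g = A.lin a [^]\<^bsub>A.FX\<^esub> (2::nat) \<otimes>\<^bsub>A.FX\<^esub> q"
    by (auto simp: pdivides_def factor_def)
  have lc: "A.lin a \<in> carrier A.FX" by (rule A.lin_closed[OF a])
  have q2: "map i g = A.lin a \<otimes>\<^bsub>A.FX\<^esub> (A.lin a \<otimes>\<^bsub>A.FX\<^esub> q)"
    unfolding q(2) numeral_2_eq_2 using lc q(1) by (simp add: AX.m_assoc)
  have \<Psi>g: "\<Psi> g = \<zero>\<^bsub>A\<^esub>"
    unfolding \<Psi>_def q2 using A.eval_FX(1)[OF a lc AX.m_closed[OF lc q(1)]] A.eval_lin[OF a] A.eval_FX(3)[OF a AX.m_closed[OF lc q(1)] q(1)] by simp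
  have \<Psi>d: "\<Psi> (formal_derivative g) = \<zero>\<^bsub>A\<^esub>"
  proof -
    have "map i (formal_derivative g) = A.formal_derivative (map i g)"
    proof (rule A.FX_eqI[OF mc[OF formal_derivative(1)[OF gF(1)]] A.formal_derivative(1)[OF mc[OF gF(1)]]])
      fix k
      have hn: "i (add_pow R n z) = add_pow A n (i z)" if "z \<in> carrier R" for n :: nat and z
        using that by (induction n) auto
      show "A.coeff (map i (formal_derivative g)) k = A.coeff (A.formal_derivative (map i g)) k"
        unfolding cm[OF formal_derivative(1)[OF gF(1)]] A.formal_derivative(2)[OF mc[OF gF(1)]] formal_derivative(2)[OF gF(1)] cm[OF gF(1)]
        by (rule hn) (use gF in simp)
    qed
    then show ?thesis unfolding \<Psi>_def using A.formal_derivative_double_root[OF a q(1) q2] by simp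
  qed
  have dg0: "formal_derivative g = []"
  proof (rule ccontr)
    assume ne: "formal_derivative g \<noteq> []"
    have "\<not> g pdivides formal_derivative g"
    proof
      assume "g pdivides formal_derivative g"
      then have "length g - 1 \<le> length (formal_derivative g) - 1" using pdivides_imp_degree_le[OF Ks g(1) dK ne] by simp
      moreover have "length (formal_derivative g) \<le> Suc d" by (rule formal_derivative_length[OF gF(1) d])
      moreover have "length (formal_derivative g) > 0" using ne by simp
      ultimately show False using d by linarith
    qed
    then obtain w h where w: "w \<in> carrier (K[X])" and h: "h \<in> carrier (K[X])"
      and "\<one>\<^bsub>K[X]\<^esub> = (g \<otimes>\<^bsub>K[X]\<^esub> w) \<oplus>\<^bsub>K[X]\<^esub> (h \<otimes>\<^bsub>K[X]\<^esub> formal_derivative g)"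
      using pirreducible_bezout[OF K g(1,2) dK] by blast
    then have one: "\<one>\<^bsub>FX\<^esub> = (g \<otimes>\<^bsub>FX\<^esub> w) \<oplus>\<^bsub>FX\<^esub> (h \<otimes>\<^bsub>FX\<^esub> formal_derivative g)"
      by (simp add: univ_poly_mult univ_poly_add univ_poly_one)
    have c: "w \<in> carrier FX" "h \<in> carrier FX" "formal_derivative g \<in> carrier FX"
      using subfield_poly_coeff(1)[OF Ks] w h dK by auto
    note Pm = ring_hom_memE[OF \<Psi>]
    have "\<one>\<^bsub>A\<^esub> = \<Psi> \<one>\<^bsub>FX\<^esub>" using Pm(4) by simp
    also have "\<dots> = \<Psi> g \<otimes>\<^bsub>A\<^esub> \<Psi> w \<oplus>\<^bsub>A\<^esub> \<Psi> h \<otimes>\<^bsub>A\<^esub> \<Psi> (formal_derivative g)"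
      unfolding one using Pm(2,3) gF(1) c by simp
    also have "\<dots> = \<zero>\<^bsub>A\<^esub>" unfolding \<Psi>g \<Psi>d using Pm(1) c by simp
    finally show False by simp
  qed
  have vanish: "add_pow R k \<one> = \<zero>" if k: "coeff g k \<noteq> \<zero>" "k > 0" for k
  proof -
    obtain j where j: "k = Suc j" using k(2) by (cases k) auto
    have "add_pow R k (coeff g k) = \<zero>" using formal_derivative(2)[OF gF(1), of j] dg0 unfolding j by simp
    then show ?thesis using nmult_eq[OF FX_coeff[OF gF(1)], of k k] k(1) gF(1) integral[of "add_pow R k \<one>" "coeff g k"]
      add.nat_pow_closed[OF one_closed, of k] by simp
  qed
  have "add_pow R (Suc d) \<one> = \<zero>" using vanish[of "Suc d"] lead by (simp del: add.nat_pow_Suc)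
  then obtain l where l: "Factorial_Ring.prime (l::nat)" "add_pow R l \<one> = \<zero>"
    using characteristic_prime[of "Suc d"] by blast
  have dvd: "l dvd k" if "coeff g k \<noteq> \<zero>" for k
    using nmult_one_eq_zero_dvd[OF l vanish[OF that]] by (cases "k = 0") auto
  then obtain r where r: "Suc d = l * r" using lead by (metis dvdE one_not_zero)
  have l2: "l \<ge> 2" using prime_ge_2_nat[OF l(1)] .
  have r0: "r > 0" using r by (cases r) auto
  have "2 * r \<le> l * r" using l2 by (rule mult_le_mono1)
  then have rd: "Suc r \<le> Suc d" using r r0 by linarith
  have "independent K (exp_base x (Suc d))" using exp_base_independent[OF K x alg] d by (simp add: g_def)
  moreover have "exp_base x (Suc d) = map (\<lambda>i. x [^] i) (rev [Suc r..<Suc d]) @ exp_base x (Suc r)"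
    using exp_base_append[of x "Suc r" "Suc d - Suc r"] rd by simp
  ultimately have ind: "independent K (exp_base x (Suc r))"
    using independent_split(1)[OF K, of "map (\<lambda>i. x [^] i) (rev [Suc r..<Suc d])" "exp_base x (Suc r)"] 
    by (metis independent_split(2)[OF K])
  let ?z = "x [^] l"
  have "map (\<lambda>x. x [^] l) (exp_base x (Suc r)) = exp_base ?z (Suc r)"
    using x by (simp add: exp_base_def nat_pow_pow mult.commute)
  then have ind': "independent K (exp_base ?z (Suc r))"
    using frobenius_independent[OF K dim sep l ind] by simp
  define h where "h = poly_of_fun (Suc r) (\<lambda>j. coeff g (l * j))"
  have h: "h \<in> carrier FX" "\<And>k. coeff h k = (if k < Suc r then coeff g (l * k) else \<zero>)" "length h \<le> Suc r"
    unfolding h_def using poly_of_fun[of "Suc r" "\<lambda>j. coeff g (l * j)"] gF(1) by auto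
  have hl: "length h = Suc r" using FX_monicI[OF h(1), of r] h(2) lead r by auto
  have zc: "?z \<in> carrier R" using x by simp
  have "eval h ?z = (\<Oplus>k\<in>{..<Suc r}. coeff h k \<otimes> ?z [^] k)"
    by (rule eval_as_finsum) (use h hl x in auto)
  also have "\<dots> = (\<Oplus>k\<in>{..<Suc r}. coeff g (l * k) \<otimes> x [^] (l * k))"
    by (rule add.finprod_cong') (use h(2) x gF(1) in \<open>auto simp: nat_pow_pow\<close>)
  also have "\<dots> = (\<Oplus>k\<in>(\<lambda>k. l * k) ` {..<Suc r}. coeff g k \<otimes> x [^] k)"
    by (rule add.finprod_reindex[symmetric]) (use x gF(1) l2 in \<open>auto intro!: inj_onI\<close>)
  also have "\<dots> = (\<Oplus>k\<in>{..<Suc (Suc d)}. coeff g k \<otimes> x [^] k)"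
  proof (rule add.finprod_mono_neutral_cong_left)
    show "(\<lambda>k. l * k) ` {..<Suc r} \<subseteq> {..<Suc (Suc d)}"
    proof
      fix k assume "k \<in> (\<lambda>k. l * k) ` {..<Suc r}"
      then obtain j where "k = l * j" "j < Suc r" by (auto simp only: image_iff lessThan_iff)
      then have "k \<le> l * r" by simp
      then show "k \<in> {..<Suc (Suc d)}" using r by simp
    qed
    show "coeff g k \<otimes> x [^] k = \<zero>" if k: "k \<in> {..<Suc (Suc d)} - (\<lambda>k. l * k) ` {..<Suc r}" for k
    proof -
      have "coeff g k = \<zero>"
      proof (rule ccontr)
        assume "coeff g k \<noteq> \<zero>"
        then obtain j where j: "k = l * j" using dvd by (auto elim!: dvdE)
        have "l * j \<le> l * r" using k unfolding j r[symmetric] by (simp only: Diff_iff lessThan_iff less_Suc_eq_le)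
        then have "j \<le> r" using l2 by simp
        then show False using k j by auto
      qed
      then show ?thesis using x by simp
    qed
  qed (use x gF(1) in auto)
  also have "\<dots> = eval g x" by (rule eval_as_finsum[symmetric]) (use gF(1) d x in auto)
  finally have "eval h ?z = \<zero>" using g(4) by simp
  then have "combine h (exp_base ?z (Suc r)) = \<zero>" using combine_eq_eval[of h ?z] hl by simp
  moreover have hK: "set h \<subseteq> K"
  proof -
    have "coeff h k \<in> K" for k using h(2) gF(2) subringE(2)[OF Ks] by simp
    then have "coeff h ` {..<length h} \<subseteq> K" by blast
    then show ?thesis unfolding coeff_img_restrict .
  qed
  ultimately have "set (take (length (exp_base ?z (Suc r))) h) \<subseteq> {\<zero>}"
    using independent_imp_trivial_combine[OF K ind'] by blast
  then have "set h \<subseteq> {\<zero>}" using hl by (simp add: exp_base_def)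
  moreover have "hd h \<noteq> \<zero>" "h \<noteq> []" using h(1) hl by (auto simp: univ_poly_carrier[symmetric] polynomial_def)
  ultimately show False by (meson hd_in_set singletonD subsetD)
qed

theorem separable_extension_criterion:
  fixes F :: "'a ring" and L :: "'b ring"
  assumes F: "field F" and L: "field L" and \<phi>: "\<phi> \<in> ring_hom F L"
    and dim: "ring.dimension L n (\<phi> ` carrier F) (carrier L)"
    and sep: "field.no_proper_power_subring L (\<phi> ` carrier F)"
  shows "separable_extension F L \<phi>"
proof -
  interpret F: field F by fact
  interpret L: field L by fact
  interpret h: ring_hom_ring F L \<phi> using ring_hom_ringI2[OF F.ring_axioms L.ring_axioms \<phi>] .
  have K: "subfield (\<phi> ` carrier F) L" using h.img_is_subfield(2)[OF F.carrier_is_subfield] by simp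
  have alg: "algebraic_extension F L \<phi>"
    unfolding algebraic_extension_def field_extension_def
    using F L \<phi> L.finite_dimension_imp_algebraic[OF K L.carrier_is_subring] L.finite_dimensionI[OF dim] by simp
  interpret A: algebraic_closure "L.alg_closure" "L.indexed_const ` carrier L" by (rule L.alg_closureE(1))
  have "no_multiple_roots L (ring.Irr L (\<phi> ` carrier F) x)" if x: "x \<in> carrier L" for x
    unfolding no_multiple_roots_def
    using L.minimal_polynomial_simple_roots[OF K dim sep x A.field_axioms L.alg_closureE(2)] by blast
  then show ?thesis unfolding separable_extension_def using alg by blast
qed

section \<open>Eisenstein polynomials and simple extensions\<close>

text \<open>Give \<open>X\<close> the value \<open>1/m\<close>. In the scale of the Gauss valuation \<open>p\<close> has value \<open>m\<close>, attained at its leading and at its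
  constant term. In a factorization \<open>p = q r\<close> the value of \<open>q\<close> is then attained at its leading and at its constant term as
  well. The former value is congruent to the degree of \<open>q\<close> modulo \<open>m\<close>, and the latter is a multiple of \<open>m\<close>; so
  the degree of \<open>q\<close> is a multiple of \<open>m\<close>.\<close>

lemma (in dval) eisenstein:
  assumes p: "p \<in> carrier FX" "length p = Suc m" "coeff p m = \<one>" and m: "m \<ge> 1"
    and low: "\<And>k. k < m \<Longrightarrow> coeff p k \<in> val_ge F v 1" and const: "coeff p 0 \<noteq> \<zero>" "v (coeff p 0) = 1"
  shows "pirreducible (carrier F) p"
proof -
  interpret FX: domain FX by (rule FX_domain)
  \<comment> \<open>slope \<open>1/m\<close>; the constant term serves as uniformizer\<close>
  interpret G: gauss F v m 0 "coeff p 0" by unfold_locales (use m p const in auto)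
  have a: "G.slope = 1" by (simp add: G.slope_def)
  have high: "coeff p k = \<zero>" if "k > m" for k
    using FX_length_le_iff[OF p(1), of "Suc m"] p(2) that by simp
  have pm: "p \<in> G.Gs (int m)"
  proof (rule G.GsI[OF p(1)])
    fix k assume nz: "coeff p k \<noteq> \<zero>"
    consider "k < m" | "k = m" | "k > m" by linarith
    then show "int m \<le> int m * v (coeff p k) + int (G.slope * k)"
    proof cases
      case 1
      then have "v (coeff p k) \<ge> 1" using low[OF 1] nz by (auto simp: val_ge_def)
      then have "int m * 1 \<le> int m * v (coeff p k)" by (intro mult_left_mono) auto
      then show ?thesis unfolding a by simp
    qed (use high nz p(3) v_one a in auto)
  qed
  have low_deg: "k = 0 \<or> k = m"
    if q: "q \<in> carrier FX" "q \<noteq> []" and r: "r \<in> carrier FX" "r \<noteq> []" and pqr: "p = q \<otimes>\<^bsub>FX\<^esub> r" and k: "length q = Suc k" for q r k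
  proof -
    obtain d where d: "q \<in> G.Gs d" "q \<notin> G.Gs (d + 1)" using G.Gs_exact_exists[OF q(1)] q(2) by (auto simp: FX_zero)
    obtain d' where d': "r \<in> G.Gs d'" "r \<notin> G.Gs (d' + 1)" using G.Gs_exact_exists[OF r(1)] r(2) by (auto simp: FX_zero)
    have "p \<notin> G.Gs (d + d' + 1)" unfolding pqr by (rule G.Gs_exact_mult[OF d d'])
    then have dm: "d + d' \<ge> int m" using G.Gs_mono[OF pm, of "d + d' + 1"] by linarith
    obtain k' where k': "length r = Suc k'" using r(2) by (cases r) auto
    have lead: "coeff q k \<noteq> \<zero>" "coeff r k' \<noteq> \<zero>"
      using lead_coeff_simp[OF q(2)] lead_coeff_simp[OF r(2)] k k' q r
      by (auto simp: univ_poly_carrier[symmetric] polynomial_def)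
    have kk: "k + k' = m" "coeff q k \<otimes> coeff r k' = \<one>"
    proof -
      have pm: "p = poly_mult q r" "polynomial (carrier F) q" "polynomial (carrier F) r"
        using pqr q(1) r(1) by (simp_all add: univ_poly_mult univ_poly_carrier)
      show kk: "k + k' = m"
        using poly_mult_degree_eq[OF carrier_is_subring pm(2,3)] q(2) r(2) k k' p(2) unfolding pm(1)[symmetric] by simp
      have "lead_coeff p = lead_coeff q \<otimes> lead_coeff r"
        using poly_mult_lead_coeff[OF carrier_is_subring pm(2,3) q(2) r(2)] unfolding pm(1)[symmetric] .
      moreover have "p \<noteq> []" using p(2) by auto
      ultimately show "coeff q k \<otimes> coeff r k' = \<one>"
        using lead_coeff_simp[of p] lead_coeff_simp[OF q(2)] lead_coeff_simp[OF r(2)] k k' p(2,3) by simp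
    qed
    have c0: "coeff p 0 = coeff q 0 \<otimes> coeff r 0" unfolding pqr coeff_FX_mult[OF q(1) r(1)] using q r by simp
    have q0: "coeff q 0 \<noteq> \<zero>" "coeff r 0 \<noteq> \<zero>" using c0 const q r by auto
    have "v (coeff q k) + v (coeff r k') = 0" using v_mult[of "coeff q k" "coeff r k'"] lead q r kk(2) v_one by auto
    then have s1: "int m * v (coeff q k) + int m * v (coeff r k') = 0" by (simp add: distrib_left[symmetric])
    have "v (coeff q 0) + v (coeff r 0) = 1" using v_mult[of "coeff q 0" "coeff r 0"] q0 q r c0 const by auto
    then have s0: "int m * v (coeff q 0) + int m * v (coeff r 0) = int m" by (simp add: distrib_left[symmetric])
    have "d = int m * v (coeff q k) + int k"
      using G.Gs_coeff_val[OF d(1) lead(1)] G.Gs_coeff_val[OF d'(1) lead(2)] s1 dm kk(1) a by simp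
    moreover have "d = int m * v (coeff q 0)"
      using G.Gs_coeff_val[OF d(1) q0(1)] G.Gs_coeff_val[OF d'(1) q0(2)] s0 dm a by simp
    ultimately have "int k = int m * (v (coeff q 0) - v (coeff q k))" by (simp add: right_diff_distrib)
    then have "m dvd k" by (metis dvd_triv_left int_dvd_int_iff)
    then show ?thesis using kk(1) by (metis add_leD1 dvd_imp_le le_antisym le_add1 neq0_conv)
  qed
  have unit: "q \<in> Units FX" if q: "q \<in> carrier FX" "length q = Suc 0" for q
  proof -
    obtain c where "q = [c]" using q(2) by (auto simp: length_Suc_conv)
    then show ?thesis using q(1) unfolding univ_poly_carrier_units
      by (auto simp: univ_poly_carrier[symmetric] polynomial_def)
  qed
  show ?thesis
  proof (rule pirreducibleI[OF carrier_is_subring p(1)])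
    show "p \<noteq> []" using p(2) by auto
    show "p \<notin> Units FX" using p(2) m unfolding univ_poly_carrier_units by auto
    fix q r assume qr: "q \<in> carrier FX" "r \<in> carrier FX" "p = q \<otimes>\<^bsub>FX\<^esub> r"
    have ne: "q \<noteq> []" "r \<noteq> []" using qr p(2) FX.l_null FX.r_null by (auto simp: FX_zero)
    obtain k where k: "length q = Suc k" using ne(1) by (cases q) auto
    consider "k = 0" | "k = m" using low_deg[OF qr(1) ne(1) qr(2) ne(2) qr(3) k] by blast
    then show "q \<in> Units FX \<or> r \<in> Units FX"
    proof cases
      case 1 then show ?thesis using unit qr(1) k by simp
    next
      case 2
      obtain k' where k': "length r = Suc k'" using ne(2) by (cases r) auto
      have "degree p = degree q + degree r"
        using poly_mult_degree_eq[OF carrier_is_subring, of q r] qr ne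
        by (simp add: univ_poly_mult univ_poly_carrier)
      then have "k' = 0" using k k' p(2) 2 by simp
      then show ?thesis using unit qr(2) k' by simp
    qed
  qed
qed

text \<open>The quotient is transported along \<open>\<eta>\<close>, which allows the extension field to be placed in a prescribed type.\<close>

lemma (in field) quotient_by_irreducible:
  fixes \<eta> :: "'a list set \<Rightarrow> 'l"
  assumes p: "p \<in> carrier FX" "pirreducible (carrier R) p" "length p = Suc m" "m \<ge> 1"
    and inj: "inj_on \<eta> (carrier (Rupt (carrier R) p))"
  shows "\<exists>(L :: 'l ring) \<epsilon>. field L \<and> \<epsilon> \<in> ring_hom FX L \<and> \<epsilon> ` carrier FX = carrier L \<and> \<epsilon> p = \<zero>\<^bsub>L\<^esub> \<and>
     (\<forall>h\<in>carrier FX. \<epsilon> h = \<zero>\<^bsub>L\<^esub> \<longrightarrow> (\<exists>g\<in>carrier FX. h = p \<otimes>\<^bsub>FX\<^esub> g)) \<and>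
     ring.dimension L m ((\<lambda>c. \<epsilon> (mono c 0)) ` carrier R) (carrier L)"
proof -
  interpret FX: domain FX by (rule FX_domain)
  let ?T = "Rupt (carrier R) p" and ?s = "rupture_surj (carrier R) p"
  interpret T: field ?T using rupture_is_field_iff_pirreducible[OF carrier_is_subfield p(1)] p(2) by simp
  have s: "?s \<in> ring_hom FX ?T" by (rule rupture_surj_hom(1)[OF carrier_is_subring p(1)])
  define L where "L = image_ring \<eta> ?T"
  define \<epsilon> where "\<epsilon> = \<eta> \<circ> ?s"
  interpret L: field L unfolding L_def by (rule T.inj_imp_image_ring_is_field[OF inj])
  have iso: "\<eta> \<in> ring_iso ?T L" unfolding L_def by (rule inj_imp_image_ring_iso[OF inj])
  then have hom: "\<eta> \<in> ring_hom ?T L" and bij: "bij_betw \<eta> (carrier ?T) (carrier L)" by (auto simp: ring_iso_def)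
  interpret h: ring_hom_ring ?T L \<eta> using ring_hom_ringI2[OF T.ring_axioms L.ring_axioms hom] .
  have e: "\<epsilon> \<in> ring_hom FX L" unfolding \<epsilon>_def by (rule ring_hom_trans[OF s hom])
  have "?s ` carrier FX = carrier ?T"
    using rupture_surj_onto[of _ "carrier R" p] ring_hom_memE(1)[OF s] by blast
  then have surj: "\<epsilon> ` carrier FX = carrier L"
    using bij unfolding \<epsilon>_def image_comp[symmetric] by (simp add: bij_betw_def)
  have sp: "?s p = \<zero>\<^bsub>?T\<^esub>"
  proof -
    have i: "ideal (PIdl\<^bsub>FX\<^esub> p) FX" using FX.cgenideal_ideal[OF p(1)] .
    have "p \<in> PIdl\<^bsub>FX\<^esub> p" using FX.cgenideal_self[OF p(1)] .
    then have "?s p = PIdl\<^bsub>FX\<^esub> p" by (rule abelian_subgroup.a_rcos_const[OF abelian_subgroupI3[OF ideal.axioms(1)[OF i] FX.is_abelian_group]])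
    then show ?thesis by (simp add: rupture_def FactRing_def)
  qed
  have z: "?s h = \<zero>\<^bsub>?T\<^esub>" if "h \<in> carrier FX" "\<epsilon> h = \<zero>\<^bsub>L\<^esub>" for h
    using that h.hom_zero bij ring_hom_memE(1)[OF s that(1)] unfolding \<epsilon>_def bij_betw_def
    by (metis T.zero_closed comp_apply inj_onD)
  have ker: "\<exists>g\<in>carrier FX. h = p \<otimes>\<^bsub>FX\<^esub> g" if "h \<in> carrier FX" "\<epsilon> h = \<zero>\<^bsub>L\<^esub>" for h
    using rupture_kernel[OF carrier_is_subring p(1) that(1) z[OF that]] .
  have pc: "poly_of_const c = mono c 0" for c by (simp add: poly_of_const_def mono_def poly_of_fun_def)
  have sf: "subfield (?s ` poly_of_const ` carrier R) ?T"
  proof -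
    have "(?s \<circ> poly_of_const) \<in> ring_hom (R \<lparr>carrier := carrier R\<rparr>) ?T"
      by (rule rupture_surj_norm_is_hom[OF carrier_is_subring p(1)])
    then have "(?s \<circ> poly_of_const) \<in> ring_hom R ?T" by simp
    then interpret c: ring_hom_ring R ?T "?s \<circ> poly_of_const" using ring_hom_ringI2[OF ring_axioms T.ring_axioms] by blast
    show ?thesis using c.img_is_subfield(2)[OF carrier_is_subfield T.one_not_zero] by (simp add: image_comp)
  qed
  have "T.dimension m (?s ` poly_of_const ` carrier R) (carrier ?T)"
    using rupture_dimension[OF carrier_is_subfield p(1)] p(3,4) by simp
  then have "L.dimension m (\<eta> ` (?s ` poly_of_const ` carrier R)) (\<eta> ` carrier ?T)"
    using h.inj_hom_dimension[OF sf L.one_not_zero inj] by simp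
  moreover have "\<eta> ` (?s ` poly_of_const ` carrier R) = (\<lambda>c. \<epsilon> (mono c 0)) ` carrier R"
    unfolding image_image pc \<epsilon>_def comp_def ..
  moreover have "\<eta> ` carrier ?T = carrier L" using bij by (simp add: bij_betw_def)
  ultimately have dim: "L.dimension m ((\<lambda>c. \<epsilon> (mono c 0)) ` carrier R) (carrier L)" by simp
  have "\<epsilon> p = \<zero>\<^bsub>L\<^esub>" unfolding \<epsilon>_def using sp h.hom_zero by simp
  then show ?thesis using L.field_axioms e surj ker dim by blast
qed

text \<open>Let \<open>E\<close> be a subring with \<open>F\<close> and all \<open>l\<close>-th powers. It is a subfield, as \<open>1/z = z\<^bsup>l-1\<^esup> (1/z)\<^sup>l\<close>, and it contains the
  image of \<open>X\<close> by \<open>mem_of_separable_root\<close>, applied to \<open>p\<close>.\<close>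

lemma (in field) simple_extension_no_proper_power_subring:
  assumes L: "field L" and e: "\<epsilon> \<in> ring_hom FX L" and surj: "\<epsilon> ` carrier FX = carrier L"
    and p: "p \<in> carrier FX" "\<epsilon> p = \<zero>\<^bsub>L\<^esub>" "coeff p 1 \<noteq> \<zero>"
    and ker: "\<And>h. h \<in> carrier FX \<Longrightarrow> \<epsilon> h = \<zero>\<^bsub>L\<^esub> \<Longrightarrow> \<exists>g\<in>carrier FX. h = p \<otimes>\<^bsub>FX\<^esub> g"
  shows "field.no_proper_power_subring L ((\<lambda>c. \<epsilon> (mono c 0)) ` carrier R)"
proof -
  interpret FX: domain FX by (rule FX_domain)
  interpret L: field L by (rule L)
  interpret LX: domain L.FX by (rule L.FX_domain)
  interpret e: ring_hom_ring FX L \<epsilon> using ring_hom_ringI2[OF FX.ring_axioms L.ring_axioms e] .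
  define \<phi> where "\<phi> c = \<epsilon> (mono c 0)" for c
  have ph: "\<phi> \<in> ring_hom R L" using ring_hom_trans[OF mono_const_hom e] by (simp add: \<phi>_def[abs_def] comp_def)
  interpret h: ring_hom_ring R L \<phi> using ring_hom_ringI2[OF ring_axioms L.ring_axioms ph] .
  have inj: "inj_on \<phi> (carrier R)"
  proof (rule h.non_trivial_field_hom_imp_inj[OF field_axioms])
    have "\<one>\<^bsub>L\<^esub> \<in> \<phi> ` carrier R" using h.hom_one by (metis imageI one_closed)
    then show "\<phi> ` carrier R \<noteq> {\<zero>\<^bsub>L\<^esub>}" using L.one_not_zero by blast
  qed
  have z0: "\<phi> c = \<zero>\<^bsub>L\<^esub> \<longleftrightarrow> c = \<zero>" if "c \<in> carrier R" for c
    using inj that h.hom_zero by (metis inj_onD zero_closed)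
  have K: "subfield (\<phi> ` carrier R) L" using h.img_is_subfield(2)[OF carrier_is_subfield] by simp
  have Ks: "subring (\<phi> ` carrier R) L" by (rule subfieldE(1)[OF K])
  define \<theta> where "\<theta> = \<epsilon> (mono \<one> 1)"
  have th: "\<theta> \<in> carrier L" unfolding \<theta>_def using mono(1)[of \<one> 1] by simp
  have mc: "map \<phi> g \<in> carrier ((\<phi> ` carrier R)[X]\<^bsub>L\<^esub>)" if g: "g \<in> carrier FX" for g
  proof (cases "g = []")
    case False
    then have "hd g \<noteq> \<zero>" "hd g \<in> carrier R" using g FX_set[OF g] by (auto simp: univ_poly_carrier[symmetric] polynomial_def)
    then have "\<phi> (hd g) \<noteq> \<zero>\<^bsub>L\<^esub>" using z0 by blast
    then show ?thesis using False FX_set[OF g] by (auto simp: univ_poly_carrier[symmetric] polynomial_def hd_map)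
  qed (simp add: univ_poly_carrier[symmetric] polynomial_def)
  have ev: "(\<lambda>g. L.eval (map \<phi> g) \<theta>) \<in> ring_hom FX L"
    by (rule h.map_poly_hom[OF inj domain_axioms L th])
  interpret ev: ring_hom_ring FX L "\<lambda>g. L.eval (map \<phi> g) \<theta>" using ring_hom_ringI2[OF FX.ring_axioms L.ring_axioms ev] .
  have ep: "L.eval (map \<phi> g) \<theta> = \<epsilon> g" if g: "g \<in> carrier FX" for g
  proof -
    have "g \<in> {g \<in> carrier FX. L.eval (map \<phi> g) \<theta> = \<epsilon> g}"
    proof (rule poly_closure[OF g])
      have const: "L.eval (map \<phi> (mono c 0)) \<theta> = \<epsilon> (mono c 0)" if c: "c \<in> carrier R" for c
      proof (cases "c = \<zero>")
        case True
        then have "mono c 0 = []" "\<epsilon> [] = \<zero>\<^bsub>L\<^esub>" using FX_zero e.hom_zero by auto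
        then show ?thesis by simp
      next
        case False
        then have "mono c 0 = [c]" by (simp add: mono_def poly_of_fun_def)
        then have "L.eval (map \<phi> (mono c 0)) \<theta> = \<phi> c" using th h.hom_closed[OF c] by simp
        then show ?thesis by (simp add: \<phi>_def)
      qed
      have var: "L.eval (map \<phi> (mono \<one> 1)) \<theta> = \<epsilon> (mono \<one> 1)"
        using th by (simp add: mono_def poly_of_fun_def \<theta>_def)
      fix k
      have c: "coeff g k \<in> carrier R" using g by simp
      have split: "mono (coeff g k) k = mono (coeff g k) 0 \<otimes>\<^bsub>FX\<^esub> (mono \<one> 1 [^]\<^bsub>FX\<^esub> k)"
        using c by (simp add: mono_pow mono_mult)
      have m: "mono (coeff g k) 0 \<in> carrier FX" "mono \<one> 1 \<in> carrier FX" using mono c by auto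
      show "mono (coeff g k) k \<in> {g \<in> carrier FX. L.eval (map \<phi> g) \<theta> = \<epsilon> g}"
        unfolding split mem_Collect_eq
        using m const[OF c] var e.hom_mult[OF m(1) FX.nat_pow_closed[OF m(2)], of k] ev.hom_mult[OF m(1) FX.nat_pow_closed[OF m(2)], of k]
          e.hom_nat_pow[OF m(2), of k] ev.hom_nat_pow[OF m(2), of k] by simp
    qed (use ev.hom_zero e.hom_zero ev.hom_add e.hom_add in auto)
    then show ?thesis by simp
  qed
  have "E = carrier L" if l: "Factorial_Ring.prime (l::nat)" and ch: "add_pow L l \<one>\<^bsub>L\<^esub> = \<zero>\<^bsub>L\<^esub>"
    and Es: "subring E L" and KE: "\<phi> ` carrier R \<subseteq> E" and pw: "\<forall>x\<in>carrier L. x [^]\<^bsub>L\<^esub> l \<in> E" for l E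
  proof -
    have EL: "E \<subseteq> carrier L" by (rule subringE(1)[OF Es])
    have E: "subfield E L"
    proof (rule L.subfieldI'[OF Es])
      fix z assume z: "z \<in> E - {\<zero>\<^bsub>L\<^esub>}"
      then have zc: "z \<in> carrier L" "z \<noteq> \<zero>\<^bsub>L\<^esub>" using EL by auto
      note iz = L.field_inv[OF zc]
      obtain d where d: "l = Suc d" using prime_gt_0_nat[OF l] by (cases l) auto
      have zd: "z [^]\<^bsub>L\<^esub> d \<in> E" using z by (induction d) (auto simp: subringE[OF Es])
      have "inv\<^bsub>L\<^esub> z = z [^]\<^bsub>L\<^esub> d \<otimes>\<^bsub>L\<^esub> (inv\<^bsub>L\<^esub> z [^]\<^bsub>L\<^esub> l)"
      proof -
        have "z [^]\<^bsub>L\<^esub> d \<otimes>\<^bsub>L\<^esub> (inv\<^bsub>L\<^esub> z [^]\<^bsub>L\<^esub> d) = (z \<otimes>\<^bsub>L\<^esub> inv\<^bsub>L\<^esub> z) [^]\<^bsub>L\<^esub> d"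
          by (rule L.nat_pow_distrib[symmetric, OF zc(1) iz(1)])
        also have "\<dots> = \<one>\<^bsub>L\<^esub>" using iz zc L.m_comm by simp
        finally show ?thesis unfolding d using zc iz by (simp add: L.m_assoc[symmetric])
      qed
      then show "inv\<^bsub>L\<^esub> z \<in> E" using zd pw iz(1) subringE(6)[OF Es] by metis
    qed
    have min: "length (map \<phi> p) \<le> length g"
      if g: "g \<in> carrier ((\<phi> ` carrier R)[X]\<^bsub>L\<^esub>)" "g \<noteq> []" "L.eval g \<theta> = \<zero>\<^bsub>L\<^esub>" for g
    proof -
      define g' where "g' = map (inv_into (carrier R) \<phi>) g"
      have gs: "set g \<subseteq> \<phi> ` carrier R" "hd g \<noteq> \<zero>\<^bsub>L\<^esub>" "hd g \<in> \<phi> ` carrier R" using g(1,2) by (auto simp: univ_poly_carrier[symmetric] polynomial_def)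
      have gg: "g = map \<phi> g'" unfolding g'_def map_map
        by (rule map_idI[symmetric]) (use gs(1) in \<open>auto simp: f_inv_into_f\<close>)
      have "set g' \<subseteq> carrier R" unfolding g'_def using gs(1) by (auto intro: inv_into_into)
      moreover have "hd g' \<noteq> \<zero>" using gs(2) g(2) gg by (cases g') auto
      ultimately have g'c: "g' \<in> carrier FX" using g(2) by (simp add: univ_poly_carrier[symmetric] polynomial_def g'_def)
      have "\<epsilon> g' = \<zero>\<^bsub>L\<^esub>" using ep[OF g'c] g(3) gg by simp
      then obtain w where w: "w \<in> carrier FX" "g' = p \<otimes>\<^bsub>FX\<^esub> w" using ker[OF g'c] by blast
      have "g' \<noteq> []" using g(2) by (simp add: g'_def)
      moreover have "p pdivides g'" using w by (auto simp: pdivides_def factor_def)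
      ultimately have "degree p \<le> degree g'" using pdivides_imp_degree_le[OF carrier_is_subring p(1) g'c] by simp
      moreover have "length g' > 0" using \<open>g' \<noteq> []\<close> by simp
      ultimately show ?thesis unfolding gg length_map by linarith
    qed
    \<comment> \<open>here the coefficient of \<open>p\<close> at \<open>X\<close> enters\<close>
    have tE: "\<theta> \<in> E"
    proof (rule L.mem_of_separable_root[OF E Ks KE th l ch _ mc[OF p(1)]])
      show "\<theta> [^]\<^bsub>L\<^esub> l \<in> E" using pw th by blast
      show "L.eval (map \<phi> p) \<theta> = \<zero>\<^bsub>L\<^esub>" using ep[OF p(1)] p(2) by simp
      show "L.coeff (map \<phi> p) 1 \<noteq> \<zero>\<^bsub>L\<^esub>" using h.coeff_hom'[OF FX_set[OF p(1)], of 1] z0[of "coeff p 1"] p(1,3) by simp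
    qed (use min in blast)
    have "\<epsilon> g \<in> E" if g: "g \<in> carrier FX" for g
    proof -
      have "g \<in> {g \<in> carrier FX. \<epsilon> g \<in> E}"
      proof (rule poly_closure[OF g])
        fix k
        have c: "coeff g k \<in> carrier R" using g by simp
        have split: "mono (coeff g k) k = mono (coeff g k) 0 \<otimes>\<^bsub>FX\<^esub> (mono \<one> 1 [^]\<^bsub>FX\<^esub> k)"
          using c by (simp add: mono_pow mono_mult)
        have m: "mono (coeff g k) 0 \<in> carrier FX" "mono \<one> 1 \<in> carrier FX" using mono c by auto
        have tk: "\<theta> [^]\<^bsub>L\<^esub> k \<in> E" using tE by (induction k) (auto simp: subringE[OF Es])
        have cE: "\<epsilon> (mono (coeff g k) 0) \<in> E" using KE c unfolding \<phi>_def by blast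
        show "mono (coeff g k) k \<in> {g \<in> carrier FX. \<epsilon> g \<in> E}"
          unfolding split mem_Collect_eq
          using m e.hom_mult[OF m(1) FX.nat_pow_closed[OF m(2)], of k] e.hom_nat_pow[OF m(2), of k]
            subringE(6)[OF Es cE tk] by (simp add: \<theta>_def)
      qed (use subringE[OF Es] in auto)
      then show ?thesis by simp
    qed
    then have "\<epsilon> ` carrier FX \<subseteq> E" by (rule image_subsetI)
    then show ?thesis using EL unfolding surj by (rule subset_antisym[rotated])
  qed
  then have "field.no_proper_power_subring L (\<phi> ` carrier R)"
    unfolding L.no_proper_power_subring_def by (intro allI impI)
  then show ?thesis by (simp add: \<phi>_def[abs_def])
qed

section \<open>Extensions with prescribed splitting\<close>

text \<open>Giving the residue map, and not just the isomorphism class of the residue field,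
  makes the notion composable in towers.\<close>

definition lies_over ::
  "'a ring \<Rightarrow> ('a \<Rightarrow> int) \<Rightarrow> 'l ring \<Rightarrow> ('a \<Rightarrow> 'l) \<Rightarrow> nat \<Rightarrow> 'k ring \<Rightarrow> ('a \<Rightarrow> 'k) \<Rightarrow> ('l \<Rightarrow> int) \<Rightarrow> ('l \<Rightarrow> 'k) \<Rightarrow> bool" where
  "lies_over F v L \<phi> e K \<tau> W r \<longleftrightarrow>
     discrete_valuation L W \<and>
     (\<forall>c\<in>carrier F. c \<noteq> \<zero>\<^bsub>F\<^esub> \<longrightarrow> W (\<phi> c) = int e * v c) \<and>
     r \<in> ring_hom (L\<lparr>carrier := val_ring L W\<rparr>) K \<and> r ` val_ring L W = carrier K \<and>
     (\<forall>x\<in>val_ring L W. r x = \<zero>\<^bsub>K\<^esub> \<longleftrightarrow> x \<in> val_ge L W 1) \<and>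
     (\<forall>c\<in>val_ring F v. \<phi> c \<in> val_ring L W \<and> r (\<phi> c) = \<tau> c)"

definition splits ::
  "'a ring \<Rightarrow> ('a \<Rightarrow> int) \<Rightarrow> 'l ring \<Rightarrow> ('a \<Rightarrow> 'l) \<Rightarrow> nat \<Rightarrow> (nat \<Rightarrow> nat) \<Rightarrow> (nat \<Rightarrow> 'k ring) \<Rightarrow> (nat \<Rightarrow> 'a \<Rightarrow> 'k)
     \<Rightarrow> (nat \<Rightarrow> 'l \<Rightarrow> int) \<Rightarrow> (nat \<Rightarrow> 'l \<Rightarrow> 'k) \<Rightarrow> bool" where
  "splits F v L \<phi> s e K \<tau> W r \<longleftrightarrow>
     (\<forall>j<s. lies_over F v L \<phi> (e j) (K j) (\<tau> j) (W j) (r j)) \<and>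
     inj_on (\<lambda>j. val_ring L (W j)) {..<s} \<and>
     (\<forall>B. valuation_ring L B \<and> B \<inter> \<phi> ` carrier F = \<phi> ` val_ring F v \<longrightarrow> (\<exists>j<s. B = val_ring L (W j)))"

lemma (in family_ext) splits:
  "splits F v L (\<lambda>c. \<epsilon> (mono c 0)) s e K \<tau> (\<lambda>j. place.W F v (e j) j \<pi> (K j) (\<tau> j) (y j) L \<epsilon>)
     (\<lambda>j. place.res F v (e j) j \<pi> (K j) (\<tau> j) (y j) L \<epsilon>)"
proof -
  interpret J: residual_ext F v "e 0" 0 \<pi> "K 0" "\<tau> 0" "y 0" "f 0" L \<epsilon>
    using res[OF s_pos] eps L.field_axioms
    by (intro residual_ext.intro residual_ext_axioms.intro)
  have ph: "ph = (\<lambda>c. \<epsilon> (mono c 0))" by (rule ext) (simp add: J.\<phi>_def)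
  have lies: "lies_over F v L ph (e j) (K j) (\<tau> j) (WW j) (rr j)" if j: "j < s" for j
    unfolding lies_over_def family_val_ring[OF j]
    using family_dval[OF j] family_ram[OF j] family_hom[OF j] family_surj[OF j] family_ker[OF j] family_res[OF j]
    by blast
  have inj: "inj_on (\<lambda>j. val_ring L (WW j)) {..<s}"
    using family_inj family_val_ring by (simp add: inj_on_def)
  have "\<exists>j<s. B = val_ring L (WW j)" if "valuation_ring L B \<and> B \<inter> ph ` carrier F = ph ` val_ring F v" for B
    using family_complete[of B] that family_val_ring by metis
  then show ?thesis unfolding splits_def ph[symmetric] using lies inj by blast
qed

text \<open>All that later arguments have to know about the polynomial \<open>Q\<close> of the introduction at one valuation: any
  field that is generated by a root of a monic polynomial close enough to \<open>Q\<close> splits as prescribed. The dummy argument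
  fixes the type of the elements of that field, over which a definition cannot quantify otherwise. The
  implication from \<open>s = 1\<close> says that \<open>Q\<close> is an Eisenstein polynomial in the totally ramified case.\<close>

definition splitting_polynomial ::
  "'l itself \<Rightarrow> 'a ring \<Rightarrow> ('a \<Rightarrow> int) \<Rightarrow> nat \<Rightarrow> (nat \<Rightarrow> nat) \<Rightarrow> (nat \<Rightarrow> nat) \<Rightarrow> (nat \<Rightarrow> 'k ring) \<Rightarrow> (nat \<Rightarrow> 'a \<Rightarrow> 'k)
     \<Rightarrow> nat \<Rightarrow> 'a list \<Rightarrow> nat \<Rightarrow> bool" where
  "splitting_polynomial T F v s e f K \<tau> m Q S \<longleftrightarrow>
    Q \<in> carrier (poly_ring F) \<and> ring.coeff F Q m = \<one>\<^bsub>F\<^esub> \<and> (\<forall>k>m. ring.coeff F Q k = \<zero>\<^bsub>F\<^esub>) \<and>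
    (s = 1 \<and> f 0 = 1 \<longrightarrow> (\<forall>k. 0 < k \<and> k < m \<longrightarrow> ring.coeff F Q k = \<zero>\<^bsub>F\<^esub>) \<and>
       ring.coeff F Q 0 \<noteq> \<zero>\<^bsub>F\<^esub> \<and> v (ring.coeff F Q 0) = 1) \<and>
    (\<forall>(L :: 'l ring) \<epsilon> p N. field L \<longrightarrow> \<epsilon> \<in> ring_hom (poly_ring F) L \<longrightarrow> \<epsilon> ` carrier (poly_ring F) = carrier L \<longrightarrow>
       p \<in> carrier (poly_ring F) \<longrightarrow> \<epsilon> p = \<zero>\<^bsub>L\<^esub> \<longrightarrow>
       (\<forall>h\<in>carrier (poly_ring F). \<epsilon> h = \<zero>\<^bsub>L\<^esub> \<longrightarrow> (\<exists>g\<in>carrier (poly_ring F). h = p \<otimes>\<^bsub>poly_ring F\<^esub> g)) \<longrightarrow>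
       (\<forall>k. ring.coeff F p k \<ominus>\<^bsub>F\<^esub> ring.coeff F Q k \<in> val_ge F v (int N)) \<longrightarrow>
       length p = Suc m \<longrightarrow> ring.coeff F p m = \<one>\<^bsub>F\<^esub> \<longrightarrow>
       S < N \<longrightarrow> (\<exists>W r. splits F v L (\<lambda>c. \<epsilon> (ring.mono F c 0)) s e K \<tau> W r))"

lemma (in family) exists_splitting_polynomial:
  assumes s: "s > 0" and m: "(\<Sum>j<s. e j * f j) = m"
  shows "\<exists>Q S. splitting_polynomial TYPE('l) F v s e f K \<tau> m Q S"
proof -
  interpret FX: domain FX by (rule FX_domain)
  have monic_const_value: "monic_const_value m (\<Sum>j<s. A j) (Qs {..<s})" using mon_Qs[of "{..<s}"] m by simp
  have one: "(\<forall>k. 0 < k \<and> k < m \<longrightarrow> coeff (Qs {..<s}) k = \<zero>) \<and> coeff (Qs {..<s}) 0 \<noteq> \<zero> \<and> v (coeff (Qs {..<s}) 0) = 1"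
    if s1: "s = 1" "f 0 = 1"
  proof -
    interpret R: residual F v "e 0" 0 \<pi> "K 0" "\<tau> 0" "y 0" "f 0" by (rule res[OF s])
    have "Qs {..<s} = P 0"
    proof -
      have "P 0 \<in> carrier FX" unfolding P_def by (rule R.local_factor(1))
      then show ?thesis unfolding Qs_def s1 by (simp add: lessThan_Suc)
    qed
    then have Q: "Qs {..<s} = R.local_factor" by (simp add: P_def)
    have m': "m = e 0" using m s1 by simp
    have sl: "R.slope = 1" by (simp add: R.slope_def)
    have "coeff R.local_factor k = \<zero>" if k: "0 < k" "k < m" for k
    proof -
      have "\<not> e 0 dvd k" using k m' by (auto dest: dvd_imp_le)
      then have "coeff R.residual_factor k = \<zero>" by (simp add: R.residual_factor_coeff)
      then show ?thesis unfolding R.local_factor_def using coeff_mono_mult[OF R.pip(1) R.residual_factor(1)] R.pip(1) by simp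
    qed
    then show ?thesis unfolding Q using R.local_factor(5,6) s1(2) sl by simp
  qed
  have ext: "\<exists>W r. splits F v L (\<lambda>c. \<epsilon> (mono c 0)) s e K \<tau> W r"
    if a: "field L" "\<epsilon> \<in> ring_hom FX L" "\<epsilon> ` carrier FX = carrier L" "p \<in> carrier FX" "\<epsilon> p = \<zero>\<^bsub>L\<^esub>"
      "\<forall>h\<in>carrier FX. \<epsilon> h = \<zero>\<^bsub>L\<^esub> \<longrightarrow> (\<exists>g\<in>carrier FX. h = p \<otimes>\<^bsub>FX\<^esub> g)"
      "\<forall>k. coeff p k \<ominus> coeff (Qs {..<s}) k \<in> val_ge F v (int N)" "length p = Suc m" "coeff p m = \<one>" "S < N"
    for L :: "'l ring" and \<epsilon> p N
  proof -
    have "family_ext F v \<pi> s e f K \<tau> y L \<epsilon> p N"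
      using a s m by (intro family_ext.intro family_ext_axioms.intro family_axioms) auto
    then show ?thesis by (intro exI) (rule family_ext.splits)
  qed
  have Q: "Qs {..<s} \<in> carrier FX" "coeff (Qs {..<s}) m = \<one>" "\<forall>k>m. coeff (Qs {..<s}) k = \<zero>"
    using monic_const_value by (auto simp: monic_const_value_def)
  have "splitting_polynomial TYPE('l) F v s e f K \<tau> m (Qs {..<s}) S"
    unfolding splitting_polynomial_def
    apply (intro conjI)
    subgoal by (rule Q(1))
    subgoal by (rule Q(2))
    subgoal by (rule Q(3))
    subgoal using one by simp
    subgoal by (intro allI impI, rule ext; assumption)
    done
  then show ?thesis by blast
qed

text \<open>The first part of the introduction. The hypothesis \<open>emb\<close> only says that the quotients of \<open>F[X]\<close> in question fit in
  the type of \<open>L\<close>.\<close>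

theorem extension_with_prescribed_splitting:
  fixes F :: "'a ring" (structure) and v :: "'i \<Rightarrow> 'a \<Rightarrow> int" and K :: "'i \<Rightarrow> nat \<Rightarrow> 'k ring"
  assumes F: "field F" and fin: "finite I" and dv: "\<And>i. i \<in> I \<Longrightarrow> discrete_valuation F (v i)"
    and inj: "inj_on (\<lambda>i. val_ring F (v i)) I"
    and rb: "\<And>i j. i \<in> I \<Longrightarrow> j < s i \<Longrightarrow> residue_basis F (v i) (K i j) (\<tau> i j) (y i j) (f i j)"
    and e: "\<And>i j. i \<in> I \<Longrightarrow> j < s i \<Longrightarrow> e i j > 0" and s: "\<And>i. i \<in> I \<Longrightarrow> s i > 0"
    and sum: "\<And>i. i \<in> I \<Longrightarrow> (\<Sum>j<s i. e i j * f i j) = m" and m: "m > 1"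
    and i0: "i0 \<in> I" "s i0 = 1" "f i0 0 = 1"
    and emb: "\<And>q. q \<in> carrier ((carrier F)[X]) \<Longrightarrow> ring_irreducible\<^bsub>(carrier F)[X]\<^esub> q \<Longrightarrow> length q = Suc m \<Longrightarrow>
        \<exists>\<eta> :: 'a list set \<Rightarrow> 'l. inj_on \<eta> (carrier (Rupt (carrier F) q))"
  shows "\<exists>(L :: 'l ring) \<phi>. field L \<and> \<phi> \<in> ring_hom F L \<and>
     ring.dimension L m (\<phi> ` carrier F) (carrier L) \<and> field.no_proper_power_subring L (\<phi> ` carrier F) \<and>
     (\<forall>i\<in>I. \<exists>W r. splits F (v i) L \<phi> (s i) (e i) (K i) (\<tau> i) W r)"
proof -
  interpret field F by (rule F)
  interpret FX: domain FX by (rule FX_domain)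
  have dvs: "dval F (v i)" if "i \<in> I" for i
    using F dv[OF that] by (intro dval.intro dval_axioms.intro)
  have "\<exists>\<pi>. \<pi> \<in> carrier F \<and> \<pi> \<noteq> \<zero> \<and> v i \<pi> = 1" if i: "i \<in> I" for i
  proof -
    interpret V: dval F "v i" by (rule dvs[OF i])
    obtain x where "x \<in> carrier F" "x \<noteq> \<zero>" "v i x = 1" using V.v_surj .
    then show ?thesis by blast
  qed
  then obtain \<pi> where \<pi>: "\<And>i. i \<in> I \<Longrightarrow> \<pi> i \<in> carrier F \<and> \<pi> i \<noteq> \<zero> \<and> v i (\<pi> i) = 1" by metis
  have fam: "family F (v i) (\<pi> i) (s i) (e i) (f i) (K i) (\<tau> i) (y i)" if i: "i \<in> I" for i
  proof (intro family.intro family_axioms.intro dvs[OF i])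
    fix j assume j: "j < s i"
    have "field (K i j)" using rb[OF i j] by (simp add: residue_basis_def)
    then show "residual F (v i) (e i j) (\<pi> i) (K i j) (\<tau> i j) (y i j) (f i j)"
      using e[OF i j] \<pi>[OF i] rb[OF i j] dvs[OF i]
      by (intro residual.intro residual_axioms.intro gauss.intro gauss_axioms.intro) auto
  qed
  have "\<forall>i. \<exists>Q S. i \<in> I \<longrightarrow> splitting_polynomial TYPE('l) F (v i) (s i) (e i) (f i) (K i) (\<tau> i) m Q S"
    using family.exists_splitting_polynomial[OF fam s sum, where ?'l = 'l] by blast
  then obtain Q Sb where "\<forall>i. i \<in> I \<longrightarrow> splitting_polynomial TYPE('l) F (v i) (s i) (e i) (f i) (K i) (\<tau> i) m (Q i) (Sb i)"
    by metis
  then have target: "splitting_polynomial TYPE('l) F (v i) (s i) (e i) (f i) (K i) (\<tau> i) m (Q i) (Sb i)" if "i \<in> I" for i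
    using that by blast
  have Q: "Q i \<in> carrier FX" "coeff (Q i) m = \<one>" "k > m \<Longrightarrow> coeff (Q i) k = \<zero>" if "i \<in> I" for i k
    using target[OF that] by (simp_all add: splitting_polynomial_def)
  \<comment> \<open>the summand \<open>2\<close> preserves the constant term of value \<open>1\<close> of the Eisenstein polynomial\<close>
  define N where "N = 2 + (\<Sum>i\<in>I. Sb i)"
  have SN: "Sb i < N" if "i \<in> I" for i
    using member_le_sum[OF that, of Sb] fin by (simp add: N_def)
  have "\<forall>k. \<exists>c. c \<in> carrier F \<and> c \<noteq> \<zero> \<and> (\<forall>i\<in>I. c \<ominus> coeff (Q i) k \<in> val_ge F (v i) (int N))"
  proof
    fix k
    show "\<exists>c. c \<in> carrier F \<and> c \<noteq> \<zero> \<and> (\<forall>i\<in>I. c \<ominus> coeff (Q i) k \<in> val_ge F (v i) (int N))"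
      by (rule weak_approximation_nonzero[OF F fin dvs inj]) (use Q(1) i0(1) in auto)
  qed
  then obtain c where c: "\<And>k. c k \<in> carrier F" "\<And>k. c k \<noteq> \<zero>"
    "\<And>k i. i \<in> I \<Longrightarrow> c k \<ominus> coeff (Q i) k \<in> val_ge F (v i) (int N)" by metis
  define p where "p = poly_of_fun (Suc m) (\<lambda>k. if k = m then \<one> else c k)"
  have p: "p \<in> carrier FX" "\<And>k. coeff p k = (if k < m then c k else if k = m then \<one> else \<zero>)"
    using poly_of_fun[of "Suc m" "\<lambda>k. if k = m then \<one> else c k"] c unfolding p_def by auto
  have pm: "coeff p m = \<one>" using p(2) by simp
  have pl: "length p = Suc m" by (rule FX_monicI[OF p(1)]) (use p(2) in auto)
  have close: "\<forall>k. coeff p k \<ominus> coeff (Q i) k \<in> val_ge F (v i) (int N)" if i: "i \<in> I" for i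
  proof
    fix k
    interpret V: dval F "v i" by (rule dvs[OF i])
    consider "k < m" | "k = m" | "k > m" by linarith
    then show "coeff p k \<ominus> coeff (Q i) k \<in> val_ge F (v i) (int N)"
      by cases (use p(2) Q(2,3)[OF i] c(3)[OF i] in \<open>auto simp: a_minus_def r_neg\<close>)
  qed
  have irr: "pirreducible (carrier F) p"
  proof -
    interpret V: dval F "v i0" by (rule dvs[OF i0(1)])
    have Q0: "\<forall>k. 0 < k \<and> k < m \<longrightarrow> coeff (Q i0) k = \<zero>" "coeff (Q i0) 0 \<noteq> \<zero>" "v i0 (coeff (Q i0) 0) = 1"
      using target[OF i0(1)] i0(2,3) by (simp_all add: splitting_polynomial_def)
    have d: "c k \<ominus> coeff (Q i0) k \<in> val_ge F (v i0) 2" for k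
      by (rule V.val_ge_mono[OF c(3)[OF i0(1)]]) (simp add: N_def sum_nonneg)
    have ck: "c k = coeff (Q i0) k \<oplus> (c k \<ominus> coeff (Q i0) k)" for k
      using c(1)[of k] Q(1)[OF i0(1)] by (simp add: a_minus_def a_lcomm r_neg)
    have c0: "v i0 (c 0) = 1"
    proof -
      have "v i0 (coeff (Q i0) 0 \<oplus> (c 0 \<ominus> coeff (Q i0) 0)) = v i0 (coeff (Q i0) 0)"
        by (rule V.val_ge_exact_add(2)) (use Q0 d[of 0] Q(1)[OF i0(1)] in auto)
      then show ?thesis using Q0 ck[of 0] by simp
    qed
    show ?thesis
    proof (rule V.eisenstein[OF p(1) pl pm])
      fix k assume k: "k < m"
      show "coeff p k \<in> val_ge F (v i0) 1"
      proof (cases "k = 0")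
        case True
        then show ?thesis using p(2) k c0 c(1) by (simp add: val_ge_def)
      next
        case False
        then have "coeff (Q i0) k = \<zero>" using Q0 k by simp
        then have "c k \<in> val_ge F (v i0) 2" using d[of k] c(1)[of k] by (simp add: a_minus_def)
        then show ?thesis using p(2) k V.val_ge_mono[of "c k" 2 1] by simp
      qed
    qed (use m p(2) c(2) c0 in auto)
  qed
  obtain \<eta> :: "'a list set \<Rightarrow> 'l" where \<eta>: "inj_on \<eta> (carrier (Rupt (carrier F) p))"
    using emb[OF p(1) irr pl] by blast
  have m1: "m \<ge> 1" using m by simp
  obtain L :: "'l ring" and \<epsilon> where L: "field L" "\<epsilon> \<in> ring_hom FX L" "\<epsilon> ` carrier FX = carrier L" "\<epsilon> p = \<zero>\<^bsub>L\<^esub>"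
    and ker: "\<forall>h\<in>carrier FX. \<epsilon> h = \<zero>\<^bsub>L\<^esub> \<longrightarrow> (\<exists>g\<in>carrier FX. h = p \<otimes>\<^bsub>FX\<^esub> g)"
    and dim: "ring.dimension L m ((\<lambda>c. \<epsilon> (mono c 0)) ` carrier F) (carrier L)"
    using quotient_by_irreducible[OF p(1) irr pl m1 \<eta>] by blast
  have hom: "(\<lambda>c. \<epsilon> (mono c 0)) \<in> ring_hom F L"
    using ring_hom_trans[OF mono_const_hom L(2)] by (simp add: comp_def)
  have p1: "coeff p 1 \<noteq> \<zero>" using p(2) c(2) m by simp
  have sep: "field.no_proper_power_subring L ((\<lambda>c. \<epsilon> (mono c 0)) ` carrier F)"
    by (rule simple_extension_no_proper_power_subring[OF L(1-3) p(1) L(4) p1]) (use ker in blast)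
  have "\<exists>W r. splits F (v i) L (\<lambda>c. \<epsilon> (mono c 0)) (s i) (e i) (K i) (\<tau> i) W r" if i: "i \<in> I" for i
    using target[OF i, unfolded splitting_polynomial_def, THEN conjunct2, THEN conjunct2, THEN conjunct2, THEN conjunct2,
      rule_format, OF L(1-3) p(1) L(4) _ _ pl pm SN[OF i]] ker close[OF i] by blast
  then show ?thesis using L(1) hom dim sep by blast
qed

section \<open>Towers of extensions\<close>

lemma field_hom_inj:
  assumes "field F" "field L" "\<phi> \<in> ring_hom F L"
  shows "inj_on \<phi> (carrier F)"
proof -
  interpret F: field F by fact
  interpret L: field L by fact
  interpret h: ring_hom_ring F L \<phi> using ring_hom_ringI2[OF F.ring_axioms L.ring_axioms assms(3)] .
  show ?thesis
  proof (rule h.non_trivial_field_hom_imp_inj[OF F.field_axioms])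
    have "\<one>\<^bsub>L\<^esub> \<in> \<phi> ` carrier F" using h.hom_one by (metis imageI F.one_closed)
    then show "\<phi> ` carrier F \<noteq> {\<zero>\<^bsub>L\<^esub>}" using L.one_not_zero by blast
  qed
qed

lemma field_hom_zero_iff:
  assumes "field F" "field L" "\<phi> \<in> ring_hom F L" "c \<in> carrier F"
  shows "\<phi> c = \<zero>\<^bsub>L\<^esub> \<longleftrightarrow> c = \<zero>\<^bsub>F\<^esub>"
proof -
  interpret F: field F by fact
  interpret L: field L by fact
  interpret h: ring_hom_ring F L \<phi> using ring_hom_ringI2[OF F.ring_axioms L.ring_axioms assms(3)] .
  show ?thesis using field_hom_inj[OF assms(1-3)] assms(4) h.hom_zero by (metis inj_onD F.zero_closed)
qed

lemma lies_over_val_ring_iff: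
  assumes F: "field F" and L: "field L" and \<phi>: "\<phi> \<in> ring_hom F L"
    and lo: "lies_over F v L \<phi> e K \<tau> W r" and e: "e > 0" and c: "c \<in> carrier F"
  shows "\<phi> c \<in> val_ring L W \<longleftrightarrow> c \<in> val_ring F v"
proof (cases "c = \<zero>\<^bsub>F\<^esub>")
  case False
  then have "W (\<phi> c) = int e * v c" using lo c by (simp add: lies_over_def)
  moreover have "\<phi> c \<noteq> \<zero>\<^bsub>L\<^esub>" using False field_hom_zero_iff[OF F L \<phi> c] by simp
  ultimately show ?thesis using c False e ring_hom_memE(1)[OF \<phi> c] by (auto simp: val_ge_def zero_le_mult_iff)
next
  case True
  then have "\<phi> c = \<zero>\<^bsub>L\<^esub>" using field_hom_zero_iff[OF F L \<phi> c] by simp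
  then show ?thesis using True c ring_hom_memE(1)[OF \<phi> c] by (simp add: val_ge_def)
qed

lemma lies_over_contraction:
  assumes "field F" "field L" "\<phi> \<in> ring_hom F L" "lies_over F v L \<phi> e K \<tau> W r" "e > 0"
  shows "val_ring L W \<inter> \<phi> ` carrier F = \<phi> ` val_ring F v"
proof -
  have "val_ring F v \<subseteq> carrier F" by (auto simp: val_ge_def)
  then show ?thesis using lies_over_val_ring_iff[OF assms] by blast
qed

lemma lies_over_trans:
  assumes \<phi>1: "\<phi>1 \<in> ring_hom F L1" and F: "field F" and L1: "field L1"
    and lo1: "lies_over F v L1 \<phi>1 e1 K1 \<tau>1 W1 r1" and lo2: "lies_over L1 W1 L2 \<phi>2 e2 K2 \<tau>2 W2 r2"
    and \<tau>: "\<And>c. c \<in> val_ring F v \<Longrightarrow> \<tau>2 (\<phi>1 c) = \<tau> c"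
  shows "lies_over F v L2 (\<phi>2 \<circ> \<phi>1) (e1 * e2) K2 \<tau> W2 r2"
proof -
  have "W2 (\<phi>2 (\<phi>1 c)) = int (e1 * e2) * v c" if c: "c \<in> carrier F" "c \<noteq> \<zero>\<^bsub>F\<^esub>" for c
  proof -
    have "\<phi>1 c \<in> carrier L1" "\<phi>1 c \<noteq> \<zero>\<^bsub>L1\<^esub>"
      using ring_hom_memE(1)[OF \<phi>1 c(1)] field_hom_zero_iff[OF F L1 \<phi>1 c(1)] c(2) by auto
    then have "W2 (\<phi>2 (\<phi>1 c)) = int e2 * W1 (\<phi>1 c)" using lo2 by (simp add: lies_over_def)
    also have "W1 (\<phi>1 c) = int e1 * v c" using lo1 c by (simp add: lies_over_def)
    finally show ?thesis by simp
  qed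
  moreover have "\<phi>2 (\<phi>1 c) \<in> val_ring L2 W2 \<and> r2 (\<phi>2 (\<phi>1 c)) = \<tau> c" if "c \<in> val_ring F v" for c
    using lo1 lo2 \<tau>[OF that] that by (simp add: lies_over_def)
  ultimately show ?thesis using lo2 unfolding lies_over_def by simp
qed

lemma valuation_ring_contraction:
  assumes L: "field L" and M: "field M" and \<phi>: "\<phi> \<in> ring_hom L M" and B: "valuation_ring M B"
  shows "valuation_ring L {x \<in> carrier L. \<phi> x \<in> B}"
proof -
  interpret L: field L by (rule L)
  interpret M: field M by (rule M)
  interpret h: ring_hom_ring L M \<phi> using ring_hom_ringI2[OF L.ring_axioms M.ring_axioms \<phi>] .
  have Bs: "subring B M" using B by (simp add: valuation_ring_def)
  have "subring {x \<in> carrier L. \<phi> x \<in> B} L"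
    by (rule L.subringI) (auto simp: subringE[OF Bs])
  moreover have "x \<in> {x \<in> carrier L. \<phi> x \<in> B} \<or> inv\<^bsub>L\<^esub> x \<in> {x \<in> carrier L. \<phi> x \<in> B}" if x: "x \<in> carrier L - {\<zero>\<^bsub>L\<^esub>}" for x
  proof -
    have xc: "x \<in> carrier L" "x \<noteq> \<zero>\<^bsub>L\<^esub>" using x by auto
    note ix = L.field_inv[OF xc]
    have px: "\<phi> x \<in> carrier M" "\<phi> x \<noteq> \<zero>\<^bsub>M\<^esub>" using xc field_hom_zero_iff[OF L M \<phi> xc(1)] by auto
    have "\<phi> (inv\<^bsub>L\<^esub> x) = inv\<^bsub>M\<^esub> (\<phi> x)"
    proof (rule M.comm_inv_char[symmetric])
      have "\<phi> x \<otimes>\<^bsub>M\<^esub> \<phi> (inv\<^bsub>L\<^esub> x) = \<phi> (x \<otimes>\<^bsub>L\<^esub> inv\<^bsub>L\<^esub> x)"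
        by (rule h.hom_mult[symmetric, OF xc(1) ix(1)])
      also have "x \<otimes>\<^bsub>L\<^esub> inv\<^bsub>L\<^esub> x = \<one>\<^bsub>L\<^esub>" using xc ix L.m_comm by simp
      finally show "\<phi> x \<otimes>\<^bsub>M\<^esub> \<phi> (inv\<^bsub>L\<^esub> x) = \<one>\<^bsub>M\<^esub>" by simp
    qed (use xc ix in auto)
    moreover have "\<phi> x \<in> B \<or> inv\<^bsub>M\<^esub> (\<phi> x) \<in> B" using B px by (simp add: valuation_ring_def)
    ultimately show ?thesis using xc ix by auto
  qed
  ultimately show ?thesis unfolding valuation_ring_def by blast
qed

text \<open>The places over \<open>v\<close> in the upper field are the places over the places in the middle field, and \<open>\<sigma>\<close> enumerates these
  pairs. A place of the upper field over \<open>v\<close> is found by contracting it to the middle field.\<close>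

lemma splits_trans:
  assumes F: "field F" and L1: "field L1" and L2: "field L2"
    and \<phi>1: "\<phi>1 \<in> ring_hom F L1" and \<phi>2: "\<phi>2 \<in> ring_hom L1 L2"
    and sp1: "splits F v L1 \<phi>1 s1 e1 K1 \<tau>1 W1 r1"
    and sp2: "\<And>j. j < s1 \<Longrightarrow> splits L1 (W1 j) L2 \<phi>2 (s2 j) (e2 j) (K2 j) (\<tau>2 j) (W2 j) (r2 j)"
    and e1: "\<And>j. j < s1 \<Longrightarrow> e1 j > 0" and e2: "\<And>j k. j < s1 \<Longrightarrow> k < s2 j \<Longrightarrow> e2 j k > 0"
    and \<sigma>: "\<sigma> ` {..<s} = (SIGMA j:{..<s1}. {..<s2 j})" "inj_on \<sigma> {..<s}"
    and e: "\<And>t. t < s \<Longrightarrow> e t = e1 (fst (\<sigma> t)) * e2 (fst (\<sigma> t)) (snd (\<sigma> t))"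
    and K: "\<And>t. t < s \<Longrightarrow> K t = K2 (fst (\<sigma> t)) (snd (\<sigma> t))"
    and \<tau>: "\<And>t c. t < s \<Longrightarrow> c \<in> val_ring F v \<Longrightarrow> \<tau>2 (fst (\<sigma> t)) (snd (\<sigma> t)) (\<phi>1 c) = \<tau> t c"
  shows "splits F v L2 (\<phi>2 \<circ> \<phi>1) s e K \<tau> (\<lambda>t. W2 (fst (\<sigma> t)) (snd (\<sigma> t))) (\<lambda>t. r2 (fst (\<sigma> t)) (snd (\<sigma> t)))"
proof -
  have st: "fst (\<sigma> t) < s1 \<and> snd (\<sigma> t) < s2 (fst (\<sigma> t))" if "t < s" for t
  proof -
    have "\<sigma> t \<in> (SIGMA j:{..<s1}. {..<s2 j})" using that \<sigma>(1) by blast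
    then show ?thesis by (cases "\<sigma> t") auto
  qed
  have lo1: "lies_over F v L1 \<phi>1 (e1 j) (K1 j) (\<tau>1 j) (W1 j) (r1 j)" if "j < s1" for j
    using sp1 that by (simp add: splits_def)
  have lo2: "lies_over L1 (W1 j) L2 \<phi>2 (e2 j k) (K2 j k) (\<tau>2 j k) (W2 j k) (r2 j k)" if "j < s1" "k < s2 j" for j k
    using sp2[OF that(1)] that(2) by (simp add: splits_def)
  have a: "lies_over F v L2 (\<phi>2 \<circ> \<phi>1) (e t) (K t) (\<tau> t) (W2 (fst (\<sigma> t)) (snd (\<sigma> t))) (r2 (fst (\<sigma> t)) (snd (\<sigma> t)))"
    if t: "t < s" for t
    unfolding e[OF t] K[OF t]
    by (rule lies_over_trans[OF \<phi>1 F L1 lo1 lo2]) (use st[OF t] \<tau>[OF t] in auto)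
  have contr: "\<phi>2 x \<in> val_ring L2 (W2 j k) \<longleftrightarrow> x \<in> val_ring L1 (W1 j)" if "j < s1" "k < s2 j" "x \<in> carrier L1" for j k x
    by (rule lies_over_val_ring_iff[OF L1 L2 \<phi>2 lo2[OF that(1,2)] e2[OF that(1,2)] that(3)])
  have b: "inj_on (\<lambda>t. val_ring L2 (W2 (fst (\<sigma> t)) (snd (\<sigma> t)))) {..<s}"
  proof (rule inj_onI)
    fix t u assume tu: "t \<in> {..<s}" "u \<in> {..<s}"
      and eq: "val_ring L2 (W2 (fst (\<sigma> t)) (snd (\<sigma> t))) = val_ring L2 (W2 (fst (\<sigma> u)) (snd (\<sigma> u)))"
    have T: "fst (\<sigma> t) < s1" "snd (\<sigma> t) < s2 (fst (\<sigma> t))" and U: "fst (\<sigma> u) < s1" "snd (\<sigma> u) < s2 (fst (\<sigma> u))"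
      using st tu by auto
    have "val_ring L1 (W1 (fst (\<sigma> t))) = val_ring L1 (W1 (fst (\<sigma> u)))"
    proof -
      have "val_ring L1 w \<subseteq> carrier L1" for w by (auto simp: val_ge_def)
      then show ?thesis using contr[OF T] contr[OF U] eq by blast
    qed
    then have f: "fst (\<sigma> t) = fst (\<sigma> u)" using sp1 T(1) U(1) unfolding splits_def by (auto dest: inj_onD)
    have "inj_on (\<lambda>k. val_ring L2 (W2 (fst (\<sigma> t)) k)) {..<s2 (fst (\<sigma> t))}"
      using sp2[OF T(1)] by (simp add: splits_def)
    then have "snd (\<sigma> t) = snd (\<sigma> u)" using eq T(2) U(2) unfolding f by (auto dest: inj_onD)
    then have "\<sigma> t = \<sigma> u" using f by (simp add: prod_eq_iff)
    then show "t = u" using \<sigma>(2) tu by (auto dest: inj_onD)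
  qed
  have c: "\<exists>t<s. B = val_ring L2 (W2 (fst (\<sigma> t)) (snd (\<sigma> t)))"
    if B: "valuation_ring L2 B" and BF: "B \<inter> (\<phi>2 \<circ> \<phi>1) ` carrier F = (\<phi>2 \<circ> \<phi>1) ` val_ring F v" for B
  proof -
    define B1 where "B1 = {x \<in> carrier L1. \<phi>2 x \<in> B}"
    have B1: "valuation_ring L1 B1" unfolding B1_def by (rule valuation_ring_contraction[OF L1 L2 \<phi>2 B])
    have cl: "\<phi>1 c \<in> carrier L1" if "c \<in> carrier F" for c using ring_hom_memE(1)[OF \<phi>1 that] .
    have inj2: "inj_on \<phi>2 (carrier L1)" by (rule field_hom_inj[OF L1 L2 \<phi>2])
    have vF: "val_ring F v \<subseteq> carrier F" by (auto simp: val_ge_def)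
    have iff: "\<phi>2 (\<phi>1 c) \<in> B \<longleftrightarrow> c \<in> val_ring F v" if c: "c \<in> carrier F" for c
    proof
      assume "\<phi>2 (\<phi>1 c) \<in> B"
      then have "(\<phi>2 \<circ> \<phi>1) c \<in> (\<phi>2 \<circ> \<phi>1) ` val_ring F v" unfolding BF[symmetric] using c by simp
      then obtain d where d: "d \<in> val_ring F v" "\<phi>2 (\<phi>1 c) = \<phi>2 (\<phi>1 d)" by auto
      then have "\<phi>1 c = \<phi>1 d" using inj2 cl c vF by (auto dest: inj_onD)
      then have "c = d" using field_hom_inj[OF F L1 \<phi>1] c d vF by (auto dest: inj_onD)
      then show "c \<in> val_ring F v" using d by simp
    next
      assume "c \<in> val_ring F v"
      then have "(\<phi>2 \<circ> \<phi>1) c \<in> B \<inter> (\<phi>2 \<circ> \<phi>1) ` carrier F" unfolding BF by (rule imageI)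
      then show "\<phi>2 (\<phi>1 c) \<in> B" by simp
    qed
    have "B1 \<inter> \<phi>1 ` carrier F = \<phi>1 ` val_ring F v"
      unfolding B1_def using iff cl vF by blast
    then obtain j where j: "j < s1" "B1 = val_ring L1 (W1 j)" using sp1 B1 unfolding splits_def by blast
    have "B \<inter> \<phi>2 ` carrier L1 = \<phi>2 ` val_ring L1 (W1 j)"
      unfolding j(2)[symmetric] B1_def by blast
    then obtain k where k: "k < s2 j" "B = val_ring L2 (W2 j k)" using sp2[OF j(1)] B unfolding splits_def by blast
    have "(j, k) \<in> \<sigma> ` {..<s}" unfolding \<sigma>(1) using j k by simp
    then obtain t where "t < s" "\<sigma> t = (j, k)" by auto
    then show ?thesis using k by (intro exI[of _ t]) simp
  qed
  show ?thesis unfolding splits_def using a b c by blast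
qed

text \<open>If a subring contains the image of \<open>K\<close> and all \<open>l\<close>-th powers, the first condition, applied to its contraction, puts
  the middle field into it; then the second condition applies.\<close>

lemma no_proper_power_subring_trans:
  assumes L1: "field L1" and L2: "field L2" and \<phi>2: "\<phi>2 \<in> ring_hom L1 L2" and K: "K \<subseteq> carrier L1"
    and n1: "field.no_proper_power_subring L1 K" and n2: "field.no_proper_power_subring L2 (\<phi>2 ` carrier L1)"
  shows "field.no_proper_power_subring L2 (\<phi>2 ` K)"
proof -
  interpret L1: field L1 by (rule L1)
  interpret L2: field L2 by (rule L2)
  interpret h: ring_hom_ring L1 L2 \<phi>2 using ring_hom_ringI2[OF L1.ring_axioms L2.ring_axioms \<phi>2] .
  have "E = carrier L2" if l: "Factorial_Ring.prime (l::nat)" and ch: "add_pow L2 l \<one>\<^bsub>L2\<^esub> = \<zero>\<^bsub>L2\<^esub>"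
    and E: "subring E L2" and KE: "\<phi>2 ` K \<subseteq> E" and pw: "\<forall>x\<in>carrier L2. x [^]\<^bsub>L2\<^esub> l \<in> E" for l E
  proof -
    define E1 where "E1 = {x \<in> carrier L1. \<phi>2 x \<in> E}"
    have s1: "subring E1 L1" unfolding E1_def
      by (rule L1.subringI) (auto simp: subringE[OF E])
    have hn: "\<phi>2 (add_pow L1 k \<one>\<^bsub>L1\<^esub>) = add_pow L2 k \<one>\<^bsub>L2\<^esub>" for k :: nat
      by (induction k) auto
    have "\<phi>2 (add_pow L1 l \<one>\<^bsub>L1\<^esub>) = \<zero>\<^bsub>L2\<^esub>" using hn[of l] ch by simp
    then have ch1: "add_pow L1 l \<one>\<^bsub>L1\<^esub> = \<zero>\<^bsub>L1\<^esub>"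
      using field_hom_zero_iff[OF L1 L2 \<phi>2, of "add_pow L1 l \<one>\<^bsub>L1\<^esub>"] by simp
    have K1: "K \<subseteq> E1" using K KE by (auto simp: E1_def)
    have p1: "\<forall>x\<in>carrier L1. x [^]\<^bsub>L1\<^esub> l \<in> E1" using pw h.hom_nat_pow by (auto simp: E1_def)
    have "E1 = carrier L1" using n1[unfolded L1.no_proper_power_subring_def, rule_format, OF l ch1 s1 K1] p1 by blast
    then have "\<phi>2 ` carrier L1 \<subseteq> E" by (auto simp: E1_def)
    then show ?thesis using n2[unfolded L2.no_proper_power_subring_def, rule_format, OF l ch E] pw by blast
  qed
  then show ?thesis unfolding L2.no_proper_power_subring_def by (intro allI impI)
qed

lemma dimension_trans:
  assumes F: "field F" and L1: "field L1" and L2: "field L2"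
    and \<phi>1: "\<phi>1 \<in> ring_hom F L1" and \<phi>2: "\<phi>2 \<in> ring_hom L1 L2"
    and d1: "ring.dimension L1 m (\<phi>1 ` carrier F) (carrier L1)" and d2: "ring.dimension L2 n (\<phi>2 ` carrier L1) (carrier L2)"
  shows "ring.dimension L2 (m * n) ((\<phi>2 \<circ> \<phi>1) ` carrier F) (carrier L2)"
proof -
  interpret F: field F by (rule F)
  interpret L1: field L1 by (rule L1)
  interpret L2: field L2 by (rule L2)
  interpret h1: ring_hom_ring F L1 \<phi>1 using ring_hom_ringI2[OF F.ring_axioms L1.ring_axioms \<phi>1] .
  interpret h2: ring_hom_ring L1 L2 \<phi>2 using ring_hom_ringI2[OF L1.ring_axioms L2.ring_axioms \<phi>2] .
  have k1: "subfield (\<phi>1 ` carrier F) L1" using h1.img_is_subfield(2)[OF F.carrier_is_subfield] by simp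
  have k2: "subfield (\<phi>2 ` \<phi>1 ` carrier F) L2" using h2.img_is_subfield(2)[OF k1] by simp
  have k3: "subfield (\<phi>2 ` carrier L1) L2" using h2.img_is_subfield(2)[OF L1.carrier_is_subfield] by simp
  have "L2.dimension m (\<phi>2 ` \<phi>1 ` carrier F) (\<phi>2 ` carrier L1)"
    using h2.inj_hom_dimension[OF k1 _ field_hom_inj[OF L1 L2 \<phi>2] d1] by simp
  then show ?thesis using L2.telescopic_base[OF k2 k3 _ d2] by (simp add: image_comp)
qed

text \<open>An element of a finite extension is encoded by the set of all lists of coordinates that represent it with respect to
  a spanning list. This keeps the second extension in the type of the first.\<close>

lemma finite_extension_relabelling:
  fixes F :: "'a ring" and T :: "'t ring"
  assumes F: "field F" and T: "field T" and \<psi>: "\<psi> \<in> ring_hom F T"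
    and d: "ring.dimension T n (\<psi> ` carrier F) (carrier T)"
  shows "\<exists>\<eta> :: 't \<Rightarrow> 'a list set. inj_on \<eta> (carrier T)"
proof -
  interpret F: field F by (rule F)
  interpret T: field T by (rule T)
  interpret h: ring_hom_ring F T \<psi> using ring_hom_ringI2[OF F.ring_axioms T.ring_axioms \<psi>] .
  have K: "subfield (\<psi> ` carrier F) T" using h.img_is_subfield(2)[OF F.carrier_is_subfield] by simp
  obtain Us where Us: "set Us \<subseteq> carrier T" "T.Span (\<psi> ` carrier F) Us = carrier T"
    using T.exists_base[OF K d] by blast
  \<comment> \<open>these sets are nonempty, and disjoint for different elements\<close>
  define \<eta> where "\<eta> z = {as. set as \<subseteq> carrier F \<and> T.combine (map \<psi> as) Us = z}" for z
  have "\<eta> z \<noteq> {}" if z: "z \<in> carrier T" for z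
  proof -
    obtain Ks where Ks: "set Ks \<subseteq> \<psi> ` carrier F" "z = T.combine Ks Us"
      using z unfolding Us(2)[symmetric] T.Span_eq_combine_set[OF K Us(1)] by blast
    have "map \<psi> (map (inv_into (carrier F) \<psi>) Ks) = Ks" unfolding map_map
      by (rule map_idI) (use Ks(1) in \<open>auto simp: f_inv_into_f\<close>)
    moreover have "set (map (inv_into (carrier F) \<psi>) Ks) \<subseteq> carrier F" using Ks(1) by (auto intro: inv_into_into)
    ultimately have "map (inv_into (carrier F) \<psi>) Ks \<in> \<eta> z" using Ks(2) by (simp add: \<eta>_def)
    then show ?thesis by blast
  qed
  then have "x = y" if "x \<in> carrier T" "\<eta> x = \<eta> y" for x y using that unfolding \<eta>_def by blast
  then have "inj_on \<eta> (carrier T)" by (intro inj_onI)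
  then show ?thesis by blast
qed

section \<open>Residue fields and ramification indices\<close>

text \<open>A nonzero generator is obtained by replacing the generator \<open>0\<close>, if need be, by \<open>1\<close>.\<close>

lemma simple_extension_power_basis:
  assumes se: "simple_algebraic_extension k K \<iota>" and deg: "extension_degree k K \<iota> d"
  shows "\<exists>y\<in>carrier K. y \<noteq> \<zero>\<^bsub>K\<^esub> \<and>
    (\<forall>z\<in>carrier K. \<exists>c. (\<forall>j. c j \<in> carrier k) \<and> z = (\<Oplus>\<^bsub>K\<^esub>j\<in>{..<d}. \<iota> (c j) \<otimes>\<^bsub>K\<^esub> y [^]\<^bsub>K\<^esub> j)) \<and>
    (\<forall>c. (\<forall>j. c j \<in> carrier k) \<longrightarrow> (\<Oplus>\<^bsub>K\<^esub>j\<in>{..<d}. \<iota> (c j) \<otimes>\<^bsub>K\<^esub> y [^]\<^bsub>K\<^esub> j) = \<zero>\<^bsub>K\<^esub> \<longrightarrow> (\<forall>j<d. c j = \<zero>\<^bsub>k\<^esub>))"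
proof -
  have ae: "algebraic_extension k K \<iota>" using se by (simp add: simple_algebraic_extension_def)
  then have k: "field k" and K: "field K" and \<iota>: "\<iota> \<in> ring_hom k K"
    by (auto simp: algebraic_extension_def field_extension_def)
  interpret k: field k by (rule k)
  interpret K: field K by (rule K)
  interpret h: ring_hom_ring k K \<iota> using ring_hom_ringI2[OF k.ring_axioms K.ring_axioms \<iota>] .
  define k' where "k' = \<iota> ` carrier k"
  have sf: "subfield k' K" unfolding k'_def using h.img_is_subfield(2)[OF k.carrier_is_subfield] by simp
  have ks: "subring k' K" by (rule subfieldE(1)[OF sf])
  have kK: "k' \<subseteq> carrier K" by (rule subringE(1)[OF ks])
  obtain x where x: "x \<in> carrier K" "generate_field K (insert x k') = carrier K"
    using se unfolding simple_algebraic_extension_def k'_def by blast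
  define y where "y = (if x = \<zero>\<^bsub>K\<^esub> then \<one>\<^bsub>K\<^esub> else x)"
  have y: "y \<in> carrier K" "y \<noteq> \<zero>\<^bsub>K\<^esub>" using x by (auto simp: y_def)
  have alg: "(K.algebraic over k') y" using ae y(1) by (simp add: algebraic_extension_def k'_def)
  have simp_y: "subfield (K.simple_extension k' y) K" using K.simple_extension_is_subfield[OF sf y(1)] alg by simp
  have "insert x k' \<subseteq> K.simple_extension k' y"
    using K.simple_extension_incl[OF kK y(1)] K.simple_extension_mem[OF ks y(1)] subringE(2)[OF ks]
    by (auto simp: y_def split: if_splits)
  then have "carrier K \<subseteq> K.simple_extension k' y"
    using K.generate_field_min_subfield1[OF _ simp_y, of "insert x k'"] x kK by simp
  then have sy: "K.simple_extension k' y = carrier K" using subringE(1)[OF subfieldE(1)[OF simp_y]] by blast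
  have D: "length (K.Irr k' y) - 1 = d"
    using K.dimI[OF sf K.dimension_simple_extension[OF sf y(1) alg]] K.dimI[OF sf] deg
    unfolding sy extension_degree_def k'_def[symmetric] by simp
  have Sp: "K.Span k' (K.exp_base y d) = carrier K" using K.Span_exp_base[OF sf y(1) alg] sy D by simp
  have ind: "K.independent k' (K.exp_base y d)" using K.exp_base_independent[OF sf y(1) alg] D by simp
  have bc: "set (K.exp_base y d) \<subseteq> carrier K" by (rule K.exp_base_closed[OF y(1)])
  have bl: "length (K.exp_base y d) = d" by (simp add: K.exp_base_def)
  have span: "\<exists>c. (\<forall>j. c j \<in> carrier k) \<and> z = (\<Oplus>\<^bsub>K\<^esub>j\<in>{..<d}. \<iota> (c j) \<otimes>\<^bsub>K\<^esub> y [^]\<^bsub>K\<^esub> j)" if z: "z \<in> carrier K" for z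
  proof -
    obtain Ks where Ks: "length Ks = d" "set Ks \<subseteq> k'" "z = K.combine Ks (K.exp_base y d)"
      using z unfolding Sp[symmetric] K.Span_eq_combine_set_length_version[OF sf bc] bl by blast
    have Kc: "set Ks \<subseteq> carrier K" using Ks(2) kK by blast
    have n: "K.normalize Ks \<in> carrier K.FX"
      using K.normalize_gives_polynomial[OF Kc] by (simp add: univ_poly_carrier)
    have nl: "length (K.normalize Ks) \<le> d" using K.normalize_length_le[of Ks] Ks(1) by simp
    have "z = K.eval Ks y" using Ks(3) K.combine_eq_eval[of Ks y] Ks(1) by simp
    also have "\<dots> = K.eval (K.normalize Ks) y" using K.eval_normalize[OF Kc y(1)] by simp
    also have "\<dots> = (\<Oplus>\<^bsub>K\<^esub>j\<in>{..<d}. K.coeff (K.normalize Ks) j \<otimes>\<^bsub>K\<^esub> y [^]\<^bsub>K\<^esub> j)"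
      by (rule K.eval_as_finsum[OF n nl y(1)])
    finally have zz: "z = (\<Oplus>\<^bsub>K\<^esub>j\<in>{..<d}. K.coeff (K.normalize Ks) j \<otimes>\<^bsub>K\<^esub> y [^]\<^bsub>K\<^esub> j)" .
    have ck: "K.coeff (K.normalize Ks) j \<in> k'" for j
    proof -
      have "K.normalize Ks \<in> carrier (k'[X]\<^bsub>K\<^esub>)"
        using K.normalize_gives_polynomial[OF Ks(2)] by (simp add: univ_poly_carrier)
      then show ?thesis using K.subfield_poly_coeff(2)[OF ks] by blast
    qed
    define c where "c j = inv_into (carrier k) \<iota> (K.coeff (K.normalize Ks) j)" for j
    have c: "c j \<in> carrier k" "\<iota> (c j) = K.coeff (K.normalize Ks) j" for j
      using ck[of j] unfolding c_def k'_def by (auto intro: inv_into_into f_inv_into_f)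
    then show ?thesis using zz by (intro exI[of _ c]) simp
  qed
  have indep: "c j = \<zero>\<^bsub>k\<^esub>" if c: "\<forall>j. c j \<in> carrier k" and s0: "(\<Oplus>\<^bsub>K\<^esub>j\<in>{..<d}. \<iota> (c j) \<otimes>\<^bsub>K\<^esub> y [^]\<^bsub>K\<^esub> j) = \<zero>\<^bsub>K\<^esub>" and j: "j < d" for c j
  proof -
    define Ks where "Ks = map (\<lambda>j. \<iota> (c j)) (rev [0..<d])"
    have Kk: "set Ks \<subseteq> k'" using c by (auto simp: Ks_def k'_def)
    have Kc: "set Ks \<subseteq> carrier K" using Kk kK by blast
    have nK: "K.normalize Ks = K.poly_of_fun d (\<lambda>j. \<iota> (c j))" by (simp add: Ks_def K.poly_of_fun_def)
    note pf = K.poly_of_fun[of d "\<lambda>j. \<iota> (c j)"]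
    have ic: "\<iota> (c j) \<in> carrier K" for j using c by simp
    have "K.combine Ks (K.exp_base y d) = K.eval (K.normalize Ks) y"
      using K.combine_eq_eval[of Ks y] K.eval_normalize[OF Kc y(1)] by (simp add: Ks_def)
    also have "\<dots> = (\<Oplus>\<^bsub>K\<^esub>j\<in>{..<d}. K.coeff (K.normalize Ks) j \<otimes>\<^bsub>K\<^esub> y [^]\<^bsub>K\<^esub> j)"
      unfolding nK by (rule K.eval_as_finsum) (use pf ic y in auto)
    also have "\<dots> = (\<Oplus>\<^bsub>K\<^esub>j\<in>{..<d}. \<iota> (c j) \<otimes>\<^bsub>K\<^esub> y [^]\<^bsub>K\<^esub> j)"
      unfolding nK by (rule K.add.finprod_cong') (use pf ic y in auto)
    also have "\<dots> = \<zero>\<^bsub>K\<^esub>" by (rule s0)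
    finally have "set (take d Ks) \<subseteq> {\<zero>\<^bsub>K\<^esub>}"
      using K.independent_imp_trivial_combine[OF sf ind Kk] bl by simp
    moreover have "\<iota> (c j) \<in> set (take d Ks)" using j by (auto simp: Ks_def)
    ultimately have "\<iota> (c j) = \<zero>\<^bsub>K\<^esub>" by blast
    then show ?thesis using field_hom_zero_iff[OF k K \<iota>] c by blast
  qed
  show ?thesis
    by (rule bexI[OF _ y(1)]) (use y(2) span indep in blast)
qed

context dval
begin

lemma residue_basis_of_power_basis:
  assumes g: "g \<in> ring_hom (F\<lparr>carrier := val_ring F v\<rparr>) k" "g ` val_ring F v = carrier k"
    and ker: "\<And>x. x \<in> val_ring F v \<Longrightarrow> g x = \<zero>\<^bsub>k\<^esub> \<longleftrightarrow> x \<in> val_ge F v 1"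
    and se: "simple_algebraic_extension k K \<iota>" and deg: "extension_degree k K \<iota> d"
  shows "\<exists>y. residue_basis F v K (\<iota> \<circ> g) y d"
proof -
  have ae: "algebraic_extension k K \<iota>" using se by (simp add: simple_algebraic_extension_def)
  then have k: "field k" and K: "field K" and \<iota>: "\<iota> \<in> ring_hom k K"
    by (auto simp: algebraic_extension_def field_extension_def)
  obtain y where y: "y \<in> carrier K" "y \<noteq> \<zero>\<^bsub>K\<^esub>"
    and span: "\<And>z. z \<in> carrier K \<Longrightarrow> \<exists>c. (\<forall>j. c j \<in> carrier k) \<and> z = (\<Oplus>\<^bsub>K\<^esub>j\<in>{..<d}. \<iota> (c j) \<otimes>\<^bsub>K\<^esub> y [^]\<^bsub>K\<^esub> j)"
    and indep: "\<And>c. (\<forall>j. c j \<in> carrier k) \<Longrightarrow> (\<Oplus>\<^bsub>K\<^esub>j\<in>{..<d}. \<iota> (c j) \<otimes>\<^bsub>K\<^esub> y [^]\<^bsub>K\<^esub> j) = \<zero>\<^bsub>K\<^esub> \<Longrightarrow> (\<forall>j<d. c j = \<zero>\<^bsub>k\<^esub>)"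
    using simple_extension_power_basis[OF se deg] by blast
  have relation_coeff: "g x \<in> carrier k" if "x \<in> val_ring F v" for x using ring_hom_memE(1)[OF g(1)] that by simp
  have tz: "(\<iota> \<circ> g) x = \<zero>\<^bsub>K\<^esub> \<longleftrightarrow> x \<in> val_ge F v 1" if x: "x \<in> val_ring F v" for x
    using field_hom_zero_iff[OF k K \<iota> relation_coeff[OF x]] ker[OF x] by simp
  have sp: "\<exists>b. (\<forall>k. b k \<in> val_ring F v) \<and> z = (\<Oplus>\<^bsub>K\<^esub>k\<in>{..<d}. (\<iota> \<circ> g) (b k) \<otimes>\<^bsub>K\<^esub> y [^]\<^bsub>K\<^esub> k)" if z: "z \<in> carrier K" for z
  proof -
    obtain c where c: "\<forall>j. c j \<in> carrier k" "z = (\<Oplus>\<^bsub>K\<^esub>j\<in>{..<d}. \<iota> (c j) \<otimes>\<^bsub>K\<^esub> y [^]\<^bsub>K\<^esub> j)" using span[OF z] by blast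
    define b where "b j = inv_into (val_ring F v) g (c j)" for j
    have b: "b j \<in> val_ring F v" "g (b j) = c j" for j
      using c(1) g(2) unfolding b_def by (auto intro: inv_into_into f_inv_into_f)
    then show ?thesis using c(2) by (intro exI[of _ b]) simp
  qed
  have ind: "\<forall>k<d. b k \<in> val_ge F v 1"
    if b: "\<forall>k. b k \<in> val_ring F v" and s: "(\<Oplus>\<^bsub>K\<^esub>k\<in>{..<d}. (\<iota> \<circ> g) (b k) \<otimes>\<^bsub>K\<^esub> y [^]\<^bsub>K\<^esub> k) = \<zero>\<^bsub>K\<^esub>" for b
  proof -
    have "\<forall>j<d. g (b j) = \<zero>\<^bsub>k\<^esub>" using indep[of "\<lambda>j. g (b j)"] b s relation_coeff by simp
    then show ?thesis using ker b by blast
  qed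
  have hom: "\<iota> \<circ> g \<in> ring_hom (F\<lparr>carrier := val_ring F v\<rparr>) K" by (rule ring_hom_trans[OF g(1) \<iota>])
  show ?thesis unfolding residue_basis_def using K hom tz y sp ind by blast
qed

text \<open>The totally ramified places: the residue field does not grow.\<close>

lemma residue_basis_trivial:
  assumes k: "field k" and g: "g \<in> ring_hom (F\<lparr>carrier := val_ring F v\<rparr>) k" "g ` val_ring F v = carrier k"
    and ker: "\<And>x. x \<in> val_ring F v \<Longrightarrow> g x = \<zero>\<^bsub>k\<^esub> \<longleftrightarrow> x \<in> val_ge F v 1"
  shows "residue_basis F v k g \<one>\<^bsub>k\<^esub> 1"
proof -
  interpret k: field k by (rule k)
  have relation_coeff: "g x \<in> carrier k" if "x \<in> val_ring F v" for x using ring_hom_memE(1)[OF g(1)] that by simp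
  have one: "(\<Oplus>\<^bsub>k\<^esub>j\<in>{..<1::nat}. g (b j) \<otimes>\<^bsub>k\<^esub> \<one>\<^bsub>k\<^esub> [^]\<^bsub>k\<^esub> j) = g (b 0)" if "\<forall>j. b j \<in> val_ring F v" for b
    using relation_coeff that by (simp add: lessThan_Suc)
  have "\<exists>b. (\<forall>k. b k \<in> val_ring F v) \<and> z = (\<Oplus>\<^bsub>k\<^esub>j\<in>{..<1::nat}. g (b j) \<otimes>\<^bsub>k\<^esub> \<one>\<^bsub>k\<^esub> [^]\<^bsub>k\<^esub> j)" if z: "z \<in> carrier k" for z
  proof -
    obtain x where x: "x \<in> val_ring F v" "z = g x" using z unfolding g(2)[symmetric] by blast
    then show ?thesis using one[of "\<lambda>_. x"] by (intro exI[of _ "\<lambda>_. x"]) simp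
  qed
  moreover have "\<forall>j<1. b j \<in> val_ge F v 1"
    if "\<forall>j. b j \<in> val_ring F v" "(\<Oplus>\<^bsub>k\<^esub>j\<in>{..<1::nat}. g (b j) \<otimes>\<^bsub>k\<^esub> \<one>\<^bsub>k\<^esub> [^]\<^bsub>k\<^esub> j) = \<zero>\<^bsub>k\<^esub>" for b
    using one[OF that(1)] that ker by simp
  ultimately show ?thesis unfolding residue_basis_def using k g ker k.one_closed k.one_not_zero by blast
qed

abbreviation "VR \<equiv> F\<lparr>carrier := val_ring F v\<rparr>"

lemma VR_cring: "cring VR"
  using subcring_iff[of "val_ring F v"] subringE(1)[OF val_ring_subring] subcringI'[OF val_ring_subring] by blast

lemma val_ring_valuation_ring: "valuation_ring F (val_ring F v)"
  by (rule DVR_valuation_ring[OF field_axioms]) (use dv in \<open>auto simp: DVR_def val_ge_def\<close>)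

lemma max_ideal_eq: "max_ideal F (val_ring F v) = val_ge F v 1"
proof -
  have "x \<in> Units VR \<longleftrightarrow> x \<notin> val_ge F v 1" if x: "x \<in> val_ring F v" for x
  proof
    assume "x \<in> Units VR"
    then obtain y where y: "y \<in> val_ring F v" "x \<otimes> y = \<one>" by (auto simp: Units_def)
    show "x \<notin> val_ge F v 1"
    proof
      assume "x \<in> val_ge F v 1"
      then have "x \<otimes> y \<in> val_ge F v 1" using val_ge_mult[of x 1 y 0] y(1) by simp
      then show False using y(2) v_one by (simp add: val_ge_def)
    qed
  next
    assume "x \<notin> val_ge F v 1"
    note u = val_unit[OF x this]
    have "inv x \<otimes> x = \<one>" "x \<otimes> inv x = \<one>" using field_inv[OF u(1,2)] u(1) m_comm[of x "inv x"] by auto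
    then show "x \<in> Units VR" using x u(4) by (auto simp: Units_def)
  qed
  moreover have "val_ge F v 1 \<subseteq> val_ring F v" using val_ge_mono by auto
  ultimately show ?thesis unfolding max_ideal_def by auto
qed

lemma residue_class_hom:
  shows "field (residue_field F (val_ring F v))"
    and "residue_class F (val_ring F v) \<in> ring_hom VR (residue_field F (val_ring F v))"
    and "residue_class F (val_ring F v) ` val_ring F v = carrier (residue_field F (val_ring F v))"
    and "x \<in> val_ring F v \<Longrightarrow> residue_class F (val_ring F v) x = \<zero>\<^bsub>residue_field F (val_ring F v)\<^esub> \<longleftrightarrow> x \<in> val_ge F v 1"
proof -
  interpret R: cring VR by (rule VR_cring)
  let ?M = "max_ideal F (val_ring F v)"
  have max: "maximalideal ?M VR"
    using valuation_ring_maximalideal_iff[OF field_axioms val_ring_valuation_ring] by simp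
  interpret M: maximalideal ?M VR by (rule max)
  show "field (residue_field F (val_ring F v))" unfolding residue_field_def by (rule M.quotient_is_field[OF R.cring_axioms])
  have rc: "residue_class F (val_ring F v) = (+>\<^bsub>VR\<^esub>) ?M" by (rule ext) (simp add: residue_class_def)
  show "residue_class F (val_ring F v) \<in> ring_hom VR (residue_field F (val_ring F v))"
    unfolding rc residue_field_def by (rule M.rcos_ring_hom)
  show "residue_class F (val_ring F v) ` val_ring F v = carrier (residue_field F (val_ring F v))"
    unfolding rc residue_field_def by (auto simp: FactRing_def A_RCOSETS_def')
  assume x: "x \<in> val_ring F v"
  have "?M +>\<^bsub>VR\<^esub> x = ?M \<longleftrightarrow> x \<in> ?M"
    using M.rcos_const_imp_mem[of x] x
      abelian_subgroup.a_rcos_const[OF abelian_subgroupI3[OF M.is_additive_subgroup R.is_abelian_group], of x] by auto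
  then show "residue_class F (val_ring F v) x = \<zero>\<^bsub>residue_field F (val_ring F v)\<^esub> \<longleftrightarrow> x \<in> val_ge F v 1"
    by (simp add: rc residue_field_def FactRing_def max_ideal_eq)
qed

lemma val_ge_ideal: "k \<ge> 0 \<Longrightarrow> ideal (val_ge F v k) VR"
proof -
  assume k: "k \<ge> 0"
  interpret R: cring VR by (rule VR_cring)
  have sub: "val_ge F v k \<subseteq> val_ring F v" using val_ge_mono k by auto
  have sg: "subgroup (val_ge F v k) (add_monoid VR)"
  proof (rule R.add.subgroupI)
    show "val_ge F v k \<subseteq> carrier VR" using sub by simp
    show "val_ge F v k \<noteq> {}" using val_ge_zero[of k] by blast
    show "a \<oplus>\<^bsub>VR\<^esub> b \<in> val_ge F v k" if "a \<in> val_ge F v k" "b \<in> val_ge F v k" for a b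
      using val_ge_add[OF that] by simp
    show "\<ominus>\<^bsub>VR\<^esub> a \<in> val_ge F v k" if a: "a \<in> val_ge F v k" for a
    proof -
      have "\<ominus>\<^bsub>VR\<^esub> a = \<ominus> a"
        by (rule R.minus_equality) (use a sub val_geD[OF a] val_ge_neg[of a 0] in \<open>auto simp: l_neg\<close>)
      then show ?thesis using val_ge_neg[OF a] by simp
    qed
  qed
  show ?thesis
  proof (rule idealI[OF R.ring_axioms sg])
    fix a x assume a: "a \<in> val_ge F v k" and x: "x \<in> carrier VR"
    then have xv: "x \<in> val_ring F v" by simp
    show "x \<otimes>\<^bsub>VR\<^esub> a \<in> val_ge F v k" using val_ge_mult[OF xv a] by simp
    show "a \<otimes>\<^bsub>VR\<^esub> x \<in> val_ge F v k" using val_ge_mult[OF a xv] by simp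
  qed
qed

lemma val_ge_principal:
  assumes t: "t \<in> carrier F" "t \<noteq> \<zero>" "v t = k" and x: "x \<in> val_ge F v (k + j)"
  shows "\<exists>z\<in>val_ge F v j. x = z \<otimes> t"
proof -
  note it = field_inv[OF t(1,2)]
  have "inv t \<in> val_ge F v (- k)" using it(1,2) v_inv[OF t(1,2)] t(3) by (simp add: val_ge_def)
  then have "x \<otimes> inv t \<in> val_ge F v j" using val_ge_mult'[OF x] by simp
  moreover have "x = (x \<otimes> inv t) \<otimes> t" using it t(1) val_geD[OF x] by (simp add: m_assoc)
  ultimately show ?thesis by blast
qed

text \<open>The maximal ideal is principal, so its powers are the ideals given by the values.\<close>

lemma max_ideal_pow: "max_ideal F (val_ring F v) [^]\<^bsub>ideals_set VR\<^esub> (n::nat) = val_ge F v (int n)"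
proof (induction n)
  case 0
  then show ?case by (simp add: nat_pow_def ideals_set_def)
next
  case (Suc n)
  have "ideal_prod VR (val_ge F v (int n)) (val_ge F v 1) = val_ge F v (int (Suc n))"
  proof
    show "ideal_prod VR (val_ge F v (int n)) (val_ge F v 1) \<subseteq> val_ge F v (int (Suc n))"
    proof
      fix z assume "z \<in> ideal_prod VR (val_ge F v (int n)) (val_ge F v 1)"
      then show "z \<in> val_ge F v (int (Suc n))"
      proof (induction rule: ideal_prod.induct)
        case (prod i j)
        then show ?case using val_ge_mult'[of i "int n" j 1 "int (Suc n)"] by simp
      next
        case (sum s1 s2)
        then show ?case using val_ge_add by simp
      qed
    qed
    obtain t where t: "t \<in> carrier F" "t \<noteq> \<zero>" "v t = 1" using v_surj .
    show "val_ge F v (int (Suc n)) \<subseteq> ideal_prod VR (val_ge F v (int n)) (val_ge F v 1)"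
    proof
      fix x assume "x \<in> val_ge F v (int (Suc n))"
      then have "x \<in> val_ge F v (1 + int n)" by simp
      then obtain z where z: "z \<in> val_ge F v (int n)" "x = z \<otimes> t" using val_ge_principal[OF t] by blast
      have "t \<in> val_ge F v 1" using t by (simp add: val_ge_def)
      then have "z \<otimes>\<^bsub>VR\<^esub> t \<in> ideal_prod VR (val_ge F v (int n)) (val_ge F v 1)" using z(1) by (intro ideal_prod.prod)
      then show "x \<in> ideal_prod VR (val_ge F v (int n)) (val_ge F v 1)" using z(2) by simp
    qed
  qed
  then show ?case using Suc by (simp add: nat_pow_def ideals_set_def max_ideal_eq)
qed

end

text \<open>The isomorphism of residue fields is induced by \<open>r\<close>. The extended ideal contains the image of a uniformizer, of value
  \<open>e\<close>, and so is the ideal of all elements of value at least \<open>e\<close>.\<close>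

lemma lies_over_realizes:
  assumes F: "field F" and L: "field L" and \<phi>: "\<phi> \<in> ring_hom F L" and dv: "discrete_valuation F v"
    and lo: "lies_over F v L \<phi> e K (\<iota> \<circ> residue_class F (val_ring F v)) W r" and e: "e > 0" and K: "field K"
  shows "val_ring L W \<in> extensions_of_valuation_ring F (val_ring F v) L \<phi>"
    and "residue_field_isomorphic F (val_ring F v) L \<phi> (val_ring L W) K \<iota>"
    and "ramification_index F (val_ring F v) L \<phi> (val_ring L W) e"
proof -
  interpret V: dval F v using F dv by (intro dval.intro dval_axioms.intro)
  interpret W: dval L W using L lo by (intro dval.intro dval_axioms.intro) (simp_all add: lies_over_def)
  interpret R: cring W.VR by (rule W.VR_cring)
  interpret K: field K by (rule K)
  have r: "r \<in> ring_hom W.VR K" "r ` val_ring L W = carrier K"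
    and ker: "\<And>x. x \<in> val_ring L W \<Longrightarrow> r x = \<zero>\<^bsub>K\<^esub> \<longleftrightarrow> x \<in> val_ge L W 1"
    and res: "\<And>c. c \<in> val_ring F v \<Longrightarrow> \<phi> c \<in> val_ring L W \<and> r (\<phi> c) = \<iota> (residue_class F (val_ring F v) c)"
    using lo by (auto simp: lies_over_def)
  show "val_ring L W \<in> extensions_of_valuation_ring F (val_ring F v) L \<phi>"
    using W.val_ring_valuation_ring lies_over_contraction[OF F L \<phi> lo e]
    by (simp add: extensions_of_valuation_ring_def)
  interpret r: ring_hom_ring W.VR K r using ring_hom_ringI2[OF R.ring_axioms K.ring_axioms r(1)] .
  have k: "a_kernel W.VR K r = max_ideal L (val_ring L W)"
    using ker W.val_ge_mono[of _ 1 0] unfolding W.max_ideal_eq a_kernel_def' by auto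
  have "(\<lambda>Z. the_elem (r ` Z)) \<in> ring_iso (residue_field L (val_ring L W)) K"
    using r.FactRing_iso_set r(2) unfolding k residue_field_def by simp
  moreover have "the_elem (r ` residue_class L (val_ring L W) (\<phi> x)) = \<iota> (residue_class F (val_ring F v) x)"
    if "x \<in> val_ring F v" for x
    using r.the_elem_simp[of "\<phi> x"] res[OF that] unfolding k residue_class_def by simp
  ultimately show "residue_field_isomorphic F (val_ring F v) L \<phi> (val_ring L W) K \<iota>"
    unfolding residue_field_isomorphic_def by (intro bexI[of _ "\<lambda>Z. the_elem (r ` Z)"] ballI)
  have ram: "W (\<phi> c) = int e * v c" if "c \<in> carrier F" "c \<noteq> \<zero>\<^bsub>F\<^esub>" for c using lo that by (simp add: lies_over_def)
  have "Idl\<^bsub>W.VR\<^esub> (\<phi> ` val_ge F v 1) = val_ge L W (int e)"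
  proof
    have "\<phi> ` val_ge F v 1 \<subseteq> val_ge L W (int e)"
    proof
      fix z assume "z \<in> \<phi> ` val_ge F v 1"
      then obtain c where c: "c \<in> val_ge F v 1" "z = \<phi> c" by blast
      have cc: "c \<in> carrier F" by (rule V.val_geD[OF c(1)])
      show "z \<in> val_ge L W (int e)"
      proof (cases "c = \<zero>\<^bsub>F\<^esub>")
        case True
        then show ?thesis using c(2) field_hom_zero_iff[OF F L \<phi> cc] by simp
      next
        case False
        then have "v c \<ge> 1" using c(1) by (simp add: val_ge_def)
        then have "int e * 1 \<le> int e * v c" by (intro mult_left_mono) auto
        then show ?thesis using ram[OF cc False] c(2) ring_hom_memE(1)[OF \<phi> cc] by (simp add: val_ge_def)
      qed
    qed
    then show "Idl\<^bsub>W.VR\<^esub> (\<phi> ` val_ge F v 1) \<subseteq> val_ge L W (int e)"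
      by (intro R.genideal_minimal W.val_ge_ideal) auto
    show "val_ge L W (int e) \<subseteq> Idl\<^bsub>W.VR\<^esub> (\<phi> ` val_ge F v 1)"
    proof
      fix x assume x: "x \<in> val_ge L W (int e)"
      obtain c where c: "c \<in> carrier F" "c \<noteq> \<zero>\<^bsub>F\<^esub>" "v c = 1" using V.v_surj .
      have cm: "c \<in> val_ge F v 1" using c by (simp add: val_ge_def)
      have pc: "\<phi> c \<in> carrier L" "\<phi> c \<noteq> \<zero>\<^bsub>L\<^esub>" "W (\<phi> c) = int e"
        using ring_hom_memE(1)[OF \<phi> c(1)] field_hom_zero_iff[OF F L \<phi> c(1)] c ram[OF c(1,2)] by auto
      obtain z where z: "z \<in> val_ring L W" "x = z \<otimes>\<^bsub>L\<^esub> \<phi> c" using W.val_ge_principal[OF pc, of x 0] x by auto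
      have sub: "\<phi> ` val_ge F v 1 \<subseteq> carrier W.VR" using res V.val_ge_mono[of _ 1 0] by auto
      interpret J: ideal "Idl\<^bsub>W.VR\<^esub> (\<phi> ` val_ge F v 1)" W.VR by (rule R.genideal_ideal[OF sub])
      have "\<phi> c \<in> Idl\<^bsub>W.VR\<^esub> (\<phi> ` val_ge F v 1)" using R.genideal_self[OF sub] cm by blast
      then show "x \<in> Idl\<^bsub>W.VR\<^esub> (\<phi> ` val_ge F v 1)" using J.I_l_closed[of "\<phi> c" z] z by simp
    qed
  qed
  then show "ramification_index F (val_ring F v) L \<phi> (val_ring L W) e"
    unfolding ramification_index_def V.max_ideal_eq using W.max_ideal_pow[of e] by simp
qed

section \<open>Realization of the star system\<close>

text \<open>The two steps of the introduction, with the index \<open>0\<close> playing the special role. In the first step the residue field of the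
  place above \<open>V\<^sub>0\<close> is the residue field \<open>k 0\<close> of \<open>V\<^sub>0\<close> itself; to have its elements in the type of the other residue
  fields, it is replaced by its image \<open>K00\<close> in \<open>K 0 0\<close>. In the second step \<open>g\<close> undoes this.\<close>

lemma star_system_realization:
  fixes F :: "'a ring" and v :: "nat \<Rightarrow> 'a \<Rightarrow> int" and K :: "nat \<Rightarrow> nat \<Rightarrow> 'k ring" and \<iota> :: "nat \<Rightarrow> nat \<Rightarrow> 'a set \<Rightarrow> 'k"
  assumes F: "field F" and n: "n > 1" and dv: "\<And>i. i < n \<Longrightarrow> discrete_valuation F (v i)"
    and inj: "inj_on (\<lambda>i. val_ring F (v i)) {..<n}" and m: "m > 1"
    and s: "\<And>i. i < n \<Longrightarrow> s i > 0" and e: "\<And>i j. i < n \<Longrightarrow> j < s i \<Longrightarrow> e i j > 0"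
    and sum: "\<And>i. i < n \<Longrightarrow> (\<Sum>j<s i. e i j * f i j) = m"
    and se: "\<And>i j. i < n \<Longrightarrow> j < s i \<Longrightarrow> simple_algebraic_extension (residue_field F (val_ring F (v i))) (K i j) (\<iota> i j)"
    and deg: "\<And>i j. i < n \<Longrightarrow> j < s i \<Longrightarrow> extension_degree (residue_field F (val_ring F (v i))) (K i j) (\<iota> i j) (f i j)"
  shows "\<exists>(L :: 'a list set ring) \<phi>. field L \<and> \<phi> \<in> ring_hom F L \<and>
     ring.dimension L (m * m) (\<phi> ` carrier F) (carrier L) \<and> field.no_proper_power_subring L (\<phi> ` carrier F) \<and>
     (\<forall>i<n. \<exists>W r. splits F (v i) L \<phi> (s i) (\<lambda>j. m * e i j) (K i) (\<lambda>j. \<iota> i j \<circ> residue_class F (val_ring F (v i))) W r)"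
proof -
  define k where "k i = residue_field F (val_ring F (v i))" for i
  define res where "res i = residue_class F (val_ring F (v i))" for i
  have dvl: "dval F (v i)" if "i < n" for i using F dv[OF that] by (intro dval.intro dval_axioms.intro)
  note rc = dval.residue_class_hom[OF dvl, folded k_def res_def]
  have fe: "field (K i j)" "\<iota> i j \<in> ring_hom (k i) (K i j)" if "i < n" "j < s i" for i j
    using se[OF that] by (auto simp: simple_algebraic_extension_def algebraic_extension_def field_extension_def k_def)
  have n0: "0 < n" "1 < n" using n by auto
  note F00 = fe[OF n0(1) s[OF n0(1)]]
  define K00 where "K00 = (K 0 0)\<lparr>carrier := \<iota> 0 0 ` carrier (k 0)\<rparr>"
  interpret k0: field "k 0" using rc(1)[OF n0(1)] .
  interpret K0: field "K 0 0" by (rule F00(1))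
  interpret i0: ring_hom_ring "k 0" "K 0 0" "\<iota> 0 0" using ring_hom_ringI2[OF k0.ring_axioms K0.ring_axioms F00(2)] .
  have sub00: "subfield (\<iota> 0 0 ` carrier (k 0)) (K 0 0)" using i0.img_is_subfield(2)[OF k0.carrier_is_subfield] by simp
  have fK00: "field K00" unfolding K00_def using K0.subfield_iff(2)[OF sub00] .
  have inj00: "inj_on (\<iota> 0 0) (carrier (k 0))" by (rule field_hom_inj[OF k0.field_axioms F00(1,2)])
  have i00: "\<iota> 0 0 \<in> ring_iso (k 0) K00"
    using inj00 F00(2) by (auto simp: ring_iso_def K00_def ring_hom_def bij_betw_def)
  have zK00: "\<zero>\<^bsub>K00\<^esub> = \<zero>\<^bsub>K 0 0\<^esub>" by (simp add: K00_def)

  define s1 where "s1 i = (if i = 0 then 1 else s i)" for i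
  define e1 where "e1 i j = (if i = 0 then m else e i j)" for i j
  define f1 where "f1 i j = (if i = 0 then 1 else f i j)" for i j :: nat
  define K1 where "K1 i j = (if i = 0 then K00 else K i j)" for i j
  define \<tau>1 where "\<tau>1 i j = (if i = 0 then \<iota> 0 0 \<circ> res 0 else \<iota> i j \<circ> res i)" for i j
  have "\<exists>y. residue_basis F (v i) (K1 i j) (\<tau>1 i j) y (f1 i j)" if ij: "i < n" "j < s1 i" for i j
  proof (cases "i = 0")
    case True
    have "residue_basis F (v 0) K00 (\<iota> 0 0 \<circ> res 0) \<one>\<^bsub>K00\<^esub> 1"
    proof (rule dval.residue_basis_trivial[OF dvl[OF n0(1)] fK00])
      show "\<iota> 0 0 \<circ> res 0 \<in> ring_hom (F\<lparr>carrier := val_ring F (v 0)\<rparr>) K00"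
        using i00 ring_hom_trans[OF rc(2)[OF n0(1)]] by (auto simp: ring_iso_def)
      show "(\<iota> 0 0 \<circ> res 0) ` val_ring F (v 0) = carrier K00"
        unfolding image_comp[symmetric] rc(3)[OF n0(1)] by (simp add: K00_def)
      fix x assume x: "x \<in> val_ring F (v 0)"
      then have "res 0 x \<in> carrier (k 0)" using rc(3)[OF n0(1)] by blast
      then show "(\<iota> 0 0 \<circ> res 0) x = \<zero>\<^bsub>K00\<^esub> \<longleftrightarrow> x \<in> val_ge F (v 0) 1"
        using field_hom_zero_iff[OF k0.field_axioms F00(1,2)] rc(4)[OF n0(1) x] zK00 by simp
    qed
    then show ?thesis using True by (auto simp: K1_def \<tau>1_def f1_def)
  next
    case False
    then have j: "j < s i" using ij by (simp add: s1_def)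
    have "\<exists>y. residue_basis F (v i) (K i j) (\<iota> i j \<circ> res i) y (f i j)"
      by (rule dval.residue_basis_of_power_basis[OF dvl[OF ij(1)] rc(2,3)[OF ij(1)] rc(4)[OF ij(1)]
          se[OF ij(1) j, folded k_def] deg[OF ij(1) j, folded k_def]])
    then show ?thesis using False by (simp add: K1_def \<tau>1_def f1_def)
  qed
  then have "\<forall>i j. \<exists>y. i < n \<and> j < s1 i \<longrightarrow> residue_basis F (v i) (K1 i j) (\<tau>1 i j) y (f1 i j)" by blast
  then obtain y1 where y1: "\<And>i j. i < n \<Longrightarrow> j < s1 i \<Longrightarrow> residue_basis F (v i) (K1 i j) (\<tau>1 i j) (y1 i j) (f1 i j)"
    by metis
  have e1: "e1 i j > 0" if "i < n" "j < s1 i" for i j using e[of i j] that m by (auto simp: e1_def s1_def)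
  have s1: "s1 i > 0" if "i < n" for i using s[OF that] by (simp add: s1_def)
  have sum1: "(\<Sum>j<s1 i. e1 i j * f1 i j) = m" if "i < n" for i
    using sum[OF that] by (simp add: s1_def e1_def f1_def)
  have "\<exists>(L :: 'a list set ring) \<phi>. field L \<and> \<phi> \<in> ring_hom F L \<and>
     ring.dimension L m (\<phi> ` carrier F) (carrier L) \<and> field.no_proper_power_subring L (\<phi> ` carrier F) \<and>
     (\<forall>i\<in>{..<n}. \<exists>W r. splits F (v i) L \<phi> (s1 i) (e1 i) (K1 i) (\<tau>1 i) W r)"
  proof (rule extension_with_prescribed_splitting[where ?i0.0 = 0, OF F _ _ inj y1 e1 s1 sum1 m])
    show "\<exists>\<eta> :: 'a list set \<Rightarrow> 'a list set. inj_on \<eta> (carrier (Rupt\<^bsub>F\<^esub> (carrier F) q))" for q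
      by (rule exI[of _ id]) simp
  qed (use dv n0 in \<open>auto simp: s1_def f1_def\<close>)
  then obtain L1 :: "'a list set ring" and \<phi>1 where L1: "field L1" and \<phi>1: "\<phi>1 \<in> ring_hom F L1"
    and d1: "ring.dimension L1 m (\<phi>1 ` carrier F) (carrier L1)" and np1: "field.no_proper_power_subring L1 (\<phi>1 ` carrier F)"
    and "\<forall>i\<in>{..<n}. \<exists>W r. splits F (v i) L1 \<phi>1 (s1 i) (e1 i) (K1 i) (\<tau>1 i) W r" by blast
  then obtain W1 r1 where sp1: "\<And>i. i < n \<Longrightarrow> splits F (v i) L1 \<phi>1 (s1 i) (e1 i) (K1 i) (\<tau>1 i) (W1 i) (r1 i)"
    by (metis lessThan_iff)
  have lo1: "lies_over F (v i) L1 \<phi>1 (e1 i j) (K1 i j) (\<tau>1 i j) (W1 i j) (r1 i j)" if "i < n" "j < s1 i" for i j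
    using sp1[OF that(1)] that(2) by (simp add: splits_def)
  have dv1: "discrete_valuation L1 (W1 i j)" if "i < n" "j < s1 i" for i j
    using lo1[OF that] by (simp add: lies_over_def)
  have r1: "r1 i j \<in> ring_hom (L1\<lparr>carrier := val_ring L1 (W1 i j)\<rparr>) (K1 i j)" "r1 i j ` val_ring L1 (W1 i j) = carrier (K1 i j)"
    "\<And>x. x \<in> val_ring L1 (W1 i j) \<Longrightarrow> r1 i j x = \<zero>\<^bsub>K1 i j\<^esub> \<longleftrightarrow> x \<in> val_ge L1 (W1 i j) 1"
    "\<And>c. c \<in> val_ring F (v i) \<Longrightarrow> r1 i j (\<phi>1 c) = \<tau>1 i j c"
    if "i < n" "j < s1 i" for i j
    using lo1[OF that] by (simp_all add: lies_over_def)
  interpret L1: field L1 by (rule L1)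

  define I2 where "I2 = (SIGMA i:{..<n}. {..<s1 i})"
  define g where "g = inv_into (carrier (k 0)) (\<iota> 0 0) \<circ> r1 0 0"
  define v2 where "v2 p = W1 (fst p) (snd p)" for p :: "nat \<times> nat"
  define s2 where "s2 p = (if fst p = 0 then s 0 else 1)" for p :: "nat \<times> nat"
  define e2 where "e2 p j = (if fst p = 0 then e 0 j else m)" for p :: "nat \<times> nat" and j
  \<comment> \<open>indices are pairs: the valuation \<open>W1 i j\<close> of \<open>L1\<close> lies over \<open>v i\<close>\<close>
  define f2 where "f2 p j = (if fst p = 0 then f 0 j else 1)" for p :: "nat \<times> nat" and j
  define K2 where "K2 p j = (if fst p = 0 then K 0 j else K (fst p) (snd p))" for p :: "nat \<times> nat" and j
  define \<tau>2 where "\<tau>2 p j = (if fst p = 0 then \<iota> 0 j \<circ> g else r1 (fst p) (snd p))" for p :: "nat \<times> nat" and j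
  have p2: "fst p < n" "snd p < s1 (fst p)" if "p \<in> I2" for p using that by (auto simp: I2_def)
  have g: "g \<in> ring_hom (L1\<lparr>carrier := val_ring L1 (W1 0 0)\<rparr>) (k 0)" "g ` val_ring L1 (W1 0 0) = carrier (k 0)"
    "\<And>x. x \<in> val_ring L1 (W1 0 0) \<Longrightarrow> g x = \<zero>\<^bsub>k 0\<^esub> \<longleftrightarrow> x \<in> val_ge L1 (W1 0 0) 1"
    "\<And>c. c \<in> val_ring F (v 0) \<Longrightarrow> g (\<phi>1 c) = res 0 c"
  proof -
    have s10: "0 < s1 0" by (simp add: s1_def)
    have K10: "K1 0 0 = K00" by (simp add: K1_def)
    note R = r1[OF n0(1) s10, unfolded K10]
    have iso: "inv_into (carrier (k 0)) (\<iota> 0 0) \<in> ring_iso K00 (k 0)"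
      by (rule ring_iso_set_sym[OF k0.ring_axioms i00])
    show "g \<in> ring_hom (L1\<lparr>carrier := val_ring L1 (W1 0 0)\<rparr>) (k 0)"
      unfolding g_def using ring_hom_trans[OF R(1)] iso by (auto simp: ring_iso_def)
    show "g ` val_ring L1 (W1 0 0) = carrier (k 0)"
      unfolding g_def image_comp[symmetric] R(2) using iso by (simp add: ring_iso_def bij_betw_def)
    show "g x = \<zero>\<^bsub>k 0\<^esub> \<longleftrightarrow> x \<in> val_ge L1 (W1 0 0) 1" if x: "x \<in> val_ring L1 (W1 0 0)" for x
    proof -
      have "r1 0 0 x \<in> carrier K00" using R(2) x by blast
      then have "g x = \<zero>\<^bsub>k 0\<^esub> \<longleftrightarrow> r1 0 0 x = \<zero>\<^bsub>K00\<^esub>"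
        unfolding g_def using field_hom_zero_iff[OF fK00 k0.field_axioms, of "inv_into (carrier (k 0)) (\<iota> 0 0)"] iso
        by (simp add: ring_iso_def)
      then show ?thesis using R(3)[OF x] by simp
    qed
    show "g (\<phi>1 c) = res 0 c" if c: "c \<in> val_ring F (v 0)" for c
    proof -
      have "res 0 c \<in> carrier (k 0)" using rc(3)[OF n0(1)] c by blast
      then show ?thesis unfolding g_def using R(4)[OF c] inv_into_f_f[OF inj00] by (simp add: \<tau>1_def)
    qed
  qed
  have inj2: "inj_on (\<lambda>p. val_ring L1 (v2 p)) I2"
  proof (rule inj_onI)
    fix p q assume p: "p \<in> I2" and q: "q \<in> I2" and eq: "val_ring L1 (v2 p) = val_ring L1 (v2 q)"
    have vF: "val_ring F w \<subseteq> carrier F" for w by (auto simp: val_ge_def)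
    have "val_ring F (v (fst p)) = val_ring F (v (fst q))"
      using lies_over_val_ring_iff[OF F L1 \<phi>1 lo1[OF p2[OF p]] e1[OF p2[OF p]]]
        lies_over_val_ring_iff[OF F L1 \<phi>1 lo1[OF p2[OF q]] e1[OF p2[OF q]]] eq vF unfolding v2_def by blast
    then have f: "fst p = fst q" using inj p2[OF p] p2[OF q] by (auto dest: inj_onD)
    have "inj_on (\<lambda>j. val_ring L1 (W1 (fst p) j)) {..<s1 (fst p)}" using sp1[OF p2(1)[OF p]] by (simp add: splits_def)
    then have "snd p = snd q" using eq p2(2)[OF p] p2(2)[OF q] unfolding v2_def f by (auto dest: inj_onD)
    then show "p = q" using f by (simp add: prod_eq_iff)
  qed
  have "\<exists>y. residue_basis L1 (v2 p) (K2 p j) (\<tau>2 p j) y (f2 p j)" if p: "p \<in> I2" and j: "j < s2 p" for p j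
  proof -
    interpret D: dval L1 "v2 p" using L1 dv1[OF p2[OF p]] unfolding v2_def by (intro dval.intro dval_axioms.intro)
    show ?thesis
    proof (cases "fst p = 0")
      case True
      then have sp: "snd p = 0" using p2[OF p] by (simp add: s1_def)
      have j': "j < s 0" using j True by (simp add: s2_def)
      have vp: "v2 p = W1 0 0" using True sp by (simp add: v2_def)
      have "\<exists>y. residue_basis L1 (v2 p) (K 0 j) (\<iota> 0 j \<circ> g) y (f 0 j)"
        by (rule D.residue_basis_of_power_basis[OF _ _ _ se[OF n0(1) j', folded k_def] deg[OF n0(1) j', folded k_def]])
          (use g vp in auto)
      then show ?thesis using True by (simp add: K2_def \<tau>2_def f2_def)
    next
      case False
      have K': "K1 (fst p) (snd p) = K (fst p) (snd p)" using False by (simp add: K1_def)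
      have sj: "snd p < s (fst p)" using p2[OF p] False by (simp add: s1_def)
      have "residue_basis L1 (v2 p) (K (fst p) (snd p)) (r1 (fst p) (snd p)) \<one>\<^bsub>K (fst p) (snd p)\<^esub> 1"
        by (rule D.residue_basis_trivial[OF fe(1)[OF p2(1)[OF p] sj]])
          (use r1[OF p2[OF p], unfolded K'] in \<open>simp_all add: v2_def\<close>)
      then show ?thesis using False by (auto simp: K2_def \<tau>2_def f2_def)
    qed
  qed
  then have "\<forall>p j. \<exists>y. p \<in> I2 \<and> j < s2 p \<longrightarrow> residue_basis L1 (v2 p) (K2 p j) (\<tau>2 p j) y (f2 p j)" by blast
  then obtain y2 where y2: "\<And>p j. p \<in> I2 \<Longrightarrow> j < s2 p \<Longrightarrow> residue_basis L1 (v2 p) (K2 p j) (\<tau>2 p j) (y2 p j) (f2 p j)"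
    by metis
  have e2: "e2 p j > 0" if "p \<in> I2" "j < s2 p" for p j using e[OF n0(1), of j] that m by (auto simp: e2_def s2_def)
  have s2: "s2 p > 0" if "p \<in> I2" for p using s[OF n0(1)] by (simp add: s2_def)
  have sum2: "(\<Sum>j<s2 p. e2 p j * f2 p j) = m" if "p \<in> I2" for p
    using sum[OF n0(1)] by (simp add: s2_def e2_def f2_def)
  have dv2: "discrete_valuation L1 (v2 p)" if "p \<in> I2" for p using dv1[OF p2[OF that]] by (simp add: v2_def)
  have "\<exists>(L :: 'a list set ring) \<phi>. field L \<and> \<phi> \<in> ring_hom L1 L \<and>
     ring.dimension L m (\<phi> ` carrier L1) (carrier L) \<and> field.no_proper_power_subring L (\<phi> ` carrier L1) \<and>
     (\<forall>p\<in>I2. \<exists>W r. splits L1 (v2 p) L \<phi> (s2 p) (e2 p) (K2 p) (\<tau>2 p) W r)"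
  proof (rule extension_with_prescribed_splitting[where ?i0.0 = "(1, 0)", OF L1 _ dv2 inj2 y2 e2 s2 sum2 m])
    show "finite I2" by (simp add: I2_def)
    show "(1, 0) \<in> I2" using n0 s[OF n0(2)] by (simp add: I2_def s1_def)
    fix q assume q: "q \<in> carrier (poly_ring L1)" "pirreducible\<^bsub>L1\<^esub> (carrier L1) q" "length q = Suc m"
    let ?T = "Rupt\<^bsub>L1\<^esub> (carrier L1) q" and ?c = "L1.rupture_surj (carrier L1) q \<circ> L1.poly_of_const"
    have T: "field ?T" using L1.rupture_is_field_iff_pirreducible[OF L1.carrier_is_subfield q(1)] q(2) by simp
    have c: "?c \<in> ring_hom L1 ?T" using L1.rupture_surj_norm_is_hom[OF L1.carrier_is_subring q(1)] by simp
    have "ring.dimension ?T m (?c ` carrier L1) (carrier ?T)"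
      using L1.rupture_dimension[OF L1.carrier_is_subfield q(1)] q(3) m by (simp add: image_comp)
    then have "ring.dimension ?T (m * m) ((?c \<circ> \<phi>1) ` carrier F) (carrier ?T)"
      by (rule dimension_trans[OF F L1 T \<phi>1 c d1])
    then show "\<exists>\<eta> :: 'a list set list set \<Rightarrow> 'a list set. inj_on \<eta> (carrier ?T)"
      by (rule finite_extension_relabelling[OF F T ring_hom_trans[OF \<phi>1 c]])
  qed (simp_all add: s2_def f2_def)
  then obtain L2 :: "'a list set ring" and \<phi>2 where L2: "field L2" and \<phi>2: "\<phi>2 \<in> ring_hom L1 L2"
    and d2: "ring.dimension L2 m (\<phi>2 ` carrier L1) (carrier L2)" and np2: "field.no_proper_power_subring L2 (\<phi>2 ` carrier L1)"
    and "\<forall>p\<in>I2. \<exists>W r. splits L1 (v2 p) L2 \<phi>2 (s2 p) (e2 p) (K2 p) (\<tau>2 p) W r" by blast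
  then obtain W2 r2 where sp2: "\<And>p. p \<in> I2 \<Longrightarrow> splits L1 (v2 p) L2 \<phi>2 (s2 p) (e2 p) (K2 p) (\<tau>2 p) (W2 p) (r2 p)"
    by metis

  have final: "\<exists>W r. splits F (v i) L2 (\<phi>2 \<circ> \<phi>1) (s i) (\<lambda>j. m * e i j) (K i) (\<lambda>j. \<iota> i j \<circ> res i) W r" if i: "i < n" for i
  proof -
    \<comment> \<open>over \<open>V\<^sub>0\<close> only the second step splits, over the other \<open>V\<^sub>i\<close> only the first\<close>
    define \<sigma> where "\<sigma> t = (if i = 0 then (0, t) else (t, 0))" for t :: nat
    have \<sigma>: "\<sigma> ` {..<s i} = (SIGMA j:{..<s1 i}. {..<s2 (i, j)})" "inj_on \<sigma> {..<s i}"
      by (auto simp: \<sigma>_def s1_def s2_def inj_on_def image_iff)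
    have I: "(i, j) \<in> I2" if "j < s1 i" for j using i that by (simp add: I2_def)
    have st: "fst (\<sigma> t) < s1 i" if "t < s i" for t using that by (simp add: \<sigma>_def s1_def)
    have "splits F (v i) L2 (\<phi>2 \<circ> \<phi>1) (s i) (\<lambda>j. m * e i j) (K i) (\<lambda>j. \<iota> i j \<circ> res i)
        (\<lambda>t. W2 (i, fst (\<sigma> t)) (snd (\<sigma> t))) (\<lambda>t. r2 (i, fst (\<sigma> t)) (snd (\<sigma> t)))"
    proof (rule splits_trans[where ?W2.0 = "\<lambda>j. W2 (i, j)" and ?r2.0 = "\<lambda>j. r2 (i, j)", OF F L1 L2 \<phi>1 \<phi>2 sp1[OF i] _ _ _ \<sigma>])
      show "splits L1 (W1 i j) L2 \<phi>2 (s2 (i, j)) (e2 (i, j)) (K2 (i, j)) (\<tau>2 (i, j)) (W2 (i, j)) (r2 (i, j))"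
        if "j < s1 i" for j using sp2[OF I[OF that]] by (simp add: v2_def)
      show "e1 i j > 0" if "j < s1 i" for j by (rule e1[OF i that])
      show "e2 (i, j) l > 0" if "j < s1 i" "l < s2 (i, j)" for j l by (rule e2[OF I[OF that(1)] that(2)])
      show "m * e i t = e1 i (fst (\<sigma> t)) * e2 (i, fst (\<sigma> t)) (snd (\<sigma> t))" for t
        by (simp add: \<sigma>_def e1_def e2_def)
      show "K i t = K2 (i, fst (\<sigma> t)) (snd (\<sigma> t))" for t by (simp add: \<sigma>_def K2_def)
      show "\<tau>2 (i, fst (\<sigma> t)) (snd (\<sigma> t)) (\<phi>1 c) = (\<iota> i t \<circ> res i) c" if t: "t < s i" and c: "c \<in> val_ring F (v i)" for t c
      proof (cases "i = 0")
        case True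
        then show ?thesis using g(4) c by (simp add: \<tau>2_def \<sigma>_def)
      next
        case False
        then show ?thesis using r1(4)[OF i, of t c] t c by (simp add: \<tau>2_def \<sigma>_def \<tau>1_def s1_def)
      qed
    qed
    then show ?thesis by blast
  qed
  have hom: "\<phi>2 \<circ> \<phi>1 \<in> ring_hom F L2" by (rule ring_hom_trans[OF \<phi>1 \<phi>2])
  have dim: "ring.dimension L2 (m * m) ((\<phi>2 \<circ> \<phi>1) ` carrier F) (carrier L2)"
    by (rule dimension_trans[OF F L1 L2 \<phi>1 \<phi>2 d1 d2])
  have "\<phi>1 ` carrier F \<subseteq> carrier L1" using ring_hom_memE(1)[OF \<phi>1] by blast
  then have np: "field.no_proper_power_subring L2 ((\<phi>2 \<circ> \<phi>1) ` carrier F)"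
    using no_proper_power_subring_trans[OF L1 L2 \<phi>2 _ np1 np2] by (simp add: image_comp)
  show ?thesis
    by (rule exI[of _ L2], rule exI[of _ "\<phi>2 \<circ> \<phi>1"], intro conjI L2 hom dim np allI impI)
      (rule final[unfolded res_def])
qed

theorem theorem2p3:
  fixes F :: "'a ring" and n m :: nat and V :: "nat \<Rightarrow> 'a set"
    and S :: "nat \<Rightarrow> ('a, 'k) triple list"
  assumes "field F"
    and "n > 1"
    and "\<And>i. i < n \<Longrightarrow> DVR F (V i)"
    and "inj_on V {..<n}"
    and "m > 1"
    and "consistent_system F n V m S"
  shows "consistent_system F n V (m\<^sup>2) (star_system m S) \<and>
         realizable F n V (m\<^sup>2) (star_system m S)"
proof -
  define s where "s i = length (S i)" for i
  define K where "K i j = fst (fst (S i ! j))" for i j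
  define \<iota> where "\<iota> i j = snd (fst (S i ! j))" for i j
  define f where "f i j = fst (snd (S i ! j))" for i j
  define e where "e i j = snd (snd (S i ! j))" for i j
  have Sij: "S i ! j = ((K i j, \<iota> i j), f i j, e i j)" for i j
    by (simp add: K_def \<iota>_def f_def e_def)
  have cs: "S i \<noteq> []" "\<And>j. j < s i \<Longrightarrow> simple_algebraic_extension (residue_field F (V i)) (K i j) (\<iota> i j) \<and>
      extension_degree (residue_field F (V i)) (K i j) (\<iota> i j) (f i j) \<and> e i j > 0"
    "(\<Sum>((K, \<iota>), f, e) \<leftarrow> S i. e * f) = m" if i: "i < n" for i
  proof -
    have all: "S i \<noteq> [] \<and>
        (\<forall>((K, \<iota>), f, e) \<in> set (S i).
           simple_algebraic_extension (residue_field F (V i)) K \<iota> \<and>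
           extension_degree (residue_field F (V i)) K \<iota> f \<and> e > 0) \<and>
        (\<Sum>((K, \<iota>), f, e) \<leftarrow> S i. e * f) = m" using assms(6) i unfolding consistent_system_def by blast
    show "S i \<noteq> []" "(\<Sum>((K, \<iota>), f, e) \<leftarrow> S i. e * f) = m" using all by blast+
    fix j assume "j < s i"
    then have "S i ! j \<in> set (S i)" by (simp add: s_def)
    then show "simple_algebraic_extension (residue_field F (V i)) (K i j) (\<iota> i j) \<and>
      extension_degree (residue_field F (V i)) (K i j) (\<iota> i j) (f i j) \<and> e i j > 0"
      using all unfolding Sij by blast
  qed
  have star: "consistent_system F n V (m\<^sup>2) (star_system m S)"
    unfolding consistent_system_def
  proof (intro conjI allI impI)
    show "m\<^sup>2 > 0" using assms(5) by simp
    fix i assume i: "i < n"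
    show "star_system m S i \<noteq> []" using cs(1)[OF i] by (simp add: star_system_def)
    show "\<forall>((K, \<iota>), f, e) \<in> set (star_system m S i).
           simple_algebraic_extension (residue_field F (V i)) K \<iota> \<and>
           extension_degree (residue_field F (V i)) K \<iota> f \<and> e > 0"
      using assms(5,6) i unfolding consistent_system_def star_system_def by fastforce
    have "(\<Sum>((K, \<iota>), f, e) \<leftarrow> star_system m S i. e * f) = m * (\<Sum>((K, \<iota>), f, e) \<leftarrow> S i. e * f)"
      unfolding star_system_def by (induction "S i" arbitrary: ) (auto simp: sum_list_const_mult[symmetric] case_prod_unfold comp_def mult.assoc)
    then show "(\<Sum>((K, \<iota>), f, e) \<leftarrow> star_system m S i. e * f) = m\<^sup>2"
      using cs(3)[OF i] by (simp add: power2_eq_square)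
  qed
  have "\<exists>v. discrete_valuation F v \<and> V i = val_ring F v" if "i < n" for i
    using assms(3)[OF that] unfolding DVR_def val_ge_def by blast
  then obtain v where v: "\<And>i. i < n \<Longrightarrow> discrete_valuation F (v i)" "\<And>i. i < n \<Longrightarrow> V i = val_ring F (v i)" by metis
  have inj: "inj_on (\<lambda>i. val_ring F (v i)) {..<n}" using assms(4) v(2) by (simp add: inj_on_def)
  have sum: "(\<Sum>j<s i. e i j * f i j) = m" if i: "i < n" for i
    using cs(3)[OF i] unfolding sum_list_sum_nth
    by (simp add: Sij case_prod_unfold s_def atLeast0LessThan)
  have s: "s i > 0" if "i < n" for i using cs(1)[OF that] by (simp add: s_def)
  have "\<exists>(L :: 'a list set ring) \<phi>. field L \<and> \<phi> \<in> ring_hom F L \<and>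
     ring.dimension L (m * m) (\<phi> ` carrier F) (carrier L) \<and> field.no_proper_power_subring L (\<phi> ` carrier F) \<and>
     (\<forall>i<n. \<exists>W r. splits F (v i) L \<phi> (s i) (\<lambda>j. m * e i j) (K i) (\<lambda>j. \<iota> i j \<circ> residue_class F (val_ring F (v i))) W r)"
    by (rule star_system_realization[OF assms(1,2) v(1) inj assms(5) s _ sum]) (use cs(2) v(2) in auto)
  then obtain L :: "'a list set ring" and \<phi> where L: "field L" and \<phi>: "\<phi> \<in> ring_hom F L"
    and dim: "ring.dimension L (m * m) (\<phi> ` carrier F) (carrier L)" and np: "field.no_proper_power_subring L (\<phi> ` carrier F)"
    and sp: "\<And>i. i < n \<Longrightarrow> \<exists>W r. splits F (v i) L \<phi> (s i) (\<lambda>j. m * e i j) (K i) (\<lambda>j. \<iota> i j \<circ> residue_class F (val_ring F (v i))) W r"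
    by blast
  have "realization F n V (m\<^sup>2) (star_system m S) L \<phi>"
    unfolding realization_def
  proof (intro conjI allI impI)
    show "separable_extension F L \<phi>" by (rule separable_extension_criterion[OF assms(1) L \<phi> dim np])
    show "extension_degree F L \<phi> (m\<^sup>2)" using dim by (simp add: extension_degree_def power2_eq_square)
    fix i assume i: "i < n"
    obtain W r where W: "splits F (v i) L \<phi> (s i) (\<lambda>j. m * e i j) (K i) (\<lambda>j. \<iota> i j \<circ> residue_class F (val_ring F (v i))) W r"
      using sp[OF i] by blast
    have len: "length (star_system m S i) = s i" by (simp add: star_system_def s_def)
    have nth: "star_system m S i ! j = ((K i j, \<iota> i j), f i j, m * e i j)" if "j < s i" for j
      using that by (simp add: star_system_def s_def Sij)
    have R: "val_ring L (W j) \<in> extensions_of_valuation_ring F (V i) L \<phi>"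
      "residue_field_isomorphic F (V i) L \<phi> (val_ring L (W j)) (K i j) (\<iota> i j)"
      "ramification_index F (V i) L \<phi> (val_ring L (W j)) (m * e i j)" if j: "j < s i" for j
    proof -
      have lo: "lies_over F (v i) L \<phi> (m * e i j) (K i j) (\<iota> i j \<circ> residue_class F (val_ring F (v i))) (W j) (r j)"
        using W j by (simp add: splits_def)
      have ep: "m * e i j > 0" using cs(2)[OF i j] assms(5) by simp
      have Kf: "field (K i j)" using cs(2)[OF i j]
        by (simp add: simple_algebraic_extension_def algebraic_extension_def field_extension_def)
      show "val_ring L (W j) \<in> extensions_of_valuation_ring F (V i) L \<phi>"
        "residue_field_isomorphic F (V i) L \<phi> (val_ring L (W j)) (K i j) (\<iota> i j)"
        "ramification_index F (V i) L \<phi> (val_ring L (W j)) (m * e i j)"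
        unfolding v(2)[OF i] by (rule lies_over_realizes[OF assms(1) L \<phi> v(1)[OF i] lo ep Kf])+
    qed
    have bij: "bij_betw (\<lambda>j. val_ring L (W j)) {..<s i} (extensions_of_valuation_ring F (V i) L \<phi>)"
      unfolding bij_betw_def
    proof
      show "inj_on (\<lambda>j. val_ring L (W j)) {..<s i}" using W by (simp add: splits_def)
      have "B \<in> (\<lambda>j. val_ring L (W j)) ` {..<s i}" if "B \<in> extensions_of_valuation_ring F (V i) L \<phi>" for B
        using W that unfolding splits_def extensions_of_valuation_ring_def v(2)[OF i] by blast
      then show "(\<lambda>j. val_ring L (W j)) ` {..<s i} = extensions_of_valuation_ring F (V i) L \<phi>" using R(1) by blast
    qed
    show "\<exists>W. bij_betw W {..<length (star_system m S i)} (extensions_of_valuation_ring F (V i) L \<phi>) \<and>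
        (\<forall>j<length (star_system m S i). case star_system m S i ! j of ((K, \<iota>), f, e) \<Rightarrow>
           residue_field_isomorphic F (V i) L \<phi> (W j) K \<iota> \<and> ramification_index F (V i) L \<phi> (W j) e)"
      unfolding len by (rule exI[of _ "\<lambda>j. val_ring L (W j)"]) (use bij R(2,3) nth in simp)
  qed
  then show ?thesis using star unfolding realizable_def by blast
qed

end
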